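(* Let $(\boldsymbol{\mathfrak g},\boldsymbol K)$ be an algebraic family of Harish-Chandra pairs over the complex affine line $\mathbb C$, with $\boldsymbol K$ a constant family of connected reductive groups with fiber $K$, equipped with a real structure $\sigma$ compatible with the standard real structure $z\mapsto\bar z$ on $\mathbb C$. Let $\mathcal F$ be a quasi-admissible and generically irreducible algebraic family of Harish-Chandra modules for $(\boldsymbol{\mathfrak g},\boldsymbol K)$, and suppose that there is an isomorphism $\varphi:\mathcal K\otimes_{\mathcal O}\mathcal F\to\mathcal K\otimes_{\mathcal O}\mathcal F^{\langle\sigma\rangle}$ of $\mathcal K$-vector spaces that is $(\boldsymbol{\mathfrak g},\boldsymbol K)$-equivariant. Then for each $x\in\mathbb R$ the Jantzen quotients $\mathcal F|_x^n/\mathcal F|_x^{n+1}$, $n\in\mathbb Z$, carry nondegenerate hermitian forms, canonical up to real scalar factors, that are $\sigma$-invariant for the actions of $(\boldsymbol{\mathfrak g}|_x,K)$. Precisely, let $p$ be a real coordinate at $x$. Then: (i) for every $n$, the assignment sending $f_1,f_2\in\mathcal F_x^n$ to the value at $x$ of $p^{-n}\langle f_1,f_2\rangle$, where $\langle f_1,f_2\rangle=\varphi(f_1)(f_2)$, induces a well-defined nondegenerate complex-sesquilinear form $\langle\ ,\ \rangle_{x,n}$ on $\mathcal F|_x^n/\mathcal F|_x^{n+1}$ that is $\sigma$-invariant: $$\langle X f_1,f_2\rangle_{x,n}+\langle f_1,\sigma(X)f_2\rangle_{x,n}=0\quad (X\in\boldsymbol{\mathfrak g}|_x),\qquad \langle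 k f_1,\sigma_{\boldsymbol K}(k)f_2\rangle_{x,n}=\langle f_1,f_2\rangle_{x,n}\quad (k\in K=\boldsymbol K|_x);$$ (ii) there is a complex scalar $\lambda$ of modulus one, independent of $n$, such that $\lambda\langle\ ,\ \rangle_{x,n}$ is hermitian for every $n$; (iii) up to a shift in the index $n$, the quotients $\mathcal F|_x^n/\mathcal F|_x^{n+1}$ are independent of the choices of $\varphi$ and $p$, and the hermitian forms $\lambda\langle\ ,\ \rangle_{x,n}$ are, up to real scalar factors, independent of all choices.
   Context: Let $\mathcal O=\mathbb C[z]$, $\mathcal K=\mathbb C(z)$; sheaves over the affine line are represented by their modules of global sections. For an $\mathcal O$-module $M$ and $z_0\in\mathbb C$, $M|_{z_0}=\mathbb C\otimes_{\mathcal O}M$ is the fiber at $z_0$ (evaluation at $z_0$). Algebraic family of Harish-Chandra pairs $(\boldsymbol{\mathfrak g},\boldsymbol K)$ with $\boldsymbol K=\mathbb C\times K$ constant ($K$ a complex connected reductive group): $\boldsymbol{\mathfrak g}$ is a locally free $\mathcal O$-module with an $\mathcal O$-linear Lie bracket, on which $K$ acts algebraically, together with a $K$-equivariant embedding $\mathrm{Lie}(\boldsymbol K)=\mathcal O\otimes\mathrm{Lie}(K)\to\boldsymbol{\mathfrak g}$ of families of Lie algebras, such that the two resulting actions of $\mathrm{Lie}(\boldsymbol K)$ on $\boldsymbol{\mathfrak g}$ (differentiated $K$-action, adjoint action) coincide. Real structure compatible with $z\mapsto\bar z$: put $\sigma(q)(z)=\overline{q(\bar z)}$ for $q\in\mathcal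 K$. A real structure consists of an involutive additive map $\sigma=\sigma_{\boldsymbol{\mathfrak g}}:\boldsymbol{\mathfrak g}\to\boldsymbol{\mathfrak g}$ with $\sigma(qX)=\sigma(q)\sigma(X)$ preserving brackets, and an involutive antiholomorphic algebraic family of group isomorphisms $\sigma_{\boldsymbol K}:\boldsymbol K|_z\to\boldsymbol K|_{\bar z}$, such that together they respect the Harish-Chandra pair structure (action of $\boldsymbol K$ on $\boldsymbol{\mathfrak g}$ and embedding of $\mathrm{Lie}(\boldsymbol K)$). At $x\in\mathbb R$ they give conjugate-linear, respectively antiholomorphic, involutions of $\boldsymbol{\mathfrak g}|_x$ and of $K=\boldsymbol K|_x$. An algebraic family of Harish-Chandra modules is a flat $\mathcal O$-module $\mathcal F$ with $\mathcal O$-linear actions of $\boldsymbol{\mathfrak g}$ and of $\boldsymbol K$ (algebraic), such that $\boldsymbol{\mathfrak g}\otimes_{\mathcal O}\mathcal F\to\mathcal F$ is $\boldsymbol K$-equivariant and the differential of the $\boldsymbol K$-action is the action of $\mathrm{Lie}(\boldsymbol K)\subset\boldsymbol{\mathfrak g}$. It is quasi-admissible if $[\mathcal L\otimes_{\mathcal O}\mathcal F]^{\boldsymbol K}$ is a locally free, finitely generated $\mathcal O$-module for every family $\mathcal L$ of representations of $\boldsymbol K$ that is locally free and finitely generated over $\mathcal O$; then $\mathcal F=\bigoplus_{\tau\in\widehat K}\mathcal F_\tau$ with isotypical summands $\mathcal F_\tau$ free of finite rank. It is generically irreducible if the representation of $\mathcal K\otimes_{\mathcal O}\boldsymbol{\mathfrak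 g}$ on $\mathcal K\otimes_{\mathcal O}\mathcal F$ is irreducible over the algebraic closure of $\mathcal K$. $\sigma$-twisted dual: $\mathcal F^{\langle\sigma\rangle}$ is the $\mathcal O$-module of additive maps $e:\mathcal F\to\mathcal O$ with $e(qf)=\sigma(q)e(f)$ for $q\in\mathcal O$, vanishing on all but finitely many $\mathcal F_\tau$, with $(q\cdot e)(f)=q\,e(f)$, $(X\cdot e)(f)=-e(\sigma(X)f)$ for $X\in\boldsymbol{\mathfrak g}$ and $(g\cdot e)(f)=e(\sigma_{\boldsymbol K}(g)^{-1}f)$ for global sections $g$ of $\boldsymbol K$. The pairing $\langle f_1,f_2\rangle=\varphi(f_1)(f_2)\in\mathcal K$ on $\mathcal K\otimes_{\mathcal O}\mathcal F$ is extended so that $\langle q_1f_1,q_2f_2\rangle=q_1\langle f_1,f_2\rangle\sigma(q_2)$ for $q_1,q_2\in\mathcal K$. Jantzen filtration: for $x\in\mathbb R$, a real coordinate at $x$ is a degree-one polynomial $p$ vanishing at $x$ with $\sigma(p)=p$. Let $\mathcal O_x\subset\mathcal K$ be the rational functions regular at $x$, $\mathcal F_x=\mathcal O_x\otimes_{\mathcal O}\mathcal F$, and for $n\in\mathbb Z$ let $\mathcal F_x^n=\{f\in\mathcal F_x:\varphi(f)\in p^n(\mathcal O_x\otimes_{\mathcal O}\mathcal F^{\langle\sigma\rangle})\}$; equivalently $\operatorname{ord}_x\langle f,f'\rangle\ge n$ for all $f'\in\mathcal F_x$. Let $\mathcal F|_x^n$ be the image of $\mathcal F_x^n$ in $\mathcal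 F|_x$. These are decreasing in $n$ and are $(\boldsymbol{\mathfrak g}|_x,K)$-submodules; the quotients $\mathcal F|_x^n/\mathcal F|_x^{n+1}$ are the Jantzen quotients at $x$. *)

theory Defs
  imports
    "HOL-Analysis.Analysis"
    "HOL-Computational_Algebra.Computational_Algebra"
    "HOL-Algebra.Algebraic_Closure_Type"
    "HOL-Algebra.Free_Abelian_Groups"
    "HOL-Algebra.Module"
begin

no_notation Polynomials.var (\<open>X\<index>\<close>)

section \<open>The rings in play\<close>

abbreviation Oring :: "complex poly ring" where "Oring \<equiv> ring_of_type_algebra"
abbreviation Kfield :: "complex poly fract ring" where "Kfield \<equiv> ring_of_type_algebra"
abbreviation Kbar :: "complex poly fract alg_closure ring" where "Kbar \<equiv> ring_of_type_algebra"
abbreviation Cfield :: "complex ring" where "Cfield \<equiv> ring_of_type_algebra"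

abbreviation Kbar_embed :: "complex poly \<Rightarrow> complex poly fract alg_closure" where
  "Kbar_embed \<equiv> (\<lambda>q. to_ac (to_fract q))"

abbreviation ev :: "complex \<Rightarrow> complex poly \<Rightarrow> complex" where
  "ev z \<equiv> (\<lambda>q. poly q z)"

text \<open>The rational functions regular at \<open>z\<close>, and those regular on the open set \<open>h \<noteq> 0\<close>.\<close>

definition local_ring :: "complex \<Rightarrow> complex poly fract ring" where
  "local_ring z = Kfield\<lparr>carrier := {Fract a b |a b. poly b z \<noteq> 0}\<rparr>"

definition basic_open_ring :: "complex poly \<Rightarrow> complex poly fract ring" where
  "basic_open_ring h = Kfield\<lparr>carrier := {Fract a (h ^ k) |a k. True}\<rparr>"

definition value_at :: "complex \<Rightarrow> complex poly fract \<Rightarrow> complex" where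
  "value_at z q = (THE v. \<exists>a b. poly b z \<noteq> 0 \<and> q = Fract a b \<and> v = poly a z / poly b z)"

text \<open>The conjugation \<open>q(z) \<mapsto> cnj (q (cnj z))\<close>: on polynomials it is \<open>map_poly cnj\<close>.\<close>

abbreviation conj_poly :: "complex poly \<Rightarrow> complex poly" where
  "conj_poly \<equiv> map_poly cnj"

definition conj_fract :: "complex poly fract \<Rightarrow> complex poly fract" where
  "conj_fract q = (THE r. \<exists>a b. b \<noteq> 0 \<and> q = Fract a b \<and> r = Fract (conj_poly a) (conj_poly b))"

section \<open>Modules: tensor products, base change, quotients\<close>

definition restrict_scalars :: "('s \<Rightarrow> 'r) \<Rightarrow> ('r, 'm) module \<Rightarrow> ('s, 'm) module" where
  "restrict_scalars h M = \<lparr>carrier = carrier M, monoid.mult = monoid.mult M, one = one M,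
     ring.zero = ring.zero M, add = add M, smult = (\<lambda>r. smult M (h r))\<rparr>"

definition alg_module :: "'a ring \<Rightarrow> ('s \<Rightarrow> 'a) \<Rightarrow> ('s, 'a) module" where
  "alg_module A h = \<lparr>carrier = carrier A, monoid.mult = monoid.mult A, one = one A,
     ring.zero = ring.zero A, add = add A, smult = (\<lambda>r a. h r \<otimes>\<^bsub>A\<^esub> a)\<rparr>"

definition linear_map :: "'r ring \<Rightarrow> ('r, 'm) module \<Rightarrow> ('r, 'n) module \<Rightarrow> ('m \<Rightarrow> 'n) \<Rightarrow> bool" where
  "linear_map R M N f \<longleftrightarrow> f \<in> carrier M \<rightarrow> carrier N
     \<and> (\<forall>u\<in>carrier M. \<forall>v\<in>carrier M. f (u \<oplus>\<^bsub>M\<^esub> v) = f u \<oplus>\<^bsub>N\<^esub> f v)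
     \<and> (\<forall>r\<in>carrier R. \<forall>u\<in>carrier M. f (r \<odot>\<^bsub>M\<^esub> u) = r \<odot>\<^bsub>N\<^esub> f u)"

text \<open>\<open>M \<otimes>\<^sub>R N\<close> is the free abelian group on pairs modulo the usual relations; its elements are cosets.\<close>

abbreviation pair_group :: "('r, 'm) module \<Rightarrow> ('r, 'n) module \<Rightarrow> ('m \<times> 'n \<Rightarrow>\<^sub>0 int) monoid" where
  "pair_group M N \<equiv> free_Abelian_group (carrier M \<times> carrier N)"

definition tensor_rel ::
    "'r ring \<Rightarrow> ('r, 'm) module \<Rightarrow> ('r, 'n) module \<Rightarrow> ('m \<times> 'n \<Rightarrow>\<^sub>0 int) set" where
  "tensor_rel R M N = generate (pair_group M N)
     ({frag_of (u \<oplus>\<^bsub>M\<^esub> u', v) - frag_of (u, v) - frag_of (u', v)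
         |u u' v. u \<in> carrier M \<and> u' \<in> carrier M \<and> v \<in> carrier N}
      \<union> {frag_of (u, v \<oplus>\<^bsub>N\<^esub> v') - frag_of (u, v) - frag_of (u, v')
         |u v v'. u \<in> carrier M \<and> v \<in> carrier N \<and> v' \<in> carrier N}
      \<union> {frag_of (r \<odot>\<^bsub>M\<^esub> u, v) - frag_of (u, r \<odot>\<^bsub>N\<^esub> v)
         |r u v. r \<in> carrier R \<and> u \<in> carrier M \<and> v \<in> carrier N})"

definition tensor_class :: "'r ring \<Rightarrow> ('r, 'm) module \<Rightarrow> ('r, 'n) module
    \<Rightarrow> ('m \<times> 'n \<Rightarrow>\<^sub>0 int) \<Rightarrow> ('m \<times> 'n \<Rightarrow>\<^sub>0 int) set" where
  "tensor_class R M N a = tensor_rel R M N #>\<^bsub>pair_group M N\<^esub> a"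

text \<open>The map \<open>f \<otimes> g\<close> into \<open>M' \<otimes>\<^sub>R N'\<close>.  For additive balanced \<open>f\<close>, \<open>g\<close> all
  the cosets in the union coincide.\<close>

definition tensor_map :: "'r ring \<Rightarrow> ('r, 'm2) module \<Rightarrow> ('r, 'n2) module \<Rightarrow> ('m \<Rightarrow> 'm2) \<Rightarrow> ('n \<Rightarrow> 'n2)
    \<Rightarrow> ('m \<times> 'n \<Rightarrow>\<^sub>0 int) set \<Rightarrow> ('m2 \<times> 'n2 \<Rightarrow>\<^sub>0 int) set" where
  "tensor_map R M' N' f g t =
     (\<Union>a\<in>t. tensor_class R M' N' (frag_extend (\<lambda>(u, v). frag_of (f u, g v)) a))"

definition tensor :: "'r ring \<Rightarrow> ('r, 'm) module \<Rightarrow> ('r, 'n) module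
    \<Rightarrow> ('r, ('m \<times> 'n \<Rightarrow>\<^sub>0 int) set) module" where
  "tensor R M N = \<lparr>carrier = carrier (pair_group M N Mod tensor_rel R M N),
     monoid.mult = undefined, one = undefined,
     ring.zero = one (pair_group M N Mod tensor_rel R M N),
     add = monoid.mult (pair_group M N Mod tensor_rel R M N),
     smult = (\<lambda>r. tensor_map R M N (\<lambda>u. r \<odot>\<^bsub>M\<^esub> u) (\<lambda>v. v))\<rparr>"

text \<open>The base change \<open>A \<otimes>\<^sub>\<O> M\<close> as an \<open>A\<close>-module, for an \<open>\<O>\<close>-algebra \<open>h : \<O> \<rightarrow> A\<close>.\<close>

definition base_change :: "'a ring \<Rightarrow> (complex poly \<Rightarrow> 'a) \<Rightarrow> (complex poly, 'm) module
    \<Rightarrow> ('a, ('a \<times> 'm \<Rightarrow>\<^sub>0 int) set) module" where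
  "base_change A h M = (let T = tensor Oring (alg_module A h) M in
     \<lparr>carrier = carrier T, monoid.mult = monoid.mult T, one = one T, ring.zero = ring.zero T, add = add T,
      smult = (\<lambda>a. tensor_map Oring (alg_module A h) M (\<lambda>b. a \<otimes>\<^bsub>A\<^esub> b) (\<lambda>m. m))\<rparr>)"

abbreviation base_map where
  "base_map A h M \<equiv> tensor_map Oring (alg_module A h) M"

abbreviation generic where "generic M \<equiv> base_change Kfield to_fract M"
abbreviation localized where "localized z M \<equiv> base_change (local_ring z) to_fract M"
abbreviation fiber where "fiber z M \<equiv> base_change Cfield (ev z) M"

definition localized_to_generic :: "(complex poly, 'm) module
    \<Rightarrow> (complex poly fract \<times> 'm \<Rightarrow>\<^sub>0 int) set \<Rightarrow> (complex poly fract \<times> 'm \<Rightarrow>\<^sub>0 int) set" where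
  "localized_to_generic M = base_map Kfield to_fract M (\<lambda>q. q) (\<lambda>m. m)"

definition localized_to_fiber :: "complex \<Rightarrow> (complex poly, 'm) module
    \<Rightarrow> (complex poly fract \<times> 'm \<Rightarrow>\<^sub>0 int) set \<Rightarrow> (complex \<times> 'm \<Rightarrow>\<^sub>0 int) set" where
  "localized_to_fiber z M = base_map Cfield (ev z) M (value_at z) (\<lambda>m. m)"

text \<open>The action \<open>(c \<otimes> X) (d \<otimes> f) = c d \<otimes> X f\<close> of \<open>A \<otimes>\<^sub>\<O> \<gg>\<close> on \<open>A \<otimes>\<^sub>\<O> M\<close>.\<close>

definition base_action :: "'a ring \<Rightarrow> (complex poly \<Rightarrow> 'a) \<Rightarrow> (complex poly, 'm) module \<Rightarrow> ('g \<Rightarrow> 'm \<Rightarrow> 'm)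
    \<Rightarrow> ('a \<times> 'g \<Rightarrow>\<^sub>0 int) set \<Rightarrow> ('a \<times> 'm \<Rightarrow>\<^sub>0 int) set \<Rightarrow> ('a \<times> 'm \<Rightarrow>\<^sub>0 int) set" where
  "base_action A h M \<pi> s t = (\<Union>a\<in>s. \<Union>b\<in>t. tensor_class Oring (alg_module A h) M
     (frag_extend (\<lambda>(c, X). frag_extend (\<lambda>(d, f). frag_of (c \<otimes>\<^bsub>A\<^esub> d, \<pi> X f)) b) a))"

text \<open>The subquotient \<open>S / H\<close> of \<open>M\<close>, for submodules \<open>H \<subseteq> S\<close>, and the map induced on it by \<open>T\<close>.\<close>

definition subquotient :: "('r, 'm) module \<Rightarrow> 'm set \<Rightarrow> 'm set \<Rightarrow> ('r, 'm set) module" where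
  "subquotient M S H = \<lparr>carrier = {H +>\<^bsub>M\<^esub> v |v. v \<in> S}, monoid.mult = undefined, one = undefined,
     ring.zero = H, add = set_add M, smult = (\<lambda>r u. \<Union>v\<in>u. H +>\<^bsub>M\<^esub> (r \<odot>\<^bsub>M\<^esub> v))\<rparr>"

definition subquotient_map :: "('r, 'm) module \<Rightarrow> 'm set \<Rightarrow> ('m \<Rightarrow> 'm) \<Rightarrow> 'm set \<Rightarrow> 'm set" where
  "subquotient_map M H T u = (\<Union>v\<in>u. H +>\<^bsub>M\<^esub> T v)"

section \<open>Finiteness, local freeness, flatness\<close>

definition fin_gen :: "'r ring \<Rightarrow> ('r, 'm) module \<Rightarrow> bool" where
  "fin_gen R M \<longleftrightarrow> (\<exists>S\<subseteq>carrier M. finite S \<and>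
     (\<forall>v\<in>carrier M. \<exists>c\<in>S \<rightarrow> carrier R. v = (\<Oplus>\<^bsub>M\<^esub>s\<in>S. c s \<odot>\<^bsub>M\<^esub> s)))"

definition free_module :: "'r ring \<Rightarrow> ('r, 'm) module \<Rightarrow> bool" where
  "free_module R M \<longleftrightarrow> (\<exists>B\<subseteq>carrier M. \<forall>v\<in>carrier M. \<exists>!c.
     c \<in> B \<rightarrow> carrier R \<and> (\<forall>b. b \<notin> B \<longrightarrow> c b = \<zero>\<^bsub>R\<^esub>) \<and> finite {b. c b \<noteq> \<zero>\<^bsub>R\<^esub>}
     \<and> v = (\<Oplus>\<^bsub>M\<^esub>b\<in>{b. c b \<noteq> \<zero>\<^bsub>R\<^esub>}. c b \<odot>\<^bsub>M\<^esub> b))"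

definition locally_free :: "(complex poly, 'm) module \<Rightarrow> bool" where
  "locally_free M \<longleftrightarrow> module Oring M \<and> (\<forall>z. \<exists>h. poly h z \<noteq> 0
     \<and> free_module (basic_open_ring h) (base_change (basic_open_ring h) to_fract M))"

text \<open>HOL cannot quantify over types inside a definition.  Here and below, test modules have carriers
  inside \<^typ>\<open>nat \<Rightarrow> complex poly\<close> (with arbitrary module operations), a type of the cardinality of the
  continuum, so up to isomorphism every finitely generated \<open>\<O>\<close>-module occurs; this is enough to detect flatness.\<close>

definition flat :: "(complex poly, 'm) module \<Rightarrow> bool" where
  "flat F \<longleftrightarrow> module Oring F \<and>
     (\<forall>(M :: (complex poly, nat \<Rightarrow> complex poly) module) (N :: (complex poly, nat \<Rightarrow> complex poly) module) f.
       module Oring M \<and> module Oring N \<and> linear_map Oring M N f \<and> inj_on f (carrier M) \<longrightarrow>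
       inj_on (tensor_map Oring N F f (\<lambda>v. v)) (carrier (tensor Oring M F)))"

section \<open>Linear algebraic groups over the complex numbers\<close>

text \<open>The coordinate ring of \<open>GL\<^sub>n\<close>.  Inverses are total in HOL, so these are functions on all matrices;
  only their restriction to invertible matrices matters.\<close>

inductive_set regular_functions :: "(complex^'n^'n \<Rightarrow> complex) set" where
  const: "(\<lambda>_. c) \<in> regular_functions"
| entry: "(\<lambda>k. k $ a $ b) \<in> regular_functions"
| inverse_det: "(\<lambda>k. inverse (det k)) \<in> regular_functions"
| add: "c \<in> regular_functions \<Longrightarrow> d \<in> regular_functions \<Longrightarrow> (\<lambda>k. c k + d k) \<in> regular_functions"
| mult: "c \<in> regular_functions \<Longrightarrow> d \<in> regular_functions \<Longrightarrow> (\<lambda>k. c k * d k) \<in> regular_functions"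

definition zariski_closed :: "(complex^'n^'n) set \<Rightarrow> bool" where
  "zariski_closed A \<longleftrightarrow> (\<exists>S\<subseteq>regular_functions. A = {k. invertible k \<and> (\<forall>c\<in>S. c k = 0)})"

definition algebraic_group :: "(complex^'n^'n) set \<Rightarrow> bool" where
  "algebraic_group K \<longleftrightarrow> zariski_closed K \<and> mat 1 \<in> K
     \<and> (\<forall>k\<in>K. \<forall>l\<in>K. k ** l \<in> K) \<and> (\<forall>k\<in>K. matrix_inv k \<in> K)"

definition zariski_connected :: "(complex^'n^'n) set \<Rightarrow> bool" where
  "zariski_connected K \<longleftrightarrow> \<not> (\<exists>A B. zariski_closed A \<and> zariski_closed B \<and> K \<subseteq> A \<union> B
     \<and> K \<inter> A \<inter> B = {} \<and> K \<inter> A \<noteq> {} \<and> K \<inter> B \<noteq> {})"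

text \<open>\<open>expansion K V \<rho> v N c m\<close>: the coaction of \<open>v\<close> is \<open>\<Sum>\<^sub>i c\<^sub>i \<otimes> m\<^sub>i\<close>.\<close>

definition expansion :: "(complex^'n^'n) set \<Rightarrow> (complex, 'v) module \<Rightarrow> (complex^'n^'n \<Rightarrow> 'v \<Rightarrow> 'v) \<Rightarrow> 'v
    \<Rightarrow> nat \<Rightarrow> (nat \<Rightarrow> complex^'n^'n \<Rightarrow> complex) \<Rightarrow> (nat \<Rightarrow> 'v) \<Rightarrow> bool" where
  "expansion K V \<rho> v N c m \<longleftrightarrow> (\<forall>i<N. c i \<in> regular_functions \<and> m i \<in> carrier V)
     \<and> (\<forall>k\<in>K. \<rho> k v = (\<Oplus>\<^bsub>V\<^esub>i\<in>{..<N}. c i k \<odot>\<^bsub>V\<^esub> m i))"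

definition algebraic_rep ::
    "(complex^'n^'n) set \<Rightarrow> (complex, 'v) module \<Rightarrow> (complex^'n^'n \<Rightarrow> 'v \<Rightarrow> 'v) \<Rightarrow> bool" where
  "algebraic_rep K V \<rho> \<longleftrightarrow> module Cfield V \<and> (\<forall>k\<in>K. linear_map Cfield V V (\<rho> k))
     \<and> (\<forall>v\<in>carrier V. \<rho> (mat 1) v = v)
     \<and> (\<forall>k\<in>K. \<forall>l\<in>K. \<forall>v\<in>carrier V. \<rho> (k ** l) v = \<rho> k (\<rho> l v))
     \<and> (\<forall>v\<in>carrier V. \<exists>N c m. expansion K V \<rho> v N c m)"

definition subrep :: "(complex^'n^'n) set \<Rightarrow> (complex, 'v) module \<Rightarrow> (complex^'n^'n \<Rightarrow> 'v \<Rightarrow> 'v) \<Rightarrow> 'v set \<Rightarrow> bool" where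
  "subrep K V \<rho> W \<longleftrightarrow> submodule W Cfield V \<and> (\<forall>k\<in>K. \<rho> k ` W \<subseteq> W)"

text \<open>Reductive in the sense of Goodman and Wallach: all finite-dimensional algebraic representations are
  completely reducible (over the complex numbers, equivalently: the unipotent radical is trivial).\<close>

definition reductive :: "(complex^'n^'n) set \<Rightarrow> bool" where
  "reductive K \<longleftrightarrow> algebraic_group K \<and>
     (\<forall>(V :: (complex, nat \<Rightarrow> complex) module) \<rho>. algebraic_rep K V \<rho> \<and> fin_gen Cfield V \<longrightarrow>
       (\<forall>W. subrep K V \<rho> W \<longrightarrow>
         (\<exists>W'. subrep K V \<rho> W' \<and> W \<inter> W' = {\<zero>\<^bsub>V\<^esub>} \<and> W <+>\<^bsub>V\<^esub> W' = carrier V)))"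

definition irreducible_subrep ::
    "(complex^'n^'n) set \<Rightarrow> (complex, 'v) module \<Rightarrow> (complex^'n^'n \<Rightarrow> 'v \<Rightarrow> 'v) \<Rightarrow> 'v set \<Rightarrow> bool" where
  "irreducible_subrep K V \<rho> W \<longleftrightarrow> subrep K V \<rho> W \<and> W \<noteq> {\<zero>\<^bsub>V\<^esub>}
     \<and> (\<forall>U. subrep K V \<rho> U \<and> U \<subseteq> W \<longrightarrow> U = {\<zero>\<^bsub>V\<^esub>} \<or> U = W)"

definition isomorphic_subreps ::
    "(complex^'n^'n) set \<Rightarrow> (complex, 'v) module \<Rightarrow> (complex^'n^'n \<Rightarrow> 'v \<Rightarrow> 'v) \<Rightarrow> 'v set \<Rightarrow> 'v set \<Rightarrow> bool" where
  "isomorphic_subreps K V \<rho> W W' \<longleftrightarrow> (\<exists>f. bij_betw f W W'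
     \<and> linear_map Cfield (V\<lparr>carrier := W\<rparr>) (V\<lparr>carrier := W'\<rparr>) f
     \<and> (\<forall>k\<in>K. \<forall>w\<in>W. f (\<rho> k w) = \<rho> k (f w)))"

text \<open>The nonzero isotypical summands \<open>V\<^sub>\<tau>\<close>: for each irreducible type that occurs in \<open>V\<close>, the sum
  of all irreducible subrepresentations of that type.\<close>

definition isotypic_summands ::
    "(complex^'n^'n) set \<Rightarrow> (complex, 'v) module \<Rightarrow> (complex^'n^'n \<Rightarrow> 'v \<Rightarrow> 'v) \<Rightarrow> 'v set set" where
  "isotypic_summands K V \<rho> =
     {\<Inter>{U. submodule U Cfield V \<and>
          (\<forall>W'. irreducible_subrep K V \<rho> W' \<and> isomorphic_subreps K V \<rho> W W' \<longrightarrow> W' \<subseteq> U)}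
      |W. irreducible_subrep K V \<rho> W}"

subsection \<open>The Lie algebra\<close>

definition dir_deriv :: "(complex^'n^'n \<Rightarrow> complex) \<Rightarrow> complex^'n^'n \<Rightarrow> complex" where
  "dir_deriv c Y = deriv (\<lambda>t. c (mat 1 + (\<chi> a b. t * Y $ a $ b))) 0"

text \<open>The tangent space at the identity.\<close>

definition lie_alg :: "(complex^'n^'n) set \<Rightarrow> (complex^'n^'n) set" where
  "lie_alg K = {Y. \<forall>c\<in>regular_functions. (\<forall>k\<in>K. c k = 0) \<longrightarrow> dir_deriv c Y = 0}"

text \<open>The derivative at the identity, in the direction \<open>Y\<close> tangent to \<open>K\<close>, of a regular function \<open>f\<close>
  which is only given on \<open>K\<close>.\<close>

definition tangent_deriv :: "(complex^'n^'n) set \<Rightarrow> (complex^'n^'n \<Rightarrow> complex) \<Rightarrow> complex^'n^'n \<Rightarrow> complex" where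
  "tangent_deriv K f Y = (THE d. \<exists>c\<in>regular_functions. (\<forall>k\<in>K. c k = f k) \<and> d = dir_deriv c Y)"

section \<open>The constant family with fiber K\<close>

definition ev_mat :: "complex \<Rightarrow> complex poly^'n^'n \<Rightarrow> complex^'n^'n" where
  "ev_mat z G = (\<chi> a b. poly (G $ a $ b) z)"

definition const_mat :: "complex^'n^'n \<Rightarrow> complex poly^'n^'n" where
  "const_mat k = (\<chi> a b. [:k $ a $ b:])"

text \<open>Global sections of the constant group and of its Lie algebra \<open>\<O> \<otimes> Lie(K)\<close>, as algebraic maps from
  the affine line.\<close>

definition sections :: "(complex^'n^'n) set \<Rightarrow> (complex poly^'n^'n) set" where
  "sections K = {G. \<forall>z. ev_mat z G \<in> K}"

definition lie_sections :: "(complex^'n^'n) set \<Rightarrow> (complex poly^'n^'n) set" where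
  "lie_sections K = {Y. \<forall>z. ev_mat z Y \<in> lie_alg K}"

abbreviation as_complex :: "(complex poly, 'm) module \<Rightarrow> (complex, 'm) module" where
  "as_complex M \<equiv> restrict_scalars (\<lambda>c. [:c:]) M"

text \<open>An algebraic \<open>\<O>\<close>-linear action of the constant group on \<open>M\<close>, given by the action of the constant
  sections; the actions of all sections of the group and of its Lie algebra (the differential) follow
  from the coaction.\<close>

definition family_rep ::
    "(complex^'n^'n) set \<Rightarrow> (complex poly, 'm) module \<Rightarrow> (complex^'n^'n \<Rightarrow> 'm \<Rightarrow> 'm) \<Rightarrow> bool" where
  "family_rep K M \<rho> \<longleftrightarrow> module Oring M \<and> algebraic_rep K (as_complex M) \<rho>
     \<and> (\<forall>k\<in>K. linear_map Oring M M (\<rho> k))"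

definition section_act :: "(complex^'n^'n) set \<Rightarrow> (complex poly, 'm) module \<Rightarrow> (complex^'n^'n \<Rightarrow> 'm \<Rightarrow> 'm)
    \<Rightarrow> complex poly^'n^'n \<Rightarrow> 'm \<Rightarrow> 'm" where
  "section_act K M \<rho> G v = (THE w. \<exists>N c m. expansion K (as_complex M) \<rho> v N c m \<and>
     w = (\<Oplus>\<^bsub>M\<^esub>i\<in>{..<N}. (THE q. \<forall>z. poly q z = c i (ev_mat z G)) \<odot>\<^bsub>M\<^esub> m i))"

definition differential_act :: "(complex^'n^'n) set \<Rightarrow> (complex poly, 'm) module \<Rightarrow> (complex^'n^'n \<Rightarrow> 'm \<Rightarrow> 'm)
    \<Rightarrow> complex poly^'n^'n \<Rightarrow> 'm \<Rightarrow> 'm" where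
  "differential_act K M \<rho> Y v = (THE w. \<exists>N c m. expansion K (as_complex M) \<rho> v N c m \<and>
     w = (\<Oplus>\<^bsub>M\<^esub>i\<in>{..<N}. (THE q. \<forall>z. poly q z = tangent_deriv K (c i) (ev_mat z Y)) \<odot>\<^bsub>M\<^esub> m i))"

section \<open>Families of Harish-Chandra pairs and modules\<close>

definition lie_algebra_family :: "(complex poly, 'g) module \<Rightarrow> ('g \<Rightarrow> 'g \<Rightarrow> 'g) \<Rightarrow> bool" where
  "lie_algebra_family \<gg> br \<longleftrightarrow> locally_free \<gg>
     \<and> (\<forall>X\<in>carrier \<gg>. linear_map Oring \<gg> \<gg> (br X) \<and> linear_map Oring \<gg> \<gg> (\<lambda>Y. br Y X))
     \<and> (\<forall>X\<in>carrier \<gg>. br X X = \<zero>\<^bsub>\<gg>\<^esub>)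
     \<and> (\<forall>X\<in>carrier \<gg>. \<forall>Y\<in>carrier \<gg>. \<forall>Z\<in>carrier \<gg>.
          br X (br Y Z) \<oplus>\<^bsub>\<gg>\<^esub> br Y (br Z X) \<oplus>\<^bsub>\<gg>\<^esub> br Z (br X Y) = \<zero>\<^bsub>\<gg>\<^esub>)"

text \<open>\<open>\<alpha>\<close> is the action of \<open>K\<close> on \<open>\<gg>\<close> and \<open>\<iota>\<close> the embedding of \<open>\<O> \<otimes> Lie(K)\<close> into \<open>\<gg>\<close>, required to be
  injective on global sections only.\<close>

locale hc_pair_family =
  fixes K :: "(complex^'n^'n) set"
    and \<gg> :: "(complex poly, 'g) module"
    and br :: "'g \<Rightarrow> 'g \<Rightarrow> 'g"
    and \<alpha> :: "complex^'n^'n \<Rightarrow> 'g \<Rightarrow> 'g"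
    and \<iota> :: "complex poly^'n^'n \<Rightarrow> 'g"
  assumes algebraic_group: "algebraic_group K"
    and lie_algebra: "lie_algebra_family \<gg> br"
    and action: "family_rep K \<gg> \<alpha>"
    and action_bracket: "\<lbrakk>k \<in> K; X \<in> carrier \<gg>; Y \<in> carrier \<gg>\<rbrakk> \<Longrightarrow> \<alpha> k (br X Y) = br (\<alpha> k X) (\<alpha> k Y)"
    and embed_closed: "U \<in> lie_sections K \<Longrightarrow> \<iota> U \<in> carrier \<gg>"
    and embed_inj: "inj_on \<iota> (lie_sections K)"
    and embed_add: "\<lbrakk>U \<in> lie_sections K; V \<in> lie_sections K\<rbrakk> \<Longrightarrow> \<iota> (U + V) = \<iota> U \<oplus>\<^bsub>\<gg>\<^esub> \<iota> V"
    and embed_smult: "U \<in> lie_sections K \<Longrightarrow> \<iota> (\<chi> a b. q * U $ a $ b) = q \<odot>\<^bsub>\<gg>\<^esub> \<iota> U"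
    and embed_bracket: "\<lbrakk>U \<in> lie_sections K; V \<in> lie_sections K\<rbrakk> \<Longrightarrow> \<iota> (U ** V - V ** U) = br (\<iota> U) (\<iota> V)"
    and embed_equivariant: "\<lbrakk>k \<in> K; U \<in> lie_sections K\<rbrakk> \<Longrightarrow>
      \<iota> (const_mat k ** U ** const_mat (matrix_inv k)) = \<alpha> k (\<iota> U)"
    and actions_coincide: "\<lbrakk>U \<in> lie_sections K; X \<in> carrier \<gg>\<rbrakk> \<Longrightarrow>
      differential_act K \<gg> \<alpha> U X = br (\<iota> U) X"

text \<open>Given \<open>\<sigma>\<^sub>K : K|\<^sub>z \<rightarrow> K|\<^bsub>cnj z\<^esub>\<close>, written \<open>\<sigma>K z\<close>: the induced maps on global sections of the group and of
  its Lie algebra (the differential of an antiholomorphic map being conjugate-linear).\<close>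

definition conj_section :: "(complex \<Rightarrow> complex^'n^'n \<Rightarrow> complex^'n^'n) \<Rightarrow> complex poly^'n^'n \<Rightarrow> complex poly^'n^'n" where
  "conj_section \<sigma>K G = (THE H. \<forall>z. ev_mat z H = \<sigma>K (cnj z) (ev_mat (cnj z) G))"

definition conj_lie_section :: "(complex^'n^'n) set \<Rightarrow> (complex \<Rightarrow> complex^'n^'n \<Rightarrow> complex^'n^'n)
    \<Rightarrow> complex poly^'n^'n \<Rightarrow> complex poly^'n^'n" where
  "conj_lie_section K \<sigma>K Y = (THE Z. \<forall>z. ev_mat z Z =
     (\<chi> a b. cnj (tangent_deriv K (\<lambda>k. cnj (\<sigma>K (cnj z) k $ a $ b)) (ev_mat (cnj z) Y))))"

locale real_hc_pair_family = hc_pair_family +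
  fixes \<sigma>\<gg> :: "'g \<Rightarrow> 'g"
    and \<sigma>K :: "complex \<Rightarrow> complex^'n^'n \<Rightarrow> complex^'n^'n"
  assumes sigma_closed: "X \<in> carrier \<gg> \<Longrightarrow> \<sigma>\<gg> X \<in> carrier \<gg>"
    and sigma_involutive: "X \<in> carrier \<gg> \<Longrightarrow> \<sigma>\<gg> (\<sigma>\<gg> X) = X"
    and sigma_add: "\<lbrakk>X \<in> carrier \<gg>; Y \<in> carrier \<gg>\<rbrakk> \<Longrightarrow> \<sigma>\<gg> (X \<oplus>\<^bsub>\<gg>\<^esub> Y) = \<sigma>\<gg> X \<oplus>\<^bsub>\<gg>\<^esub> \<sigma>\<gg> Y"
    and sigma_smult: "X \<in> carrier \<gg> \<Longrightarrow> \<sigma>\<gg> (q \<odot>\<^bsub>\<gg>\<^esub> X) = conj_poly q \<odot>\<^bsub>\<gg>\<^esub> \<sigma>\<gg> X"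
    and sigma_bracket: "\<lbrakk>X \<in> carrier \<gg>; Y \<in> carrier \<gg>\<rbrakk> \<Longrightarrow> \<sigma>\<gg> (br X Y) = br (\<sigma>\<gg> X) (\<sigma>\<gg> Y)"
    and sigmaK_closed: "k \<in> K \<Longrightarrow> \<sigma>K z k \<in> K"
    and sigmaK_involutive: "k \<in> K \<Longrightarrow> \<sigma>K (cnj z) (\<sigma>K z k) = k"
    and sigmaK_hom: "\<lbrakk>k \<in> K; l \<in> K\<rbrakk> \<Longrightarrow> \<sigma>K z (k ** l) = \<sigma>K z k ** \<sigma>K z l"
    and sigmaK_antiholomorphic: "\<exists>N c. (\<forall>i<N. c i \<in> regular_functions) \<and>
      (\<forall>z. \<forall>k\<in>K. cnj (\<sigma>K z k $ a $ b) = (\<Sum>i<N. c i k * z ^ i))"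
    and sigma_action: "\<lbrakk>G \<in> sections K; X \<in> carrier \<gg>\<rbrakk> \<Longrightarrow>
      \<sigma>\<gg> (section_act K \<gg> \<alpha> G X) = section_act K \<gg> \<alpha> (conj_section \<sigma>K G) (\<sigma>\<gg> X)"
    and sigma_embed: "U \<in> lie_sections K \<Longrightarrow> \<sigma>\<gg> (\<iota> U) = \<iota> (conj_lie_section K \<sigma>K U)"

locale hc_module_family = hc_pair_family +
  fixes F :: "(complex poly, 'f) module"
    and \<pi> :: "'g \<Rightarrow> 'f \<Rightarrow> 'f"
    and \<rho> :: "complex^'n^'n \<Rightarrow> 'f \<Rightarrow> 'f"
  assumes flat: "flat F"
    and lie_linear: "X \<in> carrier \<gg> \<Longrightarrow> linear_map Oring F F (\<pi> X)"
      "f \<in> carrier F \<Longrightarrow> linear_map Oring \<gg> F (\<lambda>X. \<pi> X f)"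
    and lie_bracket: "\<lbrakk>X \<in> carrier \<gg>; Y \<in> carrier \<gg>; f \<in> carrier F\<rbrakk> \<Longrightarrow>
      \<pi> (br X Y) f = \<pi> X (\<pi> Y f) \<ominus>\<^bsub>F\<^esub> \<pi> Y (\<pi> X f)"
    and group_action: "family_rep K F \<rho>"
    and equivariant: "\<lbrakk>k \<in> K; X \<in> carrier \<gg>; f \<in> carrier F\<rbrakk> \<Longrightarrow> \<rho> k (\<pi> X f) = \<pi> (\<alpha> k X) (\<rho> k f)"
    and differential: "\<lbrakk>U \<in> lie_sections K; f \<in> carrier F\<rbrakk> \<Longrightarrow> differential_act K F \<rho> U f = \<pi> (\<iota> U) f"

definition invariants :: "(complex^'n^'n) set \<Rightarrow> (complex poly, 'm) module \<Rightarrow> (complex^'n^'n \<Rightarrow> 'm \<Rightarrow> 'm)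
    \<Rightarrow> (complex poly, 'm) module" where
  "invariants K M \<rho> = M\<lparr>carrier := {v \<in> carrier M. \<forall>k\<in>K. \<rho> k v = v}\<rparr>"

definition quasi_admissible ::
    "(complex^'n^'n) set \<Rightarrow> (complex poly, 'f) module \<Rightarrow> (complex^'n^'n \<Rightarrow> 'f \<Rightarrow> 'f) \<Rightarrow> bool" where
  "quasi_admissible K F \<rho> \<longleftrightarrow>
     (\<forall>(L :: (complex poly, nat \<Rightarrow> complex poly) module) \<mu>.
       family_rep K L \<mu> \<and> locally_free L \<and> fin_gen Oring L \<longrightarrow>
       (let I = invariants K (tensor Oring L F) (\<lambda>k. tensor_map Oring L F (\<mu> k) (\<rho> k))
        in locally_free I \<and> fin_gen Oring I))"

definition generically_irreducible ::
    "(complex poly, 'g) module \<Rightarrow> (complex poly, 'f) module \<Rightarrow> ('g \<Rightarrow> 'f \<Rightarrow> 'f) \<Rightarrow> bool" where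
  "generically_irreducible \<gg> F \<pi> \<longleftrightarrow>
     (let V = base_change Kbar Kbar_embed F in carrier V \<noteq> {\<zero>\<^bsub>V\<^esub>} \<and>
       (\<forall>W. submodule W Kbar V \<and>
          (\<forall>s\<in>carrier (base_change Kbar Kbar_embed \<gg>). base_action Kbar Kbar_embed F \<pi> s ` W \<subseteq> W) \<longrightarrow>
          W = {\<zero>\<^bsub>V\<^esub>} \<or> W = carrier V))"

section \<open>The twisted dual and the pairing\<close>

text \<open>Functionals are normalized to vanish outside \<open>carrier F\<close>.\<close>

definition twisted_dual :: "(complex^'n^'n) set \<Rightarrow> (complex poly, 'f) module \<Rightarrow> (complex^'n^'n \<Rightarrow> 'f \<Rightarrow> 'f)
    \<Rightarrow> (complex poly, 'f \<Rightarrow> complex poly) module" where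
  "twisted_dual K F \<rho> = \<lparr>carrier = {e. (\<forall>f. f \<notin> carrier F \<longrightarrow> e f = 0)
       \<and> (\<forall>f\<in>carrier F. \<forall>f'\<in>carrier F. e (f \<oplus>\<^bsub>F\<^esub> f') = e f + e f')
       \<and> (\<forall>q. \<forall>f\<in>carrier F. e (q \<odot>\<^bsub>F\<^esub> f) = conj_poly q * e f)
       \<and> finite {U \<in> isotypic_summands K (as_complex F) \<rho>. \<exists>f\<in>U. e f \<noteq> 0}},
     monoid.mult = undefined, one = undefined,
     ring.zero = (\<lambda>_. 0), add = (\<lambda>e e' f. e f + e' f), smult = (\<lambda>q e f. q * e f)\<rparr>"

definition dual_lie_act :: "(complex poly, 'f) module \<Rightarrow> ('g \<Rightarrow> 'f \<Rightarrow> 'f) \<Rightarrow> ('g \<Rightarrow> 'g)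
    \<Rightarrow> 'g \<Rightarrow> ('f \<Rightarrow> complex poly) \<Rightarrow> 'f \<Rightarrow> complex poly" where
  "dual_lie_act F \<pi> \<sigma>\<gg> X e = (\<lambda>f. if f \<in> carrier F then - e (\<pi> (\<sigma>\<gg> X) f) else 0)"

definition dual_section_act :: "(complex^'n^'n) set \<Rightarrow> (complex poly, 'f) module \<Rightarrow> (complex^'n^'n \<Rightarrow> 'f \<Rightarrow> 'f)
    \<Rightarrow> (complex \<Rightarrow> complex^'n^'n \<Rightarrow> complex^'n^'n) \<Rightarrow> complex poly^'n^'n
    \<Rightarrow> ('f \<Rightarrow> complex poly) \<Rightarrow> 'f \<Rightarrow> complex poly" where
  "dual_section_act K F \<rho> \<sigma>K G e =
     (\<lambda>f. if f \<in> carrier F then e (section_act K F \<rho> (matrix_inv (conj_section \<sigma>K G)) f) else 0)"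

type_synonym 'f generic_map =
  "(complex poly fract \<times> 'f \<Rightarrow>\<^sub>0 int) set \<Rightarrow> (complex poly fract \<times> ('f \<Rightarrow> complex poly) \<Rightarrow>\<^sub>0 int) set"

definition equivariant_iso :: "(complex^'n^'n) set \<Rightarrow> (complex poly, 'g) module \<Rightarrow> ('g \<Rightarrow> 'g)
    \<Rightarrow> (complex \<Rightarrow> complex^'n^'n \<Rightarrow> complex^'n^'n) \<Rightarrow> (complex poly, 'f) module \<Rightarrow> ('g \<Rightarrow> 'f \<Rightarrow> 'f)
    \<Rightarrow> (complex^'n^'n \<Rightarrow> 'f \<Rightarrow> 'f) \<Rightarrow> 'f generic_map \<Rightarrow> bool" where
  "equivariant_iso K \<gg> \<sigma>\<gg> \<sigma>K F \<pi> \<rho> \<phi> \<longleftrightarrow> (let D = twisted_dual K F \<rho> in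
     linear_map Kfield (generic F) (generic D) \<phi>
     \<and> bij_betw \<phi> (carrier (generic F)) (carrier (generic D))
     \<and> (\<forall>X\<in>carrier \<gg>. \<forall>t\<in>carrier (generic F).
          \<phi> (base_map Kfield to_fract F (\<lambda>q. q) (\<pi> X) t)
            = base_map Kfield to_fract D (\<lambda>q. q) (dual_lie_act F \<pi> \<sigma>\<gg> X) (\<phi> t))
     \<and> (\<forall>G\<in>sections K. \<forall>t\<in>carrier (generic F).
          \<phi> (base_map Kfield to_fract F (\<lambda>q. q) (section_act K F \<rho> G) t)
            = base_map Kfield to_fract D (\<lambda>q. q) (dual_section_act K F \<rho> \<sigma>K G) (\<phi> t)))"

text \<open>Evaluation: \<open>(q \<otimes> e)(r \<otimes> f) = q e(f) \<sigma>(r)\<close>, independent of the chosen representatives.\<close>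

definition dual_eval :: "(complex poly fract \<times> ('f \<Rightarrow> complex poly) \<Rightarrow>\<^sub>0 int) set
    \<Rightarrow> (complex poly fract \<times> 'f \<Rightarrow>\<^sub>0 int) set \<Rightarrow> complex poly fract" where
  "dual_eval u t = (THE v. \<exists>a\<in>u. \<exists>b\<in>t.
     v = (\<Sum>(q, e)\<in>Poly_Mapping.keys a. \<Sum>(r, f)\<in>Poly_Mapping.keys b.
            of_int (Poly_Mapping.lookup a (q, e) * Poly_Mapping.lookup b (r, f))
              * (q * to_fract (e f) * conj_fract r)))"

definition pairing :: "'f generic_map \<Rightarrow> (complex poly fract \<times> 'f \<Rightarrow>\<^sub>0 int) set
    \<Rightarrow> (complex poly fract \<times> 'f \<Rightarrow>\<^sub>0 int) set \<Rightarrow> complex poly fract" where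
  "pairing \<phi> f1 f2 = dual_eval (\<phi> f1) f2"

section \<open>The Jantzen filtration\<close>

definition real_coordinate :: "real \<Rightarrow> complex poly \<Rightarrow> bool" where
  "real_coordinate x p \<longleftrightarrow> Polynomial.degree p = 1 \<and> poly p (of_real x) = 0 \<and> conj_poly p = p"

definition jantzen_local :: "(complex^'n^'n) set \<Rightarrow> (complex poly, 'f) module \<Rightarrow> (complex^'n^'n \<Rightarrow> 'f \<Rightarrow> 'f)
    \<Rightarrow> 'f generic_map \<Rightarrow> real \<Rightarrow> complex poly \<Rightarrow> int \<Rightarrow> (complex poly fract \<times> 'f \<Rightarrow>\<^sub>0 int) set set" where
  "jantzen_local K F \<rho> \<phi> x p n = (let D = twisted_dual K F \<rho> in
     {f \<in> carrier (localized (of_real x) F). \<exists>u\<in>carrier (localized (of_real x) D).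
        \<phi> (localized_to_generic F f) = (to_fract p powi n) \<odot>\<^bsub>generic D\<^esub> localized_to_generic D u})"

definition jantzen_filtration :: "(complex^'n^'n) set \<Rightarrow> (complex poly, 'f) module \<Rightarrow> (complex^'n^'n \<Rightarrow> 'f \<Rightarrow> 'f)
    \<Rightarrow> 'f generic_map \<Rightarrow> real \<Rightarrow> complex poly \<Rightarrow> int \<Rightarrow> (complex \<times> 'f \<Rightarrow>\<^sub>0 int) set set" where
  "jantzen_filtration K F \<rho> \<phi> x p n =
     localized_to_fiber (of_real x) F ` jantzen_local K F \<rho> \<phi> x p n"

definition jantzen_quotient :: "(complex^'n^'n) set \<Rightarrow> (complex poly, 'f) module \<Rightarrow> (complex^'n^'n \<Rightarrow> 'f \<Rightarrow> 'f)
    \<Rightarrow> 'f generic_map \<Rightarrow> real \<Rightarrow> complex poly \<Rightarrow> int \<Rightarrow> (complex, (complex \<times> 'f \<Rightarrow>\<^sub>0 int) set set) module" where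
  "jantzen_quotient K F \<rho> \<phi> x p n = subquotient (fiber (of_real x) F)
     (jantzen_filtration K F \<rho> \<phi> x p n) (jantzen_filtration K F \<rho> \<phi> x p (n + 1))"

definition jantzen_class :: "(complex^'n^'n) set \<Rightarrow> (complex poly, 'f) module \<Rightarrow> (complex^'n^'n \<Rightarrow> 'f \<Rightarrow> 'f)
    \<Rightarrow> 'f generic_map \<Rightarrow> real \<Rightarrow> complex poly \<Rightarrow> int
    \<Rightarrow> (complex poly fract \<times> 'f \<Rightarrow>\<^sub>0 int) set \<Rightarrow> (complex \<times> 'f \<Rightarrow>\<^sub>0 int) set set" where
  "jantzen_class K F \<rho> \<phi> x p n f =
     jantzen_filtration K F \<rho> \<phi> x p (n + 1) +>\<^bsub>fiber (of_real x) F\<^esub> localized_to_fiber (of_real x) F f"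

definition scaled_pairing :: "(complex poly, 'f) module \<Rightarrow> 'f generic_map \<Rightarrow> complex poly \<Rightarrow> int
    \<Rightarrow> (complex poly fract \<times> 'f \<Rightarrow>\<^sub>0 int) set \<Rightarrow> (complex poly fract \<times> 'f \<Rightarrow>\<^sub>0 int) set
    \<Rightarrow> complex poly fract" where
  "scaled_pairing F \<phi> p n f1 f2 =
     (to_fract p powi (- n)) * pairing \<phi> (localized_to_generic F f1) (localized_to_generic F f2)"

text \<open>The definite description alone does not make the form well defined on the Jantzen quotients: that is
  the content of \<open>induces_form\<close> below.\<close>

definition jantzen_form :: "(complex^'n^'n) set \<Rightarrow> (complex poly, 'f) module \<Rightarrow> (complex^'n^'n \<Rightarrow> 'f \<Rightarrow> 'f)
    \<Rightarrow> 'f generic_map \<Rightarrow> real \<Rightarrow> complex poly \<Rightarrow> int \<Rightarrow> (complex \<times> 'f \<Rightarrow>\<^sub>0 int) set set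
    \<Rightarrow> (complex \<times> 'f \<Rightarrow>\<^sub>0 int) set set \<Rightarrow> complex" where
  "jantzen_form K F \<rho> \<phi> x p n u v = (THE c.
     \<exists>f1\<in>jantzen_local K F \<rho> \<phi> x p n. \<exists>f2\<in>jantzen_local K F \<rho> \<phi> x p n.
       u = jantzen_class K F \<rho> \<phi> x p n f1 \<and> v = jantzen_class K F \<rho> \<phi> x p n f2
       \<and> c = value_at (of_real x) (scaled_pairing F \<phi> p n f1 f2))"

definition induces_form :: "(complex^'n^'n) set \<Rightarrow> (complex poly, 'f) module \<Rightarrow> (complex^'n^'n \<Rightarrow> 'f \<Rightarrow> 'f)
    \<Rightarrow> 'f generic_map \<Rightarrow> real \<Rightarrow> complex poly \<Rightarrow> int \<Rightarrow> bool" where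
  "induces_form K F \<rho> \<phi> x p n \<longleftrightarrow>
     (\<forall>f1\<in>jantzen_local K F \<rho> \<phi> x p n. \<forall>f2\<in>jantzen_local K F \<rho> \<phi> x p n.
        scaled_pairing F \<phi> p n f1 f2 \<in> carrier (local_ring (of_real x))
        \<and> jantzen_form K F \<rho> \<phi> x p n (jantzen_class K F \<rho> \<phi> x p n f1) (jantzen_class K F \<rho> \<phi> x p n f2)
            = value_at (of_real x) (scaled_pairing F \<phi> p n f1 f2))"

subsection \<open>Forms on complex vector spaces\<close>

definition sesquilinear_on :: "(complex, 'q) module \<Rightarrow> ('q \<Rightarrow> 'q \<Rightarrow> complex) \<Rightarrow> bool" where
  "sesquilinear_on Q B \<longleftrightarrow>
     (\<forall>u\<in>carrier Q. \<forall>v\<in>carrier Q. \<forall>w\<in>carrier Q.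
        B (u \<oplus>\<^bsub>Q\<^esub> v) w = B u w + B v w \<and> B u (v \<oplus>\<^bsub>Q\<^esub> w) = B u v + B u w)
     \<and> (\<forall>c. \<forall>u\<in>carrier Q. \<forall>v\<in>carrier Q.
        B (c \<odot>\<^bsub>Q\<^esub> u) v = c * B u v \<and> B u (c \<odot>\<^bsub>Q\<^esub> v) = cnj c * B u v)"

definition nondegenerate_on :: "(complex, 'q) module \<Rightarrow> ('q \<Rightarrow> 'q \<Rightarrow> complex) \<Rightarrow> bool" where
  "nondegenerate_on Q B \<longleftrightarrow>
     (\<forall>u\<in>carrier Q. (\<forall>v\<in>carrier Q. B u v = 0) \<longrightarrow> u = \<zero>\<^bsub>Q\<^esub>)
     \<and> (\<forall>v\<in>carrier Q. (\<forall>u\<in>carrier Q. B u v = 0) \<longrightarrow> v = \<zero>\<^bsub>Q\<^esub>)"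

definition hermitian_on :: "(complex, 'q) module \<Rightarrow> ('q \<Rightarrow> 'q \<Rightarrow> complex) \<Rightarrow> bool" where
  "hermitian_on Q B \<longleftrightarrow> sesquilinear_on Q B \<and> (\<forall>u\<in>carrier Q. \<forall>v\<in>carrier Q. B v u = cnj (B u v))"

definition fiber_lie_act :: "(complex poly, 'f) module \<Rightarrow> ('g \<Rightarrow> 'f \<Rightarrow> 'f) \<Rightarrow> real
    \<Rightarrow> (complex \<times> 'g \<Rightarrow>\<^sub>0 int) set \<Rightarrow> (complex \<times> 'f \<Rightarrow>\<^sub>0 int) set \<Rightarrow> (complex \<times> 'f \<Rightarrow>\<^sub>0 int) set" where
  "fiber_lie_act F \<pi> x = base_action Cfield (ev (of_real x)) F \<pi>"

definition fiber_group_act :: "(complex poly, 'f) module \<Rightarrow> (complex^'n^'n \<Rightarrow> 'f \<Rightarrow> 'f) \<Rightarrow> real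
    \<Rightarrow> complex^'n^'n \<Rightarrow> (complex \<times> 'f \<Rightarrow>\<^sub>0 int) set \<Rightarrow> (complex \<times> 'f \<Rightarrow>\<^sub>0 int) set" where
  "fiber_group_act F \<rho> x k = base_map Cfield (ev (of_real x)) F (\<lambda>c. c) (\<rho> k)"

definition fiber_conj :: "(complex poly, 'g) module \<Rightarrow> ('g \<Rightarrow> 'g) \<Rightarrow> real
    \<Rightarrow> (complex \<times> 'g \<Rightarrow>\<^sub>0 int) set \<Rightarrow> (complex \<times> 'g \<Rightarrow>\<^sub>0 int) set" where
  "fiber_conj \<gg> \<sigma>\<gg> x = base_map Cfield (ev (of_real x)) \<gg> cnj \<sigma>\<gg>"

definition invariant_form :: "(complex^'n^'n) set \<Rightarrow> (complex poly, 'g) module \<Rightarrow> ('g \<Rightarrow> 'g)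
    \<Rightarrow> (complex \<Rightarrow> complex^'n^'n \<Rightarrow> complex^'n^'n) \<Rightarrow> (complex poly, 'f) module \<Rightarrow> ('g \<Rightarrow> 'f \<Rightarrow> 'f)
    \<Rightarrow> (complex^'n^'n \<Rightarrow> 'f \<Rightarrow> 'f) \<Rightarrow> 'f generic_map \<Rightarrow> real \<Rightarrow> complex poly \<Rightarrow> int \<Rightarrow> bool" where
  "invariant_form K \<gg> \<sigma>\<gg> \<sigma>K F \<pi> \<rho> \<phi> x p n \<longleftrightarrow>
     (let Q = jantzen_quotient K F \<rho> \<phi> x p n; B = jantzen_form K F \<rho> \<phi> x p n;
          act = subquotient_map (fiber (of_real x) F) (jantzen_filtration K F \<rho> \<phi> x p (n + 1))
      in (\<forall>X\<in>carrier (fiber (of_real x) \<gg>). \<forall>u\<in>carrier Q. \<forall>v\<in>carrier Q.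
            B (act (fiber_lie_act F \<pi> x X) u) v
              + B u (act (fiber_lie_act F \<pi> x (fiber_conj \<gg> \<sigma>\<gg> x X)) v) = 0)
         \<and> (\<forall>k\<in>K. \<forall>u\<in>carrier Q. \<forall>v\<in>carrier Q.
            B (act (fiber_group_act F \<rho> x k) u) (act (fiber_group_act F \<rho> x (\<sigma>K (of_real x) k)) v) = B u v))"

definition hermitian_scalar :: "(complex^'n^'n) set \<Rightarrow> (complex poly, 'f) module \<Rightarrow> (complex^'n^'n \<Rightarrow> 'f \<Rightarrow> 'f)
    \<Rightarrow> 'f generic_map \<Rightarrow> real \<Rightarrow> complex poly \<Rightarrow> complex \<Rightarrow> bool" where
  "hermitian_scalar K F \<rho> \<phi> x p l \<longleftrightarrow> cmod l = 1 \<and>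
     (\<forall>n. hermitian_on (jantzen_quotient K F \<rho> \<phi> x p n) (\<lambda>u v. l * jantzen_form K F \<rho> \<phi> x p n u v))"

end

(*
The sesquilinear form attached to phi is the dot product of coordinate vectors with respect to a basis of F
adapted to the K-types.  Each K-type pairs nontrivially with exactly one K-type, so everything happens in
finite blocks, and Schur's lemma over the algebraic closure of C(z) (an eigenvector inside a block) shows that
invariant forms are unique up to a scalar.  Applied to the conjugate transpose of the form this gives a scalar
a with conj(a) a = 1, hence the hermitian normalization; applied to two isomorphisms it gives the independence
of the choices.  Nondegeneracy of the Jantzen forms: if f is not in F^(n+1) + p F_x, then f is primitive in the
lattice generated by F_x and p^n phi^-1(dual of F_x), and a functional detecting this is pairing with some g in F^n.
*)
theory Submission
  imports Defs
begin

text \<open>The first obstacle is that \<open>F\<close> comes without a basis. Quasi-admissibility,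
  tested on the constant family dual to a K-type \<open>W\<close>, makes Hom_K(W, F) finitely
  generated, hence also the isotypical summand of \<open>W\<close>; flatness makes it torsion-free,
  and over the Euclidean ring of polynomials it is then free. From there on tensors are replaced by
  finitely supported coordinate vectors. The second obstacle is that the real structure of the group
  may vary with \<open>z\<close>: a constant \<open>k\<close> crosses the form as a nonconstant
  section, so the generic form is not invariant under one fixed twist of \<open>K\<close>. The
  K-types are therefore matched at the point \<open>x\<close>: on two irreducibles the values of the
  form have bounded poles at \<open>x\<close>, the least power of \<open>p\<close> that makes them
  regular is inserted, and the value at \<open>x\<close> is a nonzero complex pairing twisted by
  \<open>sgK\<close> at \<open>x\<close>. Such a pairing determines the partner. The finite blocks
  obtained in this way supply an eigenvector although \<open>F\<close> may have infinite rank. Since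
  \<open>p\<close> is real, conj(a) a = 1 forces \<open>a\<close> to be a unit at \<open>x\<close>
  with value of modulus one; the hermitian scalar is a square root of that value.\<close>

abbreviation "pkeys == Poly_Mapping.keys"

section \<open>Tensor products\<close>

lemma type_ring_simps [simp]:
 "carrier (ring_of_type_algebra :: 'a::ring_1 ring) = UNIV"
 "monoid.mult (ring_of_type_algebra :: 'a::ring_1 ring) = (*)"
 "one (ring_of_type_algebra :: 'a::ring_1 ring) = 1"
 "ring.zero (ring_of_type_algebra :: 'a::ring_1 ring) = 0"
 "add (ring_of_type_algebra :: 'a::ring_1 ring) = (+)"
 by (simp_all add: ring_of_type_algebra_def)

lemma cring_type_ring [simp]: "cring (ring_of_type_algebra :: 'a::comm_ring_1 ring)"
 by (rule cring_from_type_algebra)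

text \<open>This is the additive extension of \<open>g\<close> from generators to the free abelian
  group. Coordinates and pairings of tensors are all written with it, because well-definedness then
  reduces to \<open>g\<close> being balanced.\<close>

definition fsum :: "('p => 'a::comm_ring_1) => ('p \<Rightarrow>\<^sub>0 int) => 'a" where
 "fsum g a = (SUM p:pkeys a. of_int (Poly_Mapping.lookup a p) * g p)"

lemma fsum_superset:
 assumes "finite S" "pkeys a <= S"
 shows "fsum g a = (SUM p:S. of_int (Poly_Mapping.lookup a p) * g p)"
 unfolding fsum_def
 by (rule sum.mono_neutral_left) (use assms in \<open>auto simp: in_keys_iff\<close>)

lemma fsum_0 [simp]: "fsum g 0 = 0"
 by (simp add: fsum_def)

lemma fsum_of [simp]: "fsum g (frag_of p) = g p"
 by (simp add: fsum_def keys_frag_of)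

lemma fsum_add: "fsum g (a + b) = fsum g a + fsum g b"
proof -
 let ?S = "pkeys a \<union> pkeys b"
 have "fsum g (a + b) = (SUM p:?S. of_int (Poly_Mapping.lookup (a + b) p) * g p)"
 by (rule fsum_superset) (auto dest: subsetD[OF Poly_Mapping.keys_add])
 also have "... = fsum g a + fsum g b"
 by (simp add: fsum_superset[of ?S] lookup_add algebra_simps sum.distrib)
 finally show ?thesis .
qed

lemma fsum_minus: "fsum g (- a) = - fsum g a"
 by (simp add: fsum_def keys_minus sum_negf)

lemma fsum_diff: "fsum g (a - b) = fsum g a - fsum g b"
 using fsum_add[of g a "- b"] by (simp add: fsum_minus)

lemma fsum_sum: "fsum g (SUM i:S. a i) = (SUM i:S. fsum g (a i))"
 by (induction S rule: infinite_finite_induct) (auto simp: fsum_add)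

lemma fsum_cong: "(!!p. p : pkeys a ==> g p = g' p) ==> fsum g a = fsum g' a"
 by (simp add: fsum_def)

lemma fsum_extend: "fsum g (frag_extend f a) = fsum (%p. fsum g (f p)) a"
proof -
 have "a = a ==> ?thesis"
 by (rule frag_induction[of a UNIV]) (auto simp: frag_extend_diff fsum_diff)
 then show ?thesis by simp
qed

lemma fsum_cmult: "fsum (%p. c * g p) a = c * fsum g a"
 by (simp add: fsum_def algebra_simps sum_distrib_left)

lemma fsum_sum_fun: "fsum (%p. SUM i:S. g i p) a = (SUM i:S. fsum (g i) a)"
 unfolding fsum_def by (simp add: sum_distrib_left) (rule sum.swap)

lemma fsum_hom:
 assumes "!!a b. \<theta> (a + b) = \<theta> a + \<theta> b" "\<theta> 0 = 0" "!!n v. \<theta> (of_int n * v) = of_int n * \<theta> v"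
 shows "\<theta> (fsum (g :: 'p => _) a) = fsum (%p. \<theta> (g p)) a"
proof -
 have "\<theta> (sum f S) = (SUM i:S. \<theta> (f i))" for f and S :: "'p set"
 by (induction S rule: infinite_finite_induct) (auto simp: assms)
 then show ?thesis by (simp add: fsum_def assms(3))
qed

text \<open>Only the additive structure and closedness of the carriers enter the tensor relations.\<close>

definition scalar_closed :: "'r ring => ('r, 'm) module => bool" where
 "scalar_closed R M \<longleftrightarrow> (ALL u:carrier M. ALL v:carrier M. u \<oplus>\<^bsub>M\<^esub> v : carrier M)
 & (ALL r:carrier R. ALL u:carrier M. r \<odot>\<^bsub>M\<^esub> u : carrier M)"

lemma scalar_closed_module: "Module.module R M ==> scalar_closed R M"
 unfolding scalar_closed_def
 by (auto simp: module.smult_closed abelian_monoid.a_closed module_def abelian_group_def)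

locale tensor_pair =
 fixes R :: "'r ring" and M :: "('r, 'm) module" and N :: "('r, 'n) module"
 assumes closed_M: "scalar_closed R M" and closed_N: "scalar_closed R N"
begin

text \<open>Differences suffice for the induction over the generated subgroup, since products and
  inverses are differences. Closure of \<open>Z\<close> is asked only for elements supported on the
  carriers: maps given by a universal property are controlled only there.\<close>

lemma rel_subset_keys: "a : tensor_rel R M N ==> pkeys a <= carrier M \<times> carrier N"
 and rel_kill: "a : tensor_rel R M N ==> 0 : Z ==>
 (!!a b. a : Z ==> b : Z ==> pkeys a <= carrier M \<times> carrier N ==>
 pkeys b <= carrier M \<times> carrier N ==> a - b : Z) ==>
 (!!u u' v. u : carrier M ==> u' : carrier M ==> v : carrier N ==>
 frag_of (u \<oplus>\<^bsub>M\<^esub> u', v) - frag_of (u, v) - frag_of (u', v) : Z) ==>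
 (!!u v v'. u : carrier M ==> v : carrier N ==> v' : carrier N ==>
 frag_of (u, v \<oplus>\<^bsub>N\<^esub> v') - frag_of (u, v) - frag_of (u, v') : Z) ==>
 (!!r u v. r : carrier R ==> u : carrier M ==> v : carrier N ==>
 frag_of (r \<odot>\<^bsub>M\<^esub> u, v) - frag_of (u, r \<odot>\<^bsub>N\<^esub> v) : Z) ==> a : Z"
proof -
 let ?G = "{frag_of (u \<oplus>\<^bsub>M\<^esub> u', v) - frag_of (u, v) - frag_of (u', v)
 |u u' v. u : carrier M & u' : carrier M & v : carrier N}
 \<union> {frag_of (u, v \<oplus>\<^bsub>N\<^esub> v') - frag_of (u, v) - frag_of (u, v')
 |u v v'. u : carrier M & v : carrier N & v' : carrier N}
 \<union> {frag_of (r \<odot>\<^bsub>M\<^esub> u, v) - frag_of (u, r \<odot>\<^bsub>N\<^esub> v)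
 |r u v. r : carrier R & u : carrier M & v : carrier N}"
 let ?S = "carrier M \<times> carrier N"
 have kd: "pkeys (a - b) <= ?S"
 if "pkeys a <= ?S" "pkeys b <= ?S" for a b :: "'m \<times> 'n \<Rightarrow>\<^sub>0 int"
 using keys_diff[of a b] that by blast
 have k1: "pkeys (frag_of x) <= ?S" if "x : ?S" for x :: "'m \<times> 'n"
 using that by (simp add: keys_frag_of)
 have G: "pkeys g <= ?S" if "g : ?G" for g
 using that closed_M closed_N unfolding scalar_closed_def
 by (elim UnE CollectE exE conjE; hypsubst; intro kd k1; simp)
 have gen: "P a & pkeys a <= ?S"
 if a: "a : tensor_rel R M N" and P: "P 0"
 "!!a b. P a ==> P b ==> pkeys a <= ?S ==> pkeys b <= ?S ==> P (a - b)"
 "!!g. g : ?G ==> P g" for P a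
 using a unfolding tensor_rel_def
 proof (induction rule: generate.induct)
 case one
 then show ?case by (simp add: P)
 next
 case (incl h)
 then show ?case using G[OF incl] P(3)[OF incl] by blast
 next
 case (inv h)
 have "P (0 - h)" using P(2)[OF P(1) P(3)[OF inv]] G[OF inv] by simp
 then show ?case using G[OF inv] kd[of 0 h] by simp
 next
 case (eng h1 h2)
 have "P (0 - h2)" using P(2)[OF P(1), of h2] eng by simp
 then have "P (h1 - (0 - h2))" using eng kd[of 0 h2] by - (rule P(2), auto)
 moreover have "pkeys (h1 - (0 - h2)) <= ?S"
 by (intro kd) (use eng in auto)
 ultimately show ?case by simp
 qed
 show "pkeys a <= ?S" if "a : tensor_rel R M N"
 using gen[OF that, of "%_. True"] by simp
 assume *: "a : tensor_rel R M N" "0 : Z"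
 "!!a b. a : Z ==> b : Z ==> pkeys a <= ?S ==> pkeys b <= ?S ==> a - b : Z"
 "!!u u' v. u : carrier M ==> u' : carrier M ==> v : carrier N ==>
 frag_of (u \<oplus>\<^bsub>M\<^esub> u', v) - frag_of (u, v) - frag_of (u', v) : Z"
 "!!u v v'. u : carrier M ==> v : carrier N ==> v' : carrier N ==>
 frag_of (u, v \<oplus>\<^bsub>N\<^esub> v') - frag_of (u, v) - frag_of (u, v') : Z"
 "!!r u v. r : carrier R ==> u : carrier M ==> v : carrier N ==>
 frag_of (r \<odot>\<^bsub>M\<^esub> u, v) - frag_of (u, r \<odot>\<^bsub>N\<^esub> v) : Z"
 show "a : Z"
 using gen[OF *(1), of "%a. a : Z"] *(2-) by blast
qed

lemma rel_0 [simp]: "0 : tensor_rel R M N"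
 unfolding tensor_rel_def using generate.one[of "pair_group M N"] by simp

lemma rel_add: "a : tensor_rel R M N ==> b : tensor_rel R M N ==> a + b : tensor_rel R M N"
 unfolding tensor_rel_def using generate.eng[of a "pair_group M N" _ b] by simp

lemma rel_uminus: "a : tensor_rel R M N ==> - a : tensor_rel R M N"
proof -
 assume a: "a : tensor_rel R M N"
 obtain X where X: "tensor_rel R M N = generate (pair_group M N) X"
 unfolding tensor_rel_def by blast
 have "X <= carrier (pair_group M N)"
 using rel_subset_keys unfolding X
 by (metis carrier_free_Abelian_group_iff generate.incl subsetI)
 then have "inv\<^bsub>pair_group M N\<^esub> a : tensor_rel R M N"
 using group.generate_m_inv_closed[OF group_free_Abelian_group, of X] a unfolding X by blast
 then show ?thesis using rel_subset_keys[OF a] by simp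
qed

lemma rel_diff: "a : tensor_rel R M N ==> b : tensor_rel R M N ==> a - b : tensor_rel R M N"
 using rel_add[of a "- b"] rel_uminus by simp

lemma rel_sum: "(!!i. i : S ==> f i : tensor_rel R M N) ==> (SUM i:S. f i) : tensor_rel R M N"
 by (induction S rule: infinite_finite_induct) (auto intro: rel_add)

lemma rel_add_left: "u : carrier M ==> u' : carrier M ==> v : carrier N ==>
 frag_of (u \<oplus>\<^bsub>M\<^esub> u', v) - frag_of (u, v) - frag_of (u', v) : tensor_rel R M N"
 and rel_add_right: "u : carrier M ==> v : carrier N ==> v' : carrier N ==>
 frag_of (u, v \<oplus>\<^bsub>N\<^esub> v') - frag_of (u, v) - frag_of (u, v') : tensor_rel R M N"
 and rel_smult: "r : carrier R ==> u : carrier M ==> v : carrier N ==>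
 frag_of (r \<odot>\<^bsub>M\<^esub> u, v) - frag_of (u, r \<odot>\<^bsub>N\<^esub> v) : tensor_rel R M N"
 unfolding tensor_rel_def by (rule generate.incl, blast)+

lemma class_eq: "tensor_class R M N a = {r + a |r. r : tensor_rel R M N}"
 unfolding tensor_class_def r_coset_def by auto

lemma mem_class: "a' : tensor_class R M N a \<longleftrightarrow> a' - a : tensor_rel R M N"
 unfolding class_eq by (auto, metis diff_add_cancel)

lemma self_mem_class [simp]: "a : tensor_class R M N a"
 by (simp add: mem_class)

lemma class_eq_iff: "tensor_class R M N a = tensor_class R M N b \<longleftrightarrow> a - b : tensor_rel R M N"
proof
 assume "tensor_class R M N a = tensor_class R M N b"
 then show "a - b : tensor_rel R M N" using self_mem_class[of a] by (simp add: mem_class)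
next
 assume ab: "a - b : tensor_rel R M N"
 show "tensor_class R M N a = tensor_class R M N b"
 proof (intro Set.set_eqI)
 fix c
 have "c - a : tensor_rel R M N \<longleftrightarrow> c - b : tensor_rel R M N"
 using rel_add[OF _ ab, of "c - a"] rel_diff[OF _ ab, of "c - b"] by auto
 then show "c : tensor_class R M N a \<longleftrightarrow> c : tensor_class R M N b"
 by (simp add: mem_class)
 qed
qed

lemma carrier_tensor:
 "carrier (tensor R M N) = {tensor_class R M N a |a. pkeys a <= carrier M \<times> carrier N}"
 unfolding tensor_def tensor_class_def by (auto simp: FactGroup_def RCOSETS_def)

lemma class_in_tensor [simp]:
 "pkeys a <= carrier M \<times> carrier N ==> tensor_class R M N a : carrier (tensor R M N)"
 unfolding carrier_tensor by blast

lemma mem_tensor_keys: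
 assumes "t : carrier (tensor R M N)" "a : t"
 shows "pkeys a <= carrier M \<times> carrier N" and "t = tensor_class R M N a"
proof -
 obtain b where b: "t = tensor_class R M N b" "pkeys b <= carrier M \<times> carrier N"
 using assms(1) unfolding carrier_tensor by blast
 then have ab: "a - b : tensor_rel R M N" using assms(2) by (simp add: mem_class)
 show "t = tensor_class R M N a" using b(1) ab class_eq_iff by blast
 have "pkeys (a - b + b) <= carrier M \<times> carrier N"
 using keys_add[of "a - b" b] rel_subset_keys[OF ab] b(2) by blast
 then show "pkeys a <= carrier M \<times> carrier N" by simp
qed

lemma add_tensor:
 "tensor_class R M N a \<oplus>\<^bsub>tensor R M N\<^esub> tensor_class R M N b = tensor_class R M N (a + b)"
proof -
 have "tensor_class R M N a \<oplus>\<^bsub>tensor R M N\<^esub> tensor_class R M N b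
 = {s + t |s t. s : tensor_class R M N a & t : tensor_class R M N b}"
 unfolding tensor_def by (auto simp: FactGroup_def set_mult_def)
 also have "... = tensor_class R M N (a + b)"
 proof (intro Set.set_eqI iffI)
 fix c assume "c : {s + t |s t. s : tensor_class R M N a & t : tensor_class R M N b}"
 then obtain s t where st: "c = s + t" "s - a : tensor_rel R M N" "t - b : tensor_rel R M N"
 by (auto simp: mem_class)
 have "(s - a) + (t - b) : tensor_rel R M N" using st rel_add by blast
 then show "c : tensor_class R M N (a + b)" by (simp add: mem_class st(1) algebra_simps)
 next
 fix c assume "c : tensor_class R M N (a + b)"
 then have "c - b : tensor_class R M N a" by (simp add: mem_class algebra_simps)
 then show "c : {s + t |s t. s : tensor_class R M N a & t : tensor_class R M N b}"
 using self_mem_class[of b] by (metis (mono_tags, lifting) diff_add_cancel mem_Collect_eq)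
 qed
 finally show ?thesis .
qed

lemma zero_tensor: "\<zero>\<^bsub>tensor R M N\<^esub> = tensor_class R M N 0"
 unfolding tensor_def class_eq by simp

text \<open>The universal property of the tensor product in the form used below: a biadditive
  balanced \<open>g\<close> takes the same \<open>fsum\<close> on all representatives of a
  coset.\<close>

lemma fsum_kill:
 assumes "a : tensor_rel R M N"
 and "!!u u' v. u : carrier M ==> u' : carrier M ==> v : carrier N ==>
 g (u \<oplus>\<^bsub>M\<^esub> u', v) = g (u, v) + g (u', v)"
 and "!!u v v'. u : carrier M ==> v : carrier N ==> v' : carrier N ==>
 g (u, v \<oplus>\<^bsub>N\<^esub> v') = g (u, v) + g (u, v')"
 and "!!r u v. r : carrier R ==> u : carrier M ==> v : carrier N ==>
 g (r \<odot>\<^bsub>M\<^esub> u, v) = g (u, r \<odot>\<^bsub>N\<^esub> v)"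
 shows "fsum g a = 0"
proof -
 have "a : {a. fsum g a = 0}"
 by (rule rel_kill[OF assms(1)]) (use assms(2-) in \<open>auto simp: fsum_diff\<close>)
 then show ?thesis by simp
qed

end

text \<open>The union in \<open>tensor_map\<close> collapses to one coset because the extended map
  sends relations to relations. The condition \<open>bal\<close> asks for balance modulo the target
  relations and not for linearity, so that conjugations and evaluations at a point are covered as
  well.\<close>

lemma tensor_map_class:
 fixes M :: "('r, 'm) module" and M' :: "('r, 'm2) module" and N' :: "('r, 'n2) module"
 assumes "tensor_pair R M N" "tensor_pair R M' N'"
 and f: "!!u. u : carrier M ==> f u : carrier M'" "!!v. v : carrier N ==> g v : carrier N'"
 and fadd: "!!u v. u : carrier M ==> v : carrier M ==> f (u \<oplus>\<^bsub>M\<^esub> v) = f u \<oplus>\<^bsub>M'\<^esub> f v"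
 and gadd: "!!u v. u : carrier N ==> v : carrier N ==> g (u \<oplus>\<^bsub>N\<^esub> v) = g u \<oplus>\<^bsub>N'\<^esub> g v"
 and bal: "!!r u v. r : carrier R ==> u : carrier M ==> v : carrier N ==>
 frag_of (f (r \<odot>\<^bsub>M\<^esub> u), g v) - frag_of (f u, g (r \<odot>\<^bsub>N\<^esub> v)) : tensor_rel R M' N'"
 and a: "pkeys a <= carrier M \<times> carrier N"
 shows "tensor_map R M' N' f g (tensor_class R M N a)
 = tensor_class R M' N' (frag_extend (%(u, v). frag_of (f u, g v)) a)" (is "_ = tensor_class R M' N' (?E a)")
 and "pkeys (frag_extend (%(u, v). frag_of (f u, g v)) a) <= carrier M' \<times> carrier N'"
proof -
 interpret S: tensor_pair R M N by fact
 interpret T: tensor_pair R M' N' by fact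
 have "pkeys (?E a) <= (UN x:pkeys a. pkeys ((%(u, v). frag_of (f u, g v)) x))"
 by (rule keys_frag_extend)
 also have "... <= carrier M' \<times> carrier N'"
 using a f by (fastforce simp: keys_frag_of split: prod.splits)
 finally show "pkeys (?E a) <= carrier M' \<times> carrier N'" .
 have E: "?E r : tensor_rel R M' N'" if "r : tensor_rel R M N" for r
 proof -
 have "r : {r. ?E r : tensor_rel R M' N'}"
 proof (rule S.rel_kill[OF that])
 fix r u v assume "r : carrier R" "u : carrier M" "v : carrier N"
 then show "frag_of (r \<odot>\<^bsub>M\<^esub> u, v) - frag_of (u, r \<odot>\<^bsub>N\<^esub> v) : {r. ?E r : tensor_rel R M' N'}"
 using bal by (simp add: frag_extend_diff)
 qed (auto simp: frag_extend_diff fadd gadd f T.rel_add_left T.rel_add_right T.rel_diff)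
 then show ?thesis by simp
 qed
 have "tensor_map R M' N' f g (tensor_class R M N a) = (UN b:tensor_class R M N a. tensor_class R M' N' (?E b))"
 by (simp add: tensor_map_def)
 also have "... = tensor_class R M' N' (?E a)"
 proof -
 have "tensor_class R M' N' (?E b) = tensor_class R M' N' (?E a)" if "b : tensor_class R M N a" for b
 using that E[of "b - a"] by (simp add: S.mem_class T.class_eq_iff frag_extend_diff)
 then show ?thesis using S.self_mem_class[of a] by blast
 qed
 finally show "tensor_map R M' N' f g (tensor_class R M N a) = tensor_class R M' N' (?E a)" .
qed

section \<open>Base change of modules with a basis\<close>

text \<open>One interface for all base changes: the field of fractions, its algebraic closure, the
  complex numbers, the local ring at a point and the trivial basic open set. The carrier may be a
  proper subring of its type, hence the closure conditions.\<close>

locale scalar_ext =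
 fixes A :: "'a::comm_ring_1 ring" and h :: "complex poly => 'a"
 assumes ops: "monoid.mult A = (*)" "add A = (+)" "ring.zero A = 0" "one A = 1"
 and one_in [simp]: "1 : carrier A"
 and diff_in: "!!a b. a : carrier A ==> b : carrier A ==> a - b : carrier A"
 and mult_in: "!!a b. a : carrier A ==> b : carrier A ==> a * b : carrier A"
 and h_in [simp]: "h r : carrier A"
 and h_add: "h (r + s) = h r + h s"
 and h_mult: "h (r * s) = h r * h s"
 and h_1 [simp]: "h 1 = 1"
begin

lemma zero_in [simp]: "0 : carrier A" using diff_in[OF one_in one_in] by simp
lemma uminus_in: "a : carrier A ==> - a : carrier A" using diff_in[OF zero_in] by simp
lemma add_in: "a : carrier A ==> b : carrier A ==> a + b : carrier A"
 using diff_in[OF _ uminus_in, of a b] by simp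

lemma sum_in: "(!!i. i : S ==> f i : carrier A) ==> (SUM i:S. f i) : carrier A"
 by (induction S rule: infinite_finite_induct) (auto intro: add_in)

lemma of_int_in: "of_int n : carrier A"
proof -
 have "of_nat n : carrier A" for n by (induction n) (auto intro: add_in)
 then show ?thesis by (cases n rule: int_cases2) (auto intro: uminus_in)
qed

lemma fsum_in: "(!!p. p : pkeys a ==> g p : carrier A) ==> fsum g a : carrier A"
 unfolding fsum_def by (intro sum_in mult_in of_int_in) auto

lemma h_0 [simp]: "h 0 = 0" using h_add[of 0 0] by simp
lemma h_sum: "h (SUM i:S. f i) = (SUM i:S. h (f i))"
 by (induction S rule: infinite_finite_induct) (auto simp: h_add)

lemma alg_module_simps [simp]:
 "carrier (alg_module A h) = carrier A"
 "add (alg_module A h) = (+)" "ring.zero (alg_module A h) = 0"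
 "smult (alg_module A h) = (%r a. h r * a)"
 by (simp_all add: alg_module_def ops)

lemma scalar_closed_alg: "scalar_closed Oring (alg_module A h)"
 by (simp add: scalar_closed_def add_in mult_in)

lemma cring_A: "cring A"
proof (rule cringI)
 show "abelian_group A"
 proof (rule abelian_groupI)
 fix x assume "x : carrier A"
 then show "EX y:carrier A. y \<oplus>\<^bsub>A\<^esub> x = \<zero>\<^bsub>A\<^esub>"
 by (intro bexI[of _ "- x"]) (simp_all add: ops uminus_in)
 qed (simp_all add: ops add_in algebra_simps)
 show "comm_monoid A"
 by (rule comm_monoidI) (simp_all add: ops mult_in algebra_simps)
qed (simp add: ops algebra_simps)

end

text \<open>Freeness by a coordinate function that is total and vanishes off \<open>I\<close>, which
  avoids choosing expansions repeatedly. The index type is kept apart from the module: numbers index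
  the test modules, while the elements of one basis of \<open>F\<close> index both \<open>F\<close>
  and its twisted dual.\<close>

locale based =
 fixes M :: "(complex poly, 'm) module" and I :: "'i set"
 and crd :: "'m => 'i => complex poly" and bas :: "'i => 'm"
 assumes mod: "Module.module Oring M"
 and crd_add: "!!u v. u : carrier M ==> v : carrier M ==> crd (u \<oplus>\<^bsub>M\<^esub> v) i = crd u i + crd v i"
 and crd_smult: "!!q u. u : carrier M ==> crd (q \<odot>\<^bsub>M\<^esub> u) i = q * crd u i"
 and crd_finite: "!!u. u : carrier M ==> finite {i. crd u i ~= 0}"
 and crd_outside: "!!u i. u : carrier M ==> i ~: I ==> crd u i = 0"
 and bas_in: "!!i. i : I ==> bas i : carrier M"
 and crd_bas: "!!i j. i : I ==> crd (bas i) j = (if j = i then 1 else 0)"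
 and crd_inj: "!!u v. u : carrier M ==> v : carrier M ==> crd u = crd v ==> u = v"
begin

sublocale M: Module.module Oring M by (rule mod)

lemma crd_zero [simp]: "crd \<zero>\<^bsub>M\<^esub> i = 0"
 using crd_add[of "\<zero>\<^bsub>M\<^esub>" "\<zero>\<^bsub>M\<^esub>" i] by simp

lemma crd_finsum:
 assumes "finite J" "f : J \<rightarrow> carrier M"
 shows "crd (\<Oplus>\<^bsub>M\<^esub>j\<in>J. f j) i = (SUM j:J. crd (f j) i)"
 using assms by (induction J) (auto simp: crd_add Pi_def)

lemma reconstruct:
 assumes "u : carrier M" "finite J" "{i. crd u i ~= 0} <= J" "J <= I"
 shows "u = (\<Oplus>\<^bsub>M\<^esub>i\<in>J. crd u i \<odot>\<^bsub>M\<^esub> bas i)"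
proof (rule crd_inj)
 have *: "(%i. crd u i \<odot>\<^bsub>M\<^esub> bas i) : J \<rightarrow> carrier M" using assms(4) bas_in by auto
 then show "(\<Oplus>\<^bsub>M\<^esub>i\<in>J. crd u i \<odot>\<^bsub>M\<^esub> bas i) : carrier M" by (rule M.M.finsum_closed)
 show "crd u = crd (\<Oplus>\<^bsub>M\<^esub>i\<in>J. crd u i \<odot>\<^bsub>M\<^esub> bas i)"
 proof
 fix i
 have "crd (\<Oplus>\<^bsub>M\<^esub>i\<in>J. crd u i \<odot>\<^bsub>M\<^esub> bas i) i = (SUM j:J. crd u j * (if i = j then 1 else 0))"
 unfolding crd_finsum[OF assms(2) *]
 by (intro sum.cong) (use assms(4) in \<open>auto simp: crd_smult bas_in crd_bas\<close>)
 also have "... = crd u i" using assms(2,3) by (auto simp: sum.delta if_distrib cong: if_cong)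
 finally show "crd u i = crd (\<Oplus>\<^bsub>M\<^esub>i\<in>J. crd u i \<odot>\<^bsub>M\<^esub> bas i) i" ..
 qed
qed (use assms in auto)

lemma crd_mk:
 assumes "finite J" "J <= I"
 shows "(\<Oplus>\<^bsub>M\<^esub>i\<in>J. q i \<odot>\<^bsub>M\<^esub> bas i) : carrier M"
 and "crd (\<Oplus>\<^bsub>M\<^esub>i\<in>J. q i \<odot>\<^bsub>M\<^esub> bas i) j = (if j : J then q j else 0)"
proof -
 have *: "(%i. q i \<odot>\<^bsub>M\<^esub> bas i) : J \<rightarrow> carrier M" using assms(2) bas_in by auto
 then show "(\<Oplus>\<^bsub>M\<^esub>i\<in>J. q i \<odot>\<^bsub>M\<^esub> bas i) : carrier M" by (rule M.M.finsum_closed)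
 have "crd (\<Oplus>\<^bsub>M\<^esub>i\<in>J. q i \<odot>\<^bsub>M\<^esub> bas i) j = (SUM i:J. q i * (if j = i then 1 else 0))"
 unfolding crd_finsum[OF assms(1) *]
 by (intro sum.cong) (use assms(2) in \<open>auto simp: crd_smult bas_in crd_bas\<close>)
 also have "... = (if j : J then q j else 0)" using assms(1) by (auto simp: if_distrib cong: if_cong)
 finally show "crd (\<Oplus>\<^bsub>M\<^esub>i\<in>J. q i \<odot>\<^bsub>M\<^esub> bas i) j = (if j : J then q j else 0)" .
qed

lemma scalar_closed_M: "scalar_closed Oring M"
 by (rule scalar_closed_module) (rule mod)

end

definition fcoord :: "(complex poly => 'a::comm_ring_1) => ('m => 'i => complex poly) => ('a \<times> 'm \<Rightarrow>\<^sub>0 int) => 'i => 'a" where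
 "fcoord h crd a i = fsum (%(c, m). c * h (crd m i)) a"

text \<open>The base ring does not occur in it, so that coordinates over the local ring and over the
  field of fractions are literally the same function. The choice of representative is harmless by
  \<open>tc_class\<close>.\<close>

definition tcoord :: "(complex poly => 'a::comm_ring_1) => ('m => 'i => complex poly) => ('a \<times> 'm \<Rightarrow>\<^sub>0 int) set => 'i => 'a" where
 "tcoord h crd t = fcoord h crd (SOME a. a : t)"

definition fin_supp :: "'i set => 'a::comm_ring_1 set => ('i => 'a) set" where
 "fin_supp I S = {v. finite {i. v i ~= 0} & (ALL i. i ~: I --> v i = 0) & range v <= S}"

lemma base_change_simps [simp]:
 "carrier (base_change A h M) = carrier (tensor Oring (alg_module A h) M)"
 "add (base_change A h M) = add (tensor Oring (alg_module A h) M)"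
 "ring.zero (base_change A h M) = ring.zero (tensor Oring (alg_module A h) M)"
 "smult (base_change A h M) = (%a. tensor_map Oring (alg_module A h) M (%b. a \<otimes>\<^bsub>A\<^esub> b) (%m. m))"
 by (simp_all add: base_change_def Let_def)

locale based_ext = based M I crd bas + scalar_ext A h
 for M :: "(complex poly, 'm) module" and I :: "'i set"
 and crd :: "'m => 'i => complex poly" and bas :: "'i => 'm"
 and A :: "'a::comm_ring_1 ring" and h :: "complex poly => 'a"
begin

sublocale T: tensor_pair Oring "alg_module A h" M
 by unfold_locales (rule scalar_closed_alg scalar_closed_M)+

abbreviation "BC \<equiv> base_change A h M"
abbreviation "cls \<equiv> tensor_class Oring (alg_module A h) M"
abbreviation "rel \<equiv> tensor_rel Oring (alg_module A h) M"
abbreviation "fc \<equiv> fcoord h crd"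
abbreviation "tc \<equiv> tcoord h crd"

lemma fc_rel: "a : rel ==> fc a i = 0"
 unfolding fcoord_def
 by (erule T.fsum_kill) (simp_all add: crd_add crd_smult h_add h_mult algebra_simps)

lemma fc_diff: "fc (a - b) i = fc a i - fc b i" and fc_add: "fc (a + b) i = fc a i + fc b i"
 and fc_0 [simp]: "fc 0 i = 0"
 and fc_of [simp]: "fc (frag_of (c, m)) i = c * h (crd m i)"
 by (simp_all add: fcoord_def fsum_diff fsum_add)

lemma frag_zero_left: "m : carrier M ==> frag_of (0, m) : rel"
 using T.rel_add_left[of 0 0 m] T.rel_uminus[of "- frag_of (0, m)"] by simp

lemma frag_zero_right: "c : carrier A ==> frag_of (c, \<zero>\<^bsub>M\<^esub>) : rel"
 using T.rel_add_right[of c "\<zero>\<^bsub>M\<^esub>" "\<zero>\<^bsub>M\<^esub>"] T.rel_uminus[of "- frag_of (c, \<zero>\<^bsub>M\<^esub>)"] by simp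

lemma frag_finsum:
 assumes "finite J" "f : J \<rightarrow> carrier M" "c : carrier A"
 shows "frag_of (c, \<Oplus>\<^bsub>M\<^esub>j\<in>J. f j) - (SUM j:J. frag_of (c, f j)) : rel"
 using assms(1,2)
proof (induction J)
 case empty
 then show ?case by (simp add: frag_zero_right assms(3))
next
 case (insert x J)
 then have *: "f x : carrier M" "f : J \<rightarrow> carrier M" by auto
 let ?s = "\<Oplus>\<^bsub>M\<^esub>j\<in>J. f j"
 have s: "?s : carrier M" using * by (rule_tac M.M.finsum_closed)
 have "(frag_of (c, f x \<oplus>\<^bsub>M\<^esub> ?s) - frag_of (c, f x) - frag_of (c, ?s))
 + (frag_of (c, ?s) - (SUM j:J. frag_of (c, f j))) : rel"
 using insert * s assms(3) by (intro T.rel_add T.rel_add_right) auto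
 then show ?case using insert * by (simp add: algebra_simps)
qed

text \<open>The expansion is claimed for every sufficiently large finite \<open>J\<close>, because
  the induction step for a difference must expand both terms over a common index set.\<close>

lemma frag_expand:
 assumes "pkeys a <= carrier A \<times> carrier M"
 shows "EX J0. finite J0 & J0 <= I & (ALL J. finite J & J0 <= J & J <= I -->
 (ALL i. i ~: J --> fc a i = 0) & a - (SUM i:J. frag_of (fc a i, bas i)) : rel)" (is "?P a")
proof (rule free_Abelian_group_induct[OF assms, of ?P])
 show "?P 0"
 by (rule exI[of _ "{}"]) (auto intro!: T.rel_uminus T.rel_sum frag_zero_left bas_in simp: subset_iff)
next
 fix a b :: "'a \<times> 'm \<Rightarrow>\<^sub>0 int" assume k: "pkeys a <= carrier A \<times> carrier M" "pkeys b <= carrier A \<times> carrier M"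
 assume "?P a"
 then obtain Ja where a: "finite Ja" "Ja <= I" "ALL J. finite J & Ja <= J & J <= I -->
 (ALL i. i ~: J --> fc a i = 0) & a - (SUM i:J. frag_of (fc a i, bas i)) : rel"
 by (elim exE conjE)
 assume "?P b"
 then obtain Jb where b: "finite Jb" "Jb <= I" "ALL J. finite J & Jb <= J & J <= I -->
 (ALL i. i ~: J --> fc b i = 0) & b - (SUM i:J. frag_of (fc b i, bas i)) : rel"
 by (elim exE conjE)
 show "?P (a - b)"
 proof (intro exI[of _ "Ja \<union> Jb"] conjI allI impI)
 fix J assume J: "finite J & Ja \<union> Jb <= J & J <= I"
 then have A: "ALL i. i ~: J --> fc a i = 0" "a - (SUM i:J. frag_of (fc a i, bas i)) : rel"
 and B: "ALL i. i ~: J --> fc b i = 0" "b - (SUM i:J. frag_of (fc b i, bas i)) : rel"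
 using a(3)[rule_format, of J] b(3)[rule_format, of J] by auto
 show "fc (a - b) i = 0" if "i ~: J" for i using A B that by (simp add: fc_diff)
 have fa: "fc a i : carrier A" "fc b i : carrier A" for i
 unfolding fcoord_def using k by (auto intro!: fsum_in mult_in)
 \<comment> \<open>Here \<open>frag_of\<close> is not additive in its first entry. This sum of
   relations converts the coordinates of \<open>a\<close> into those of \<open>a - b\<close> plus
   those of \<open>b\<close>.\<close>
 have s: "(SUM i:J. frag_of (fc (a - b) i + fc b i, bas i) - frag_of (fc (a - b) i, bas i) - frag_of (fc b i, bas i)) : rel"
 proof (rule T.rel_sum)
 fix i assume "i : J"
 then have "bas i : carrier M" using J bas_in by auto
 moreover have "fc (a - b) i : carrier A" using fa diff_in by (simp add: fc_diff)
 ultimately show "frag_of (fc (a - b) i + fc b i, bas i) - frag_of (fc (a - b) i, bas i) - frag_of (fc b i, bas i) : rel"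
 using T.rel_add_left[of "fc (a - b) i" "fc b i" "bas i"] fa by simp
 qed
 have "(a - (SUM i:J. frag_of (fc a i, bas i))) - (b - (SUM i:J. frag_of (fc b i, bas i)))
 + (SUM i:J. frag_of (fc (a - b) i + fc b i, bas i) - frag_of (fc (a - b) i, bas i) - frag_of (fc b i, bas i)) : rel"
 by (intro T.rel_add T.rel_diff A B s)
 then show "a - b - (SUM i:J. frag_of (fc (a - b) i, bas i)) : rel"
 by (simp add: sum_subtractf sum.distrib fc_diff algebra_simps)
 qed (use a b in auto)
next
 fix p assume "p : carrier A \<times> carrier M"
 then obtain c m where p: "p = (c, m)" and c: "c : carrier A" and m: "m : carrier M" by blast
 show "?P (frag_of p)"
 proof (intro exI[of _ "{i. crd m i ~= 0}"] conjI allI impI)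
 fix J assume J: "finite J & {i. crd m i ~= 0} <= J & J <= I"
 show "fc (frag_of p) i = 0" if "i ~: J" for i
 using J that by (force simp: p)
 have mm: "m = (\<Oplus>\<^bsub>M\<^esub>i\<in>J. crd m i \<odot>\<^bsub>M\<^esub> bas i)" using J m by (intro reconstruct) auto
 have b: "bas i : carrier M" if "i : J" for i using that J bas_in by auto
 have "frag_of (c, m) - (SUM i:J. frag_of (c, crd m i \<odot>\<^bsub>M\<^esub> bas i)) : rel"
 by (subst mm) (use J b c in \<open>auto intro!: frag_finsum\<close>)
 moreover have "(SUM i:J. frag_of (h (crd m i) * c, bas i) - frag_of (c, crd m i \<odot>\<^bsub>M\<^esub> bas i)) : rel"
 using T.rel_smult c b by (intro T.rel_sum) simp
 ultimately have "(frag_of (c, m) - (SUM i:J. frag_of (c, crd m i \<odot>\<^bsub>M\<^esub> bas i)))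
 - (SUM i:J. frag_of (h (crd m i) * c, bas i) - frag_of (c, crd m i \<odot>\<^bsub>M\<^esub> bas i)) : rel"
 by (rule T.rel_diff)
 then show "frag_of p - (SUM i:J. frag_of (fc (frag_of p) i, bas i)) : rel"
 by (simp add: p sum_subtractf algebra_simps)
 qed (use crd_finite[OF m] crd_outside[OF m] in auto)
qed

lemma frag_expand_obtain:
 assumes "pkeys a <= carrier A \<times> carrier M"
 obtains J where "finite J" "J <= I" "ALL i. i ~: J --> fc a i = 0"
 "a - (SUM i:J. frag_of (fc a i, bas i)) : rel"
proof -
 from frag_expand[OF assms] obtain J where J: "finite J" "J <= I"
 and *: "ALL J'. finite J' & J <= J' & J' <= I -->
 (ALL i. i ~: J' --> fc a i = 0) & a - (SUM i:J'. frag_of (fc a i, bas i)) : rel"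
 by (elim exE conjE)
 show thesis using that[OF J] *[rule_format, of J] J by simp
qed

text \<open>The expansion over the basis leaves only terms with coefficient 0, and these are
  relations. Coordinates are thus injective on the tensor product.\<close>

lemma rel_iff:
 assumes "pkeys a <= carrier A \<times> carrier M"
 shows "a : rel \<longleftrightarrow> (ALL i. fc a i = 0)"
proof
 assume z: "ALL i. fc a i = 0"
 obtain J where "finite J" "J <= I" "a - (SUM i:J. frag_of (fc a i, bas i)) : rel"
 using frag_expand_obtain[OF assms] .
 moreover have "(SUM i:J. frag_of (fc a i, bas i)) : rel"
 using \<open>J <= I\<close> z by (intro T.rel_sum) (auto intro!: frag_zero_left bas_in)
 ultimately show "a : rel" using T.rel_add by fastforce
qed (use fc_rel in blast)

lemma fc_fin_supp:
 assumes "pkeys a <= carrier A \<times> carrier M"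
 shows "fc a : fin_supp I (carrier A)"
proof -
 obtain J where J: "finite J" "J <= I" "ALL i. i ~: J --> fc a i = 0"
 using frag_expand_obtain[OF assms] .
 have "fc a i : carrier A" for i
 unfolding fcoord_def using assms by (auto intro!: fsum_in mult_in)
 moreover have "{i. fc a i ~= 0} <= J" using J(3) by blast
 then have "finite {i. fc a i ~= 0}" using J(1) finite_subset by blast
 ultimately show ?thesis unfolding fin_supp_def using J(2,3) by auto
qed

lemma tc_class: "tc (cls a) = fc a"
proof -
 define b where "b = (SOME b. b : cls a)"
 have "b : cls a" unfolding b_def by (rule someI[of _ a]) simp
 then have "fc (b - a) i = 0" for i unfolding T.mem_class by (rule fc_rel)
 then show ?thesis
 unfolding tcoord_def b_def[symmetric] by (auto simp: fc_diff)
qed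

lemma tc_mem: "t : carrier BC ==> a : t ==> tc t = fc a"
 using T.mem_tensor_keys(2)[of t a] tc_class by simp

lemma BC_cases:
 assumes "t : carrier BC"
 obtains a where "t = cls a" "pkeys a <= carrier A \<times> carrier M" "a : t"
proof -
 have "t : {cls a |a. pkeys a <= carrier A \<times> carrier M}"
 using assms by (simp only: base_change_simps T.carrier_tensor alg_module_simps)
 then show thesis using that T.self_mem_class by blast
qed

lemma tc_in: "t : carrier BC ==> tc t : fin_supp I (carrier A)"
 by (erule BC_cases) (simp add: tc_class fc_fin_supp)

lemma tc_inj:
 assumes "s : carrier BC" "t : carrier BC" "tc s = tc t" shows "s = t"
proof -
 obtain a b where a: "s = cls a" "pkeys a <= carrier A \<times> carrier M"
 and b: "t = cls b" "pkeys b <= carrier A \<times> carrier M"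
 using assms(1,2) BC_cases by metis
 have "pkeys (a - b) <= carrier A \<times> carrier M" using a b keys_diff[of a b] by blast
 moreover have "fc (a - b) i = 0" for i using assms(3) a b by (simp add: tc_class fc_diff)
 ultimately show ?thesis using rel_iff a b T.class_eq_iff by blast
qed

definition mk :: "('i => 'a) => ('a \<times> 'm \<Rightarrow>\<^sub>0 int) set" where
 "mk v = cls (SUM i:{i. v i ~= 0}. frag_of (v i, bas i))"

lemma mk:
 assumes "v : fin_supp I (carrier A)"
 shows "mk v : carrier BC" "tc (mk v) = v"
proof -
 let ?S = "{i. v i ~= 0}"
 have S: "finite ?S" "?S <= I" "!!i. v i : carrier A" using assms by (auto simp: fin_supp_def)
 have "(SUM i:?S. frag_of (v i, bas i)) : carrier (free_Abelian_group (carrier A \<times> carrier M))"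
 by (rule sum_closed_free_Abelian_group) (use S bas_in in \<open>auto simp: keys_frag_of\<close>)
 then show "mk v : carrier BC" by (simp add: mk_def)
 show "tc (mk v) = v"
 proof
 fix j
 have "tc (mk v) j = (SUM i:?S. v i * h (crd (bas i) j))"
 by (simp add: mk_def tc_class fcoord_def fsum_sum)
 also have "... = (SUM i:?S. if j = i then v i else 0)"
 by (intro sum.cong) (use S in \<open>auto simp: crd_bas\<close>)
 also have "... = v j" using S(1) by auto
 finally show "tc (mk v) j = v j" .
 qed
qed

lemma mk_tc: "t : carrier BC ==> mk (tc t) = t"
 using tc_inj mk tc_in by metis

lemma tc_add:
 "s : carrier BC ==> t : carrier BC ==> tc (s \<oplus>\<^bsub>BC\<^esub> t) = (%i. tc s i + tc t i)"
 by (elim BC_cases) (simp add: T.add_tensor tc_class fc_add fun_eq_iff)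

lemma BC_add_closed:
 assumes "s : carrier BC" "t : carrier BC" shows "s \<oplus>\<^bsub>BC\<^esub> t : carrier BC"
proof -
 obtain a b where a: "s = cls a" "pkeys a <= carrier A \<times> carrier M"
 and b: "t = cls b" "pkeys b <= carrier A \<times> carrier M"
 using assms BC_cases by metis
 have "pkeys (a + b) <= carrier A \<times> carrier M" using a b keys_add[of a b] by blast
 then show ?thesis by (simp add: a b T.add_tensor)
qed

lemma tc_zero: "tc \<zero>\<^bsub>BC\<^esub> = (%i. 0)" and BC_zero_closed: "\<zero>\<^bsub>BC\<^esub> : carrier BC"
 by (simp_all add: T.zero_tensor tc_class fun_eq_iff)

lemma smult_class:
 assumes c: "c : carrier A" and a: "pkeys a <= carrier A \<times> carrier M"
 shows "c \<odot>\<^bsub>BC\<^esub> cls a = cls (frag_extend (%(u, v). frag_of (c * u, v)) a)"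
 "pkeys (frag_extend (%(u, v). frag_of (c * u, v)) a) <= carrier A \<times> carrier M"
proof -
 have *: "frag_of (c * (h r * u), v) - frag_of (c * u, r \<odot>\<^bsub>M\<^esub> v) : rel"
 if "u : carrier A" "v : carrier M" for r u v
 using T.rel_smult[of r "c * u" v] that c by (simp add: mult_in algebra_simps)
 note tm = tensor_map_class[OF T.tensor_pair_axioms T.tensor_pair_axioms, where f = "%u. c * u" and g = "%v. v" and a = a]
 show "c \<odot>\<^bsub>BC\<^esub> cls a = cls (frag_extend (%(u, v). frag_of (c * u, v)) a)"
 unfolding base_change_simps ops
 by (rule tm(1)) (use c a * in \<open>auto simp: mult_in algebra_simps\<close>)
 show "pkeys (frag_extend (%(u, v). frag_of (c * u, v)) a) <= carrier A \<times> carrier M"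
 using tm(2) c a * by (auto simp: mult_in algebra_simps)
qed

lemma fc_extend: "fc (frag_extend (%(u, v). frag_of (f u, g v)) a) i = fsum (%(u, v). f u * h (crd (g v) i)) a"
 unfolding fcoord_def fsum_extend by (rule fsum_cong) auto

lemma tc_smult:
 assumes "c : carrier A" "t : carrier BC"
 shows "tc (c \<odot>\<^bsub>BC\<^esub> t) = (%i. c * tc t i)" "c \<odot>\<^bsub>BC\<^esub> t : carrier BC"
proof -
 obtain a where a: "t = cls a" "pkeys a <= carrier A \<times> carrier M"
 using assms BC_cases by metis
 show "c \<odot>\<^bsub>BC\<^esub> t : carrier BC"
 unfolding a(1) smult_class(1)[OF assms(1) a(2)]
 by (simp add: smult_class(2)[OF assms(1) a(2)])
 show "tc (c \<odot>\<^bsub>BC\<^esub> t) = (%i. c * tc t i)"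
 proof
 fix i
 have "fsum (%(u, v). c * u * h (crd v i)) a = fsum (%p. c * (case p of (u, v) => u * h (crd v i))) a"
 by (rule fsum_cong) (auto simp: algebra_simps)
 then show "tc (c \<odot>\<^bsub>BC\<^esub> t) i = c * tc t i"
 unfolding a(1) smult_class(1)[OF assms(1) a(2)] tc_class fc_extend
 by (simp add: fsum_cmult fcoord_def)
 qed
qed

text \<open>Every axiom is pulled back along the injective coordinate map, where it is an identity
  between functions.\<close>

lemma module_BC: "Module.module A BC"
proof (rule moduleI)
 show "cring A" by (rule cring_A)
 show "abelian_group BC"
 proof (rule abelian_groupI)
 fix s t r assume st: "s : carrier BC" "t : carrier BC" "r : carrier BC"
 show "s \<oplus>\<^bsub>BC\<^esub> t : carrier BC" using st by (rule_tac BC_add_closed)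
 show "s \<oplus>\<^bsub>BC\<^esub> t = t \<oplus>\<^bsub>BC\<^esub> s"
 by (rule tc_inj) (use st in \<open>simp_all only: BC_add_closed tc_add add.commute\<close>)
 show "(s \<oplus>\<^bsub>BC\<^esub> t) \<oplus>\<^bsub>BC\<^esub> r = s \<oplus>\<^bsub>BC\<^esub> (t \<oplus>\<^bsub>BC\<^esub> r)"
 by (rule tc_inj) (use st in \<open>simp_all only: BC_add_closed tc_add add.assoc\<close>)
 next
 fix s assume s: "s : carrier BC"
 show "\<zero>\<^bsub>BC\<^esub> \<oplus>\<^bsub>BC\<^esub> s = s"
 by (rule tc_inj) (use s in \<open>simp_all only: BC_add_closed BC_zero_closed tc_add tc_zero add_0\<close>)
 show "EX t:carrier BC. t \<oplus>\<^bsub>BC\<^esub> s = \<zero>\<^bsub>BC\<^esub>"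
 proof (rule bexI)
 have m1: "-1 : carrier A" by (simp add: uminus_in)
 show "(-1) \<odot>\<^bsub>BC\<^esub> s \<oplus>\<^bsub>BC\<^esub> s = \<zero>\<^bsub>BC\<^esub>"
 by (rule tc_inj) (use s m1 in \<open>simp_all only: BC_add_closed BC_zero_closed tc_add tc_zero tc_smult\<close>, simp)
 show "(-1) \<odot>\<^bsub>BC\<^esub> s : carrier BC" using s m1 by (rule_tac tc_smult)
 qed
 qed (rule BC_zero_closed)
next
 fix s assume s: "s : carrier BC"
 show "\<one>\<^bsub>A\<^esub> \<odot>\<^bsub>BC\<^esub> s = s"
 by (rule tc_inj) (use s in \<open>simp_all only: ops tc_smult one_in mult_1_left\<close>)
next
 fix a b s t assume *: "a : carrier A" "s : carrier BC"
 show "a \<odot>\<^bsub>BC\<^esub> s : carrier BC" using * by (rule tc_smult)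
 assume b: "b : carrier A"
 show "(a \<oplus>\<^bsub>A\<^esub> b) \<odot>\<^bsub>BC\<^esub> s = (a \<odot>\<^bsub>BC\<^esub> s) \<oplus>\<^bsub>BC\<^esub> (b \<odot>\<^bsub>BC\<^esub> s)"
 by (rule tc_inj) (use * b in \<open>simp_all only: ops tc_smult tc_add BC_add_closed add_in distrib_right\<close>)
 show "(a \<otimes>\<^bsub>A\<^esub> b) \<odot>\<^bsub>BC\<^esub> s = a \<odot>\<^bsub>BC\<^esub> (b \<odot>\<^bsub>BC\<^esub> s)"
 by (rule tc_inj) (use * b in \<open>simp_all only: ops tc_smult mult_in mult.assoc\<close>)
next
 fix a s t assume *: "a : carrier A" "s : carrier BC" "t : carrier BC"
 show "a \<odot>\<^bsub>BC\<^esub> (s \<oplus>\<^bsub>BC\<^esub> t) = (a \<odot>\<^bsub>BC\<^esub> s) \<oplus>\<^bsub>BC\<^esub> (a \<odot>\<^bsub>BC\<^esub> t)"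
 by (rule tc_inj) (use * in \<open>simp_all only: tc_smult tc_add BC_add_closed distrib_left\<close>)
qed

end

section \<open>Finitely generated modules over Euclidean rings\<close>

definition LC :: "('r, 'm) module => ('m => 'r) => 'm set => 'm" where
 "LC M c B = (\<Oplus>\<^bsub>M\<^esub>b\<in>B. c b \<odot>\<^bsub>M\<^esub> b)"

definition Sp :: "('r, 'm) module => 'm set => 'm set" where
 "Sp M B = {LC M c B |c. True}"

definition indep :: "('r::zero, 'm) module => 'm set => bool" where
 "indep M B \<longleftrightarrow> (ALL c. LC M c B = \<zero>\<^bsub>M\<^esub> --> (ALL b:B. c b = 0))"

abbreviation "submod M H \<equiv> submodule H ring_of_type_algebra M"

locale tmod =
 fixes M :: "('r::euclidean_ring, 'm) module" (structure)
 assumes module_type: "Module.module ring_of_type_algebra M"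
begin

sublocale Module.module ring_of_type_algebra M by (rule module_type)

lemma tsmult_closed [simp]: "u : carrier M ==> r \<odot> u : carrier M"
 using smult_closed by simp
lemma tsmult_l_distr: "u : carrier M ==> (r + s) \<odot> u = r \<odot> u \<oplus> s \<odot> u"
 using smult_l_distr[of r s u] by simp
lemma tsmult_r_distr: "u : carrier M ==> v : carrier M ==> r \<odot> (u \<oplus> v) = r \<odot> u \<oplus> r \<odot> v"
 using smult_r_distr[of r u v] by simp
lemma tsmult_assoc: "u : carrier M ==> r \<odot> (s \<odot> u) = (r * s) \<odot> u"
 using smult_assoc1[of r s u] by simp
lemma tsmult_1 [simp]: "u : carrier M ==> 1 \<odot> u = u"
 using smult_one[of u] by simp
lemma tsmult_0 [simp]: "u : carrier M ==> 0 \<odot> u = \<zero>"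
 using smult_l_null[of u] by simp
lemma tsmult_zero [simp]: "r \<odot> \<zero> = \<zero>"
 using smult_r_null[of r] by simp
lemma tsmult_m1: "u : carrier M ==> (-1) \<odot> u = \<ominus> u"
proof -
 assume u: "u : carrier M"
 have "(-1) \<odot> u \<oplus> u = ((-1) + 1) \<odot> u" using u by (simp only: tsmult_l_distr tsmult_1)
 then have "(-1) \<odot> u \<oplus> u = \<zero>" using u by simp
 then show ?thesis using M.minus_equality u by (metis tsmult_closed)
qed
lemma tsmult_uminus: "u : carrier M ==> (- r) \<odot> u = \<ominus> (r \<odot> u)"
 using tsmult_assoc[of u "-1" r] tsmult_m1[of "r \<odot> u"] by simp

lemma add_diff_cancel3: "u : carrier M ==> v : carrier M ==> v \<oplus> (u \<oplus> \<ominus> v) = u"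
 by (metis M.a_comm M.a_lcomm M.minus_closed M.r_neg M.r_zero a_minus_def abelian_group.a_inv_closed M.abelian_group_axioms)

lemma diff_eq_0:
 assumes "u : carrier M" "v : carrier M" "u \<ominus> v = \<zero>"
 shows "u = v"
 using add_diff_cancel3[of u v] assms by (simp add: a_minus_def)

lemma submodD:
 assumes "submod M H"
 shows "H <= carrier M" "\<zero> : H" "!!u v. u : H ==> v : H ==> u \<oplus> v : H"
 "!!r u. u : H ==> r \<odot> u : H" "!!u. u : H ==> \<ominus> u : H" "!!u v. u : H ==> v : H ==> u \<ominus> v : H"
proof -
 note * = submoduleE[OF assms]
 show "H <= carrier M" "!!u v. u : H ==> v : H ==> u \<oplus> v : H" "!!r u. u : H ==> r \<odot> u : H"
 "!!u. u : H ==> \<ominus> u : H" using * by auto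
 then show "!!u v. u : H ==> v : H ==> u \<ominus> v : H" by (simp add: a_minus_def)
 obtain h where "h : H" using *(2) by blast
 then show "\<zero> : H" using *(4)[of 0 h] *(1) by auto
qed

lemma submodI:
 assumes "H <= carrier M" "\<zero> : H" "!!u v. u : H ==> v : H ==> u \<oplus> v : H"
 "!!r u. u : H ==> r \<odot> u : H"
 shows "submod M H"
proof (rule submoduleI)
 fix a assume "a : H"
 then show "\<ominus> a : H" using assms(4)[of a "-1"] assms(1) tsmult_m1 by (metis subsetD)
qed (use assms in auto)

lemma submod_finsum:
 assumes "submod M H" "finite A" "!!i. i : A ==> f i : H"
 shows "(\<Oplus>i\<in>A. f i) : H"
 using assms(2,3)
proof (induction A)
 case empty
 then show ?case using submodD(2)[OF assms(1)] by simp
next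
 case (insert x A)
 then have "f : A \<rightarrow> carrier M" "f x : carrier M" using submodD(1)[OF assms(1)] by auto
 then show ?case using insert submodD(3)[OF assms(1)] by simp
qed

lemma submod_carrier: "submod M (carrier M)" by (rule carrier_is_submodule)
lemma submod_zero: "submod M {\<zero>}" by (rule submodI) auto
lemma submod_Inter:
 assumes "!!H. H : \<H> ==> submod M H" "\<H> ~= {}"
 shows "submod M (\<Inter>\<H>)"
proof (rule submodI)
 obtain H where "H : \<H>" using assms(2) by blast
 then show "\<Inter>\<H> <= carrier M" using submodD(1)[OF assms(1)] by blast
qed (use assms(1) submodD(2,3,4) in blast)+
lemma submod_Int: "submod M H ==> submod M H' ==> submod M (H \<inter> H')"
 using submod_Inter[of "{H, H'}"] by auto

context
 fixes B assumes fin: "finite B" and sub: "B <= carrier M"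
begin

lemma LC_fun: "(%b. c b \<odot> b) : B \<rightarrow> carrier M" using sub by auto

lemma LC_closed [simp]: "LC M c B : carrier M"
 unfolding LC_def using LC_fun by (rule M.finsum_closed)

lemma LC_add: "LC M (%b. c b + d b) B = LC M c B \<oplus> LC M d B"
proof -
 have "LC M (%b. c b + d b) B = (\<Oplus>b\<in>B. c b \<odot> b \<oplus> d b \<odot> b)"
 unfolding LC_def by (intro M.finsum_cong') (use sub in \<open>auto simp: tsmult_l_distr\<close>)
 then show ?thesis unfolding LC_def using LC_fun by (simp add: M.finsum_addf)
qed

lemma LC_smult: "LC M (%b. r * c b) B = r \<odot> LC M c B"
proof -
 have "LC M (%b. r * c b) B = (\<Oplus>b\<in>B. r \<odot> (c b \<odot> b))"
 unfolding LC_def by (intro M.finsum_cong') (use sub in \<open>auto simp: tsmult_assoc\<close>)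
 then show ?thesis unfolding LC_def using LC_fun fin by (simp add: finsum_smult_ldistr)
qed

lemma LC_zero [simp]: "LC M (%b. 0) B = \<zero>"
proof -
 have "LC M (%b. 0) B = (\<Oplus>b\<in>B. \<zero>)"
 unfolding LC_def by (intro M.finsum_cong') (use sub in auto)
 then show ?thesis by simp
qed

lemma LC_cong: "(!!b. b : B ==> c b = d b) ==> LC M c B = LC M d B"
 unfolding LC_def by (intro M.finsum_cong') (use sub in auto)

lemma LC_uminus: "LC M (%b. - c b) B = \<ominus> LC M c B"
 using LC_smult[of "-1" c] by (simp add: tsmult_m1)

lemma LC_diff: "LC M (%b. c b - d b) B = LC M c B \<ominus> LC M d B"
 using LC_add[of c "%b. - d b"] LC_uminus[of d] by (simp add: a_minus_def)

lemma submod_Sp: "submod M (Sp M B)"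
proof (rule submodI)
 show "\<zero> : Sp M B" unfolding Sp_def using LC_zero by (metis (mono_tags, lifting) mem_Collect_eq)
qed (auto simp: Sp_def simp flip: LC_add LC_smult)

lemma Sp_sub: "Sp M B <= carrier M" unfolding Sp_def by auto

lemma LC_delta: "b : B ==> LC M (%b'. if b' = b then 1 else 0) B = b"
proof -
 assume b: "b : B"
 then have bc: "b : carrier M" using sub by auto
 have "LC M (%b'. if b' = b then 1 else 0) B = (\<Oplus>b'\<in>B. if b' = b then b else \<zero>)"
 unfolding LC_def by (intro M.finsum_cong') (use sub bc in auto)
 also have "... = (\<Oplus>b'\<in>insert b (B - {b}). if b' = b then b else \<zero>)" using b by (simp add: insert_absorb)
 also have "... = b \<oplus> (\<Oplus>b'\<in>B - {b}. if b' = b then b else \<zero>)"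
 using fin bc by (subst M.finsum_insert) auto
 also have "(\<Oplus>b'\<in>B - {b}. if b' = b then b else \<zero>) = (\<Oplus>b'\<in>B - {b}. \<zero>)"
 by (rule M.finsum_cong') auto
 finally show ?thesis using bc by simp
qed

lemma Sp_base: "B <= Sp M B"
 unfolding Sp_def using LC_delta by (auto, metis)

lemma Sp_least: "submod M H ==> B <= H ==> Sp M B <= H"
 unfolding Sp_def LC_def by (auto intro!: submod_finsum submodD(4) fin)

lemma LC_insert: "b ~: B ==> b : carrier M ==> LC M c (insert b B) = c b \<odot> b \<oplus> LC M c B"
 unfolding LC_def using fin LC_fun by simp

end

lemma LC_upd:
 "finite B ==> B <= carrier M ==> b ~: B ==> LC M (c(b := a)) B = LC M c B"
 by (rule LC_cong) auto

lemma Sp_mono: "finite B ==> B' <= B ==> B <= carrier M ==> Sp M B' <= Sp M B"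
 using Sp_least[of B' "Sp M B"] submod_Sp[of B] Sp_base[of B] finite_subset[of B' B] by blast

lemma Sp_empty: "Sp M {} = {\<zero>}"
 unfolding Sp_def LC_def by simp

lemma Sp_insert:
 assumes "finite B" "B <= carrier M" "b ~: B" "b : carrier M"
 shows "u : Sp M (insert b B) \<longleftrightarrow> (EX a. EX v:Sp M B. u = a \<odot> b \<oplus> v)"
proof
 assume "u : Sp M (insert b B)"
 then show "EX a. EX v:Sp M B. u = a \<odot> b \<oplus> v"
 unfolding Sp_def using LC_insert[OF assms] by blast
next
 assume "EX a. EX v:Sp M B. u = a \<odot> b \<oplus> v"
 then obtain a c where u: "u = a \<odot> b \<oplus> LC M c B" unfolding Sp_def by blast
 have "LC M (c(b := a)) (insert b B) = u"
 unfolding LC_insert[OF assms] u using assms LC_upd[of B b c a] by simp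
 then show "u : Sp M (insert b B)" unfolding Sp_def by blast
qed

lemma indep_insert:
 assumes B: "finite B" "B <= carrier M" "indep M B" "b : carrier M"
 and *: "!!a. a \<odot> b : Sp M B ==> a = 0"
 shows "indep M (insert b B)" "b ~: B"
proof -
 show bB: "b ~: B"
 proof
 assume "b : B"
 then have "1 \<odot> b : Sp M B" using B Sp_base by auto
 then show False using * by fastforce
 qed
 show "indep M (insert b B)"
 unfolding indep_def
 proof (intro allI impI)
 fix c assume z: "LC M c (insert b B) = \<zero>"
 then have z': "c b \<odot> b \<oplus> LC M c B = \<zero>" using LC_insert[OF B(1,2) bB B(4)] by simp
 then have "c b \<odot> b = \<ominus> LC M c B" using B by (simp add: M.minus_equality)
 then have "c b \<odot> b : Sp M B"
 using submodD(5)[OF submod_Sp[OF B(1,2)]] unfolding Sp_def by auto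
 then have cb: "c b = 0" using * by blast
 then have "LC M c B = \<zero>" using z' B by simp
 then show "ALL b:insert b B. c b = 0" using B(3) cb unfolding indep_def by auto
 qed
qed

text \<open>A rank argument that stays inside the module: a generator with a nonzero multiple in the
  span of the independent set is left out, and its multiplier is absorbed into the common factor
  \<open>d\<close>.\<close>

lemma exists_indep:
 assumes "finite G" "G <= carrier M"
 shows "EX B<=G. indep M B & (EX d. d ~= 0 & (ALL g:G. d \<odot> g : Sp M B))"
 using assms
proof (induction G)
 case empty
 then show ?case by (auto simp: indep_def intro: exI[of _ 1])
next
 case (insert g G)
 then obtain B d where B: "B <= G" "indep M B" "d ~= 0" "!!x. x : G ==> d \<odot> x : Sp M B" by auto
 have fB: "finite B" "B <= carrier M" "g : carrier M" "G <= carrier M"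
 using B(1) insert by (auto intro: finite_subset)
 show ?case
 proof (cases "EX e. e ~= 0 & e \<odot> g : Sp M B")
 case True
 then obtain e where e: "e ~= 0" "e \<odot> g : Sp M B" by blast
 have "(d * e) \<odot> x : Sp M B" if x: "x : insert g G" for x
 proof (cases "x = g")
 case True
 then show ?thesis using e submodD(4)[OF submod_Sp[OF fB(1,2)], of "e \<odot> g" d] fB by (simp add: tsmult_assoc)
 next
 case False
 then have "x : G" using x by simp
 then have "e \<odot> (d \<odot> x) : Sp M B" using B(4) submodD(4)[OF submod_Sp[OF fB(1,2)]] by blast
 moreover have "e \<odot> (d \<odot> x) = (d * e) \<odot> x"
 using \<open>x : G\<close> fB(4) by (auto simp: tsmult_assoc mult.commute)
 ultimately show ?thesis by simp
 qed
 then show ?thesis using B e by (intro exI[of _ B]) (auto intro!: exI[of _ "d * e"])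
 next
 case False
 then have i: "indep M (insert g B)" using indep_insert[OF fB(1,2) B(2) fB(3)] by blast
 have "d \<odot> x : Sp M (insert g B)" if x: "x : insert g G" for x
 proof (cases "x = g")
 case True
 then show ?thesis
 using submodD(4)[OF submod_Sp, of "insert g B" g d] Sp_base[of "insert g B"] fB by auto
 next
 case False
 then show ?thesis using B(4) x Sp_mono[of "insert g B" B] fB by auto
 qed
 then show ?thesis using B i by (intro exI[of _ "insert g B"]) auto
 qed
qed

lemma ideal_principal:
 assumes "(0::'r) : I" "!!a b. a : I ==> b : I ==> a + b : I" "!!r a. a : I ==> r * a : I"
 shows "EX g:I. ALL a:I. EX r. a = r * g"
proof (cases "I <= {0}")
 case True
 then have "ALL a:I. EX r. a = r * 0" by auto
 then show ?thesis using assms(1) by blast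
next
 case False
 then obtain a0 where a0: "a0 : I" "a0 ~= 0" by auto
 define g where "g = arg_min euclidean_size (%a. a : I & a ~= 0)"
 have g: "g : I" "g ~= 0" and min: "!!a. a : I ==> a ~= 0 ==> euclidean_size g <= euclidean_size a"
 using arg_min_nat_lemma[of "%a. a : I & a ~= 0" a0 euclidean_size] a0 unfolding g_def by auto
 have "EX r. a = r * g" if "a : I" for a
 proof -
 have "a mod g = a + (- (a div g)) * g" using div_mult_mod_eq[of a g] by (simp add: algebra_simps)
 then have "a mod g : I" using assms g that by metis
 then have "a mod g = 0" using min[of "a mod g"] mod_size_less[OF g(2), of a] by fastforce
 then show ?thesis using div_mult_mod_eq[of a g] by (intro exI[of _ "a div g"]) simp
 qed
 then show ?thesis using g by blast
qed

text \<open>The coefficients at \<open>b\<close> of the elements of \<open>U\<close> form an ideal,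
  which is principal. An element \<open>u0\<close> of \<open>U\<close> whose coefficient generates
  it splits \<open>U\<close> into the multiples of \<open>u0\<close> and the part inside the span of
  \<open>B\<close>, to which the induction applies.\<close>

lemma sub_free:
 assumes "finite B" "B <= carrier M" "indep M B" "submod M U" "U <= Sp M B"
 shows "EX B'<=U. finite B' & indep M B' & U = Sp M B'"
 using assms
proof (induction B arbitrary: U)
 case empty
 then have "U = {\<zero>}" using submodD(2) Sp_empty by blast
 then show ?case by (intro exI[of _ "{}"]) (auto simp: indep_def Sp_empty)
next
 case (insert b B)
 then have B: "finite B" "B <= carrier M" "b ~: B" "b : carrier M" by auto
 note U = submodD[OF insert.prems(3)]
 note S = submodD[OF submod_Sp[OF B(1,2)]]
 have uniq: "a = 0 & v = \<zero>" if asm: "a \<odot> b \<oplus> v = \<zero>" "v : Sp M B" for a v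
 proof -
 obtain c where v: "v = LC M c B" using asm(2) unfolding Sp_def by blast
 have "LC M (c(b := a)) (insert b B) = \<zero>"
 unfolding LC_insert[OF B] using asm(1) v B LC_upd[of B b c a] by simp
 then have "(c(b := a)) b = 0" "ALL x:B. (c(b := a)) x = 0"
 using insert.prems(2) unfolding indep_def by blast+
 then have "a = 0" "ALL x:B. c x = 0" using B(3) by (auto split: if_splits)
 then show ?thesis using v LC_cong[OF B(1,2), of c "%_. 0"] LC_zero[OF B(1,2)] by auto
 qed
 have iB: "indep M B"
 proof (unfold indep_def, intro allI impI)
 fix c assume z: "LC M c B = \<zero>"
 have "LC M (c(b := 0)) (insert b B) = \<zero>"
 unfolding LC_insert[OF B] using z B LC_upd[of B b c 0] by simp
 then have "ALL x:insert b B. (c(b := 0)) x = 0" using insert.prems(2) unfolding indep_def by blast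
 then show "ALL x:B. c x = 0" using B(3) by (auto split: if_splits)
 qed
 define I where "I = {a. EX v:Sp M B. a \<odot> b \<oplus> v : U}"
 have ex: "EX g:I. ALL a:I. EX r. a = r * g"
 proof (rule ideal_principal)
 show "0 : I" unfolding I_def using U S B by (intro CollectI bexI[of _ \<zero>]) auto
 fix a a' assume "a : I" "a' : I"
 then obtain v v' where v: "v : Sp M B" "a \<odot> b \<oplus> v : U" "v' : Sp M B" "a' \<odot> b \<oplus> v' : U"
 unfolding I_def by blast
 have vc: "v : carrier M" "v' : carrier M" using v S(1) by auto
 have "(a + a') \<odot> b \<oplus> (v \<oplus> v') = (a \<odot> b \<oplus> v) \<oplus> (a' \<odot> b \<oplus> v')"
 using B vc by (simp add: tsmult_l_distr M.a_ac)
 then show "a + a' : I" unfolding I_def using v U(3) S(3) by (intro CollectI bexI[of _ "v \<oplus> v'"]) auto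
 next
 fix r a assume "a : I"
 then obtain v where v: "v : Sp M B" "a \<odot> b \<oplus> v : U" unfolding I_def by blast
 have "(r * a) \<odot> b \<oplus> r \<odot> v = r \<odot> (a \<odot> b \<oplus> v)"
 using B v S(1) by (simp add: tsmult_r_distr tsmult_assoc subsetD)
 then show "r * a : I" unfolding I_def using v U(4) S(4) by (intro CollectI bexI[of _ "r \<odot> v"]) auto
 qed
 then obtain g where g: "g : I" "!!a. a : I ==> EX r. a = r * g" by blast
 show ?case
 proof (cases "g = 0")
 case True
 have "U <= Sp M B"
 proof
 fix u assume u: "u : U"
 then obtain a v where v: "u = a \<odot> b \<oplus> v" "v : Sp M B"
 using insert.prems(4) Sp_insert[OF B] by blast
 then have "a : I" using u unfolding I_def by blast
 then have "a = 0" using g(2) True by auto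
 then show "u : Sp M B" using v B S(1) by auto
 qed
 then show ?thesis using insert.IH[OF B(2) iB insert.prems(3)] by blast
 next
 case False
 obtain v0 where v0: "v0 : Sp M B" "g \<odot> b \<oplus> v0 : U" using g(1) unfolding I_def by blast
 define u0 where "u0 = g \<odot> b \<oplus> v0"
 have u0: "u0 : U" "u0 : carrier M" using v0 U(1) by (auto simp: u0_def)
 have sub: "submod M (U \<inter> Sp M B)" by (intro submod_Int insert.prems submod_Sp B)
 obtain B' where B': "B' <= U \<inter> Sp M B" "finite B'" "indep M B'" "U \<inter> Sp M B = Sp M B'"
 using insert.IH[OF B(2) iB sub] by blast
 have B'c: "B' <= carrier M" using B'(1) U(1) by blast
 have i: "a = 0" if "a \<odot> u0 : Sp M B'" for a
 proof -
 have w: "a \<odot> u0 : Sp M B" using that B'(4) by blast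
 have "(a * g) \<odot> b \<oplus> (a \<odot> v0 \<ominus> a \<odot> u0) = \<zero>"
 using B v0 S(1) by (auto simp: u0_def tsmult_r_distr tsmult_assoc subsetD a_minus_def M.minus_add M.a_ac M.r_neg
 M.r_neg1 M.r_neg2)
 moreover have "a \<odot> v0 \<ominus> a \<odot> u0 : Sp M B" using S(4,6) w v0 by blast
 ultimately have "a * g = 0" using uniq by blast
 then show "a = 0" using False by simp
 qed
 have "U <= Sp M (insert u0 B')"
 proof
 fix u assume u: "u : U"
 then obtain a v where v: "u = a \<odot> b \<oplus> v" "v : Sp M B"
 using insert.prems(4) Sp_insert[OF B] by blast
 then have "a : I" using u unfolding I_def by blast
 then obtain r where r: "a = r * g" using g(2) by blast
 have vc: "v : carrier M" "v0 : carrier M" using v v0 S(1) by auto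
 have "u = r \<odot> u0 \<oplus> (v \<ominus> r \<odot> v0)"
 using vc B v(1) r by (simp add: u0_def tsmult_r_distr tsmult_assoc a_minus_def M.a_assoc add_diff_cancel3)
 moreover have "u \<ominus> r \<odot> u0 = v \<ominus> r \<odot> v0"
 using calculation vc u0 B by (simp add: a_minus_def M.a_ac M.r_neg1 M.r_neg2 M.r_neg)
 ultimately have "v \<ominus> r \<odot> v0 : U \<inter> Sp M B" "u = r \<odot> u0 \<oplus> (v \<ominus> r \<odot> v0)"
 using U(4,6) S(4,6) u u0 v v0 by (metis IntI)+
 then show "u : Sp M (insert u0 B')"
 using Sp_insert[OF B'(2) B'c indep_insert(2)[OF B'(2) B'c B'(3) u0(2) i] u0(2)] B'(4) by blast
 qed
 moreover have "Sp M (insert u0 B') <= U"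
 by (rule Sp_least) (use B' u0 B'c insert.prems in auto)
 ultimately show ?thesis
 using indep_insert(1)[OF B'(2) B'c B'(3) u0(2) i] B' u0 by (intro exI[of _ "insert u0 B'"]) auto
 qed
qed

text \<open>Multiplication by a common denominator \<open>d\<close> is injective by
  \<open>tf\<close> and moves \<open>U\<close> into the span of an independent set. There the image
  is free, and the preimages of its basis form a basis of \<open>U\<close>.\<close>

theorem finite_basis:
 assumes G: "finite G" "G <= carrier M" and U: "submod M U" "U <= Sp M G"
 and tf: "!!r u. u : carrier M ==> r \<odot> u = \<zero> ==> r = 0 | u = \<zero>"
 shows "EX B<=U. finite B & indep M B & U = Sp M B"
proof -
 obtain B0 d where B0: "B0 <= G" "indep M B0" "d ~= 0" "!!g. g : G ==> d \<odot> g : Sp M B0"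
 using exists_indep[OF G] by blast
 have fB0: "finite B0" "B0 <= carrier M" using B0(1) G by (auto intro: finite_subset)
 note UD = submodD[OF U(1)] and SD = submodD[OF submod_Sp[OF fB0]]
 define U' where "U' = (%u. d \<odot> u) ` U"
 have sm: "submod M {u : carrier M. d \<odot> u : Sp M B0}"
 proof (rule submodI)
 fix r u assume u: "u : {u : carrier M. d \<odot> u : Sp M B0}"
 then have "r \<odot> (d \<odot> u) : Sp M B0" using SD(4) by blast
 then show "r \<odot> u : {u : carrier M. d \<odot> u : Sp M B0}"
 using u by (simp add: tsmult_assoc mult.commute)
 qed (use SD in \<open>auto simp: tsmult_r_distr\<close>)
 have "Sp M G <= {u : carrier M. d \<odot> u : Sp M B0}"
 by (rule Sp_least[OF G sm]) (use B0(4) G in auto)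
 then have U'S: "U' <= Sp M B0" using U(2) unfolding U'_def by blast
 have "submod M U'"
 proof (rule submodI)
 show "\<zero> : U'" unfolding U'_def using UD(2) by (metis imageI tsmult_zero)
 fix u v assume "u : U'" "v : U'"
 then obtain u' v' where uv: "u = d \<odot> u'" "v = d \<odot> v'" "u' : U" "v' : U" unfolding U'_def by blast
 then have "u \<oplus> v = d \<odot> (u' \<oplus> v')" using UD(1) by (simp add: tsmult_r_distr subsetD)
 then show "u \<oplus> v : U'" using uv UD(3) unfolding U'_def by blast
 next
 fix r u assume "u : U'"
 then obtain u' where uv: "u = d \<odot> u'" "u' : U" unfolding U'_def by blast
 then have "r \<odot> u = d \<odot> (r \<odot> u')" using UD(1) by (simp add: tsmult_assoc mult.commute subsetD)
 then show "r \<odot> u : U'" using uv UD(4) unfolding U'_def by blast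
 qed (use UD(1) in \<open>auto simp: U'_def\<close>)
 then obtain B' where B': "B' <= U'" "finite B'" "indep M B'" "U' = Sp M B'"
 using sub_free[OF fB0 B0(2) _ U'S] by blast
 have inj: "inj_on (%u. d \<odot> u) U"
 proof (rule inj_onI)
 fix u v assume uv: "u : U" "v : U" "d \<odot> u = d \<odot> v"
 then have c: "u : carrier M" "v : carrier M" using UD(1) by auto
 have "d \<odot> (u \<ominus> v) = d \<odot> u \<ominus> d \<odot> v"
 using c tsmult_r_distr[of u "\<ominus> v" d] tsmult_assoc[of v d "-1"] tsmult_assoc[of v "-1" d]
 by (simp add: a_minus_def tsmult_m1[symmetric])
 then have "d \<odot> (u \<ominus> v) = \<zero>" using uv c by (simp add: M.r_neg a_minus_def)
 then have "u \<ominus> v = \<zero>" using tf[of "u \<ominus> v" d] c B0(3) by auto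
 then show "u = v" using c diff_eq_0 by blast
 qed
 define B where "B = {u : U. d \<odot> u : B'}"
 have B'B: "B' = (%u. d \<odot> u) ` B" using B'(1) unfolding B_def U'_def by auto
 have injB: "inj_on (%u. d \<odot> u) B" using inj by (rule inj_on_subset) (auto simp: B_def)
 have fB: "finite B" using B'(2) B'B injB finite_imageD by blast
 have BU: "B <= U" "B <= carrier M" using UD(1) by (auto simp: B_def)
 have LC': "LC M c B' = d \<odot> LC M (%b. c (d \<odot> b)) B" for c
 proof -
 have "LC M c B' = (\<Oplus>b\<in>B. c (d \<odot> b) \<odot> (d \<odot> b))"
 unfolding LC_def B'B using BU by (intro M.finsum_reindex injB) auto
 also have "... = (\<Oplus>b\<in>B. (d * c (d \<odot> b)) \<odot> b)"
 by (intro M.finsum_cong') (use BU in \<open>auto simp: tsmult_assoc mult.commute subsetD\<close>)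
 also have "... = d \<odot> LC M (%b. c (d \<odot> b)) B"
 using LC_smult[OF fB BU(2), of d "%b. c (d \<odot> b)"] by (simp add: LC_def)
 finally show ?thesis .
 qed
 have "indep M B"
 unfolding indep_def
 proof (intro allI impI)
 fix c assume z: "LC M c B = \<zero>"
 define c' where "c' = (%v. c (the_inv_into B (%u. d \<odot> u) v))"
 have c': "c' (d \<odot> b) = c b" if "b : B" for b
 unfolding c'_def using the_inv_into_f_f[OF injB that] by simp
 have "LC M c' B' = d \<odot> LC M c B" unfolding LC' using c' by (subst LC_cong[OF fB BU(2)]) auto
 then have "LC M c' B' = \<zero>" using z by simp
 then have "ALL b':B'. c' b' = 0" using B'(3) unfolding indep_def by blast
 then show "ALL b:B. c b = 0" using c' B'B by force
 qed
 moreover have "U = Sp M B"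
 proof
 show "Sp M B <= U" by (rule Sp_least[OF fB BU(2) U(1) BU(1)])
 show "U <= Sp M B"
 proof
 fix u assume u: "u : U"
 then have "d \<odot> u : Sp M B'" using B'(4) U'_def by blast
 then obtain c where "d \<odot> u = LC M c B'" unfolding Sp_def by blast
 then have "d \<odot> u = d \<odot> LC M (%b. c (d \<odot> b)) B" using LC' by simp
 moreover have "LC M (%b. c (d \<odot> b)) B : Sp M B" unfolding Sp_def by blast
 ultimately show "u : Sp M B" using inj u \<open>Sp M B <= U\<close> by (metis inj_onD subsetD)
 qed
 qed
 ultimately show ?thesis using fB BU by blast
qed

text \<open>Submodules of a finitely generated vector space satisfy the descending chain condition.\<close>

lemma minimal_submodule:
 assumes "finite G" "G <= carrier M" "!!U. U : \<F> ==> submod M U & U <= Sp M G" "\<F> ~= {}"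
 and inv: "!!r :: 'r. r ~= 0 ==> EX s. s * r = 1"
 shows "EX U:\<F>. ALL U':\<F>. U' <= U --> U' = U"
 using assms(1-4)
proof (induction G arbitrary: \<F>)
 case empty
 then have "U = {\<zero>}" if "U : \<F>" for U using that submodD(2) Sp_empty by blast
 then show ?case using empty.prems(3) by blast
next
 case (insert b B)
 then have B: "finite B" "B <= carrier M" "b ~: B" "b : carrier M" by auto
 note S = submodD[OF submod_Sp[OF B(1,2)]]
 have "EX V:(%U. U \<inter> Sp M B) ` \<F>. ALL V':(%U. U \<inter> Sp M B) ` \<F>. V' <= V --> V' = V"
 by (rule insert.IH[OF B(2)]) (use insert.prems submod_Int submod_Sp[OF B(1,2)] in auto)
 then obtain V where V: "V : (%U. U \<inter> Sp M B) ` \<F>" "ALL V':(%U. U \<inter> Sp M B) ` \<F>. V' <= V --> V' = V" ..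
 from V(1) obtain U0 where U0V: "V = U0 \<inter> Sp M B" "U0 : \<F>" ..
 have U0: "U0 : \<F>" "!!U'. U' : \<F> ==> U' \<inter> Sp M B <= U0 \<inter> Sp M B ==> U' \<inter> Sp M B = U0 \<inter> Sp M B"
 using U0V(2) V(2)[rule_format, OF imageI] unfolding U0V(1) .
 show ?case
 \<comment> \<open>\<open>U0\<close> has minimal trace on the span of \<open>B\<close>. A member
   with the same trace that lies inside that span equals its trace and is minimal. If there is none,
   every smaller member contains a vector with invertible coefficient at \<open>b\<close>, and
   together with the common trace this recovers all of \<open>U0\<close>.\<close>
 proof (cases "EX U:\<F>. U \<inter> Sp M B = U0 \<inter> Sp M B & U <= Sp M B")
 case True
 then obtain U where U: "U : \<F>" "U \<inter> Sp M B = U0 \<inter> Sp M B" "U <= Sp M B" by blast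
 have "U' = U" if "U' : \<F>" "U' <= U" for U'
 using U0(2)[OF that(1)] U that by blast
 then show ?thesis using U(1) by blast
 next
 case False
 have "U' = U0" if U': "U' : \<F>" "U' <= U0" for U'
 proof -
 have e: "U' \<inter> Sp M B = U0 \<inter> Sp M B" using U0(2) U' by blast
 note UD = submodD[OF conjunct1[OF insert.prems(2)[OF U'(1)]]]
 note UD0 = submodD[OF conjunct1[OF insert.prems(2)[OF U0(1)]]]
 obtain u1 where u1: "u1 : U'" "u1 ~: Sp M B" using False U' e by blast
 then obtain a v where av: "u1 = a \<odot> b \<oplus> v" "v : Sp M B"
 using insert.prems(2)[OF U'(1)] Sp_insert[OF B] by blast
 then have "a ~= 0" using u1 B S(1) by auto
 then obtain s where s: "s * a = 1" using inv by blast
 have "U0 <= U'"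
 proof
 fix u assume u: "u : U0"
 then obtain c w where cw: "u = c \<odot> b \<oplus> w" "w : Sp M B"
 using insert.prems(2)[OF U0(1)] Sp_insert[OF B] by blast
 have c: "v : carrier M" "w : carrier M" "u1 : carrier M" using av cw S(1) u1 UD(1) by auto
 have "(c * s) \<odot> u1 = c \<odot> b \<oplus> (c * s) \<odot> v"
 unfolding av(1) using c B s by (simp add: tsmult_r_distr tsmult_assoc mult.assoc)
 then have d: "u \<ominus> (c * s) \<odot> u1 = w \<ominus> (c * s) \<odot> v"
 using c B cw by (simp add: a_minus_def M.minus_add M.a_ac M.r_neg1 M.r_neg2 M.r_neg)
 have "u \<ominus> (c * s) \<odot> u1 : U0" using UD0(4,6) u u1 U'(2) by blast
 moreover have "u \<ominus> (c * s) \<odot> u1 : Sp M B" unfolding d using S(4,6) av cw by blast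
 ultimately have "u \<ominus> (c * s) \<odot> u1 : U'" using e by blast
 then have "(u \<ominus> (c * s) \<odot> u1) \<oplus> (c * s) \<odot> u1 : U'" using UD(3,4) u1 by blast
 then show "u : U'" using c u UD0(1) by (simp add: a_minus_def M.a_assoc M.l_neg subsetD)
 qed
 then show ?thesis using U'(2) by blast
 qed
 then show ?thesis using U0(1) by blast
 qed
qed

end

section \<open>Algebraic representations of a reductive group\<close>

locale arep =
 fixes K :: "(complex^'n^'n) set" and V :: "(complex, 'v) module" (structure)
 and rh :: "complex^'n^'n => 'v => 'v"
 assumes alg: "algebraic_group K" and rep: "algebraic_rep K V rh"
begin

sublocale tmod V using rep by (intro tmod.intro) (simp add: algebraic_rep_def)

lemma one_K [simp]: "mat 1 : K" and mult_K: "k : K ==> l : K ==> k ** l : K"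
 and inv_K: "k : K ==> matrix_inv k : K" and invertible_K: "k : K ==> invertible k"
 using alg unfolding algebraic_group_def zariski_closed_def by blast+

lemma matrix_inv_K: "k : K ==> matrix_inv k ** k = mat 1" "k : K ==> k ** matrix_inv k = mat 1"
 using someI_ex[of "%l. k ** l = mat 1 & l ** k = mat 1"] invertible_K[of k]
 unfolding invertible_def matrix_inv_def by auto

lemma rho_lin: "k : K ==> linear_map Cfield V V (rh k)"
 using rep unfolding algebraic_rep_def by blast

lemma rho_closed: "k : K ==> v : carrier V ==> rh k v : carrier V"
 and rho_add: "k : K ==> u : carrier V ==> v : carrier V ==> rh k (u \<oplus> v) = rh k u \<oplus> rh k v"
 and rho_smult: "k : K ==> v : carrier V ==> rh k (c \<odot> v) = c \<odot> rh k v"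
 using rho_lin[of k] by (auto simp: linear_map_def Pi_iff)

lemma rho_1: "v : carrier V ==> rh (mat 1) v = v"
 and rho_mult: "k : K ==> l : K ==> v : carrier V ==> rh (k ** l) v = rh k (rh l v)"
 and expansion_ex: "v : carrier V ==> EX N c m. expansion K V rh v N c m"
 using rep unfolding algebraic_rep_def by blast+

lemma rho_zero: "k : K ==> rh k \<zero> = \<zero>"
 using rho_smult[of k \<zero> 0] rho_closed[of k \<zero>] by simp

lemma rho_inv: "k : K ==> v : carrier V ==> rh (matrix_inv k) (rh k v) = v"
 and rho_inv': "k : K ==> v : carrier V ==> rh k (rh (matrix_inv k) v) = v"
 by (metis inv_K matrix_inv_K(1) rho_1 rho_mult, metis inv_K matrix_inv_K(2) rho_1 rho_mult)

abbreviation "srep \<equiv> subrep K V rh"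
abbreviation "irr \<equiv> irreducible_subrep K V rh"
abbreviation "iso_rep \<equiv> isomorphic_subreps K V rh"

lemma srepD: "srep W ==> submod V W" "srep W ==> k : K ==> w : W ==> rh k w : W"
 unfolding subrep_def by auto

lemma srepI: "submod V W ==> (!!k w. k : K ==> w : W ==> rh k w : W) ==> srep W"
 unfolding subrep_def by auto

lemma srep_sub: "srep W ==> W <= carrier V" using submodD(1) srepD(1) by blast

lemma srep_Inter: "(!!H. H : \<H> ==> srep H) ==> \<H> ~= {} ==> srep (\<Inter>\<H>)"
 by (intro srepI submod_Inter) (use srepD in blast)+

lemma srep_Int: "srep W ==> srep W' ==> srep (W \<inter> W')"
 using srep_Inter[of "{W, W'}"] by auto

lemma srep_carrier: "srep (carrier V)" by (intro srepI submod_carrier rho_closed)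
lemma srep_zero: "srep {\<zero>}" by (intro srepI submod_zero) (auto simp: rho_zero)

lemma irrD: "irr W ==> srep W" "irr W ==> W ~= {\<zero>}"
 "irr W ==> srep U ==> U <= W ==> U = {\<zero>} | U = W"
 unfolding irreducible_subrep_def by auto

lemma irr_nonzero: "irr W ==> EX w:W. w ~= \<zero>"
 using irrD(2) submodD(2)[OF srepD(1)[OF irrD(1)]] by blast

lemma reg_smult: "f : regular_functions ==> (%k. a * f k) : regular_functions"
 by (rule regular_functions.mult[OF regular_functions.const])

lemma finsum_Suc:
 "(!!i. i <= N ==> f i : carrier V) ==> (\<Oplus>i\<in>{..<Suc N}. f i) = f N \<oplus> (\<Oplus>i\<in>{..<N}. f i)"
 unfolding lessThan_Suc by (rule M.finsum_insert) auto

text \<open>The coefficient vectors of a coaction can be moved into any submodule containing the orbit: divide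
 by a coefficient that does not vanish identically on the group, and subtract.\<close>

lemma expansion_in:
 fixes N :: nat
 assumes W: "submod V W"
 and "!!k. k : K ==> f k : W" "!!i. i < N ==> c i : regular_functions & m i : carrier V"
 and "!!k. k : K ==> f k = (\<Oplus>i\<in>{..<N}. c i k \<odot> m i)"
 shows "EX N' c' m'. (\<forall>i<N'. c' i : regular_functions & m' i : W)
 & (ALL k:K. f k = (\<Oplus>i\<in>{..<N'::nat}. c' i k \<odot> m' i))"
 using assms(2-)
proof (induction N arbitrary: f c)
 case 0
 then show ?case by (intro exI[of _ 0]) auto
next
 case (Suc N)
 have fc: "c i k \<odot> m i : carrier V" if "i <= N" for i k using Suc.prems(2)[of i] that by simp
 have exp: "f k = c N k \<odot> m N \<oplus> (\<Oplus>i\<in>{..<N}. c i k \<odot> m i)" if "k : K" for k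
 using Suc.prems(3)[OF that] finsum_Suc[of N "%i. c i k \<odot> m i"] fc by simp
 have sc: "(\<Oplus>i\<in>{..<N}. c i k \<odot> m i) : carrier V" for k
 by (rule M.finsum_closed) (use fc in auto)
 show ?case
 proof (cases "ALL k:K. c N k = 0")
 case True
 then have "f k = (\<Oplus>i\<in>{..<N}. c i k \<odot> m i)" if "k : K" for k
 using exp[OF that] that sc Suc.prems(2)[of N] by simp
 then show ?thesis using Suc.IH[of f c] Suc.prems(1,2) by simp
 next
 case False
 then obtain k0 where k0: "k0 : K" "c N k0 ~= 0" by blast
 define c' where "c' i k = c i k + (- inverse (c N k0) * c i k0) * c N k" for i k
 define f' where "f' k = f k \<oplus> (- inverse (c N k0) * c N k) \<odot> f k0" for k
 have 1: "f' k : W" if "k : K" for k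
 unfolding f'_def using submodD(3,4)[OF W] Suc.prems(1) that k0 by blast
 have 2: "c' i : regular_functions & m i : carrier V" if "i < N" for i
 unfolding c'_def using Suc.prems(2)[of i] Suc.prems(2)[of N] that
 by (intro conjI regular_functions.add reg_smult) auto
 have 3: "f' k = (\<Oplus>i\<in>{..<N}. c' i k \<odot> m i)" if k: "k : K" for k
 proof -
 let ?a = "- inverse (c N k0) * c N k"
 have "(\<Oplus>i\<in>{..<N}. c' i k \<odot> m i) = (\<Oplus>i\<in>{..<N}. c i k \<odot> m i \<oplus> ?a \<odot> (c i k0 \<odot> m i))"
 by (intro M.finsum_cong')
 (use Suc.prems(2) in \<open>auto simp: c'_def tsmult_assoc mult_ac simp flip: tsmult_l_distr\<close>)
 also have "... = (\<Oplus>i\<in>{..<N}. c i k \<odot> m i) \<oplus> (\<Oplus>i\<in>{..<N}. ?a \<odot> (c i k0 \<odot> m i))"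
 by (intro M.finsum_addf) (use fc in auto)
 also have "(\<Oplus>i\<in>{..<N}. ?a \<odot> (c i k0 \<odot> m i)) = ?a \<odot> (\<Oplus>i\<in>{..<N}. c i k0 \<odot> m i)"
 by (rule finsum_smult_ldistr[symmetric]) (use fc in auto)
 finally have A: "(\<Oplus>i\<in>{..<N}. c' i k \<odot> m i) = (\<Oplus>i\<in>{..<N}. c i k \<odot> m i) \<oplus> ?a \<odot> (\<Oplus>i\<in>{..<N}. c i k0 \<odot> m i)" .
 have mN: "m N : carrier V" using Suc.prems(2) by simp
 have "?a \<odot> (c N k0 \<odot> m N) = (- c N k) \<odot> m N" using mN k0 by (simp add: tsmult_assoc field_simps)
 then have "f' k = c N k \<odot> m N \<oplus> (\<Oplus>i\<in>{..<N}. c i k \<odot> m i) \<oplus> ((- c N k) \<odot> m N \<oplus> ?a \<odot> (\<Oplus>i\<in>{..<N}. c i k0 \<odot> m i))"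
 unfolding f'_def exp[OF k] exp[OF k0(1)] using sc mN by (simp add: tsmult_r_distr)
 also have "... = (\<Oplus>i\<in>{..<N}. c i k \<odot> m i) \<oplus> ?a \<odot> (\<Oplus>i\<in>{..<N}. c i k0 \<odot> m i)"
 using sc mN by (simp add: tsmult_uminus M.a_ac M.r_neg1 M.r_neg2 M.r_neg)
 finally show ?thesis using A by simp
 qed
 obtain N' c'' m' where IH: "\<forall>i<N'. c'' i : regular_functions & m' i : W"
 "ALL k:K. f' k = (\<Oplus>i\<in>{..<N'::nat}. c'' i k \<odot> m' i)"
 using Suc.IH[of f' c', OF 1 2 3] by blast
 define C where "C = c''(N' := (%k. inverse (c N k0) * c N k))"
 define M where "M = m'(N' := f k0)"
 have fk0: "f k0 : W" "f k0 : carrier V" using Suc.prems(1) k0 submodD(1)[OF W] by auto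
 have reg: "\<forall>i<Suc N'. C i : regular_functions & M i : W"
 using IH(1) fk0 Suc.prems(2)[of N] by (auto simp: C_def M_def less_Suc_eq reg_smult)
 have "f k = (\<Oplus>i\<in>{..<Suc N'}. C i k \<odot> M i)" if k: "k : K" for k
 proof -
 have "M i : carrier V" if "i <= N'" for i using reg that submodD(1)[OF W] by auto
 then have "(\<Oplus>i\<in>{..<Suc N'}. C i k \<odot> M i) = C N' k \<odot> M N' \<oplus> (\<Oplus>i\<in>{..<N'}. C i k \<odot> M i)"
 by (intro finsum_Suc) auto
 also have "(\<Oplus>i\<in>{..<N'}. C i k \<odot> M i) = f' k"
 using IH k submodD(1)[OF W] by (auto simp: C_def M_def intro!: M.finsum_cong')
 also have "C N' k \<odot> M N' \<oplus> f' k = f k"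
 unfolding f'_def using fk0 Suc.prems(1)[OF k] submodD(1)[OF W]
 by (simp add: C_def M_def tsmult_uminus subsetD add_diff_cancel3)
 finally show ?thesis ..
 qed
 then show ?thesis using reg by blast
 qed
qed

lemma expansion_in_srep:
 assumes "srep W" "v : W"
 shows "EX N c m. expansion K V rh v N c m & (\<forall>i<N. m i : W)"
proof -
 have vV: "v : carrier V" using assms srep_sub by blast
 obtain N c m where e: "expansion K V rh v N c m" using expansion_ex[OF vV] by blast
 have "EX N' c' m'. (\<forall>i<N'. c' i : regular_functions & m' i : W)
 & (ALL k:K. rh k v = (\<Oplus>i\<in>{..<N'::nat}. c' i k \<odot> m' i))"
 by (rule expansion_in[OF srepD(1)[OF assms(1)], where N = N and c = c and m = m])
 (use e srepD(2)[OF assms(1) _ assms(2)] in \<open>simp_all add: expansion_def\<close>)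
 then show ?thesis using srep_sub[OF assms(1)] unfolding expansion_def by blast
qed

section \<open>Local finiteness: the subrepresentation generated by a vector\<close>

definition orb :: "'v => 'v set" where "orb v = \<Inter>{W. srep W & v : W}"

lemma orb:
 assumes "v : carrier V"
 shows "srep (orb v)" "v : orb v" "srep W ==> v : W ==> orb v <= W"
 using srep_carrier assms unfolding orb_def by (auto intro!: srep_Inter)

text \<open>The coefficient vectors of the coaction can be taken inside \<open>orb v\<close>, and
  their span contains all translates of \<open>v\<close>. The vectors all of whose translates lie in
  this span form a subrepresentation inside the span, so it catches \<open>orb v\<close>.\<close>

lemma orb_fg:
 assumes v: "v : carrier V"
 shows "EX G. finite G & G <= orb v & orb v = Sp V G"
proof -
 obtain N c m where e: "expansion K V rh v N c m" "\<forall>i<N. m i : orb v"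
 using expansion_in_srep orb(1,2)[OF v] by blast
 define G where "G = m ` {..<N}"
 have G: "finite G" "G <= orb v" using e(2) by (auto simp: G_def)
 then have Gc: "G <= carrier V" using srep_sub orb(1)[OF v] by blast
 note S = submodD[OF submod_Sp[OF G(1) Gc]]
 define U where "U = {u : carrier V. ALL k:K. rh k u : Sp V G}"
 have "srep U"
 proof (intro srepI submodI)
 fix k w assume k: "k : K" "w : U"
 then have "rh l (rh k w) : Sp V G" if "l : K" for l
 using rho_mult[OF that k(1), of w] that mult_K[OF that k(1)] unfolding U_def by auto
 then show "rh k w : U" using k rho_closed by (auto simp: U_def)
 qed (use S in \<open>auto simp: U_def rho_zero rho_add rho_smult\<close>)
 moreover have "v : U"
 proof -
 have "(\<Oplus>i\<in>{..<N}. c i k \<odot> m i) : Sp V G" for k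
 by (rule submod_finsum[OF submod_Sp[OF G(1) Gc]]) (use Sp_base[OF G(1) Gc] S(4) in \<open>auto simp: G_def\<close>)
 then show ?thesis using e(1) v unfolding U_def expansion_def by auto
 qed
 ultimately have "orb v <= U" using orb(3)[OF v] by blast
 moreover have "U <= Sp V G"
 proof
 fix u assume "u : U"
 then have "u : carrier V" "rh (mat 1) u : Sp V G" using one_K unfolding U_def by blast+
 then show "u : Sp V G" using rho_1[of u] by simp
 qed
 moreover have "Sp V G <= orb v" using Sp_least[OF G(1) Gc srepD(1)[OF orb(1)[OF v]] G(2)] .
 ultimately show ?thesis using G by blast
qed

lemma irr_orb: "irr W ==> w : W ==> w ~= \<zero> ==> W = orb w"
proof -
 assume W: "irr W" "w : W" "w ~= \<zero>"
 then have w: "w : carrier V" using srep_sub irrD(1) by blast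
 have "orb w <= W" using orb(3)[OF w] W irrD(1) by blast
 then have "orb w = {\<zero>} | orb w = W" using irrD(3)[OF W(1)] orb(1)[OF w] by blast
 then show "W = orb w" using orb(2)[OF w] W(3) by auto
qed

lemma irr_fg: "irr W ==> EX G. finite G & G <= W & W = Sp V G"
proof -
 assume W: "irr W"
 obtain w where w: "w : W" "w ~= \<zero>" using irr_nonzero[OF W] by blast
 then have "w : carrier V" using srep_sub[OF irrD(1)[OF W]] by blast
 then show ?thesis using orb_fg irr_orb[OF W w] by simp
qed

lemma complex_torsion_free: "u : carrier V ==> r \<odot> u = \<zero> ==> r = 0 | u = \<zero>"
 using tsmult_assoc[of u "inverse r" r] by (cases "r = 0") auto

lemma irr_basis: "irr W ==> EX B<=W. finite B & indep V B & W = Sp V B"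
proof -
 assume W: "irr W"
 obtain G where "finite G" "G <= W" "W = Sp V G" using irr_fg[OF W] by blast
 then show ?thesis
 using finite_basis[of G W] srep_sub[OF irrD(1)[OF W]] srepD(1)[OF irrD(1)[OF W]] complex_torsion_free
 by blast
qed

definition ssum :: "'v set => 'v set => 'v set" where
 "ssum U W = {u \<oplus> w |u w. u : U & w : W}"

lemma ssum_submod:
 assumes U: "submod V U" and W: "submod V W"
 shows "submod V (ssum U W)"
proof (rule submodI)
 note UD = submodD[OF U] and WD = submodD[OF W]
 show "ssum U W <= carrier V" using UD(1) WD(1) unfolding ssum_def by auto
 have "\<zero> \<oplus> \<zero> : ssum U W" unfolding ssum_def using UD(2) WD(2) by blast
 then show "\<zero> : ssum U W" by simp
 fix u v assume "u : ssum U W" "v : ssum U W"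
 then obtain a b c d where ab: "u = a \<oplus> b" "a : U" "b : W" "v = c \<oplus> d" "c : U" "d : W"
 unfolding ssum_def by blast
 have "a : carrier V" "b : carrier V" "c : carrier V" "d : carrier V" using ab UD(1) WD(1) by auto
 then have "u \<oplus> v = (a \<oplus> c) \<oplus> (b \<oplus> d)" using ab by (simp add: M.a_ac)
 moreover have "a \<oplus> c : U" "b \<oplus> d : W" using ab UD(3) WD(3) by blast+
 ultimately show "u \<oplus> v : ssum U W" unfolding ssum_def by blast
next
 note UD = submodD[OF U] and WD = submodD[OF W]
 fix r u assume u: "u : ssum U W"
 then obtain a b where ab: "u = a \<oplus> b" "a : U" "b : W" unfolding ssum_def by blast
 then have "r \<odot> u = r \<odot> a \<oplus> r \<odot> b" using UD(1) WD(1) by (simp add: tsmult_r_distr subsetD)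
 moreover have "r \<odot> a : U" "r \<odot> b : W" using ab UD(4) WD(4) by blast+
 ultimately show "r \<odot> u : ssum U W" unfolding ssum_def by blast
qed

lemma ssum_srep: "srep U ==> srep W ==> srep (ssum U W)"
proof (rule srepI)
 assume U: "srep U" and W: "srep W"
 show "submod V (ssum U W)" using ssum_submod srepD(1) U W by blast
 fix k w assume k: "k : K" "w : ssum U W"
 then obtain a b where ab: "w = a \<oplus> b" "a : U" "b : W" unfolding ssum_def by blast
 then have "rh k w = rh k a \<oplus> rh k b" using srep_sub[OF U] srep_sub[OF W] k by (simp add: rho_add subsetD)
 then show "rh k w : ssum U W" using ab srepD(2) U W k unfolding ssum_def by blast
qed

lemma ssum_left: "submod V U ==> submod V W ==> U <= ssum U W"
proof
 fix u assume U: "submod V U" and W: "submod V W" and u: "u : U"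
 then have "u = u \<oplus> \<zero>" using submodD(1)[OF U] by auto
 then show "u : ssum U W" using u submodD(2)[OF W] unfolding ssum_def by blast
qed

text \<open>Reductivity is stated for representations carried by a fixed type; any injection transports the
 structure of a finite-dimensional subrepresentation there.\<close>

lemma complement:
 assumes red: "reductive K" and G: "finite G" "G <= U" and U: "srep U" "U = Sp V G"
 and W: "srep W" "W <= U"
 shows "EX W'. srep W' & W' <= U & W \<inter> W' = {\<zero>} & ssum W W' = U"
proof -
 note UD = submodD[OF srepD(1)[OF U(1)]]
 have Gc: "G <= carrier V" using G(2) UD(1) by blast
 \<comment> \<open>\<open>from_nat_into\<close> enumerates the finite set \<open>G\<close>, so the
   sequence of chosen coefficients determines the vector. It has the type over which
   \<open>reductive\<close> quantifies.\<close>
 define j0 :: "'v => nat => complex" where "j0 u i = (SOME c. u = LC V c G) (from_nat_into G i)" for u i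
 have inj: "inj_on j0 U"
 proof (rule inj_onI)
 fix u v assume uv: "u : U" "v : U" "j0 u = j0 v"
 have ex: "u' = LC V (SOME c. u' = LC V c G) G" if "u' : U" for u'
 proof -
 have "EX c. u' = LC V c G" using that U(2) unfolding Sp_def by blast
 then show ?thesis by (rule someI_ex)
 qed
 have "(SOME c. u = LC V c G) g = (SOME c. v = LC V c G) g" if gG: "g : G" for g
 proof -
 obtain i where "from_nat_into G i = g"
 using from_nat_into_surj[OF countable_finite[OF G(1)] gG] by blast
 then show ?thesis using fun_cong[OF uv(3), of i] unfolding j0_def by simp
 qed
 then have "LC V (SOME c. u = LC V c G) G = LC V (SOME c. v = LC V c G) G"
 by (rule LC_cong[OF G(1) Gc])
 then show "u = v" using ex uv by metis
 qed
 define e where "e = the_inv_into U j0"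
 have ej [simp]: "e (j0 u) = u" if "u : U" for u
 unfolding e_def using the_inv_into_f_f[OF inj that] .
 define V' :: "(complex, nat => complex) module" where
 "V' = \<lparr>carrier = j0 ` U, monoid.mult = undefined, one = undefined, ring.zero = j0 \<zero>,
 add = (%f g. j0 (e f \<oplus> e g)), smult = (%r f. j0 (r \<odot> e f))\<rparr>"
 define rh' where "rh' k f = j0 (rh k (e f))" for k f
 have V'[simp]: "carrier V' = j0 ` U" "add V' = (%f g. j0 (e f \<oplus> e g))" "ring.zero V' = j0 \<zero>"
 "smult V' = (%r f. j0 (r \<odot> e f))" by (simp_all add: V'_def)
 have Uc [simp]: "u : carrier V" if "u : U" for u using UD(1) that by blast
 have mod': "Module.module Cfield V'"
 proof (rule moduleI)
 show "abelian_group V'"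
 proof (rule abelian_groupI)
 fix f assume "f : carrier V'"
 then obtain u where u: "f = j0 u" "u : U" by auto
 then show "EX g:carrier V'. g \<oplus>\<^bsub>V'\<^esub> f = \<zero>\<^bsub>V'\<^esub>"
 using UD(5) by (intro bexI[of _ "j0 (\<ominus> u)"]) (auto simp: M.l_neg)
 qed (use UD in \<open>auto simp: M.a_ac\<close>)
 qed (use UD in \<open>auto simp: tsmult_l_distr tsmult_r_distr tsmult_assoc\<close>)
 interpret V': tmod V' using mod' by (rule tmod.intro)
 have fs: "(\<Oplus>\<^bsub>V'\<^esub>i\<in>A. j0 (f i)) = j0 (\<Oplus>i\<in>A. f i)" if A: "finite A" "!!i. i : A ==> f i : U" for f and A :: "'i set"
 using A
 proof (induction A)
 case empty
 then show ?case by simp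
 next
 case (insert x A)
 then have "(\<Oplus>i\<in>A. f i) : U" "f x : U" by (auto intro!: submod_finsum srepD(1) U(1))
 moreover have "(\<Oplus>\<^bsub>V'\<^esub>i\<in>insert x A. j0 (f i)) = j0 (f x) \<oplus>\<^bsub>V'\<^esub> (\<Oplus>\<^bsub>V'\<^esub>i\<in>A. j0 (f i))"
 using insert by (intro V'.M.finsum_insert) auto
 moreover have "(\<Oplus>i\<in>insert x A. f i) = f x \<oplus> (\<Oplus>i\<in>A. f i)"
 using insert by (intro M.finsum_insert) auto
 ultimately show ?case using insert by simp
 qed
 have rep': "algebraic_rep K V' rh'"
 unfolding algebraic_rep_def
 proof (intro conjI ballI)
 fix k assume k: "k : K"
 show "linear_map Cfield V' V' (rh' k)"
 using srepD(2)[OF U(1) k] UD k unfolding linear_map_def rh'_def by (auto simp: rho_add rho_smult)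
 fix l v assume "l : K" "v : carrier V'"
 then show "rh' (k ** l) v = rh' k (rh' l v)"
 using srepD(2)[OF U(1)] k by (auto simp: rh'_def rho_mult)
 next
 fix v assume v: "v : carrier V'"
 then show "rh' (mat 1) v = v" by (auto simp: rh'_def rho_1)
 obtain u where u: "v = j0 u" "u : U" using v by auto
 obtain N c m where ex: "expansion K V rh u N c m" "\<forall>i<N. m i : U"
 using expansion_in_srep[OF U(1) u(2)] by blast
 have "rh' k v = (\<Oplus>\<^bsub>V'\<^esub>i\<in>{..<N}. c i k \<odot>\<^bsub>V'\<^esub> j0 (m i))" if "k : K" for k
 proof -
 have "(\<Oplus>\<^bsub>V'\<^esub>i\<in>{..<N}. c i k \<odot>\<^bsub>V'\<^esub> j0 (m i)) = (\<Oplus>\<^bsub>V'\<^esub>i\<in>{..<N}. j0 (c i k \<odot> m i))"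
 by (intro V'.M.finsum_cong') (use ex(2) UD(4) in auto)
 also have "... = j0 (\<Oplus>i\<in>{..<N}. c i k \<odot> m i)" using ex(2) UD(4) by (intro fs) auto
 finally show ?thesis using ex(1) that u by (simp add: expansion_def rh'_def)
 qed
 then have "expansion K V' rh' v N c (%i. j0 (m i))"
 using ex unfolding expansion_def by auto
 then show "EX N c m. expansion K V' rh' v N c m" by blast
 qed (rule mod')
 have fg: "fin_gen Cfield V'"
 unfolding fin_gen_def
 proof (intro exI[of _ "j0 ` G"] conjI ballI)
 show "j0 ` G <= carrier V'" using G by auto
 show "finite (j0 ` G)" using G by auto
 fix v assume "v : carrier V'"
 then obtain c where c: "v = j0 (LC V c G)" "LC V c G : U" using U(2) unfolding Sp_def by auto
 have "(\<Oplus>\<^bsub>V'\<^esub>s\<in>j0 ` G. c (e s) \<odot>\<^bsub>V'\<^esub> s) = (\<Oplus>\<^bsub>V'\<^esub>g\<in>G. c (e (j0 g)) \<odot>\<^bsub>V'\<^esub> j0 g)"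
 using G UD(4) by (intro V'.M.finsum_reindex inj_on_subset[OF inj]) auto
 also have "... = (\<Oplus>\<^bsub>V'\<^esub>g\<in>G. j0 (c g \<odot> g))"
 by (intro V'.M.finsum_cong') (use G UD(4) in auto)
 also have "... = v" unfolding c(1) LC_def using G UD(4) by (intro fs) auto
 finally have "v = (\<Oplus>\<^bsub>V'\<^esub>s\<in>j0 ` G. (%s. c (e s)) s \<odot>\<^bsub>V'\<^esub> s)" by simp
 then show "EX c:j0 ` G \<rightarrow> carrier Cfield. v = (\<Oplus>\<^bsub>V'\<^esub>s\<in>j0 ` G. c s \<odot>\<^bsub>V'\<^esub> s)"
 by (intro bexI[of _ "%s. c (e s)"]) auto
 qed
 note WD = submodD[OF srepD(1)[OF W(1)]]
 have WU [simp]: "w : U" if "w : W" for w using W(2) that by blast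
 have "subrep K V' rh' (j0 ` W)"
 unfolding subrep_def
 proof (intro conjI ballI V'.submodI)
 show "\<zero>\<^bsub>V'\<^esub> : j0 ` W" using WD(2) by simp
 qed (use WD srepD(2)[OF W(1)] in \<open>auto simp: rh'_def\<close>)
 then obtain X where X: "subrep K V' rh' X" "j0 ` W \<inter> X = {\<zero>\<^bsub>V'\<^esub>}" "j0 ` W <+>\<^bsub>V'\<^esub> X = carrier V'"
 using red rep' fg unfolding reductive_def by blast
 note XD = V'.submodD[OF conjunct1[OF X(1)[unfolded subrep_def]]]
 define W' where "W' = e ` X"
 have Xj: "X = j0 ` W'" "W' <= U" using XD(1) unfolding W'_def by (auto simp: image_iff, force+)
 have Xm: "j0 u : X \<longleftrightarrow> u : W'" if "u : U" for u
 using that Xj inj by (auto simp: inj_on_def subset_iff)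
 have "srep W'"
 proof (intro srepI submodI)
 show "W' <= carrier V" using Xj(2) by auto
 show "\<zero> : W'" using XD(2) Xm UD(2) by simp
 fix u v assume uv: "u : W'" "v : W'"
 then have "j0 u \<oplus>\<^bsub>V'\<^esub> j0 v : X" using XD(3) Xj by blast
 then show "u \<oplus> v : W'" using uv Xj(2) Xm[of "u \<oplus> v"] UD(3) by (simp add: subset_iff)
 next
 fix r u assume u: "u : W'"
 then have "r \<odot>\<^bsub>V'\<^esub> j0 u : X" using XD(4) Xj by blast
 then show "r \<odot> u : W'" using u Xj(2) Xm[of "r \<odot> u"] UD(4) by (simp add: subset_iff)
 next
 fix k u assume u: "u : W'" "k : K"
 then have "rh' k (j0 u) : X" using X(1) Xj unfolding subrep_def by blast
 then show "rh k u : W'" using u Xj(2) Xm[of "rh k u"] srepD(2)[OF U(1)] by (simp add: rh'_def subset_iff)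
 qed
 moreover have "W \<inter> W' = {\<zero>}"
 proof -
 have "u = \<zero>" if "u : W" "u : W'" for u
 proof -
 have "j0 u : j0 ` W \<inter> X" using that Xj by blast
 then have "j0 u = j0 \<zero>" using X(2) by simp
 then show ?thesis using inj that(1) UD(2) by (simp add: inj_on_def)
 qed
 then show ?thesis using WD(2) submodD(2)[OF srepD(1)[OF \<open>srep W'\<close>]] by blast
 qed
 moreover have "ssum W W' = U"
 proof
 show "ssum W W' <= U" unfolding ssum_def using Xj(2) UD(3) by (auto simp: subset_iff)
 show "U <= ssum W W'"
 proof
 fix u assume u: "u : U"
 then have "j0 u : j0 ` W <+>\<^bsub>V'\<^esub> X" unfolding X(3) by simp
 then obtain w x where wx: "w : W" "x : X" "j0 u = j0 w \<oplus>\<^bsub>V'\<^esub> x"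
 unfolding set_add_def set_mult_def by auto
 then obtain x' where x': "x = j0 x'" "x' : W'" using Xj by blast
 then have "j0 u = j0 (w \<oplus> x')" using wx Xj(2) by (simp add: subset_iff)
 then have "u = w \<oplus> x'" using inj u wx x' Xj(2) UD(3) by (simp add: inj_on_def subset_iff)
 then show "u : ssum W W'" using wx x' unfolding ssum_def by blast
 qed
 qed
 ultimately show ?thesis using Xj(2) by blast
qed

text \<open>Among the subrepresentations of \<open>U1\<close> not inside \<open>Z\<close> take a
  minimal one, \<open>X\<close>. It is not irreducible, and a complement of a proper part
  \<open>Y\<close>, cut down to \<open>X\<close> by the modular law, writes \<open>X\<close> as a
  sum of two smaller pieces, which lie in \<open>Z\<close> by minimality.\<close>

lemma semisimple:
 assumes red: "reductive K" and G: "finite G" "G <= U" and U: "srep U" "U = Sp V G"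
 and U1: "srep U1" "U1 <= U" and Z: "submod V Z" "!!W. irr W ==> W <= U1 ==> W <= Z"
 shows "U1 <= Z"
proof (rule ccontr)
 assume neg: "~ U1 <= Z"
 define \<F> where "\<F> = {X. srep X & X <= U1 & ~ X <= Z}"
 have Gc: "G <= carrier V" using G(2) srep_sub[OF U(1)] by blast
 have "EX X:\<F>. ALL X':\<F>. X' <= X --> X' = X"
 proof (rule minimal_submodule[OF G(1) Gc])
 show "submod V X & X <= Sp V G" if "X : \<F>" for X
 using that srepD(1) U1(2) U(2) unfolding \<F>_def by blast
 show "\<F> ~= {}" using U1 neg unfolding \<F>_def by blast
 show "EX s. s * r = 1" if "r ~= 0" for r :: complex
 using that by (intro exI[of _ "inverse r"]) simp
 qed
 then obtain X where X: "X : \<F>" and Xmin: "!!X'. X' : \<F> ==> X' <= X ==> X' = X" by blast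
 have Xs: "srep X" "X <= U1" "~ X <= Z" using X unfolding \<F>_def by auto
 have "X ~= {\<zero>}" using Xs(3) submodD(2)[OF Z(1)] by blast
 moreover have "~ irr X" using Z(2) Xs by blast
 ultimately obtain Y where Y: "srep Y" "Y <= X" "Y ~= {\<zero>}" "Y ~= X"
 using Xs(1) unfolding irreducible_subrep_def by blast
 have "Y <= U" using Y Xs U1 by blast
 then obtain Y' where Y': "srep Y'" "Y' <= U" "Y \<inter> Y' = {\<zero>}" "ssum Y Y' = U"
 using complement[OF red G U Y(1)] by blast
 have s: "srep (Y' \<inter> X)" using srep_Int Y' Xs by blast
 have "X <= ssum Y (Y' \<inter> X)"
 proof
 fix u assume u: "u : X"
 then have "u : ssum Y Y'" using Y' Xs U1 by blast
 then obtain a b where ab: "u = a \<oplus> b" "a : Y" "b : Y'" unfolding ssum_def by blast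
 have c: "a : carrier V" "b : carrier V" using ab Y Y' srep_sub by blast+
 then have "b = u \<ominus> a" unfolding ab(1) by (simp add: a_minus_def M.a_assoc add_diff_cancel3)
 then have "b : X" using u ab(2) Y(2) submodD(6)[OF srepD(1)[OF Xs(1)]] by blast
 then show "u : ssum Y (Y' \<inter> X)" using ab unfolding ssum_def by blast
 qed
 moreover have "Y <= Z" using Xmin[of Y] Y Xs unfolding \<F>_def by blast
 moreover have "Y' \<inter> X <= Z"
 proof (rule ccontr)
 assume "~ Y' \<inter> X <= Z"
 then have "Y' \<inter> X = X" using Xmin[of "Y' \<inter> X"] s Xs unfolding \<F>_def by blast
 then have "Y <= {\<zero>}" using Y(2) Y'(3) by blast
 then show False using Y(3) submodD(2)[OF srepD(1)[OF Y(1)]] by blast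
 qed
 ultimately show False using Xs(3) submodD(3)[OF Z(1)] unfolding ssum_def by blast
qed

text \<open>An equivariant linear correspondence between irreducibles that is the graph of an injective map
 is the graph of an isomorphism.\<close>

lemma iso_of_graph:
 assumes W: "irr W" "irr W'" and \<Gamma>: "\<Gamma> <= W \<times> W'"
 and add: "!!u u' v v'. (u, u') : \<Gamma> ==> (v, v') : \<Gamma> ==> (u \<oplus> v, u' \<oplus> v') : \<Gamma>"
 and sm: "!!c u u'. (u, u') : \<Gamma> ==> (c \<odot> u, c \<odot> u') : \<Gamma>"
 and eq: "!!k u u'. k : K ==> (u, u') : \<Gamma> ==> (rh k u, rh k u') : \<Gamma>"
 and total: "!!u. u : W ==> EX u'. (u, u') : \<Gamma>"
 and left: "!!u. (\<zero>, u) : \<Gamma> ==> u = \<zero>" and right: "!!u. (u, \<zero>) : \<Gamma> ==> u = \<zero>"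
 shows "iso_rep W W'"
proof -
 have Wc: "u : carrier V" if "u : W | u : W'" for u using that W irrD(1) srep_sub by blast
 have diff: "(u \<ominus> v, u' \<ominus> v') : \<Gamma>" if "(u, u') : \<Gamma>" "(v, v') : \<Gamma>" for u v u' v'
 using add[OF that(1) sm[OF that(2), of "-1"]] that \<Gamma> Wc by (auto simp: tsmult_m1 a_minus_def)
 have func: "u' = v'" if "(u, u') : \<Gamma>" "(u, v') : \<Gamma>" for u u' v'
 proof -
 have c: "u : carrier V" "u' : carrier V" "v' : carrier V" using that \<Gamma> Wc by auto
 have "(\<zero>, u' \<ominus> v') : \<Gamma>" using diff[OF that] c by (simp add: a_minus_def M.r_neg)
 then show ?thesis using left diff_eq_0 c by blast
 qed
 have inj: "u = v" if "(u, u') : \<Gamma>" "(v, u') : \<Gamma>" for u u' v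
 proof -
 have c: "u : carrier V" "u' : carrier V" "v : carrier V" using that \<Gamma> Wc by auto
 have "(u \<ominus> v, \<zero>) : \<Gamma>" using diff[OF that] c by (simp add: a_minus_def M.r_neg)
 then show ?thesis using right diff_eq_0 c by blast
 qed
 define f where "f u = (THE u'. (u, u') : \<Gamma>)" for u
 have f: "(u, f u) : \<Gamma>" if "u : W" for u
 unfolding f_def using total[OF that] func by (metis theI)
 have f_eq: "f u = u'" if "(u, u') : \<Gamma>" for u u' using f func that \<Gamma> by blast
 define R where "R = f ` W"
 note WD = submodD[OF srepD(1)[OF irrD(1)[OF W(1)]]]
 have "srep R"
 proof (intro srepI submodI)
 show "R <= carrier V" using f \<Gamma> Wc unfolding R_def by blast
 obtain u' where "(\<zero>, u') : \<Gamma>" using total WD(2) by blast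
 then have "f \<zero> = \<zero>" using left f_eq by blast
 then show "\<zero> : R" using WD(2) unfolding R_def by force
 fix u v assume "u : R" "v : R"
 then obtain u' v' where "u = f u'" "v = f v'" "u' : W" "v' : W" unfolding R_def by blast
 then have "u \<oplus> v = f (u' \<oplus> v')" "u' \<oplus> v' : W" using add f f_eq WD(3) by metis+
 then show "u \<oplus> v : R" unfolding R_def by blast
 next
 fix r u assume "u : R"
 then obtain u' where "u = f u'" "u' : W" unfolding R_def by blast
 then have "r \<odot> u = f (r \<odot> u')" "r \<odot> u' : W" using sm f f_eq WD(4) by metis+
 then show "r \<odot> u : R" unfolding R_def by blast
 next
 fix k u assume k: "k : K" "u : R"
 then obtain u' where "u = f u'" "u' : W" unfolding R_def by blast
 then have "rh k u = f (rh k u')" "rh k u' : W" using eq f f_eq k srepD(2)[OF irrD(1)[OF W(1)]] by metis+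
 then show "rh k u : R" unfolding R_def by blast
 qed
 moreover have "R <= W'" using f \<Gamma> unfolding R_def by blast
 moreover have "R ~= {\<zero>}"
 proof
 assume R: "R = {\<zero>}"
 obtain w where w: "w : W" "w ~= \<zero>" using irr_nonzero[OF W(1)] by blast
 then have "f w = \<zero>" using R unfolding R_def by blast
 then show False using f[OF w(1)] right w(2) by metis
 qed
 ultimately have RW: "R = W'" using irrD(3)[OF W(2)] by blast
 show ?thesis
 unfolding isomorphic_subreps_def
 proof (intro exI[of _ f] conjI ballI)
 show "bij_betw f W W'"
 unfolding bij_betw_def using RW R_def f inj by (metis inj_onI)
 show "linear_map Cfield (V\<lparr>carrier := W\<rparr>) (V\<lparr>carrier := W'\<rparr>) f"
 unfolding linear_map_def using RW R_def add sm f f_eq by auto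
 show "f (rh k w) = rh k (f w)" if "k : K" "w : W" for k w using eq f f_eq that by blast
 qed
qed

section \<open>Isomorphic subrepresentations and sums of irreducibles\<close>

lemma iso_sym:
 assumes "srep W" "iso_rep W W'" shows "iso_rep W' W"
proof -
 obtain f where f: "bij_betw f W W'" "linear_map Cfield (V\<lparr>carrier := W\<rparr>) (V\<lparr>carrier := W'\<rparr>) f"
 "ALL k:K. ALL w:W. f (rh k w) = rh k (f w)" using assms(2) unfolding isomorphic_subreps_def by blast
 note WD = submodD[OF srepD(1)[OF assms(1)]]
 let ?g = "the_inv_into W f"
 have g: "bij_betw ?g W' W" using f(1) bij_betw_the_inv_into by blast
 have gf: "?g (f w) = w" if "w : W" for w using f(1) that by (simp add: bij_betw_def the_inv_into_f_f)
 have W': "W' = f ` W" using f(1) by (simp add: bij_betw_def)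
 have a: "f (u \<oplus> v) = f u \<oplus> f v" "f (r \<odot> u) = r \<odot> f u" if "u : W" "v : W" for u v r
 using f(2) that unfolding linear_map_def by auto
 show ?thesis
 unfolding isomorphic_subreps_def
 proof (intro exI[of _ ?g] conjI ballI g)
 show "linear_map Cfield (V\<lparr>carrier := W'\<rparr>) (V\<lparr>carrier := W\<rparr>) ?g"
 unfolding linear_map_def W' using gf WD a by (auto simp flip: a)
 show "?g (rh k w) = rh k (?g w)" if "k : K" "w : W'" for k w
 using that f(3) gf srepD(2)[OF assms(1)] unfolding W' by (metis imageE)
 qed
qed

lemma iso_trans:
 assumes "iso_rep W W'" "iso_rep W' W''" shows "iso_rep W W''"
proof -
 obtain f where f: "bij_betw f W W'" "linear_map Cfield (V\<lparr>carrier := W\<rparr>) (V\<lparr>carrier := W'\<rparr>) f"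
 "ALL k:K. ALL w:W. f (rh k w) = rh k (f w)" using assms(1) unfolding isomorphic_subreps_def by blast
 obtain g where g: "bij_betw g W' W''" "linear_map Cfield (V\<lparr>carrier := W'\<rparr>) (V\<lparr>carrier := W''\<rparr>) g"
 "ALL k:K. ALL w:W'. g (rh k w) = rh k (g w)" using assms(2) unfolding isomorphic_subreps_def by blast
 have fW: "f w : W'" if "w : W" for w using f(1) that by (auto simp: bij_betw_def)
 show ?thesis
 unfolding isomorphic_subreps_def
 proof (intro exI[of _ "g \<circ> f"] conjI ballI)
 show "bij_betw (g \<circ> f) W W''" using f(1) g(1) bij_betw_trans by blast
 show "linear_map Cfield (V\<lparr>carrier := W\<rparr>) (V\<lparr>carrier := W''\<rparr>) (g \<circ> f)"
 using f(2) g(2) fW unfolding linear_map_def by auto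
 show "(g \<circ> f) (rh k w) = rh k ((g \<circ> f) w)" if "k : K" "w : W" for k w
 using that f(3) g(3) fW by auto
 qed
qed

lemma iso_refl: "srep W ==> iso_rep W W"
 unfolding isomorphic_subreps_def
 by (rule exI[of _ id]) (auto simp: linear_map_def)

fun slist :: "'v set list => 'v set" where
 "slist [] = {\<zero>}"
| "slist (W # Ws) = ssum W (slist Ws)"

lemma slist_srep: "(!!W. W : set Ws ==> srep W) ==> srep (slist Ws)"
 by (induction Ws) (auto simp: srep_zero ssum_srep)

lemma slist_append:
 assumes "!!W. W : set Ws \<union> set Ws' ==> srep W" "u : slist Ws" "v : slist Ws'"
 shows "u \<oplus> v : slist (Ws @ Ws')"
 using assms
proof (induction Ws arbitrary: u)
 case Nil
 then show ?case using srep_sub[OF slist_srep[of Ws']] by auto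
next
 case (Cons W Ws)
 then obtain a b where ab: "u = a \<oplus> b" "a : W" "b : slist Ws" by (auto simp: ssum_def)
 have "b \<oplus> v : slist (Ws @ Ws')" using Cons ab by auto
 moreover have "a : carrier V" "b : carrier V" "v : carrier V"
 using ab Cons.prems srep_sub[of W] srep_sub[OF slist_srep[of Ws]] srep_sub[OF slist_srep[of Ws']] by auto
 then have "u \<oplus> v = a \<oplus> (b \<oplus> v)" using ab(1) by (simp add: M.a_assoc)
 ultimately show ?case using ab(2) by (auto simp: ssum_def)
qed

definition cspan :: "'v set set => 'v set" where
 "cspan \<W> = \<Inter>{U. submod V U & (ALL W:\<W>. W <= U)}"

lemma cspan_submod: "(!!W. W : \<W> ==> W <= carrier V) ==> submod V (cspan \<W>)"
 unfolding cspan_def using submod_carrier by (intro submod_Inter) auto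

lemma cspan_upper: "W : \<W> ==> W <= cspan \<W>" unfolding cspan_def by auto

lemma cspan_least: "submod V U ==> (!!W. W : \<W> ==> W <= U) ==> cspan \<W> <= U"
 unfolding cspan_def by auto

lemma cspan_slist:
 assumes \<W>: "!!W. W : \<W> ==> srep W" and u: "u : cspan \<W>"
 shows "EX Ws. set Ws <= \<W> & u : slist Ws"
proof -
 let ?U = "{u. EX Ws. set Ws <= \<W> & u : slist Ws}"
 have "cspan \<W> <= ?U"
 proof (rule cspan_least)
 show "submod V ?U"
 proof (rule submodI)
 show "?U <= carrier V" using slist_srep srep_sub \<W> by blast
 show "\<zero> : ?U" by (intro CollectI exI[of _ "[]"]) auto
 fix u v assume "u : ?U" "v : ?U"
 then obtain Ws Ws' where *: "set Ws <= \<W>" "u : slist Ws" "set Ws' <= \<W>" "v : slist Ws'" by blast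
 then have "u \<oplus> v : slist (Ws @ Ws')" by (intro slist_append \<W>) auto
 then show "u \<oplus> v : ?U" using * by (intro CollectI exI[of _ "Ws @ Ws'"]) auto
 next
 fix r u assume "u : ?U"
 then obtain Ws where *: "set Ws <= \<W>" "u : slist Ws" by blast
 then have "r \<odot> u : slist Ws" using submodD(4)[OF srepD(1)[OF slist_srep[of Ws]]] \<W> by blast
 then show "r \<odot> u : ?U" using * by blast
 qed
 fix W assume W: "W : \<W>"
 have "W <= slist [W]" using ssum_left[of W "{\<zero>}"] srepD(1) \<W>[OF W] submod_zero by simp
 then show "W <= ?U" using W by (auto intro!: exI[of _ "[W]"])
 qed
 then show ?thesis using u by blast
qed

text \<open>If \<open>W\<close> is not inside the sum \<open>U\<close> of the tail, then both
  \<open>W\<close> and \<open>X\<close> meet \<open>U\<close> trivially, and the projection to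
  \<open>X\<close> along \<open>U\<close> is an injective equivariant map on \<open>W\<close>;
  \<Gamma> is its graph.\<close>

lemma irr_in_slist:
 assumes "irr W" "!!X. X : set Ws ==> irr X" "W <= slist Ws"
 shows "EX X:set Ws. iso_rep W X"
 using assms(2,3)
proof (induction Ws)
 case Nil
 then show ?case using irr_nonzero[OF assms(1)] by auto
next
 case (Cons X Ws)
 define U where "U = slist Ws"
 have U: "srep U" unfolding U_def by (intro slist_srep) (use Cons.prems irrD in auto)
 have X: "irr X" using Cons.prems by simp
 note UD = submodD[OF srepD(1)[OF U]] and XD = submodD[OF srepD(1)[OF irrD(1)[OF X]]]
 and WD = submodD[OF srepD(1)[OF irrD(1)[OF assms(1)]]]
 show ?case
 proof (cases "W <= U")
 case True
 then show ?thesis using Cons unfolding U_def by auto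
 next
 case False
 have WU: "W \<inter> U = {\<zero>}"
 using irrD(3)[OF assms(1) srep_Int[OF irrD(1)[OF assms(1)] U]] False by blast
 have WXU: "W <= ssum X U" using Cons.prems(2) by (simp add: U_def)
 have XU: "X \<inter> U = {\<zero>}"
 proof (rule ccontr)
 assume "X \<inter> U ~= {\<zero>}"
 then have "X <= U" using irrD(3)[OF X srep_Int[OF irrD(1)[OF X] U]] by blast
 then have "ssum X U <= U" using UD(3) unfolding ssum_def by blast
 then show False using WXU False by blast
 qed
 define \<Gamma> where "\<Gamma> = {(w, x). w : W & x : X & (EX u:U. w = x \<oplus> u)}"
 have "iso_rep W X"
 proof (rule iso_of_graph[OF assms(1) X, of \<Gamma>])
 fix u u' v v' assume "(u, u') : \<Gamma>" "(v, v') : \<Gamma>"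
 then obtain a b where *: "u : W" "u' : X" "v : W" "v' : X" "a : U" "b : U" "u = u' \<oplus> a" "v = v' \<oplus> b"
 unfolding \<Gamma>_def by blast
 then have "u' : carrier V" "v' : carrier V" "a : carrier V" "b : carrier V" using UD(1) XD(1) by auto
 then have "u \<oplus> v = (u' \<oplus> v') \<oplus> (a \<oplus> b)" using *(7,8) by (simp add: M.a_ac)
 moreover have "a \<oplus> b : U" "u \<oplus> v : W" "u' \<oplus> v' : X" using * UD(3) XD(3) WD(3) by blast+
 ultimately show "(u \<oplus> v, u' \<oplus> v') : \<Gamma>" unfolding \<Gamma>_def by blast
 next
 fix c u u' assume "(u, u') : \<Gamma>"
 then obtain a where *: "u : W" "u' : X" "a : U" "u = u' \<oplus> a" unfolding \<Gamma>_def by blast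
 then have "c \<odot> u = c \<odot> u' \<oplus> c \<odot> a" using UD(1) XD(1) by (simp add: tsmult_r_distr subsetD)
 moreover have "c \<odot> a : U" "c \<odot> u : W" "c \<odot> u' : X" using * UD(4) XD(4) WD(4) by blast+
 ultimately show "(c \<odot> u, c \<odot> u') : \<Gamma>" unfolding \<Gamma>_def by blast
 next
 fix k u u' assume k: "k : K" and "(u, u') : \<Gamma>"
 then obtain a where *: "u : W" "u' : X" "a : U" "u = u' \<oplus> a" unfolding \<Gamma>_def by blast
 then have "rh k u = rh k u' \<oplus> rh k a" using UD(1) XD(1) k by (simp add: rho_add subsetD)
 moreover have "rh k a : U" "rh k u : W" "rh k u' : X"
 using * k srepD(2) U irrD(1) X assms(1) by blast+
 ultimately show "(rh k u, rh k u') : \<Gamma>" unfolding \<Gamma>_def by blast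
 next
 fix u assume "u : W"
 then show "EX u'. (u, u') : \<Gamma>" using WXU unfolding \<Gamma>_def ssum_def by blast
 next
 fix x assume "(\<zero>, x) : \<Gamma>"
 then obtain a where *: "x : X" "a : U" "\<zero> = x \<oplus> a" unfolding \<Gamma>_def by blast
 then have "\<ominus> a = x" using UD(1) XD(1) by (intro M.minus_equality) auto
 then have "x : U" using * UD(5) by blast
 then show "x = \<zero>" using XU * by blast
 next
 fix w assume "(w, \<zero>) : \<Gamma>"
 then show "w = \<zero>" using WU UD(1) unfolding \<Gamma>_def by (auto simp: subset_iff)
 qed (auto simp: \<Gamma>_def)
 then show ?thesis by simp
 qed
qed

lemma irr_in_cspan:
 assumes "irr W" "!!X. X : \<W> ==> irr X" "W <= cspan \<W>"
 shows "EX X:\<W>. iso_rep W X"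
proof -
 obtain w where w: "w : W" "w ~= \<zero>" using irr_nonzero[OF assms(1)] by blast
 then obtain Ws where Ws: "set Ws <= \<W>" "w : slist Ws"
 using cspan_slist[of \<W> w] assms irrD(1) by blast
 have s: "srep (slist Ws)" using slist_srep Ws(1) assms(2) irrD(1) by blast
 have "W \<inter> slist Ws = W" using irrD(3)[OF assms(1) srep_Int[OF irrD(1)[OF assms(1)] s]] w Ws(2) by blast
 then show ?thesis using irr_in_slist[OF assms(1), of Ws] Ws(1) assms(2) by blast
qed

lemma cspan_srep: assumes "!!W. W : \<W> ==> srep W" shows "srep (cspan \<W>)"
proof (rule srepI)
 show c: "submod V (cspan \<W>)" using assms srep_sub by (intro cspan_submod) auto
 fix k w assume k: "k : K" "w : cspan \<W>"
 have "submod V {w : cspan \<W>. rh k w : cspan \<W>}"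
 by (rule submodI) (use submodD[OF c] k(1) in \<open>auto simp: rho_zero rho_add rho_smult subsetD\<close>)
 then have "cspan \<W> <= {w : cspan \<W>. rh k w : cspan \<W>}"
 using cspan_upper srepD(2)[OF assms k(1)] by (intro cspan_least) blast+
 then show "rh k w : cspan \<W>" using k by blast
qed

section \<open>Isotypical components: independence and span\<close>

definition isotyp :: "'v set => 'v set" where
 "isotyp W = cspan {W'. irr W' & iso_rep W W'}"

lemma isotypic_summands_eq: "isotypic_summands K V rh = isotyp ` {W. irr W}"
 unfolding isotypic_summands_def isotyp_def cspan_def by auto

lemma isotyp_srep: "srep (isotyp W)"
 unfolding isotyp_def by (rule cspan_srep) (auto dest: irrD)

lemma irr_isotyp: "irr W ==> irr W' ==> iso_rep W W' ==> W' <= isotyp W"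
 unfolding isotyp_def by (rule cspan_upper) auto

lemma isotyp_cong: "irr W ==> irr W' ==> iso_rep W W' ==> isotyp W = isotyp W'"
 unfolding isotyp_def using iso_trans iso_sym irrD(1) by (metis (lifting))

text \<open>A nonzero intersection contains an irreducible by semisimplicity. Lying in both sides,
  it would be isomorphic to \<open>W\<close> and also to an irreducible with a different
  component.\<close>

lemma isotypic_indep:
 assumes red: "reductive K" and W: "irr W"
 shows "isotyp W \<inter> cspan (isotypic_summands K V rh - {isotyp W}) = {\<zero>}"
proof (rule ccontr)
 let ?\<W> = "{W'. irr W' & isotyp W' ~= isotyp W}"
 define X where "X = isotyp W \<inter> cspan (isotypic_summands K V rh - {isotyp W})"
 assume "isotyp W \<inter> cspan (isotypic_summands K V rh - {isotyp W}) ~= {\<zero>}"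
 then have "X ~= {\<zero>}" unfolding X_def .
 have "srep (cspan (isotypic_summands K V rh - {isotyp W}))"
 by (rule cspan_srep) (auto simp: isotypic_summands_eq isotyp_srep)
 then have Xs: "srep X" unfolding X_def using srep_Int isotyp_srep by blast
 then obtain x where x: "x : X" "x ~= \<zero>" using \<open>X ~= {\<zero>}\<close> submodD(2)[OF srepD(1)] by blast
 then have xc: "x : carrier V" using Xs srep_sub by blast
 obtain G where G: "finite G" "G <= orb x" "orb x = Sp V G" using orb_fg[OF xc] by blast
 have "EX W0. irr W0 & W0 <= orb x"
 proof (rule ccontr)
 assume "\<nexists>W0. irr W0 & W0 <= orb x"
 then have "orb x <= {\<zero>}"
 using semisimple[OF red G(1,2) orb(1)[OF xc] G(3) orb(1)[OF xc] order_refl submod_zero] by blast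
 then show False using orb(2)[OF xc] x(2) by blast
 qed
 then obtain W0 where W0: "irr W0" "W0 <= X" using orb(3)[OF xc Xs x(1)] by blast
 have "EX W1:{W'. irr W' & iso_rep W W'}. iso_rep W0 W1"
 by (rule irr_in_cspan[OF W0(1)]) (use W0(2) in \<open>auto simp: X_def isotyp_def\<close>)
 then obtain W1 where W1: "irr W1" "iso_rep W W1" "iso_rep W0 W1" by auto
 have a: "isotyp W0 = isotyp W"
 using isotyp_cong[OF W0(1) W1(1,3)] isotyp_cong[OF W W1(1,2)] by simp
 have "cspan (isotypic_summands K V rh - {isotyp W}) <= cspan ?\<W>"
 proof (rule cspan_least)
 show "submod V (cspan ?\<W>)" by (rule cspan_submod) (auto dest: irrD(1) srep_sub)
 fix U assume "U : isotypic_summands K V rh - {isotyp W}"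
 then obtain W1 where W1: "U = isotyp W1" "irr W1" "isotyp W1 ~= isotyp W" by (auto simp: isotypic_summands_eq)
 have "isotyp W1 <= cspan ?\<W>"
 proof (subst isotyp_def, rule cspan_least)
 show "submod V (cspan ?\<W>)" by (rule cspan_submod) (auto dest: irrD(1) srep_sub)
 fix W2 assume "W2 : {W'. irr W' & iso_rep W1 W'}"
 then show "W2 <= cspan ?\<W>" using isotyp_cong[OF W1(2), of W2] W1(3) by (intro cspan_upper) auto
 qed
 then show "U <= cspan ?\<W>" using W1 by simp
 qed
 then have "W0 <= cspan ?\<W>" using W0(2) unfolding X_def by blast
 then obtain W2 where "irr W2" "isotyp W2 ~= isotyp W" "iso_rep W0 W2"
 using irr_in_cspan[OF W0(1), of ?\<W>] by blast
 then show False using isotyp_cong[OF W0(1)] a by metis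
qed

lemma isotypic_span:
 assumes red: "reductive K" and Z: "submod V Z" "!!U. U : isotypic_summands K V rh ==> U <= Z"
 shows "carrier V <= Z"
proof
 fix v assume v: "v : carrier V"
 obtain G where G: "finite G" "G <= orb v" "orb v = Sp V G" using orb_fg[OF v] by blast
 have "orb v <= Z"
 proof (rule semisimple[OF red G(1,2) orb(1)[OF v] G(3) orb(1)[OF v] order_refl Z(1)])
 fix W assume "irr W"
 then show "W <= Z" using Z(2)[of "isotyp W"] irr_isotyp[of W W] iso_refl irrD(1)
 by (auto simp: isotypic_summands_eq)
 qed
 then show "v : Z" using orb(2)[OF v] by blast
qed

end

section \<open>Regular functions\<close>

lemma regular_sum:
 "(!!i. i : S ==> f i : regular_functions) ==> (%k. SUM i:S. f i k) : regular_functions"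
 by (induction S rule: infinite_finite_induct) (auto intro: regular_functions.intros)

lemma regular_prod:
 "(!!i. i : S ==> f i : regular_functions) ==> (%k. \<Prod>i\<in>S. f i k) : regular_functions"
 by (induction S rule: infinite_finite_induct) (auto intro: regular_functions.intros)

lemma regular_det:
 fixes A :: "complex^'n^'n => complex^'n^'n"
 assumes "!!i j. (%k. A k $ i $ j) : regular_functions"
 shows "(%k. det (A k)) : regular_functions"
 unfolding det_def
 by (intro regular_sum regular_functions.mult regular_functions.const regular_prod assms)

lemma matrix_inv_props:
 fixes k :: "complex^'n^'n"
 assumes "invertible k"
 shows "k ** matrix_inv k = mat 1" "matrix_inv k ** k = mat 1"
 using someI_ex[of "%l. k ** l = mat 1 & l ** k = mat 1"] assms
 unfolding invertible_def matrix_inv_def by auto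

lemma matrix_inv_entry:
 fixes k :: "complex^'n^'n"
 assumes "invertible k"
 shows "matrix_inv k $ a $ b = det (\<chi> i j. if j = a then axis b 1 $ i else k $ i $ j) * inverse (det k)"
proof -
 have d: "det k ~= 0" using assms invertible_det_nz by blast
 have "k *v (matrix_inv k *v axis b 1) = axis b 1"
 using matrix_inv_props[OF assms] by (simp add: matrix_vector_mul_assoc)
 then have "matrix_inv k *v axis b 1 = (\<chi> a. det (\<chi> i j. if j = a then axis b 1 $ i else k $ i $ j) / det k)"
 using cramer[OF d] by blast
 then have "(matrix_inv k *v axis b 1) $ a = det (\<chi> i j. if j = a then axis b 1 $ i else k $ i $ j) / det k"
 by simp
 moreover have "(matrix_inv k *v axis b 1) $ a = matrix_inv k $ a $ b"
 by (simp add: matrix_vector_mult_def axis_def if_distrib cong: if_cong)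
 ultimately show ?thesis by (simp add: divide_inverse)
qed

text \<open>Inversion of matrices is a regular map: the entries are given by Cramer's rule, and the
  inverse determinant becomes the determinant. This serves the contragredient representation and the
  inverses of sections.\<close>

lemma regular_inv:
 assumes "c : regular_functions"
 shows "EX c':regular_functions. ALL k. invertible k --> c' k = c (matrix_inv k)"
 using assms
proof induction
 case (const c)
 then show ?case by (intro bexI[of _ "%_. c"] regular_functions.const) simp
next
 case (entry a b)
 have "(%k. det (\<chi> i j. if j = a then axis b 1 $ i else k $ i $ j) * inverse (det k)) : regular_functions"
 proof (intro regular_functions.mult regular_functions.inverse_det regular_det)
 fix i j :: 'a
 show "(%k. (\<chi> i j. if j = a then axis b 1 $ i else k $ i $ j) $ i $ j) : regular_functions"
 by (cases "j = a") (simp_all add: regular_functions.const regular_functions.entry)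
 qed
 then show ?case by (rule rev_bexI) (simp add: matrix_inv_entry)
next
 case inverse_det
 have "det k = inverse (det (matrix_inv k))" if "invertible k" for k :: "complex^'a^'a"
 proof -
 have "det k * det (matrix_inv k) = 1"
 using matrix_inv_props[OF that] by (metis det_I det_mul)
 then show ?thesis by (metis inverse_unique mult.commute)
 qed
 moreover have "(%k::complex^'a^'a. det k) : regular_functions"
 by (intro regular_det regular_functions.entry)
 ultimately show ?case by blast
next
 case (add c d)
 then obtain c' d' where "c' : regular_functions" "ALL k. invertible k --> c' k = c (matrix_inv k)"
 "d' : regular_functions" "ALL k. invertible k --> d' k = d (matrix_inv k)" by blast
 then show ?case by (intro bexI[of _ "%k. c' k + d' k"] regular_functions.add) auto
next
 case (mult c d)
 then obtain c' d' where "c' : regular_functions" "ALL k. invertible k --> c' k = c (matrix_inv k)"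
 "d' : regular_functions" "ALL k. invertible k --> d' k = d (matrix_inv k)" by blast
 then show ?case by (intro bexI[of _ "%k. c' k * d' k"] regular_functions.mult) auto
qed

section \<open>Free modules of finite rank\<close>

text \<open>The free module of rank \<open>N\<close>, carried by the type over which
  \<open>flat\<close> and \<open>quasi_admissible\<close> quantify, so that it can be inserted as a
  test module.\<close>

definition free_mod :: "nat => (complex poly, nat => complex poly) module" where
 "free_mod N = \<lparr>carrier = {f. ALL i. i \<ge> N --> f i = 0}, monoid.mult = undefined, one = undefined,
 ring.zero = (%_. 0), add = (%f g i. f i + g i), smult = (%q f i. q * f i)\<rparr>"

lemma free_mod_simps [simp]:
 "carrier (free_mod N) = {f. ALL i. i \<ge> N --> f i = 0}" "ring.zero (free_mod N) = (%_. 0)"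
 "add (free_mod N) = (%f g i. f i + g i)" "smult (free_mod N) = (%q f i. q * f i)"
 by (simp_all add: free_mod_def)

abbreviation delta :: "'i => 'i => 'a::zero_neq_one" where "delta i \<equiv> (%j. if j = i then 1 else 0)"

lemma module_free_mod: "Module.module Oring (free_mod N)"
proof (rule moduleI)
 show "abelian_group (free_mod N)"
 proof (rule abelian_groupI)
 fix f assume "f : carrier (free_mod N)"
 then show "EX g:carrier (free_mod N). g \<oplus>\<^bsub>free_mod N\<^esub> f = \<zero>\<^bsub>free_mod N\<^esub>"
 by (intro bexI[of _ "%i. - f i"]) auto
 qed (auto simp: algebra_simps)
qed (auto simp: algebra_simps)

lemma based_free_mod: "based (free_mod N) {..<N} (%f. f) delta"
proof (rule based.intro)
 fix u :: "nat => complex poly" assume "u : carrier (free_mod N)"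
 then have "{i. u i ~= 0} <= {..<N}" by (auto simp: not_le[symmetric])
 then show "finite {i. u i ~= 0}" using finite_subset by blast
qed (auto simp: module_free_mod)

lemma restrict_scalars_simps [simp]:
 "carrier (restrict_scalars h M) = carrier M" "ring.zero (restrict_scalars h M) = ring.zero M"
 "add (restrict_scalars h M) = add M" "smult (restrict_scalars h M) = (%r. smult M (h r))"
 by (simp_all add: restrict_scalars_def)

lemma finsum_same_add:
 assumes "add M = add N" "ring.zero M = ring.zero N" "carrier M = carrier N"
 shows "finsum M f A = finsum N f A"
 unfolding finsum_def finprod_def using assms by simp

lemma finsum_restrict: "finsum (restrict_scalars h M) f A = finsum M f A"
 by (rule finsum_same_add) simp_all

lemma finsum_free_mod:
 assumes "finite P" "!!p. p : P ==> f p : carrier (free_mod N)"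
 shows "finsum (free_mod N) f P = (%i. SUM p:P. f p i)"
 using based.crd_finsum[OF based_free_mod, of P f N] assms by (auto simp: Pi_iff fun_eq_iff)

context based_ext
begin

lemma tc_finsum:
 assumes "finite S" "!!s. s : S ==> f s : carrier BC"
 shows "tc (finsum BC f S) = (%i. SUM s:S. tc (f s) i)"
proof -
 interpret BC: Module.module A BC by (rule module_BC)
 show ?thesis
 using assms
 proof (induction S)
 case empty
 then show ?case using BC.M.finsum_empty tc_zero by simp
 next
 case (insert x S)
 then have f: "f : S \<rightarrow> carrier BC" "f x : carrier BC" by (auto simp del: base_change_simps)
 then have "finsum BC f S : carrier BC" by (rule_tac BC.M.finsum_closed)
 then have "tc (f x \<oplus>\<^bsub>BC\<^esub> finsum BC f S) = (%i. tc (f x) i + tc (finsum BC f S) i)"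
 by (rule tc_add[OF f(2)])
 then show ?case using insert f BC.M.finsum_insert[OF insert.hyps f] by (simp del: base_change_simps)
 qed
qed

lemma free_BC: "free_module A BC"
proof -
 interpret BC: Module.module A BC by (rule module_BC)
 define \<beta> where "\<beta> i = mk (delta i)" for i :: 'i
 have fs: "delta i : fin_supp I (carrier A)" if "i : I" for i
 using that by (auto simp: fin_supp_def)
 have \<beta>: "\<beta> i : carrier BC" "tc (\<beta> i) = delta i" if "i : I" for i
 unfolding \<beta>_def by (rule mk[OF fs[OF that]])+
 have inj: "inj_on \<beta> I"
 by (rule inj_onI) (metis \<beta>(2) zero_neq_one)
 have lin: "tc (\<Oplus>\<^bsub>BC\<^esub>b\<in>{b. c b ~= \<zero>\<^bsub>A\<^esub>}. c b \<odot>\<^bsub>BC\<^esub> b) = (%i. if i : I then c (\<beta> i) else 0)"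
 and lin_in: "(\<Oplus>\<^bsub>BC\<^esub>b\<in>{b. c b ~= \<zero>\<^bsub>A\<^esub>}. c b \<odot>\<^bsub>BC\<^esub> b) : carrier BC"
 if c: "c : \<beta> ` I \<rightarrow> carrier A" "ALL b. b ~: \<beta> ` I --> c b = \<zero>\<^bsub>A\<^esub>" "finite {b. c b ~= \<zero>\<^bsub>A\<^esub>}" for c
 proof -
 have sub: "{b. c b ~= \<zero>\<^bsub>A\<^esub>} <= \<beta> ` I" using c(2) by blast
 have mem: "c b : carrier A" "b : carrier BC" if "b : {b. c b ~= \<zero>\<^bsub>A\<^esub>}" for b
 using that sub c(1) \<beta>(1) by (auto simp del: base_change_simps)
 show "(\<Oplus>\<^bsub>BC\<^esub>b\<in>{b. c b ~= \<zero>\<^bsub>A\<^esub>}. c b \<odot>\<^bsub>BC\<^esub> b) : carrier BC"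
 by (rule BC.M.finsum_closed) (use mem tc_smult(2) in blast)
 have "tc (\<Oplus>\<^bsub>BC\<^esub>b\<in>{b. c b ~= \<zero>\<^bsub>A\<^esub>}. c b \<odot>\<^bsub>BC\<^esub> b) = (%i. SUM b:{b. c b ~= \<zero>\<^bsub>A\<^esub>}. tc (c b \<odot>\<^bsub>BC\<^esub> b) i)"
 by (rule tc_finsum[OF c(3)]) (use mem tc_smult(2) in blast)
 also have "... = (%i. SUM b:{b. c b ~= \<zero>\<^bsub>A\<^esub>}. c b * tc b i)"
 by (rule ext, rule sum.cong) (use mem tc_smult(1) in auto)
 also have "... = (%i. if i : I then c (\<beta> i) else 0)"
 proof
 fix i
 show "(SUM b:{b. c b ~= \<zero>\<^bsub>A\<^esub>}. c b * tc b i) = (if i : I then c (\<beta> i) else 0)"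
 proof (cases "i : I")
 case True
 have "(SUM b:{b. c b ~= \<zero>\<^bsub>A\<^esub>}. c b * tc b i) = (SUM b:{b. c b ~= \<zero>\<^bsub>A\<^esub>}. if b = \<beta> i then c b else 0)"
 proof (rule sum.cong[OF refl])
 fix b assume "b : {b. c b ~= \<zero>\<^bsub>A\<^esub>}"
 then obtain j where j: "b = \<beta> j" "j : I" using sub by blast
 then show "c b * tc b i = (if b = \<beta> i then c b else 0)"
 using \<beta>(2)[OF j(2)] inj True by (auto simp: inj_on_def)
 qed
 also have "... = c (\<beta> i)" using c(3) by (simp add: ops)
 finally show ?thesis using True by simp
 next
 case False
 have "tc b i = 0" if "b : {b. c b ~= \<zero>\<^bsub>A\<^esub>}" for b
 using that sub \<beta>(2) False by auto
 then show ?thesis using False by simp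
 qed
 qed
 finally show "tc (\<Oplus>\<^bsub>BC\<^esub>b\<in>{b. c b ~= \<zero>\<^bsub>A\<^esub>}. c b \<odot>\<^bsub>BC\<^esub> b) = (%i. if i : I then c (\<beta> i) else 0)" .
 qed
 show ?thesis
 unfolding free_module_def
 proof (intro exI[of _ "\<beta> ` I"] conjI ballI)
 show "\<beta> ` I <= carrier BC" using \<beta>(1) by blast
 fix v assume v: "v : carrier BC"
 have vs: "finite {i. tc v i ~= 0}" "!!i. i ~: I ==> tc v i = 0" "!!i. tc v i : carrier A"
 using tc_in[OF v] unfolding fin_supp_def by auto
 define c where "c b = (if b : \<beta> ` I then tc v (the_inv_into I \<beta> b) else \<zero>\<^bsub>A\<^esub>)" for b
 have c\<beta>: "c (\<beta> i) = tc v i" if "i : I" for i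
 using that the_inv_into_f_f[OF inj that] by (simp add: c_def)
 have "{b. c b ~= \<zero>\<^bsub>A\<^esub>} <= \<beta> ` {i. tc v i ~= 0}"
 proof
 fix b assume b: "b : {b. c b ~= \<zero>\<^bsub>A\<^esub>}"
 then obtain i where "b = \<beta> i" "i : I" by (auto simp: c_def split: if_splits)
 then show "b : \<beta> ` {i. tc v i ~= 0}" using b c\<beta> by (auto simp: ops)
 qed
 then have cfin: "finite {b. c b ~= \<zero>\<^bsub>A\<^esub>}" using vs(1) finite_surj by blast
 have c1: "c : \<beta> ` I \<rightarrow> carrier A" using c\<beta> vs(3) by auto
 have c2: "ALL b. b ~: \<beta> ` I --> c b = \<zero>\<^bsub>A\<^esub>" by (simp add: c_def)
 show "\<exists>!c. c : \<beta> ` I \<rightarrow> carrier A & (ALL b. b ~: \<beta> ` I --> c b = \<zero>\<^bsub>A\<^esub>) & finite {b. c b ~= \<zero>\<^bsub>A\<^esub>}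
 & v = (\<Oplus>\<^bsub>BC\<^esub>b\<in>{b. c b ~= \<zero>\<^bsub>A\<^esub>}. c b \<odot>\<^bsub>BC\<^esub> b)"
 proof (rule ex1I[of _ c])
 have "v = (\<Oplus>\<^bsub>BC\<^esub>b\<in>{b. c b ~= \<zero>\<^bsub>A\<^esub>}. c b \<odot>\<^bsub>BC\<^esub> b)"
 by (rule tc_inj[OF v lin_in[OF c1 c2 cfin]]) (use lin[OF c1 c2 cfin] c\<beta> vs(2) in \<open>auto simp: fun_eq_iff\<close>)
 then show "c : \<beta> ` I \<rightarrow> carrier A & (ALL b. b ~: \<beta> ` I --> c b = \<zero>\<^bsub>A\<^esub>) & finite {b. c b ~= \<zero>\<^bsub>A\<^esub>}
 & v = (\<Oplus>\<^bsub>BC\<^esub>b\<in>{b. c b ~= \<zero>\<^bsub>A\<^esub>}. c b \<odot>\<^bsub>BC\<^esub> b)" using c1 c2 cfin by blast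
 fix d assume d: "d : \<beta> ` I \<rightarrow> carrier A & (ALL b. b ~: \<beta> ` I --> d b = \<zero>\<^bsub>A\<^esub>) & finite {b. d b ~= \<zero>\<^bsub>A\<^esub>}
 & v = (\<Oplus>\<^bsub>BC\<^esub>b\<in>{b. d b ~= \<zero>\<^bsub>A\<^esub>}. d b \<odot>\<^bsub>BC\<^esub> b)"
 then have "tc v = tc (\<Oplus>\<^bsub>BC\<^esub>b\<in>{b. d b ~= \<zero>\<^bsub>A\<^esub>}. d b \<odot>\<^bsub>BC\<^esub> b)"
 by (intro arg_cong[of _ _ tc]) (elim conjE)
 also have "... = (%i. if i : I then d (\<beta> i) else 0)"
 by (rule lin[OF conjunct1[OF d] conjunct1[OF conjunct2[OF d]] conjunct1[OF conjunct2[OF conjunct2[OF d]]]])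
 finally have "tc v = (%i. if i : I then d (\<beta> i) else 0)" .
 then have in_I: "d (\<beta> i) = c (\<beta> i)" if "i : I" for i using c\<beta> that by simp
 have out: "d b = c b" if "b ~: \<beta> ` I" for b
 using conjunct1[OF conjunct2[OF d]] c2 that by simp
 show "d = c"
 proof
 fix b show "d b = c b" by (cases "b : \<beta> ` I") (auto simp: in_I out)
 qed
 qed
 qed
qed

end

lemma basic_open_ext: "scalar_ext (basic_open_ring 1) to_fract"
proof (rule scalar_ext.intro)
 show "1 : carrier (basic_open_ring 1)" by (auto simp: basic_open_ring_def One_fract_def intro!: exI[of _ 1])
 show "a - b : carrier (basic_open_ring 1)" "a * b : carrier (basic_open_ring 1)"
 if "a : carrier (basic_open_ring 1)" "b : carrier (basic_open_ring 1)" for a b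
 using that by (auto simp: basic_open_ring_def)
qed (auto simp: basic_open_ring_def to_fract_def One_fract_def)

lemma locally_free_free_mod: "locally_free (free_mod N)"
proof -
 interpret based_ext "free_mod N" "{..<N}" "%f. f" delta "basic_open_ring 1" to_fract
 by (intro based_ext.intro based_free_mod basic_open_ext)
 show ?thesis
 unfolding locally_free_def using free_BC module_free_mod
 by (auto simp del: base_change_simps intro!: exI[of _ "1 :: complex poly"])
qed

lemma fin_gen_free_mod: "fin_gen Oring (free_mod N)"
 unfolding fin_gen_def
proof (intro exI[of _ "delta ` {..<N}"] conjI ballI)
 interpret based "free_mod N" "{..<N}" "%f. f" delta by (rule based_free_mod)
 fix v :: "nat => complex poly" assume v: "v : carrier (free_mod N)"
 have inj: "inj_on (delta :: nat => nat => complex poly) {..<N}"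
 by (rule inj_onI) (metis zero_neq_one)
 have "(\<Oplus>\<^bsub>free_mod N\<^esub>s\<in>delta ` {..<N}. v (the_inv_into {..<N} delta s) \<odot>\<^bsub>free_mod N\<^esub> s)
 = (\<Oplus>\<^bsub>free_mod N\<^esub>i\<in>{..<N}. v (the_inv_into {..<N} delta (delta i :: nat => complex poly)) \<odot>\<^bsub>free_mod N\<^esub> delta i)"
 by (rule M.M.finsum_reindex) (use inj in auto)
 also have "... = (\<Oplus>\<^bsub>free_mod N\<^esub>i\<in>{..<N}. v i \<odot>\<^bsub>free_mod N\<^esub> delta i)"
 by (rule M.M.finsum_cong') (use the_inv_into_f_f[OF inj] in auto)
 also have "... = v"
 proof -
 have "{i. v i ~= 0} <= {..<N}" using v by (force simp: not_less[symmetric])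
 then show ?thesis using reconstruct[OF v, of "{..<N}"] by simp
 qed
 finally show "EX c:delta ` {..<N} \<rightarrow> carrier Oring. v = (\<Oplus>\<^bsub>free_mod N\<^esub>s\<in>delta ` {..<N}. c s \<odot>\<^bsub>free_mod N\<^esub> s)"
 by (intro bexI[of _ "%s. v (the_inv_into {..<N} delta s)"]) (auto simp del: free_mod_simps)
qed auto

text \<open>The coordinates \<open>O\<^sup>N \<otimes> F \<rightarrow> F\<close> of the tensor product with a free module.\<close>

locale free_tensor = tmod F for F :: "(complex poly, 'f) module" (structure) + fixes N :: nat
begin

sublocale P: tensor_pair Oring "free_mod N" F
 by (intro tensor_pair.intro scalar_closed_module module_free_mod module_type)

abbreviation "pairs \<equiv> carrier (free_mod N) \<times> carrier F"
abbreviation "clsF \<equiv> tensor_class Oring (free_mod N) F"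

text \<open>At this stage \<open>F\<close> has no basis, so the coordinate at \<open>j\<close> of a
  tensor takes its value in \<open>F\<close> itself. The homomorphism comes from the universal
  property of the free abelian group.\<close>

definition ecoord :: "nat => ((nat => complex poly) \<times> 'f \<Rightarrow>\<^sub>0 int) => 'f" where
 "ecoord j = (SOME e. e : hom (pair_group (free_mod N) F) (add_monoid F)
 & (ALL f v. (f, v) : pairs --> e (frag_of (f, v)) = f j \<odot> v))"

lemma ecoord: "ecoord j : hom (pair_group (free_mod N) F) (add_monoid F)"
 "(f, v) : pairs ==> ecoord j (frag_of (f, v)) = f j \<odot> v"
proof -
 have "(%(f, v). f j \<odot> v) ` pairs <= carrier (add_monoid F)" by auto
 then obtain e where e: "e : hom (pair_group (free_mod N) F) (add_monoid F)"
 "!!x. x : pairs ==> e (frag_of x) = (%(f, v). f j \<odot> v) x"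
 by (rule comm_group.free_Abelian_group_universal[OF M.a_comm_group]) (rule that; simp)
 have "EX e. e : hom (pair_group (free_mod N) F) (add_monoid F)
 & (ALL f v. (f, v) : pairs --> e (frag_of (f, v)) = f j \<odot> v)"
 by (intro exI[of _ e] conjI e(1)) (simp add: e(2) del: free_mod_simps)
 note * = someI_ex[OF this, folded ecoord_def]
 show "ecoord j : hom (pair_group (free_mod N) F) (add_monoid F)" using * by (rule conjunct1)
 show "ecoord j (frag_of (f, v)) = f j \<odot> v" if "(f, v) : pairs" using * that by simp
qed

lemma ecoord_closed: "pkeys a <= pairs ==> ecoord j a : carrier F"
 using ecoord(1)[of j] by (auto simp: hom_def)

lemma ecoord_add: "pkeys a <= pairs ==> pkeys b <= pairs ==>
 ecoord j (a + b) = ecoord j a \<oplus> ecoord j b"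
 using ecoord(1)[of j] by (auto simp: hom_def)

lemma ecoord_0: "ecoord j 0 = \<zero>"
 using ecoord_add[of 0 0 j] ecoord_closed[of 0 j] by simp

lemma ecoord_diff: "pkeys a <= pairs ==> pkeys b <= pairs ==>
 ecoord j (a - b) = ecoord j a \<ominus> ecoord j b"
proof -
 assume *: "pkeys a <= pairs" "pkeys b <= pairs"
 then have d: "pkeys (a - b) <= pairs" using keys_diff[of a b] by blast
 have "ecoord j a = ecoord j (a - b) \<oplus> ecoord j b" using ecoord_add[OF d *(2), of j] by simp
 then show ?thesis
 using ecoord_closed[OF d] ecoord_closed[OF *(2)] by (simp add: a_minus_def M.a_assoc M.r_neg)
qed

lemma ecoord_sum:
 "finite S ==> (!!i. i : S ==> pkeys (f i) <= pairs) ==>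
 ecoord j (SUM i:S. f i) = (\<Oplus>i\<in>S. ecoord j (f i)) & pkeys (SUM i:S. f i) <= pairs"
proof (induction S rule: finite_induct)
 case empty
 then show ?case by (simp add: ecoord_0)
next
 case (insert x S)
 then have IH: "ecoord j (SUM i:S. f i) = (\<Oplus>i\<in>S. ecoord j (f i))" "pkeys (SUM i:S. f i) <= pairs"
 "pkeys (f x) <= pairs" by auto
 have "(\<Oplus>i\<in>insert x S. ecoord j (f i)) = ecoord j (f x) \<oplus> (\<Oplus>i\<in>S. ecoord j (f i))"
 using insert by (intro M.finsum_insert) (auto intro!: ecoord_closed simp del: free_mod_simps)
 moreover have "pkeys (f x + (SUM i:S. f i)) <= pairs" using IH keys_add[of "f x"] by blast
 ultimately show ?case using IH insert.hyps by (simp add: ecoord_add)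
qed

lemma ecoord_rel:
 assumes "a : tensor_rel Oring (free_mod N) F"
 shows "ecoord j a = \<zero>"
proof -
 have k1: "pkeys (frag_of x) <= pairs \<longleftrightarrow> x : pairs" for x :: "(nat => complex poly) \<times> 'f"
 by (simp add: keys_frag_of)
 have kd: "pkeys (a - b) <= pairs"
 if "pkeys a <= pairs" "pkeys b <= pairs" for a b :: "(nat => complex poly) \<times> 'f \<Rightarrow>\<^sub>0 int"
 using keys_diff[of a b] that by blast
 have zz: "u \<oplus> v \<ominus> u \<ominus> v = \<zero>" if "u : carrier F" "v : carrier F" for u v
 proof -
 have "u \<oplus> v \<ominus> u \<ominus> v = (u \<oplus> v) \<oplus> \<ominus> (u \<oplus> v)"
 using that by (simp add: a_minus_def M.a_assoc M.minus_add)
 then show ?thesis using that by (simp add: M.r_neg)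
 qed
 have "a : {a. ecoord j a = \<zero>}"
 proof (rule P.rel_kill[OF assms])
 show "a - b : {a. ecoord j a = \<zero>}" if "a : {a. ecoord j a = \<zero>}" "b : {a. ecoord j a = \<zero>}"
 "pkeys a <= pairs" "pkeys b <= pairs" for a b
 using that by (simp add: ecoord_diff M.r_neg a_minus_def)
 next
 fix u u' v assume *: "u : carrier (free_mod N)" "u' : carrier (free_mod N)" "v : carrier F"
 then have p: "(u \<oplus>\<^bsub>free_mod N\<^esub> u', v) : pairs" "(u, v) : pairs" "(u', v) : pairs" by auto
 have "ecoord j (frag_of (u \<oplus>\<^bsub>free_mod N\<^esub> u', v) - frag_of (u, v) - frag_of (u', v))
 = ecoord j (frag_of (u \<oplus>\<^bsub>free_mod N\<^esub> u', v)) \<ominus> ecoord j (frag_of (u, v)) \<ominus> ecoord j (frag_of (u', v))"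
 using p by (simp only: ecoord_diff kd k1)
 also have "... = \<zero>" using p zz[of "u j \<odot> v" "u' j \<odot> v"] * by (simp only: ecoord(2)) (simp add: tsmult_l_distr)
 finally show "frag_of (u \<oplus>\<^bsub>free_mod N\<^esub> u', v) - frag_of (u, v) - frag_of (u', v) : {a. ecoord j a = \<zero>}" by simp
 next
 fix u v v' assume *: "u : carrier (free_mod N)" "v : carrier F" "v' : carrier F"
 then have p: "(u, v \<oplus> v') : pairs" "(u, v) : pairs" "(u, v') : pairs" by auto
 have "ecoord j (frag_of (u, v \<oplus> v') - frag_of (u, v) - frag_of (u, v'))
 = ecoord j (frag_of (u, v \<oplus> v')) \<ominus> ecoord j (frag_of (u, v)) \<ominus> ecoord j (frag_of (u, v'))"
 using p by (simp only: ecoord_diff kd k1)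
 also have "... = \<zero>" using p zz[of "u j \<odot> v" "u j \<odot> v'"] * by (simp only: ecoord(2)) (simp add: tsmult_r_distr)
 finally show "frag_of (u, v \<oplus> v') - frag_of (u, v) - frag_of (u, v') : {a. ecoord j a = \<zero>}" by simp
 next
 fix r u v assume *: "u : carrier (free_mod N)" "v : carrier F"
 then have p: "(r \<odot>\<^bsub>free_mod N\<^esub> u, v) : pairs" "(u, r \<odot> v) : pairs" by auto
 have "ecoord j (frag_of (r \<odot>\<^bsub>free_mod N\<^esub> u, v) - frag_of (u, r \<odot> v))
 = ecoord j (frag_of (r \<odot>\<^bsub>free_mod N\<^esub> u, v)) \<ominus> ecoord j (frag_of (u, r \<odot> v))"
 using p by (simp only: ecoord_diff kd k1)
 also have "... = \<zero>" using p * by (simp only: ecoord(2)) (simp add: tsmult_assoc mult.commute a_minus_def M.r_neg)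
 finally show "frag_of (r \<odot>\<^bsub>free_mod N\<^esub> u, v) - frag_of (u, r \<odot> v) : {a. ecoord j a = \<zero>}" by simp
 qed (simp add: ecoord_0)
 then show ?thesis by simp
qed

lemma ecoord_expand:
 assumes "pkeys a <= pairs"
 shows "a - (\<Sum>j<N. frag_of (delta j, ecoord j a)) : tensor_rel Oring (free_mod N) F"
proof -
 have dl: "delta j : carrier (free_mod N)" if "j < N" for j :: nat using that by auto
 show ?thesis
 proof (rule free_Abelian_group_induct[OF assms])
 have "frag_of (delta j, \<zero>) : tensor_rel Oring (free_mod N) F" if "j < N" for j :: nat
 using P.rel_add_right[OF dl[OF that], of \<zero> \<zero>] P.rel_uminus[of "- frag_of (delta j, \<zero>)"] by simp
 then show "0 - (\<Sum>j<N. frag_of (delta j, ecoord j 0)) : tensor_rel Oring (free_mod N) F"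
 unfolding ecoord_0 diff_0 by (intro P.rel_uminus P.rel_sum) simp
 next
 fix a b assume k: "pkeys a <= pairs" "pkeys b <= pairs"
 and IH: "a - (\<Sum>j<N. frag_of (delta j, ecoord j a)) : tensor_rel Oring (free_mod N) F"
 "b - (\<Sum>j<N. frag_of (delta j, ecoord j b)) : tensor_rel Oring (free_mod N) F"
 have "(\<Sum>j<N. frag_of (delta j, ecoord j (a - b) \<oplus> ecoord j b) - frag_of (delta j, ecoord j (a - b))
 - frag_of (delta j, ecoord j b)) : tensor_rel Oring (free_mod N) F"
 using k by (intro P.rel_sum P.rel_add_right dl ecoord_closed) (use keys_diff[of a b] in auto)
 moreover have "ecoord j (a - b) \<oplus> ecoord j b = ecoord j a" for j
 proof -
 have "pkeys (a - b) <= pairs" using k keys_diff[of a b] by blast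
 then show ?thesis using ecoord_add[of "a - b" b j] k by simp
 qed
 ultimately have "(\<Sum>j<N. frag_of (delta j, ecoord j a) - frag_of (delta j, ecoord j (a - b))
 - frag_of (delta j, ecoord j b)) : tensor_rel Oring (free_mod N) F" by simp
 from P.rel_add[OF P.rel_diff[OF IH] this]
 show "a - b - (\<Sum>j<N. frag_of (delta j, ecoord j (a - b))) : tensor_rel Oring (free_mod N) F"
 by (simp add: sum_subtractf sum.distrib algebra_simps)
 next
 fix p assume p: "p : pairs"
 then obtain f v where fv: "p = (f, v)" "f : carrier (free_mod N)" "v : carrier F" by blast
 \<comment> \<open>The pure tensor is built up one coordinate of \<open>f\<close> at a time: the
   truncation of \<open>f\<close> at \<open>n\<close> is compared with the first \<open>n\<close>
   terms.\<close>
 have part: "frag_of ((%i. if i < n then f i else 0), v) - (\<Sum>j<n. frag_of (delta j, f j \<odot> v))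
 : tensor_rel Oring (free_mod N) F" if "n <= N" for n
 using that
 proof (induction n)
 case 0
 have "frag_of (%i. 0, v) : tensor_rel Oring (free_mod N) F"
 using P.rel_add_left[of "%i. 0" "%i. 0" v] P.rel_uminus[of "- frag_of (%i. 0, v)"] fv(3) by simp
 then show ?case by simp
 next
 case (Suc n)
 let ?f = "%i. if i < n then f i else 0"
 let ?g = "%i. f n * delta n i"
 have c: "?f : carrier (free_mod N)" "?g : carrier (free_mod N)" using Suc.prems by auto
 have "?f \<oplus>\<^bsub>free_mod N\<^esub> ?g = (%i. if i < Suc n then f i else 0)" by (auto simp: fun_eq_iff less_Suc_eq)
 then have 1: "frag_of (%i. if i < Suc n then f i else 0, v) - frag_of (?f, v) - frag_of (?g, v) : tensor_rel Oring (free_mod N) F"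
 using P.rel_add_left[OF c fv(3)] by simp
 have 2: "frag_of (?g, v) - frag_of (delta n, f n \<odot> v) : tensor_rel Oring (free_mod N) F"
 using P.rel_smult[of "f n" "delta n" v] dl[of n] Suc.prems fv(3) by simp
 have 3: "frag_of (?f, v) - (\<Sum>j<n. frag_of (delta j, f j \<odot> v)) : tensor_rel Oring (free_mod N) F"
 using Suc by simp
 from P.rel_add[OF P.rel_add[OF 1 2] 3] show ?case by (simp add: algebra_simps)
 qed
 have "(%i. if i < N then f i else 0) = f" using fv(2) by (auto simp: fun_eq_iff not_le[symmetric])
 then show "frag_of p - (\<Sum>j<N. frag_of (delta j, ecoord j (frag_of p))) : tensor_rel Oring (free_mod N) F"
 using part[of N] p fv ecoord(2)[of f v] by simp
 qed
qed

lemma class_eqI: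
 assumes "pkeys a <= pairs" "pkeys b <= pairs"
 "!!j. j < N ==> ecoord j a = ecoord j b"
 shows "clsF a = clsF b"
proof -
 have "(a - (\<Sum>j<N. frag_of (delta j, ecoord j a))) - (b - (\<Sum>j<N. frag_of (delta j, ecoord j b)))
 : tensor_rel Oring (free_mod N) F"
 by (rule P.rel_diff) (rule ecoord_expand, fact)+
 moreover have "(\<Sum>j<N. frag_of (delta j, ecoord j a)) = (\<Sum>j<N. frag_of (delta j :: nat => complex poly, ecoord j b))"
 by (rule sum.cong) (use assms(3) in auto)
 ultimately show ?thesis unfolding P.class_eq_iff by simp
qed

lemma smult_tensor:
 fixes r :: "complex poly"
 assumes a: "pkeys a <= pairs"
 defines "a' \<equiv> frag_extend (%(u, v). frag_of (r \<odot>\<^bsub>free_mod N\<^esub> u, v)) a"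
 shows "r \<odot>\<^bsub>tensor Oring (free_mod N) F\<^esub> clsF a = clsF a'"
 and "pkeys a' <= pairs"
 and "ecoord j a' = r \<odot> ecoord j a"
proof -
 let ?e = "frag_extend (%(u, v). frag_of (r \<odot>\<^bsub>free_mod N\<^esub> u, v))"
 have bal: "frag_of (r \<odot>\<^bsub>free_mod N\<^esub> (r' \<odot>\<^bsub>free_mod N\<^esub> u), v) - frag_of (r \<odot>\<^bsub>free_mod N\<^esub> u, r' \<odot> v) : tensor_rel Oring (free_mod N) F"
 if "u : carrier (free_mod N)" "v : carrier F" for r' u v
 using P.rel_smult[of r' "r \<odot>\<^bsub>free_mod N\<^esub> u" v] that by (simp add: algebra_simps)
 note tm = tensor_map_class[OF P.tensor_pair_axioms P.tensor_pair_axioms,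
 of "%u. r \<odot>\<^bsub>free_mod N\<^esub> u" "%v. v" a]
 have "r \<odot>\<^bsub>tensor Oring (free_mod N) F\<^esub> clsF a
 = tensor_map Oring (free_mod N) F (%u. r \<odot>\<^bsub>free_mod N\<^esub> u) (%v. v) (clsF a)"
 by (simp only: tensor_def module.select_convs)
 also have "... = clsF (?e a)"
 by (rule tm(1)) (use bal a in \<open>auto simp: algebra_simps\<close>)
 finally show "r \<odot>\<^bsub>tensor Oring (free_mod N) F\<^esub> clsF a = clsF a'" unfolding a'_def .
 have k: "pkeys (?e a) <= pairs & ecoord j (?e a) = r \<odot> ecoord j a"
 proof (rule free_Abelian_group_induct[OF a, of "%a. pkeys (?e a) <= pairs & ecoord j (?e a) = r \<odot> ecoord j a"])
 fix a b assume *: "pkeys a <= pairs" "pkeys b <= pairs"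
 "pkeys (?e a) <= pairs & ecoord j (?e a) = r \<odot> ecoord j a"
 "pkeys (?e b) <= pairs & ecoord j (?e b) = r \<odot> ecoord j b"
 have "pkeys (?e a - ?e b) <= pairs" using *(3,4) keys_diff[of "?e a" "?e b"] by blast
 moreover have "ecoord j (?e a - ?e b) = r \<odot> ecoord j a \<ominus> r \<odot> ecoord j b"
 using *(3,4) by (simp add: ecoord_diff)
 moreover have "r \<odot> (ecoord j a \<ominus> ecoord j b) = r \<odot> ecoord j a \<ominus> r \<odot> ecoord j b"
 using ecoord_closed[OF *(1)] ecoord_closed[OF *(2)] tsmult_assoc[of "ecoord j b" r "-1"]
 by (simp add: a_minus_def tsmult_r_distr tsmult_m1[symmetric] tsmult_assoc)
 ultimately show "pkeys (?e (a - b)) <= pairs & ecoord j (?e (a - b)) = r \<odot> ecoord j (a - b)"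
 unfolding frag_extend_diff using *(1,2) by (simp add: ecoord_diff)
 next
 fix x assume "x : pairs"
 then obtain u v where x: "x = (u, v)" "u : carrier (free_mod N)" "v : carrier F" by blast
 then have p: "(r \<odot>\<^bsub>free_mod N\<^esub> u, v) : pairs" "(u, v) : pairs" by auto
 show "pkeys (?e (frag_of x)) <= pairs & ecoord j (?e (frag_of x)) = r \<odot> ecoord j (frag_of x)"
 unfolding x(1) frag_extend_of prod.case ecoord(2)[OF p(1)] ecoord(2)[OF p(2)]
 using p(1) x(3) by (simp add: keys_frag_of tsmult_assoc)
 qed (simp add: ecoord_0)
 show "pkeys a' <= pairs" "ecoord j a' = r \<odot> ecoord j a" using k by (auto simp: a'_def)
qed

lemma ecoord_class:
 assumes "pkeys a <= pairs" "pkeys b <= pairs" "clsF a = clsF b"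
 shows "ecoord j a = ecoord j b"
proof -
 have "ecoord j (a - b) = \<zero>" using assms(3) unfolding P.class_eq_iff by (rule ecoord_rel)
 then show ?thesis using assms diff_eq_0 ecoord_closed by (simp add: ecoord_diff)
qed

end

text \<open>Multiplication by \<open>q\<close> on the free module of rank one is injective, so
  flatness keeps it injective after tensoring with \<open>F\<close>. It sends the tensor of the
  generator with \<open>v\<close> to a tensor with coordinate \<open>q\<close> times
  \<open>v\<close>, which is zero.\<close>

lemma flat_torsion_free:
 assumes "flat F" "v : carrier F" "q \<odot>\<^bsub>F\<^esub> v = \<zero>\<^bsub>F\<^esub>" "q ~= 0"
 shows "v = \<zero>\<^bsub>F\<^esub>"
proof -
 interpret free_tensor F 1
 using assms(1) by (intro free_tensor.intro tmod.intro) (simp add: flat_def)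
 define f where "f = (%(u :: nat => complex poly) i. q * u i)"
 have lin: "linear_map Oring (free_mod 1) (free_mod 1) f"
 unfolding linear_map_def f_def by (auto simp: algebra_simps)
 have "inj_on f (carrier (free_mod 1))"
 by (rule inj_onI) (use assms(4) in \<open>auto simp: f_def fun_eq_iff\<close>)
 then have inj: "inj_on (tensor_map Oring (free_mod 1) F f (%v. v)) (carrier (tensor Oring (free_mod 1) F))"
 using assms(1) lin module_free_mod unfolding flat_def by blast
 have d: "(delta 0, v) : pairs" "(f (delta 0), v) : pairs" using assms(2) by (auto simp: f_def)
 have tm: "tensor_map Oring (free_mod 1) F f (%v. v) (clsF a) = clsF (frag_extend (%(u, v). frag_of (f u, v)) a)"
 if "pkeys a <= pairs" for a
 proof (rule tensor_map_class(1)[OF P.tensor_pair_axioms P.tensor_pair_axioms _ _ _ _ _ that])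
 fix r u v assume "u : carrier (free_mod 1)" "v : carrier F"
 then have "frag_of (r \<odot>\<^bsub>free_mod 1\<^esub> f u, v) - frag_of (f u, r \<odot>\<^bsub>F\<^esub> v) : tensor_rel Oring (free_mod 1) F"
 by (intro P.rel_smult) (auto simp: f_def)
 moreover have "r \<odot>\<^bsub>free_mod 1\<^esub> f u = f (r \<odot>\<^bsub>free_mod 1\<^esub> u)" by (auto simp: f_def algebra_simps)
 ultimately show "frag_of (f (r \<odot>\<^bsub>free_mod 1\<^esub> u), v) - frag_of (f u, r \<odot>\<^bsub>F\<^esub> v) : tensor_rel Oring (free_mod 1) F"
 by simp
 qed (auto simp: f_def algebra_simps)
 have k: "pkeys (frag_of (delta 0, v)) <= pairs" "pkeys (frag_of (f (delta 0), v)) <= pairs"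
 using d by (simp_all add: keys_frag_of del: free_mod_simps)
 have "tensor_map Oring (free_mod 1) F f (%v. v) (clsF (frag_of (delta 0, v))) = clsF (frag_of (f (delta 0), v))"
 unfolding tm[OF k(1)] by simp
 also have "... = clsF 0"
 by (rule class_eqI[OF k(2)], simp, unfold ecoord_0 ecoord(2)[OF d(2)]) (use assms(3) in \<open>simp add: f_def\<close>)
 also have "... = tensor_map Oring (free_mod 1) F f (%v. v) (clsF 0)"
 using tm[of 0] by simp
 finally have "clsF (frag_of (delta 0, v)) = clsF 0"
 by (rule inj_onD[OF inj]) (rule P.class_in_tensor[OF k(1)], rule P.class_in_tensor, simp)
 then have "ecoord 0 (frag_of (delta 0, v)) = ecoord 0 0" using k(1) by (intro ecoord_class) auto
 then have "ecoord 0 (frag_of (delta 0, v)) = \<zero>\<^bsub>F\<^esub>" unfolding ecoord_0 .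
 then show ?thesis using ecoord(2)[OF d(1), of 0] assms(2) by (simp add: ecoord_0)
qed

section \<open>A basis adapted to the isotypic decomposition\<close>

locale fam_rep =
 fixes K :: "(complex^'n^'n) set" and F :: "(complex poly, 'f) module" (structure)
 and rh :: "complex^'n^'n => 'f => 'f"
 assumes alg_group: "algebraic_group K" and fam: "family_rep K F rh" and flat: "flat F"
begin

sublocale F: tmod F using fam by (intro tmod.intro) (simp add: family_rep_def)

abbreviation "V \<equiv> as_complex F"

sublocale V: arep K V rh using alg_group fam by (intro arep.intro) (simp_all add: family_rep_def)

lemma rho_osmult: "k : K ==> v : carrier F ==> rh k (q \<odot> v) = q \<odot> rh k v"
 using fam unfolding family_rep_def linear_map_def by auto

lemma torsion_free: "v : carrier F ==> q \<odot> v = \<zero> ==> q = 0 | v = \<zero>"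
 using flat_torsion_free[OF flat] by blast

lemma submod_complex: "submod F U ==> submod V U"
 by (rule V.submodI) (use F.submodD in \<open>auto simp: subset_iff\<close>)

text \<open>Multiplication by a nonzero polynomial commutes with \<open>K\<close> and is injective
  because \<open>F\<close> is torsion-free, hence it maps \<open>W\<close> onto a copy of
  itself.\<close>

lemma irr_osmult:
 assumes W: "V.irr W" and q: "q ~= 0"
 shows "V.irr ((%w. q \<odot> w) ` W)" "V.iso_rep W ((%w. q \<odot> w) ` W)"
proof -
 let ?g = "%w. q \<odot> w"
 note Ws = V.irrD(1)[OF W]
 note WD = V.submodD[OF V.srepD(1)[OF Ws], simplified]
 have Wc [simp]: "w : carrier F" if "w : W" for w using WD(1) that by blast
 have g_add: "?g (u \<oplus> v) = ?g u \<oplus> ?g v" if "u : W" "v : W" for u v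
 using that by (simp add: F.tsmult_r_distr)
 have g_sm: "?g ([:c:] \<odot> u) = [:c:] \<odot> ?g u" if "u : W" for u c
 using that by (simp add: F.tsmult_assoc mult.commute)
 have g_k: "?g (rh k u) = rh k (?g u)" if "u : W" "k : K" for u k
 using that by (simp add: rho_osmult)
 have inj: "inj_on ?g W"
 proof (rule inj_onI)
 fix u v assume uv: "u : W" "v : W" "?g u = ?g v"
 have "?g (u \<oplus> [:-1:] \<odot> v) = ?g u \<oplus> [:-1:] \<odot> ?g v"
 using uv WD(4)[of v "-1"] by (simp add: g_add g_sm)
 also have "... = (1 + [:-1:]) \<odot> ?g v"
 unfolding F.tsmult_l_distr[OF F.tsmult_closed[OF Wc[OF uv(2)]]] using uv by simp
 also have "... = \<zero>" using uv by (simp add: one_pCons)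
 finally have "u \<oplus> [:-1:] \<odot> v = \<zero>" using torsion_free[of "u \<oplus> [:-1:] \<odot> v" q] uv q by simp
 moreover have "[:-1:] \<odot> v = \<ominus> v" using F.tsmult_m1[of v] uv by (simp add: one_pCons)
 ultimately show "u = v" using F.diff_eq_0[of u v] uv by (simp add: a_minus_def)
 qed
 have sub: "V.srep (?g ` U)" if U: "V.srep U" "U <= W" for U
 proof (intro V.srepI V.submodI)
 note UD = V.submodD[OF V.srepD(1)[OF U(1)], simplified]
 have UW: "u : W" if "u : U" for u using U(2) that by blast
 show "?g ` U <= carrier V" using UW by auto
 have "?g \<zero> : ?g ` U" using UD(2) by blast
 then show "\<zero>\<^bsub>V\<^esub> : ?g ` U" by simp
 show "u \<oplus>\<^bsub>V\<^esub> v : ?g ` U" if "u : ?g ` U" "v : ?g ` U" for u v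
 using that UD(3) UW by (auto simp flip: g_add)
 show "c \<odot>\<^bsub>V\<^esub> u : ?g ` U" if "u : ?g ` U" for c u
 using that UD(4) UW by (auto simp flip: g_sm)
 show "rh k u : ?g ` U" if "u : ?g ` U" "k : K" for k u
 using that V.srepD(2)[OF U(1)] UW by (auto simp flip: g_k)
 qed
 show "V.irr (?g ` W)"
 unfolding irreducible_subrep_def
 proof (intro conjI allI impI)
 show "V.srep (?g ` W)" by (rule sub[OF Ws order_refl])
 obtain w where "w : W" "w ~= \<zero>" using V.irr_nonzero[OF W] by auto
 then show "?g ` W ~= {\<zero>\<^bsub>V\<^esub>}" using torsion_free[of w q] q by auto
 fix U assume U: "V.srep U & U <= ?g ` W"
 note UD = V.submodD[OF V.srepD(1)[OF conjunct1[OF U]], simplified]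
 define U' where "U' = {w : W. ?g w : U}"
 have "V.srep U'"
 proof (intro V.srepI V.submodI)
 show "U' <= carrier V" by (auto simp: U'_def)
 show "\<zero>\<^bsub>V\<^esub> : U'" using WD(2) UD(2) by (simp add: U'_def)
 show "u \<oplus>\<^bsub>V\<^esub> v : U'" if "u : U'" "v : U'" for u v
 using that UD(3) WD(3) g_add[of u v] by (simp add: U'_def)
 show "c \<odot>\<^bsub>V\<^esub> u : U'" if "u : U'" for c u
 using that UD(4) WD(4) g_sm[of u c] by (simp add: U'_def)
 show "rh k u : U'" if "u : U'" "k : K" for k u
 using that V.srepD(2)[OF conjunct1[OF U]] V.srepD(2)[OF Ws] g_k[of u k] by (simp add: U'_def)
 qed
 then have "U' = {\<zero>\<^bsub>V\<^esub>} | U' = W" using V.irrD(3)[OF W, of U'] by (auto simp: U'_def)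
 moreover have "U = ?g ` U'" using U by (auto simp: U'_def)
 ultimately show "U = {\<zero>\<^bsub>V\<^esub>} | U = ?g ` W" by auto
 qed
 show "V.iso_rep W (?g ` W)"
 unfolding isomorphic_subreps_def
 proof (intro exI[of _ ?g] conjI ballI)
 show "bij_betw ?g W (?g ` W)" using inj by (simp add: bij_betw_def)
 show "linear_map Cfield (V\<lparr>carrier := W\<rparr>) (V\<lparr>carrier := ?g ` W\<rparr>) ?g"
 unfolding linear_map_def by (auto simp: g_add g_sm)
 qed (simp add: g_k)
qed

text \<open>The component is defined over the complex numbers only. It is stable under polynomials
  because these permute the irreducibles of a given type up to isomorphism, or kill them.\<close>

lemma isotyp_osubmod:
 assumes W: "V.irr W" shows "submod F (V.isotyp W)"
proof -
 note D = V.submodD[OF V.srepD(1)[OF V.isotyp_srep[of W]], simplified]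
 have "q \<odot> u : V.isotyp W" if u: "u : V.isotyp W" for q u
 proof -
 have "V.isotyp W <= {u : carrier F. q \<odot> u : V.isotyp W}"
 proof (subst V.isotyp_def, rule V.cspan_least)
 show "submod V {u : carrier F. q \<odot> u : V.isotyp W}"
 proof (rule V.submodI)
 show "c \<odot>\<^bsub>V\<^esub> u : {u : carrier F. q \<odot> u : V.isotyp W}"
 if "u : {u : carrier F. q \<odot> u : V.isotyp W}" for c u
 using that D(4)[of "q \<odot> u" c] by (simp add: F.tsmult_assoc mult.commute)
 qed (use D in \<open>auto simp: F.tsmult_r_distr\<close>)
 fix W' assume "W' : {W'. V.irr W' & V.iso_rep W W'}"
 then have W': "V.irr W'" "V.iso_rep W W'" by auto
 have c: "W' <= carrier F" using V.srep_sub[OF V.irrD(1)[OF W'(1)]] by simp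
 show "W' <= {u : carrier F. q \<odot> u : V.isotyp W}"
 proof (cases "q = 0")
 case True
 then show ?thesis using c D(2) by auto
 next
 case False
 have "(%w. q \<odot> w) ` W' <= V.isotyp W"
 using irr_osmult[OF W'(1) False] V.irr_isotyp[OF W] V.iso_trans[OF W'(2)] by blast
 then show ?thesis using c by auto
 qed
 qed
 then show ?thesis using u by blast
 qed
 then show ?thesis using D(1-3) by (intro F.submodI) auto
qed

end

lemma linear_map_complex:
 "linear_map Oring M M' f ==> linear_map Cfield (as_complex M) (as_complex M') f"
 unfolding linear_map_def by simp

lemma const_poly_sum: "[:SUM i:S. f i:] = (SUM i:S. [:f i:])"
proof (induction S rule: infinite_finite_induct)
 case (insert x S)
 have "[:f x + sum f S:] = [:f x:] + [:sum f S:]" by simp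
 then show ?case using insert by (simp del: add_pCons)
qed auto

lemma const_poly_mult: "[:a * b:] = [:a:] * [:b :: 'a :: comm_semiring_0:]"
 by (simp add: mult.commute)

lemma expansion_finite:
 fixes K :: "(complex^'n^'n) set" and V :: "(complex, 'v) module"
 assumes V: "Module.module Cfield V" and "finite P"
 "!!p. p : P ==> c p : regular_functions & m p : carrier V"
 "!!k. k : K ==> rh k v = (\<Oplus>\<^bsub>V\<^esub>p\<in>P. c p k \<odot>\<^bsub>V\<^esub> m p)"
 shows "EX N c m. expansion K V rh v N c m"
proof -
 interpret tmod V using V by (rule tmod.intro)
 obtain h where h: "bij_betw h {0..<card P} P" using ex_bij_betw_nat_finite[OF assms(2)] by blast
 then have hP: "P = h ` {..<card P}" "inj_on h {..<card P}" by (auto simp: bij_betw_def lessThan_atLeast0)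
 have "rh k v = (\<Oplus>\<^bsub>V\<^esub>i\<in>{..<card P}. c (h i) k \<odot>\<^bsub>V\<^esub> m (h i))" if "k : K" for k
 proof -
 have "(%p. c p k \<odot>\<^bsub>V\<^esub> m p) : h ` {..<card P} \<rightarrow> carrier V"
 using assms(3) hP(1) by (auto simp: Pi_iff)
 then have "(\<Oplus>\<^bsub>V\<^esub>p\<in>h ` {..<card P}. c p k \<odot>\<^bsub>V\<^esub> m p) = (\<Oplus>\<^bsub>V\<^esub>i\<in>{..<card P}. c (h i) k \<odot>\<^bsub>V\<^esub> m (h i))"
 using hP(2) by (rule M.finsum_reindex)
 then show ?thesis using assms(4)[OF that] hP(1) by simp
 qed
 moreover have "c (h i) : regular_functions & m (h i) : carrier V" if "i < card P" for i
 using assms(3)[of "h i"] hP(1) that by blast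
 ultimately have "expansion K V rh v (card P) (%i. c (h i)) (%i. m (h i))"
 unfolding expansion_def by blast
 then show ?thesis by blast
qed

context fam_rep
begin

lemma rho_finsum:
 assumes k: "k : K" and "finite P" "f : P \<rightarrow> carrier V"
 shows "rh k (\<Oplus>\<^bsub>V\<^esub>p\<in>P. f p) = (\<Oplus>\<^bsub>V\<^esub>p\<in>P. rh k (f p))"
 using assms(2,3)
proof (induction P)
 case empty
 then show ?case using V.rho_zero[OF k] by simp
next
 case (insert p P)
 then have f: "f : P \<rightarrow> carrier V" "f p : carrier V" by auto
 then have g: "(%p. rh k (f p)) : P \<rightarrow> carrier V" "rh k (f p) : carrier V"
 using V.rho_closed[OF k] by (simp_all add: Pi_iff)
 show ?case
 unfolding V.M.finsum_insert[OF insert.hyps f] V.M.finsum_insert[OF insert.hyps g]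
 V.rho_add[OF k f(2) V.M.finsum_closed[OF f(1)]] insert.IH[OF f(1)] ..
qed

text \<open>The invariants of (dual of \<open>W\<close>) tensor \<open>F\<close> are the equivariant
  maps from \<open>W\<close> to \<open>F\<close>. Quasi-admissibility gives finitely many generators
  of this module, and their coordinates span a submodule that contains the image of every such map,
  hence the whole component.\<close>

lemma isotyp_fg:
 assumes qa: "quasi_admissible K F rh" and W: "V.irr W"
 shows "EX G. finite G & G <= carrier F & V.isotyp W <= Sp F G"
proof -
 obtain B where B: "B <= W" "finite B" "indep V B" "W = Sp V B" using V.irr_basis[OF W] by blast
 define N where "N = card B"
 obtain b where "bij_betw b {0..<N} B" using ex_bij_betw_nat_finite[OF B(2)] N_def by blast
 then have b: "B = b ` {..<N}" "inj_on b {..<N}" by (auto simp: bij_betw_def lessThan_atLeast0)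
 note Ws = V.irrD(1)[OF W]
 note WD = V.submodD[OF V.srepD(1)[OF Ws]]
 have Bc: "B <= carrier V" using B(1) WD(1) by blast
 have bW: "b i : W" "b i : B" if "i < N" for i using that b B(1) by auto
 define co where "co u = (SOME c. u = LC V c B)" for u
 have co: "u = LC V (co u) B" if "u : W" for u
 proof -
 have "EX c. u = LC V c B" using that B(4) unfolding Sp_def by blast
 then show ?thesis unfolding co_def by (rule someI_ex)
 qed
 have co_eq: "co u x = c x" if "u : W" "u = LC V c B" "x : B" for u c x
 proof -
 have "LC V (%b. co u b - c b) B = \<zero>\<^bsub>V\<^esub>"
 unfolding V.LC_diff[OF B(2) Bc] using co[OF that(1)] that(2) V.LC_closed[OF B(2) Bc]
 by (metis V.M.minus_eq V.M.r_neg)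
 then show ?thesis using B(3) that(3) unfolding indep_def by fastforce
 qed
 have co_add: "co (u \<oplus>\<^bsub>V\<^esub> v) x = co u x + co v x" if "u : W" "v : W" "x : B" for u v x
 by (rule co_eq[OF WD(3)[OF that(1,2)] _ that(3)]) (use co that V.LC_add[OF B(2) Bc] in simp)
 have co_sm: "co (c \<odot>\<^bsub>V\<^esub> u) x = c * co u x" if "u : W" "x : B" for u c x
 by (rule co_eq[OF WD(4)[OF that(1)] _ that(2)]) (use co that V.LC_smult[OF B(2) Bc] in simp)
 have co_0: "co \<zero>\<^bsub>V\<^esub> x = 0" if "x : B" for x
 using co_sm[OF WD(2) that, of 0] by simp
 have co_sum: "co (\<Oplus>\<^bsub>V\<^esub>p\<in>P. f p) x = (SUM p:P. co (f p) x)"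
 if "finite P" "!!p. p : P ==> f p : W" "x : B" for P :: "nat set" and f x
 using that
 proof (induction P)
 case empty
 then show ?case using co_0 V.M.finsum_empty by simp
 next
 case (insert p P)
 have fP: "f : P \<rightarrow> carrier V" "f p : carrier V" using insert.prems(1) WD(1) by blast+
 have s: "(\<Oplus>\<^bsub>V\<^esub>p\<in>P. f p) : W" using insert by (intro V.submod_finsum V.srepD(1)[OF Ws]) auto
 have "(\<Oplus>\<^bsub>V\<^esub>p\<in>insert p P. f p) = f p \<oplus>\<^bsub>V\<^esub> (\<Oplus>\<^bsub>V\<^esub>p\<in>P. f p)"
 using insert fP by (intro V.M.finsum_insert) auto
 then show ?case using insert co_add[OF insert.prems(1) s] by simp
 qed
 have co_b: "co (b j) (b i) = (if i = j then 1 else 0)" if "i < N" "j < N" for i j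
 using co_eq[OF bW(1)[OF that(2)] V.LC_delta[OF B(2) Bc bW(2)[OF that(2)], symmetric] bW(2)[OF that(1)]]
 b(2) that by (auto simp: inj_on_def)
 have LC_b: "LC V c B = (\<Oplus>\<^bsub>V\<^esub>i\<in>{..<N}. c (b i) \<odot>\<^bsub>V\<^esub> b i)" for c
 proof -
 have "(%x. c x \<odot>\<^bsub>V\<^esub> x) : b ` {..<N} \<rightarrow> carrier V" using Bc b(1) V.tsmult_closed by blast
 then show ?thesis unfolding LC_def b(1) using b(2) by (rule V.M.finsum_reindex)
 qed
 \<comment> \<open>The matrix coefficients of \<open>W\<close> in the basis \<open>b\<close>. They
   agree on \<open>K\<close> with regular functions because the coaction of a vector of
   \<open>W\<close> can be written with vectors of \<open>W\<close>.\<close>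
 define C where "C i j k = co (rh k (b j)) (b i)" for i j k
 have C_reg: "EX c:regular_functions. ALL k:K. c k = C i j k" if ij: "i < N" "j < N" for i j
 proof -
 obtain N' c m where e: "expansion K V rh (b j) N' c m" "\<forall>l<N'. m l : W"
 using V.expansion_in_srep[OF Ws bW(1)[OF ij(2)]] by blast
 have "C i j k = (\<Sum>l<N'. co (m l) (b i) * c l k)" if "k : K" for k
 proof -
 have "rh k (b j) = (\<Oplus>\<^bsub>V\<^esub>l\<in>{..<N'}. c l k \<odot>\<^bsub>V\<^esub> m l)" using e(1) that unfolding expansion_def by blast
 then have "C i j k = (\<Sum>l<N'. co (c l k \<odot>\<^bsub>V\<^esub> m l) (b i))"
 unfolding C_def using e(2) WD(4) bW(2)[OF ij(1)] by (simp only:) (rule co_sum, auto)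
 also have "... = (\<Sum>l<N'. co (m l) (b i) * c l k)"
 by (rule sum.cong[OF refl], subst co_sm) (use e(2) bW(2)[OF ij(1)] in auto)
 finally show ?thesis .
 qed
 moreover have "(%k. \<Sum>l<N'. co (m l) (b i) * c l k) : regular_functions"
 using e(1) unfolding expansion_def by (intro regular_sum V.reg_smult) auto
 ultimately show ?thesis by (intro bexI) auto
 qed
 have C_rho: "rh k (b j) = (\<Oplus>\<^bsub>V\<^esub>i\<in>{..<N}. C i j k \<odot>\<^bsub>V\<^esub> b i)" if "k : K" "j < N" for k j
 using co[OF V.srepD(2)[OF Ws that(1) bW(1)[OF that(2)]]] unfolding LC_b C_def .
 have C_mult: "C i j (k ** l) = (\<Sum>p<N. C i p k * C p j l)" if kl: "k : K" "l : K" "i < N" "j < N" for i j k l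
 proof -
 have bc: "b p : carrier V" if "p < N" for p using bW(1)[OF that] WD(1) by blast
 have fc: "(%p. C p j l \<odot>\<^bsub>V\<^esub> b p) : {..<N} \<rightarrow> carrier V" using bc by (intro Pi_I V.tsmult_closed) simp
 note rs = rho_finsum[OF kl(1)]
 have "rh (k ** l) (b j) = rh k (rh l (b j))" using V.rho_mult kl(1,2) bc[OF kl(4)] by blast
 also have "... = (\<Oplus>\<^bsub>V\<^esub>p\<in>{..<N}. rh k (C p j l \<odot>\<^bsub>V\<^esub> b p))"
 unfolding C_rho[OF kl(2,4)] by (rule rs[OF _ fc]) simp
 also have "... = (\<Oplus>\<^bsub>V\<^esub>p\<in>{..<N}. C p j l \<odot>\<^bsub>V\<^esub> rh k (b p))"
 by (rule V.M.finsum_cong') (use V.rho_smult[OF kl(1)] V.rho_closed[OF kl(1)] bc in \<open>auto intro!: V.tsmult_closed simp del: restrict_scalars_simps\<close>)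
 finally have "C i j (k ** l) = (\<Sum>p<N. co (C p j l \<odot>\<^bsub>V\<^esub> rh k (b p)) (b i))"
 unfolding C_def[of i j] using bW kl WD(4) V.srepD(2)[OF Ws] by (simp only:) (rule co_sum, auto)
 also have "... = (\<Sum>p<N. C i p k * C p j l)"
 proof (rule sum.cong[OF refl])
 fix p assume "p : {..<N}"
 then have "rh k (b p) : W" using V.srepD(2)[OF Ws kl(1)] bW by auto
 then show "co (C p j l \<odot>\<^bsub>V\<^esub> rh k (b p)) (b i) = C i p k * C p j l"
 using co_sm bW(2)[OF kl(3)] by (simp add: C_def[of i p])
 qed
 finally show ?thesis .
 qed
 have C_1: "C i j (mat 1) = (if i = j then 1 else 0)" if "i < N" "j < N" for i j
 using co_b[OF that] V.rho_1[of "b j"] bW(1)[OF that(2)] WD(1) unfolding C_def by auto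
 \<comment> \<open>The contragredient of \<open>W\<close>, extended linearly to polynomials: its
   matrix is the transpose of the matrix of the inverse, whence the swapped indices.\<close>
 define \<mu> :: "complex^'n^'n => (nat => complex poly) => nat => complex poly" where
 "\<mu> k f i = (if i < N then \<Sum>j<N. [:C j i (matrix_inv k):] * f j else 0)" for k f i
 have inv_mult: "matrix_inv (k ** l) = matrix_inv l ** matrix_inv k" if "k : K" "l : K" for k l
 proof -
 have "matrix_inv l ** matrix_inv k ** (k ** l) = matrix_inv l ** (matrix_inv k ** k) ** l"
 by (simp add: matrix_mul_assoc)
 then have "matrix_inv l ** matrix_inv k ** (k ** l) = mat 1" using V.matrix_inv_K that by simp
 then show ?thesis
 using V.matrix_inv_K(2)[OF V.mult_K[OF that]] by (metis matrix_mul_assoc matrix_mul_lid matrix_mul_rid)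
 qed
 have mod_free: "Module.module Cfield (as_complex (free_mod N))"
 proof -
 have "abelian_group (as_complex (free_mod N))"
 proof (rule abelian_groupI)
 fix f assume "f : carrier (as_complex (free_mod N))"
 then show "EX g:carrier (as_complex (free_mod N)). g \<oplus>\<^bsub>as_complex (free_mod N)\<^esub> f = \<zero>\<^bsub>as_complex (free_mod N)\<^esub>"
 by (intro bexI[of _ "%i. - f i"]) auto
 qed (auto simp: algebra_simps)
 then show ?thesis by (intro moduleI) (auto simp: algebra_simps smult_add_left smult_add_right)
 qed
 have \<mu>_lin: "linear_map Oring (free_mod N) (free_mod N) (\<mu> k)" for k
 unfolding linear_map_def
 by (auto simp: \<mu>_def fun_eq_iff sum_distrib_left sum.distrib smult_add_right mult.left_commute)
 have \<mu>_comp: "\<mu> (k ** l) f = \<mu> k (\<mu> l f)" if kl: "k : K" "l : K" for k l f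
 proof
 fix i
 show "\<mu> (k ** l) f i = \<mu> k (\<mu> l f) i"
 proof (cases "i < N")
 case True
 have "\<mu> k (\<mu> l f) i = (\<Sum>p<N. \<Sum>j<N. [:C p i (matrix_inv k):] * ([:C j p (matrix_inv l):] * f j))"
 using True by (simp add: \<mu>_def sum_distrib_left del: mult_pCons_left)
 also have "... = (\<Sum>j<N. \<Sum>p<N. [:C p i (matrix_inv k):] * ([:C j p (matrix_inv l):] * f j))"
 by (rule sum.swap)
 also have "... = (\<Sum>j<N. [:\<Sum>p<N. C j p (matrix_inv l) * C p i (matrix_inv k):] * f j)"
 by (rule sum.cong[OF refl]) (simp only: const_poly_sum const_poly_mult sum_distrib_right sum_distrib_left mult.commute mult.left_commute mult.assoc)
 also have "... = (\<Sum>j<N. [:C j i (matrix_inv (k ** l)):] * f j)"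
 using True kl V.inv_K by (intro sum.cong[OF refl]) (simp add: inv_mult C_mult)
 finally show ?thesis using True by (simp add: \<mu>_def)
 qed (simp add: \<mu>_def)
 qed
 have C_inv_reg: "EX c:regular_functions. ALL k:K. c k = C i j (matrix_inv k)" if ij: "i < N" "j < N" for i j
 proof -
 obtain c where c: "c : regular_functions" "ALL k:K. c k = C i j k" using C_reg[OF ij] by blast
 obtain c' where "c' : regular_functions" "ALL k. invertible k --> c' k = c (matrix_inv k)"
 using regular_inv[OF c(1)] by blast
 then show ?thesis using c(2) V.inv_K V.invertible_K by (intro bexI[of _ c']) auto
 qed
 have fam\<mu>: "family_rep K (free_mod N) \<mu>"
 unfolding family_rep_def algebraic_rep_def
 proof (intro conjI ballI module_free_mod mod_free \<mu>_lin)
 fix k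
 show "linear_map Cfield (as_complex (free_mod N)) (as_complex (free_mod N)) (\<mu> k)"
 by (rule linear_map_complex[OF \<mu>_lin])
 next
 fix f assume f: "f : carrier (as_complex (free_mod N))"
 have "matrix_inv (mat 1 :: complex^'n^'n) = mat 1" using V.matrix_inv_K(2)[OF V.one_K] by simp
 moreover have "(\<Sum>j<N. [:C j i (mat 1):] * f j) = (\<Sum>j<N. if j = i then f j else 0)" if "i < N" for i
 using that by (intro sum.cong refl) (auto simp: C_1)
 ultimately show "\<mu> (mat 1) f = f"
 using f by (auto simp: \<mu>_def fun_eq_iff simp del: mult_pCons_left)
 obtain c where c: "!!i j. i < N ==> j < N ==> c i j : regular_functions & (ALL k:K. c i j k = C i j (matrix_inv k))"
 using C_inv_reg by metis
 show "EX N' c m. expansion K (as_complex (free_mod N)) \<mu> f N' c m"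
 proof (rule expansion_finite[OF mod_free, of "{..<N} \<times> {..<N}"])
 show "(case p of (i, j) => c j i) : regular_functions
 & (case p of (i, j) => %l. f j * delta i l) : carrier (as_complex (free_mod N))"
 if "p : {..<N} \<times> {..<N}" for p
 using that c by auto
 fix k assume k: "k : K"
 have "(\<Oplus>\<^bsub>as_complex (free_mod N)\<^esub>p\<in>{..<N} \<times> {..<N}. (case p of (i, j) => c j i) k
 \<odot>\<^bsub>as_complex (free_mod N)\<^esub> (case p of (i, j) => %l. f j * delta i l))
 = (%l. SUM p:{..<N} \<times> {..<N}. ((case p of (i, j) => c j i) k \<odot>\<^bsub>as_complex (free_mod N)\<^esub> (case p of (i, j) => %l. f j * delta i l)) l)"
 unfolding finsum_restrict by (rule finsum_free_mod) auto
 also have "... = (%l. \<Sum>i<N. \<Sum>j<N. if l = i then [:c j i k:] * f j else 0)"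
 by (rule ext, unfold sum.cartesian_product, intro sum.cong refl) auto
 also have "... = \<mu> k f"
 proof
 fix l
 have "(\<Sum>i<N. \<Sum>j<N. if l = i then [:c j i k:] * f j else 0) = (\<Sum>i<N. if l = i then \<Sum>j<N. [:c j i k:] * f j else 0)"
 by (intro sum.cong refl) auto
 also have "... = \<mu> k f l" using c k by (auto simp: \<mu>_def)
 finally show "(\<Sum>i<N. \<Sum>j<N. if l = i then [:c j i k:] * f j else 0) = \<mu> k f l" .
 qed
 finally show "\<mu> k f = (\<Oplus>\<^bsub>as_complex (free_mod N)\<^esub>p\<in>{..<N} \<times> {..<N}. (case p of (i, j) => c j i) k
 \<odot>\<^bsub>as_complex (free_mod N)\<^esub> (case p of (i, j) => %l. f j * delta i l))" ..
 qed simp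
 qed (auto simp: \<mu>_comp)
 interpret T: free_tensor F N by (intro free_tensor.intro F.tmod_axioms)
 define act where "act k = tensor_map Oring (free_mod N) F (\<mu> k) (rh k)" for k
 define I where "I = invariants K (tensor Oring (free_mod N) F) act"
 have I: "Module.module Oring I" "fin_gen Oring I"
 using qa fam\<mu> locally_free_free_mod fin_gen_free_mod
 unfolding quasi_admissible_def I_def act_def locally_free_def Let_def by blast+
 interpret I: tmod I using I(1) by (rule tmod.intro)
 obtain S where S: "S <= carrier I" "finite S"
 "ALL v:carrier I. EX c:S \<rightarrow> carrier Oring. v = (\<Oplus>\<^bsub>I\<^esub>s\<in>S. c s \<odot>\<^bsub>I\<^esub> s)"
 using I(2) unfolding fin_gen_def by blast
 define E where "E j t = T.ecoord j (SOME a. a : t)" for j t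
 have IT: "t : carrier (tensor Oring (free_mod N) F)" if "t : carrier I" for t
 using that by (simp add: I_def invariants_def)
 have E_class: "E j (T.clsF a) = T.ecoord j a" if "pkeys a <= T.pairs" for j a
 proof -
 have m: "(SOME x. x : T.clsF a) : T.clsF a" by (rule someI[of _ a]) simp
 note * = T.P.mem_tensor_keys[OF T.P.class_in_tensor[OF that] m]
 show ?thesis unfolding E_def by (rule T.ecoord_class[OF *(1) that]) (simp add: *(2)[symmetric])
 qed
 have act_class: "act k (T.clsF a) = T.clsF (frag_extend (%(u, v). frag_of (\<mu> k u, rh k v)) a)"
 "pkeys (frag_extend (%(u, v). frag_of (\<mu> k u, rh k v)) a) <= T.pairs"
 if k: "k : K" and a: "pkeys a <= T.pairs" for k a
 proof -
 have \<mu>1: "\<mu> k u : carrier (free_mod N)" for u by (simp add: \<mu>_def)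
 have \<mu>2: "\<mu> k (r \<odot>\<^bsub>free_mod N\<^esub> u) = r \<odot>\<^bsub>free_mod N\<^esub> \<mu> k u"
 "\<mu> k (u \<oplus>\<^bsub>free_mod N\<^esub> v) = \<mu> k u \<oplus>\<^bsub>free_mod N\<^esub> \<mu> k v"
 if "u : carrier (free_mod N)" "v : carrier (free_mod N)" for r u v
 using \<mu>_lin[of k] that unfolding linear_map_def by auto
 have bal: "frag_of (\<mu> k (r \<odot>\<^bsub>free_mod N\<^esub> u), rh k v) - frag_of (\<mu> k u, rh k (r \<odot> v)) : tensor_rel Oring (free_mod N) F"
 if "u : carrier (free_mod N)" "v : carrier F" for r u v
 unfolding \<mu>2(1)[OF that(1) that(1)] rho_osmult[OF k that(2)]
 by (rule T.P.rel_smult) (use \<mu>1 V.rho_closed[OF k] that in simp_all)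
 note tm = tensor_map_class[OF T.P.tensor_pair_axioms T.P.tensor_pair_axioms, of "\<mu> k" "rh k" a]
 show "act k (T.clsF a) = T.clsF (frag_extend (%(u, v). frag_of (\<mu> k u, rh k v)) a)"
 unfolding act_def
 by (rule tm(1)) (use \<mu>1 \<mu>2(2) V.rho_closed[OF k] V.rho_add[OF k] bal a in \<open>simp_all del: free_mod_simps\<close>)
 show "pkeys (frag_extend (%(u, v). frag_of (\<mu> k u, rh k v)) a) <= T.pairs"
 by (rule tm(2)) (use \<mu>1 \<mu>2(2) V.rho_closed[OF k] V.rho_add[OF k] bal a in \<open>simp_all del: free_mod_simps\<close>)
 qed
 \<comment> \<open>All \<open>F\<close>-valued coordinates of the finitely many generators of the
   invariants.\<close>
 define G where "G = (%(s, j). E j s) ` (S \<times> {..<N})"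
 have E_closed: "E j t : carrier F" if tI: "t : carrier I" for j t
 proof -
 obtain a where "t = T.clsF a" "pkeys a <= T.pairs"
 using IT[OF tI] unfolding T.P.carrier_tensor by blast
 then show ?thesis using E_class T.ecoord_closed by simp
 qed
 have G: "finite G" "G <= carrier F" using S E_closed by (auto simp: G_def)
 note GD = F.submodD[OF F.submod_Sp[OF G]]
 \<comment> \<open>The invariants with all coordinates in the span of \<open>G\<close> form a
   submodule containing the generators, so they are all invariants.\<close>
 define Z where "Z = {t : carrier I. \<forall>j<N. E j t : Sp F G}"
 have Isimps: "add I = add (tensor Oring (free_mod N) F)" "smult I = smult (tensor Oring (free_mod N) F)"
 "\<zero>\<^bsub>I\<^esub> = \<zero>\<^bsub>tensor Oring (free_mod N) F\<^esub>" by (simp_all add: I_def invariants_def)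
 have "submod I Z"
 proof (rule I.submodI)
 show "Z <= carrier I" by (auto simp: Z_def)
 have "E j \<zero>\<^bsub>I\<^esub> = \<zero>" for j unfolding Isimps T.P.zero_tensor by (simp add: E_class T.ecoord_0)
 then show "\<zero>\<^bsub>I\<^esub> : Z" using I.M.zero_closed GD(2) by (simp add: Z_def)
 fix s t assume st: "s : Z" "t : Z"
 then have c: "s : carrier I" "t : carrier I" by (auto simp: Z_def)
 then obtain a d where a: "s = T.clsF a" "pkeys a <= T.pairs"
 and d: "t = T.clsF d" "pkeys d <= T.pairs"
 using IT unfolding T.P.carrier_tensor by blast
 have k: "pkeys (a + d) <= T.pairs" using keys_add[of a d] a d by blast
 have "E j (s \<oplus>\<^bsub>I\<^esub> t) = E j s \<oplus> E j t" for j
 unfolding Isimps a(1) d(1) T.P.add_tensor E_class[OF k] E_class[OF a(2)] E_class[OF d(2)]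
 by (rule T.ecoord_add[OF a(2) d(2)])
 then show "s \<oplus>\<^bsub>I\<^esub> t : Z" using st c I.M.a_closed GD(3) by (simp add: Z_def)
 next
 fix r t assume t: "t : Z"
 then have c: "t : carrier I" by (auto simp: Z_def)
 then obtain a where a: "t = T.clsF a" "pkeys a <= T.pairs"
 using IT unfolding T.P.carrier_tensor by blast
 have "E j (r \<odot>\<^bsub>I\<^esub> t) = r \<odot> E j t" for j
 unfolding Isimps a(1) T.smult_tensor(1)[OF a(2)] E_class[OF a(2)] E_class[OF T.smult_tensor(2)[OF a(2)]]
 by (rule T.smult_tensor(3)[OF a(2)])
 then show "r \<odot>\<^bsub>I\<^esub> t : Z" using t c I.tsmult_closed GD(4) by (simp add: Z_def)
 qed
 moreover have "S <= Z"
 proof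
 fix s assume s: "s : S"
 then have "E j s : G" if "j < N" for j using that by (auto simp: G_def)
 then show "s : Z" using s S(1) F.Sp_base[OF G] by (auto simp: Z_def)
 qed
 ultimately have ZS: "submod I Z" "S <= Z" by blast+
 have I_Z: "carrier I <= Z"
 proof
 fix v assume "v : carrier I"
 then obtain c where v: "v = (\<Oplus>\<^bsub>I\<^esub>s\<in>S. c s \<odot>\<^bsub>I\<^esub> s)" using S(3) by blast
 show "v : Z" unfolding v
 by (rule I.submod_finsum[OF ZS(1) S(2)], rule I.submodD(4)[OF ZS(1)]) (use ZS(2) in blast)
 qed
 have "V.isotyp W <= Sp F G"
 proof (subst V.isotyp_def, rule V.cspan_least)
 show "submod V (Sp F G)" by (rule submod_complex[OF F.submod_Sp[OF G]])
 fix W' assume "W' : {W'. V.irr W' & V.iso_rep W W'}"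
 then have W': "V.irr W'" "V.iso_rep W W'" by auto
 obtain f where f: "bij_betw f W W'" "linear_map Cfield (V\<lparr>carrier := W\<rparr>) (V\<lparr>carrier := W'\<rparr>) f"
 "ALL k:K. ALL w:W. f (rh k w) = rh k (f w)" using W'(2) unfolding isomorphic_subreps_def by blast
 have W'c: "W' <= carrier F" using V.srep_sub[OF V.irrD(1)[OF W'(1)]] by simp
 have fW: "f w : W'" if "w : W" for w using f(1) that by (auto simp: bij_betw_def)
 have f_add: "f (u \<oplus>\<^bsub>V\<^esub> v) = f u \<oplus>\<^bsub>V\<^esub> f v" and f_sm: "f (c \<odot>\<^bsub>V\<^esub> u) = c \<odot>\<^bsub>V\<^esub> f u" if "u : W" "v : W" for u v c
 using f(2) that unfolding linear_map_def by auto
 have f_0: "f \<zero>\<^bsub>V\<^esub> = \<zero>\<^bsub>V\<^esub>" using f_sm[OF WD(2) WD(2), of 0] fW[OF WD(2)] W'c by auto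
 have f_sum: "f (\<Oplus>\<^bsub>V\<^esub>p\<in>P. g p) = (\<Oplus>\<^bsub>V\<^esub>p\<in>P. f (g p))" if "finite P" "!!p. p : P ==> g p : W" for P :: "nat set" and g
 using that
 proof (induction P)
 case empty
 then show ?case using f_0 by simp
 next
 case (insert p P)
 have gP: "g : P \<rightarrow> carrier V" "g p : carrier V" using insert.prems(1) WD(1) by blast+
 have hP: "(%p. f (g p)) : P \<rightarrow> carrier V" "f (g p) : carrier V" using insert.prems(1) fW W'c by auto
 have s: "(\<Oplus>\<^bsub>V\<^esub>p\<in>P. g p) : W" using insert by (intro V.submod_finsum V.srepD(1)[OF Ws]) auto
 have 1: "(\<Oplus>\<^bsub>V\<^esub>p\<in>insert p P. g p) = g p \<oplus>\<^bsub>V\<^esub> (\<Oplus>\<^bsub>V\<^esub>p\<in>P. g p)"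
 by (rule V.M.finsum_insert[OF insert.hyps gP])
 have 2: "(\<Oplus>\<^bsub>V\<^esub>p\<in>insert p P. f (g p)) = f (g p) \<oplus>\<^bsub>V\<^esub> (\<Oplus>\<^bsub>V\<^esub>p\<in>P. f (g p))"
 by (rule V.M.finsum_insert[OF insert.hyps hP])
 have "f (\<Oplus>\<^bsub>V\<^esub>p\<in>P. g p) = (\<Oplus>\<^bsub>V\<^esub>p\<in>P. f (g p))" by (rule insert.IH) (use insert.prems in auto)
 then show ?case unfolding 1 2 using f_add[OF insert.prems(1)[of p] s] by simp
 qed
 define w where "w i = f (b i)" for i
 have w: "w i : W'" "w i : carrier F" if "i < N" for i using fW bW(1)[OF that] W'c by (auto simp: w_def)
 \<comment> \<open>The tensor that corresponds to the equivariant map \<open>f\<close> under the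
   identification of invariants with Hom_K(W, F).\<close>
 define a where "a = (\<Sum>j<N. frag_of (delta j :: nat => complex poly, w j))"
 have dl: "(delta j :: nat => complex poly, w j) : T.pairs" if "j < N" for j using that w by auto
 have ecs: "T.ecoord i a = (\<Oplus>j\<in>{..<N}. T.ecoord i (frag_of (delta j, w j))) & pkeys a <= T.pairs"
 for i
 unfolding a_def by (rule T.ecoord_sum) (use dl in \<open>auto simp: keys_frag_of simp del: free_mod_simps\<close>)
 have ka: "pkeys a <= T.pairs" using ecs by blast
 have Ea: "T.ecoord i a = w i" if i: "i < N" for i
 proof -
 have "T.ecoord i a = (\<Oplus>j\<in>{..<N}. T.ecoord i (frag_of (delta j, w j)))" using ecs by blast
 also have "... = (\<Oplus>j\<in>{..<N}. if i = j then w j else \<zero>)"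
 proof (rule F.M.finsum_cong')
 fix j assume "j : {..<N}"
 then show "T.ecoord i (frag_of (delta j, w j)) = (if i = j then w j else \<zero>)"
 using T.ecoord(2)[OF dl[of j], of i] w(2)[of j] by simp
 qed (use w in auto)
 also have "... = w i"
 using i w by (intro F.M.finsum_singleton) auto
 finally show ?thesis .
 qed
 have "T.clsF a : carrier I"
 unfolding I_def invariants_def
 proof (simp, intro conjI ballI)
 show "T.clsF a : carrier (tensor Oring (free_mod N) F)" using ka by (rule T.P.class_in_tensor)
 fix k assume k: "k : K"
 let ?a = "frag_extend (%(u, v). frag_of (\<mu> k u, rh k v)) a"
 \<comment> \<open>Invariance, coordinate by coordinate: expanding the inverse of \<open>k\<close>
   applied to \<open>b i\<close> and then applying \<open>k\<close> returns \<open>b i\<close>, and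
   \<open>f\<close> commutes with \<open>k\<close>.\<close>
 have "T.ecoord i ?a = T.ecoord i a" if i: "i < N" for i
 proof -
 have p: "(\<mu> k (delta j), rh k (w j)) : T.pairs" if "j < N" for j
 using V.rho_closed[OF k] w[OF that] by (auto simp: \<mu>_def)
 have \<mu>d: "\<mu> k (delta j) i = [:C j i (matrix_inv k):]" if "j < N" for j
 using i that by (simp add: \<mu>_def if_distrib cong: if_cong)
 have "?a = (\<Sum>j<N. frag_of (\<mu> k (delta j), rh k (w j)))"
 by (simp add: a_def frag_extend_sum)
 then have "T.ecoord i ?a = (\<Oplus>j\<in>{..<N}. T.ecoord i (frag_of (\<mu> k (delta j), rh k (w j))))"
 using T.ecoord_sum[of "{..<N}" "%j. frag_of (\<mu> k (delta j), rh k (w j))" i] p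
 by (simp add: keys_frag_of del: free_mod_simps)
 also have "... = (\<Oplus>j\<in>{..<N}. f (C j i (matrix_inv k) \<odot>\<^bsub>V\<^esub> rh k (b j)))"
 proof (rule F.M.finsum_cong')
 show "T.ecoord i (frag_of (\<mu> k (delta j), rh k (w j))) = f (C j i (matrix_inv k) \<odot>\<^bsub>V\<^esub> rh k (b j))"
 if "j : {..<N}" for j
 using that p[of j] T.ecoord(2) \<mu>d[of j] f_sm[OF V.srepD(2)[OF Ws k bW(1)] V.srepD(2)[OF Ws k bW(1)]] f(3) k bW(1)[of j]
 by (simp add: w_def del: free_mod_simps)
 show "(%j. f (C j i (matrix_inv k) \<odot>\<^bsub>V\<^esub> rh k (b j))) : {..<N} \<rightarrow> carrier F"
 using WD(4)[OF V.srepD(2)[OF Ws k bW(1)]] fW W'c by blast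
 qed simp
 also have "... = f (\<Oplus>\<^bsub>V\<^esub>j\<in>{..<N}. C j i (matrix_inv k) \<odot>\<^bsub>V\<^esub> rh k (b j))"
 unfolding finsum_restrict[symmetric, of F _ _ "%c. [:c:]"]
 by (rule f_sum[symmetric]) (use WD(4)[OF V.srepD(2)[OF Ws k bW(1)]] in auto)
 also have "(\<Oplus>\<^bsub>V\<^esub>j\<in>{..<N}. C j i (matrix_inv k) \<odot>\<^bsub>V\<^esub> rh k (b j)) = rh k (rh (matrix_inv k) (b i))"
 proof -
 have bc: "b j : carrier V" if "j < N" for j using bW(1)[OF that] WD(1) by blast
 have "rh k (rh (matrix_inv k) (b i)) = (\<Oplus>\<^bsub>V\<^esub>j\<in>{..<N}. rh k (C j i (matrix_inv k) \<odot>\<^bsub>V\<^esub> b j))"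
 unfolding C_rho[OF V.inv_K[OF k] i]
 by (rule rho_finsum[OF k]) (use bc V.tsmult_closed in blast)+
 also have "... = (\<Oplus>\<^bsub>V\<^esub>j\<in>{..<N}. C j i (matrix_inv k) \<odot>\<^bsub>V\<^esub> rh k (b j))"
 by (rule V.M.finsum_cong') (use V.rho_smult[OF k] V.rho_closed[OF k] bc V.tsmult_closed in blast)+
 finally show ?thesis ..
 qed
 also have "rh k (rh (matrix_inv k) (b i)) = b i" using V.rho_inv'[OF k] bW(1)[OF i] WD(1) by blast
 finally show ?thesis using Ea[OF i] by (simp add: w_def)
 qed
 then have "T.clsF ?a = T.clsF a" by (intro T.class_eqI act_class(2)[OF k ka] ka)
 then show "act k (T.clsF a) = T.clsF a" using act_class(1)[OF k ka] by simp
 qed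
 then have "T.clsF a : Z" using I_Z by blast
 then have "w j : Sp F G" if "j < N" for j
 using that Ea[OF that] E_class[OF ka, of j] by (auto simp: Z_def)
 moreover have "W' <= {f u |u. u : W}" using f(1) by (auto simp: bij_betw_def)
 moreover have "f u = (\<Oplus>\<^bsub>V\<^esub>i\<in>{..<N}. co u (b i) \<odot>\<^bsub>V\<^esub> w i)" if "u : W" for u
 proof -
 have "f u = f (\<Oplus>\<^bsub>V\<^esub>i\<in>{..<N}. co u (b i) \<odot>\<^bsub>V\<^esub> b i)" using co[OF that] unfolding LC_b by simp
 also have "... = (\<Oplus>\<^bsub>V\<^esub>i\<in>{..<N}. f (co u (b i) \<odot>\<^bsub>V\<^esub> b i))"
 by (rule f_sum) (use WD(4) bW(1) in auto)
 also have "... = (\<Oplus>\<^bsub>V\<^esub>i\<in>{..<N}. co u (b i) \<odot>\<^bsub>V\<^esub> w i)"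
 by (rule V.M.finsum_cong') (use f_sm[OF bW(1) bW(1)] w in \<open>auto simp: w_def\<close>)
 finally show ?thesis .
 qed
 moreover have "(\<Oplus>\<^bsub>V\<^esub>i\<in>{..<N}. c i \<odot>\<^bsub>V\<^esub> w i) : Sp F G" if "!!j. j < N ==> w j : Sp F G" for c
 by (rule V.submod_finsum[OF submod_complex[OF F.submod_Sp[OF G]]]) (use that GD(4) in auto)
 ultimately show "W' <= Sp F G" by auto
 qed
 then show ?thesis using G by blast
qed

end

context fam_rep
begin

text \<open>Each isotypical summand is a finitely generated torsion-free module over polynomials and
  so has a finite basis. The union of these bases spans since the summands do, and it is independent
  since the summands are.\<close>

theorem adapted_basis:
 assumes red: "reductive K" and qa: "quasi_admissible K F rh"
 shows "EX B crd Bs. based F B crd (%b. b) & B = (UN U:isotypic_summands K V rh. Bs U)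
 & (ALL U:isotypic_summands K V rh. finite (Bs U) & Bs U <= U & U = Sp F (Bs U))
 & (ALL U:isotypic_summands K V rh. ALL U':isotypic_summands K V rh. U ~= U' --> Bs U \<inter> Bs U' = {})"
proof -
 define \<U> where "\<U> = isotypic_summands K V rh"
 have Uo: "submod F U" if "U : \<U>" for U
 using that isotyp_osubmod by (auto simp: \<U>_def V.isotypic_summands_eq)
 have "EX B<=U. finite B & indep F B & U = Sp F B" if U: "U : \<U>" for U
 proof -
 obtain W where W: "U = V.isotyp W" "V.irr W" using U by (auto simp: \<U>_def V.isotypic_summands_eq)
 obtain G where G: "finite G" "G <= carrier F" "U <= Sp F G" using isotyp_fg[OF qa W(2)] W(1) by blast
 show ?thesis by (rule F.finite_basis[OF G(1,2) Uo[OF U] G(3)]) (rule torsion_free)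
 qed
 then obtain Bs where Bs: "!!U. U : \<U> ==> Bs U <= U & finite (Bs U) & indep F (Bs U) & U = Sp F (Bs U)"
 by metis
 have Uc: "U <= carrier F" if "U : \<U>" for U using F.submodD(1)[OF Uo[OF that]] .
 define B where "B = (UN U:\<U>. Bs U)"
 have Bc: "B <= carrier F" using Bs Uc unfolding B_def by blast
 have span: "EX J c. finite J & J <= B & u = LC F c J" if u: "u : carrier F" for u
 proof -
 define Z where "Z = {u. EX J. finite J & J <= B & u : Sp F J}"
 have Zi: "u : Z" if "finite J" "J <= B" "u : Sp F J" for u J using that unfolding Z_def by blast
 have "submod F Z"
 proof (rule F.submodI)
 show "Z <= carrier F" unfolding Z_def using F.Sp_sub Bc by blast
 show "\<zero> : Z" by (rule Zi[of "{}"]) (auto simp: F.Sp_empty)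
 fix u v assume "u : Z" "v : Z"
 then obtain J J' where J: "finite J" "J <= B" "u : Sp F J" "finite J'" "J' <= B" "v : Sp F J'"
 unfolding Z_def by blast
 then have "u : Sp F (J \<union> J')" "v : Sp F (J \<union> J')" using F.Sp_mono[of "J \<union> J'"] Bc by blast+
 moreover have "finite (J \<union> J')" "J \<union> J' <= carrier F" using J Bc by auto
 ultimately have "u \<oplus> v : Sp F (J \<union> J')" using F.submodD(3)[OF F.submod_Sp] by blast
 then show "u \<oplus> v : Z" using J Zi[of "J \<union> J'"] by simp
 next
 fix r u assume "u : Z"
 then obtain J where J: "finite J" "J <= B" "u : Sp F J" unfolding Z_def by blast
 then have "r \<odot> u : Sp F J" using F.submodD(4)[OF F.submod_Sp] Bc by blast
 then show "r \<odot> u : Z" using J Zi by blast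
 qed
 moreover have "U <= Z" if "U : \<U>" for U
 using Bs[OF that] that Zi[of "Bs U"] unfolding B_def by blast
 ultimately have "carrier V <= Z" using V.isotypic_span[OF red submod_complex] unfolding \<U>_def by blast
 then show ?thesis using u unfolding Z_def Sp_def by auto
 qed
 have ext: "LC F c J = LC F (%b. if b : J then c b else 0) J'" if "finite J'" "J <= J'" "J' <= B" for c J J'
 unfolding LC_def
 by (rule F.M.add.finprod_mono_neutral_cong_left[OF that(1,2)]) (use Bc that in auto)
 \<comment> \<open>The part of a relation inside \<open>U\<close> is minus the part in the other
   summands, so it lies in a trivial intersection; independence inside \<open>U\<close> then kills
   its coefficients.\<close>
 have zero: "c b = 0" if J: "finite J" "J <= B" "LC F c J = \<zero>" "b : J" for c J b
 proof -
 obtain U where U: "U : \<U>" "b : Bs U" using J unfolding B_def by blast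
 obtain W where W: "U = V.isotyp W" "V.irr W" using U by (auto simp: \<U>_def V.isotypic_summands_eq)
 define J1 J2 where "J1 = J \<inter> Bs U" and "J2 = J - Bs U"
 have J12: "finite J1" "finite J2" "J1 <= carrier F" "J2 <= carrier F" "J = J1 \<union> J2" "J1 \<inter> J2 = {}"
 using J Bc unfolding J1_def J2_def by auto
 define D where "D = V.cspan (\<U> - {U})"
 have Ds: "submod V D" unfolding D_def using Uc by (intro V.cspan_submod) auto
 have 1: "LC F c J1 : U"
 unfolding LC_def by (rule F.submod_finsum[OF Uo[OF U(1)] J12(1)], rule F.submodD(4)[OF Uo[OF U(1)]])
 (use Bs[OF U(1)] in \<open>auto simp: J1_def\<close>)
 have "c b' \<odot> b' : D" if b'J: "b' : J2" for b'
 proof -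
 have b': "b' : B" "b' ~: Bs U" using b'J J(2) by (auto simp: J2_def)
 then obtain U' where U': "U' : \<U>" "b' : Bs U'" unfolding B_def by blast
 then have "U' ~= U" using b'(2) by blast
 then have "U' <= D" using U' unfolding D_def by (intro V.cspan_upper) auto
 moreover have "c b' \<odot> b' : U'" using F.submodD(4)[OF Uo[OF U'(1)]] Bs[OF U'(1)] U'(2) by blast
 ultimately show ?thesis by blast
 qed
 then have 2: "LC F c J2 : D"
 unfolding LC_def finsum_restrict[symmetric, of F _ _ "%c. [:c:]"]
 by (intro V.submod_finsum[OF Ds J12(2)])
 have "LC F c J = LC F c J1 \<oplus> LC F c J2"
 unfolding LC_def J12(5)
 by (rule F.M.finsum_Un_disjoint) (use J12 in \<open>auto intro!: F.tsmult_closed\<close>)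
 then have z: "LC F c J1 \<oplus> LC F c J2 = \<zero>" using J(3) by simp
 have cl: "LC F c J1 : carrier F" "LC F c J2 : carrier F" using F.LC_closed J12 by auto
 have "\<ominus> LC F c J2 = LC F c J1" by (rule F.M.minus_equality[OF z cl(2,1)])
 moreover have "[:-1:] \<odot> LC F c J2 = \<ominus> LC F c J2" using F.tsmult_m1[OF cl(2)] by (simp add: one_pCons)
 ultimately have "LC F c J1 : D" using V.submodD(4)[OF Ds 2, of "-1"] by simp
 then have "LC F c J1 = \<zero>"
 using V.isotypic_indep[OF red W(2)] 1 W(1) unfolding D_def \<U>_def by auto
 moreover have "LC F c J1 = LC F (%b. if b : J1 then c b else 0) (Bs U)"
 by (rule ext) (use Bs[OF U(1)] U(1) in \<open>auto simp: J1_def B_def\<close>)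
 ultimately have eq0: "LC F (%b. if b : J1 then c b else 0) (Bs U) = \<zero>" by simp
 have "indep F (Bs U)" using Bs[OF U(1)] by blast
 from this[unfolded indep_def, rule_format, OF eq0 U(2)] show ?thesis
 using J(4) U(2) by (simp add: J1_def)
 qed
 \<comment> \<open>A vector is represented by a finite set with coefficients. \<open>val\<close>
   extends the coefficients by 0, which makes the coordinates independent of the chosen
   representation.\<close>
 define rep where "rep u Jc \<longleftrightarrow> finite (fst Jc) & fst Jc <= B & u = LC F (snd Jc) (fst Jc)" for u and Jc :: "'f set \<times> ('f => complex poly)"
 define val where "val Jc b = (if b : fst Jc then snd Jc b else 0)" for b and Jc :: "'f set \<times> ('f => complex poly)"
 have v: "val (J, c) = (%b. if b : J then c b else 0)" for J c by (auto simp: val_def)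
 define crd where "crd u = val (SOME Jc. rep u Jc)" for u
 have crd_eq: "crd u = val (J, c)" if J: "finite J" "J <= B" "u = LC F c J" for u J c
 proof -
 have "rep u (J, c)" using J by (simp add: rep_def)
 then have r: "rep u (SOME Jc. rep u Jc)" by (rule someI)
 obtain J' c' where Jc': "(SOME Jc. rep u Jc) = (J', c')" by (cases "SOME Jc. rep u Jc")
 have r': "finite J'" "J' <= B" "u = LC F c' J'" using r[unfolded Jc'] by (auto simp: rep_def)
 have fin: "finite (J \<union> J')" "J \<union> J' <= B" "J \<union> J' <= carrier F" using J r' Bc by auto
 have "LC F (val (J, c)) (J \<union> J') = u" "LC F (val (J', c')) (J \<union> J') = u"
 using ext[of "J \<union> J'" J c] ext[of "J \<union> J'" J' c'] fin J r' unfolding v by auto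
 then have "LC F (%b. val (J, c) b - val (J', c') b) (J \<union> J') = \<zero>"
 unfolding F.LC_diff[OF fin(1,3)] using F.LC_closed[OF fin(1,3)] by (metis F.M.minus_eq F.M.r_neg)
 then have same: "val (J, c) b - val (J', c') b = 0" if "b : J \<union> J'" for b
 using zero[OF fin(1,2)] that by blast
 show ?thesis unfolding crd_def Jc'
 proof
 fix b show "val (J', c') b = val (J, c) b"
 by (cases "b : J \<union> J'") (use same[of b] in \<open>auto simp: v\<close>)
 qed
 qed
 have crd_rep: "EX J. finite J & J <= B & {b. crd u b ~= 0} <= J & (ALL J'. finite J' & J <= J' & J' <= B --> u = LC F (crd u) J')"
 if u: "u : carrier F" for u
 proof -
 obtain J c where J: "finite J" "J <= B" "u = LC F c J" using span[OF u] by blast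
 have e: "crd u = val (J, c)" by (rule crd_eq[OF J])
 have "u = LC F (crd u) J'" if "finite J'" "J <= J'" "J' <= B" for J'
 unfolding e v using J(3) ext[OF that, of c] by simp
 moreover have "{b. crd u b ~= 0} <= J" by (auto simp: e v)
 ultimately show ?thesis using J by (intro exI[of _ J]) blast
 qed
 have based: "based F B crd (%b. b)"
 proof (rule based.intro)
 show "Module.module Oring F" by (rule F.module_type)
 fix u v i assume uv: "u : carrier F" "v : carrier F"
 from crd_rep[OF uv(1)] obtain J where J0: "finite J" "J <= B" "{b. crd u b ~= 0} <= J"
 "ALL J0. finite J0 & J <= J0 & J0 <= B --> u = LC F (crd u) J0" by (elim exE conjE)
 note J = J0(1-3) J0(4)[rule_format, OF conjI[OF _ conjI]]
 from crd_rep[OF uv(2)] obtain J' where J'0: "finite J'" "J' <= B" "{b. crd v b ~= 0} <= J'"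
 "ALL J0. finite J0 & J' <= J0 & J0 <= B --> v = LC F (crd v) J0" by (elim exE conjE)
 note J' = J'0(1-3) J'0(4)[rule_format, OF conjI[OF _ conjI]]
 have fin: "finite (J \<union> J')" "J \<union> J' <= B" "J \<union> J' <= carrier F" using J J' Bc by auto
 have "u \<oplus> v = LC F (%b. crd u b + crd v b) (J \<union> J')"
 unfolding F.LC_add[OF fin(1,3)] using J(4)[OF fin(1) _ fin(2)] J'(4)[OF fin(1) _ fin(2)] by auto
 then have "crd (u \<oplus> v) = val (J \<union> J', %b. crd u b + crd v b)" by (rule crd_eq[OF fin(1,2)])
 moreover have "crd u i = 0 & crd v i = 0" if "i ~: J \<union> J'" using that J(3) J'(3) by blast
 ultimately show "crd (u \<oplus> v) i = crd u i + crd v i" by (cases "i : J \<union> J'") (auto simp: v)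
 show "u = v" if "crd u = crd v"
 using J(4)[OF fin(1) _ fin(2)] J'(4)[OF fin(1) _ fin(2)] that by auto
 next
 fix q u i assume u: "u : carrier F"
 from crd_rep[OF u] obtain J where J0: "finite J" "J <= B" "{b. crd u b ~= 0} <= J"
 "ALL J0. finite J0 & J <= J0 & J0 <= B --> u = LC F (crd u) J0" by (elim exE conjE)
 note J = J0(1-3) J0(4)[rule_format, OF conjI[OF _ conjI]]
 have fin: "J <= carrier F" using J Bc by auto
 have "q \<odot> u = LC F (%b. q * crd u b) J"
 unfolding F.LC_smult[OF J(1) fin] using J(4)[OF J(1) order_refl J(2)] by simp
 then have "crd (q \<odot> u) = val (J, %b. q * crd u b)" by (rule crd_eq[OF J(1,2)])
 moreover have "crd u i = 0" if "i ~: J" using that J(3) by blast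
 ultimately show "crd (q \<odot> u) i = q * crd u i" by (cases "i : J") (auto simp: v)
 show "finite {i. crd u i ~= 0}" using J(1,3) finite_subset by blast
 show "crd u i = 0" if "i ~: B" using J(2,3) that by blast
 next
 fix i j assume i: "i : B"
 show "i : carrier F" using i Bc by blast
 have "i = LC F (delta i) {i}"
 using F.LC_delta[of "{i}" i] i Bc by auto
 then have "crd i = val ({i}, delta i)" using i by (intro crd_eq) auto
 then show "crd i j = (if j = i then 1 else 0)" by (auto simp: v)
 qed
 have disj: "Bs U \<inter> Bs U' = {}" if U: "U : \<U>" "U' : \<U>" "U ~= U'" for U U'
 proof (rule ccontr)
 assume "Bs U \<inter> Bs U' ~= {}"
 then obtain b where b: "b : Bs U" "b : Bs U'" by blast
 obtain W where W: "U = V.isotyp W" "V.irr W" using U by (auto simp: \<U>_def V.isotypic_summands_eq)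
 have "U' <= V.cspan (\<U> - {U})" using U by (intro V.cspan_upper) auto
 then have "b : V.isotyp W \<inter> V.cspan (\<U> - {V.isotyp W})" using b Bs[OF U(1)] Bs[OF U(2)] W(1) by blast
 then have "b = \<zero>" using V.isotypic_indep[OF red W(2)] unfolding \<U>_def by auto
 moreover have "b : B" using b U unfolding B_def by blast
 ultimately show False using based.crd_bas[OF based, of b b] based.crd_zero[OF based, of b] by simp
 qed
 show ?thesis
 by (rule exI[of _ B], rule exI[of _ crd], rule exI[of _ Bs], intro conjI ballI impI)
 (use based Bs disj in \<open>auto simp: B_def \<U>_def\<close>)
qed

end

section \<open>Rational functions\<close>

lemma poly_conj_poly: "poly (conj_poly q) z = cnj (poly q (cnj z))"
 by (induction q) (simp_all add: map_poly_pCons)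

lemma conj_poly_eqI: "(!!z. poly p z = poly q z) ==> p = (q :: complex poly)"
 by (simp add: poly_eq_poly_eq_iff[symmetric] fun_eq_iff)

lemma conj_poly_add [simp]: "conj_poly (p + q) = conj_poly p + conj_poly q"
 by (rule conj_poly_eqI) (simp add: poly_conj_poly)
lemma conj_poly_mult [simp]: "conj_poly (p * q) = conj_poly p * conj_poly q"
 by (rule conj_poly_eqI) (simp add: poly_conj_poly)
lemma conj_poly_diff [simp]: "conj_poly (p - q) = conj_poly p - conj_poly q"
 by (rule conj_poly_eqI) (simp add: poly_conj_poly)
lemma conj_poly_involutive [simp]: "conj_poly (conj_poly p) = p"
 by (rule conj_poly_eqI) (simp add: poly_conj_poly)
lemma conj_poly_1 [simp]: "conj_poly 1 = 1"
 by (rule conj_poly_eqI) (simp add: poly_conj_poly)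
lemma conj_poly_eq_0 [simp]: "conj_poly p = 0 \<longleftrightarrow> p = 0"
 by (metis conj_poly_involutive map_poly_0)

lemma conj_fract_Fract: "b ~= 0 ==> conj_fract (Fract a b) = Fract (conj_poly a) (conj_poly b)"
 unfolding conj_fract_def
proof (rule the_equality)
 assume b: "b ~= 0"
 then show "EX a' b'. b' ~= 0 & Fract a b = Fract a' b' & Fract (conj_poly a) (conj_poly b) = Fract (conj_poly a') (conj_poly b')"
 by blast
 fix r assume "EX a' b'. b' ~= 0 & Fract a b = Fract a' b' & r = Fract (conj_poly a') (conj_poly b')"
 then obtain a' b' where *: "b' ~= 0" "Fract a b = Fract a' b'" "r = Fract (conj_poly a') (conj_poly b')" by blast
 then have "a * b' = a' * b" using b by (simp add: eq_fract)
 then have "conj_poly a * conj_poly b' = conj_poly a' * conj_poly b" by (metis conj_poly_mult)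
 then show "r = Fract (conj_poly a) (conj_poly b)" using * b by (simp add: eq_fract)
qed

lemma conj_fract_add [simp]: "conj_fract (q + r) = conj_fract q + conj_fract r"
 by (cases q, cases r) (simp add: conj_fract_Fract)
lemma conj_fract_mult [simp]: "conj_fract (q * r) = conj_fract q * conj_fract r"
 by (cases q, cases r) (simp add: conj_fract_Fract)
lemma conj_fract_involutive [simp]: "conj_fract (conj_fract q) = q"
 by (cases q) (simp add: conj_fract_Fract)
lemma conj_fract_to_fract [simp]: "conj_fract (to_fract a) = to_fract (conj_poly a)"
 by (simp add: to_fract_def conj_fract_Fract)
lemma conj_fract_0 [simp]: "conj_fract 0 = 0"
 using conj_fract_to_fract[of 0] by simp
lemma conj_fract_1 [simp]: "conj_fract 1 = 1"
 using conj_fract_to_fract[of 1] by simp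
lemma conj_fract_eq_0 [simp]: "conj_fract q = 0 \<longleftrightarrow> q = 0"
 by (metis conj_fract_involutive conj_fract_0)
lemma conj_fract_uminus [simp]: "conj_fract (- q) = - conj_fract q"
 using conj_fract_add[of q "- q"] by (simp add: eq_neg_iff_add_eq_0 add.commute)
lemma conj_fract_diff [simp]: "conj_fract (q - r) = conj_fract q - conj_fract r"
 using conj_fract_add[of q "- r"] by simp
lemma conj_fract_sum: "conj_fract (SUM i:S. f i) = (SUM i:S. conj_fract (f i))"
 by (induction S rule: infinite_finite_induct) auto
lemma conj_fract_inverse [simp]: "conj_fract (inverse q) = inverse (conj_fract q)"
proof (cases "q = 0")
 case False
 then have "conj_fract (inverse q) * conj_fract q = 1" by (simp flip: conj_fract_mult)
 then show ?thesis by (metis inverse_unique mult.commute)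
qed simp
lemma conj_fract_power [simp]: "conj_fract (q ^ n) = conj_fract q ^ n"
 by (induction n) auto
lemma conj_fract_powi [simp]: "conj_fract (q powi n) = conj_fract q powi n"
 by (simp add: power_int_def)
lemma conj_fract_of_int [simp]: "conj_fract (of_int n) = of_int n"
proof -
 have "conj_fract (of_nat m) = of_nat m" for m by (induction m) auto
 then show ?thesis by (cases n rule: int_cases2) auto
qed

abbreviation Rloc :: "complex => complex poly fract set" where "Rloc z \<equiv> carrier (local_ring z)"

lemma to_fract_power: "to_fract (a ^ n) = to_fract a ^ n"
 by (induction n) simp_all

lemma Rloc_iff: "q : Rloc z \<longleftrightarrow> (EX a b. poly b z ~= 0 & q = Fract a b)"
 by (auto simp: local_ring_def)

lemma value_at_Fract: "poly b z ~= 0 ==> value_at z (Fract a b) = poly a z / poly b z"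
 unfolding value_at_def
proof (rule the_equality)
 assume b: "poly b z ~= 0"
 then show "EX a' b'. poly b' z ~= 0 & Fract a b = Fract a' b' & poly a z / poly b z = poly a' z / poly b' z" by blast
 fix v assume "EX a' b'. poly b' z ~= 0 & Fract a b = Fract a' b' & v = poly a' z / poly b' z"
 then obtain a' b' where *: "poly b' z ~= 0" "Fract a b = Fract a' b'" "v = poly a' z / poly b' z" by blast
 moreover have "b ~= 0" "b' ~= 0" using b * by auto
 ultimately have "a * b' = a' * b" by (simp add: eq_fract)
 then have "poly a z * poly b' z = poly a' z * poly b z" by (metis poly_mult)
 then show "v = poly a z / poly b z" using * b by (simp add: frac_eq_eq)
qed

lemma Rloc_add: "q : Rloc z ==> r : Rloc z ==> q + r : Rloc z & value_at z (q + r) = value_at z q + value_at z r"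
 and Rloc_mult: "q : Rloc z ==> r : Rloc z ==> q * r : Rloc z & value_at z (q * r) = value_at z q * value_at z r"
proof -
 assume "q : Rloc z" "r : Rloc z"
 then obtain a b c d where *: "q = Fract a b" "r = Fract c d" "poly b z ~= 0" "poly d z ~= 0"
 unfolding Rloc_iff by blast
 moreover have nz: "b ~= 0" "d ~= 0" using * by auto
 moreover have bd: "poly (b * d) z ~= 0" using * by simp
 ultimately have "q + r = Fract (a * d + c * b) (b * d)" "q * r = Fract (a * c) (b * d)" by simp_all
 note eqs = this
 have "q + r : Rloc z" "q * r : Rloc z" unfolding Rloc_iff using bd eqs by blast+
 moreover have "value_at z (q + r) = value_at z q + value_at z r"
 by (subst eqs(1), subst value_at_Fract[OF bd], unfold *(1,2) value_at_Fract[OF *(3)] value_at_Fract[OF *(4)])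
 (use *(3,4) in \<open>simp add: add_frac_eq\<close>)
 moreover have "value_at z (q * r) = value_at z q * value_at z r"
 by (subst eqs(2), subst value_at_Fract[OF bd], unfold *(1,2) value_at_Fract[OF *(3)] value_at_Fract[OF *(4)]) simp
 ultimately show "q + r : Rloc z & value_at z (q + r) = value_at z q + value_at z r"
 "q * r : Rloc z & value_at z (q * r) = value_at z q * value_at z r" by blast+
qed

lemma Rloc_to_fract [simp]: "to_fract a : Rloc z" "value_at z (to_fract a) = poly a z"
proof -
 have "poly 1 z ~= 0" by simp
 then show "to_fract a : Rloc z" unfolding Rloc_iff to_fract_def by blast
 show "value_at z (to_fract a) = poly a z" by (simp add: to_fract_def value_at_Fract)
qed

lemma Rloc_0 [simp]: "0 : Rloc z" "value_at z 0 = 0"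
 using Rloc_to_fract[where a = 0 and z = z] by simp_all
lemma Rloc_1 [simp]: "1 : Rloc z" "value_at z 1 = 1"
 using Rloc_to_fract[where a = 1 and z = z] by simp_all
lemma Rloc_uminus: "q : Rloc z ==> - q : Rloc z & value_at z (- q) = - value_at z q"
 using Rloc_mult[where q = "to_fract (-1)" and z = z and r = q] Rloc_to_fract[where a = "-1" and z = z]
 by (simp del: Rloc_to_fract)
lemma Rloc_diff: "q : Rloc z ==> r : Rloc z ==> q - r : Rloc z & value_at z (q - r) = value_at z q - value_at z r"
 using Rloc_add[where q = q and z = z and r = "- r"] Rloc_uminus[of r z] by auto
lemma Rloc_sum: "(!!i. i : S ==> f i : Rloc z) ==> (SUM i:S. f i) : Rloc z & value_at z (SUM i:S. f i) = (SUM i:S. value_at z (f i))"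
 by (induction S rule: infinite_finite_induct) (auto simp: Rloc_add)

lemma Rloc_inverse: "q : Rloc z ==> value_at z q ~= 0 ==> inverse q : Rloc z & value_at z (inverse q) = inverse (value_at z q)"
proof -
 assume q: "q : Rloc z" "value_at z q ~= 0"
 then obtain a b where *: "q = Fract a b" "poly b z ~= 0" unfolding Rloc_iff by blast
 then have "poly a z ~= 0" using q(2) by (simp add: value_at_Fract)
 then show ?thesis using * by (auto simp: Rloc_iff value_at_Fract)
qed

lemma Rloc_conj: "q : Rloc (of_real x) ==> conj_fract q : Rloc (of_real x) & value_at (of_real x) (conj_fract q) = cnj (value_at (of_real x) q)"
proof -
 assume "q : Rloc (of_real x)"
 then obtain a b where *: "q = Fract a b" "poly b (of_real x) ~= 0" unfolding Rloc_iff by blast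
 then have "b ~= 0" "poly (conj_poly b) (of_real x) ~= 0" by (auto simp: poly_conj_poly)
 note b = this
 have "conj_fract q = Fract (conj_poly a) (conj_poly b)" using * b by (simp add: conj_fract_Fract)
 moreover from this have "conj_fract q : Rloc (of_real x)" unfolding Rloc_iff using b(2) by blast
 ultimately show ?thesis using *(1) b(2) by (simp add: value_at_Fract value_at_Fract[OF *(2)] poly_conj_poly)
qed

lemma local_ring_ext: "scalar_ext (local_ring z) to_fract"
proof (rule scalar_ext.intro)
 show "monoid.mult (local_ring z) = (*)" "add (local_ring z) = (+)" "ring.zero (local_ring z) = 0" "one (local_ring z) = 1"
 by (simp_all add: local_ring_def)
 show "a - b : Rloc z" "a * b : Rloc z" if "a : Rloc z" "b : Rloc z" for a b
 using Rloc_diff[OF that] Rloc_mult[OF that] by blast+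
qed auto

lemma Kfield_ext: "scalar_ext Kfield to_fract"
 by (rule scalar_ext.intro) auto
lemma Cfield_ext: "scalar_ext Cfield (ev z)"
 by (rule scalar_ext.intro) auto
lemma Kbar_ext: "scalar_ext Kbar Kbar_embed"
 by (rule scalar_ext.intro) auto

locale real_coord =
 fixes x :: real and p :: "complex poly"
 assumes coord: "real_coordinate x p"
begin

abbreviation "x0 \<equiv> (of_real x :: complex)"
abbreviation "R \<equiv> Rloc x0"
abbreviation "val \<equiv> value_at x0"
definition "P = to_fract p"

lemma p_nz: "p ~= 0" using coord unfolding real_coordinate_def by auto
lemma P_nz [simp]: "P ~= 0" by (simp add: P_def p_nz)
lemma P_in [simp]: "P : R" "val P = 0" using coord by (simp_all add: P_def real_coordinate_def)
lemma P_conj [simp]: "conj_fract P = P" using coord by (simp add: P_def real_coordinate_def)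

lemma poly_zero_factor: "poly a x0 = 0 ==> EX a'. a = p * a'"
proof -
 assume a: "poly a x0 = 0"
 have "Polynomial.degree p = 1" "poly p x0 = 0" using coord by (auto simp: real_coordinate_def)
 obtain c where c: "p = [:- x0, 1:] * c" using \<open>poly p x0 = 0\<close> by (metis dvd_def poly_eq_0_iff_dvd)
 then have "Polynomial.degree c = 0" using \<open>Polynomial.degree p = 1\<close> p_nz degree_mult_eq[of "[:- x0, 1:]" c] by (cases "c = 0") auto
 then obtain d where d: "c = [:d:]" by (metis degree_eq_zeroE)
 have "d ~= 0" using c d p_nz by auto
 obtain a' where a': "a = [:- x0, 1:] * a'" using a by (metis dvd_def poly_eq_0_iff_dvd)
 have "p = Polynomial.smult d [:- x0, 1:]" unfolding c d by simp
 then have "p * Polynomial.smult (inverse d) a' = Polynomial.smult (inverse d * d) ([:- x0, 1:] * a')"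
 by (simp only: mult_smult_left mult_smult_right smult_smult)
 then have "p * Polynomial.smult (inverse d) a' = a" using \<open>d ~= 0\<close> a' by simp
 then show ?thesis by metis
qed

lemma R_zero_factor: "q : R ==> val q = 0 ==> EX r:R. q = P * r"
proof -
 assume q: "q : R" "val q = 0"
 then obtain a b where *: "q = Fract a b" "poly b x0 ~= 0" unfolding Rloc_iff by blast
 then have "poly a x0 = 0" using q(2) by (simp add: value_at_Fract)
 then obtain a' where "a = p * a'" using poly_zero_factor by blast
 then have "q = P * Fract a' b" using * by (simp add: P_def to_fract_def)
 then show ?thesis using * Rloc_iff by blast
qed

lemma order_unit_poly: "a ~= 0 ==> EX n u. poly u x0 ~= 0 & a = p ^ n * u"
proof (induction "Polynomial.degree a" arbitrary: a rule: less_induct)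
 case less
 show ?case
 proof (cases "poly a x0 = 0")
 case True
 then obtain a' where a': "a = p * a'" using poly_zero_factor by blast
 then have "a' ~= 0" using less.prems by auto
 then have "Polynomial.degree a' < Polynomial.degree a" using a' p_nz coord by (simp add: degree_mult_eq real_coordinate_def)
 then obtain n u where "poly u x0 ~= 0" "a' = p ^ n * u" using less.hyps \<open>a' ~= 0\<close> by blast
 then show ?thesis using a' by (intro exI[of _ "Suc n"] exI[of _ u]) (simp add: mult.assoc)
 next
 case False
 then show ?thesis by (intro exI[of _ 0] exI[of _ a]) simp
 qed
qed

text \<open>The rational functions regular at \<open>x\<close> form a discrete valuation ring with
  uniformizer \<open>P\<close>. Arguments about the order at \<open>x\<close> rest on this
  factorization.\<close>

lemma order_unit: "q ~= 0 ==> EX k u. u : R & val u ~= 0 & q = P powi k * u"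
proof -
 assume q: "q ~= 0"
 obtain a b where ab: "q = Fract a b" "b ~= 0" by (cases q) auto
 then have "a ~= 0" using q by (auto simp: Zero_fract_def eq_fract)
 obtain n u m w where *: "poly u x0 ~= 0" "a = p ^ n * u" "poly w x0 ~= 0" "b = p ^ m * w"
 using order_unit_poly[OF \<open>a ~= 0\<close>] order_unit_poly[OF ab(2)] by blast
 have "w ~= 0" using * by auto
 have "q = to_fract a / to_fract b" using ab by (simp add: to_fract_def)
 also have "... = P ^ n / P ^ m * (to_fract u / to_fract w)"
 unfolding *(2,4) by (simp add: P_def to_fract_power)
 also have "P ^ n / P ^ m = P powi (int n - int m)" by (simp add: power_int_diff)
 also have "to_fract u / to_fract w = Fract u w" using \<open>w ~= 0\<close> by (simp add: to_fract_def)
 finally have "q = P powi (int n - int m) * Fract u w" .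
 moreover have "Fract u w : R" "val (Fract u w) ~= 0" using * by (auto simp: Rloc_iff value_at_Fract)
 ultimately show ?thesis by blast
qed

lemma Ppowi_in: "k \<ge> 0 ==> P powi k : R"
proof -
 have "P ^ n : R" for n by (induction n) (auto simp: Rloc_mult)
 then show "k \<ge> 0 ==> P powi k : R" by (simp add: power_int_def)
qed

lemma Ppowi_val: "k > 0 ==> q : R ==> P powi k * q : R & val (P powi k * q) = 0"
proof -
 assume k: "k > 0" and q: "q : R"
 have "P powi k = P * P powi (k - 1)" using k by (simp add: power_int_minus_left power_int_diff)
 moreover have "P powi (k - 1) * q : R" using Ppowi_in[of "k - 1"] q k Rloc_mult by simp
 ultimately show ?thesis using Rloc_mult[where q = P and z = x0 and r = "P powi (k - 1) * q"] by (simp add: mult.assoc)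
qed

end

section \<open>The twisted dual in coordinates\<close>

lemma twisted_dual_simps [simp]:
 "add (twisted_dual K F rh) = (%e e' f. e f + e' f)" "ring.zero (twisted_dual K F rh) = (%_. 0)"
 "smult (twisted_dual K F rh) = (%q e f. q * e f)"
 by (simp_all add: twisted_dual_def)

text \<open>The matrix of \<open>T\<close>, with entries moved along \<open>h\<close>, acting on
  coordinate vectors. Basis elements are their own indices, hence the term
  \<open>T b\<close>.\<close>

definition extm :: "(complex poly => 'a::comm_ring_1) => ('m => 'm => complex poly) => ('m => 'm) => ('m => 'a) => 'm => 'a" where
 "extm h crd T v i = (SUM b:{b. v b ~= 0}. v b * h (crd (T b) i))"

lemma extm_superset: "finite J ==> {b. v b ~= 0} <= J ==> extm h crd T v i = (SUM b:J. v b * h (crd (T b) i))"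
 unfolding extm_def by (rule sum.mono_neutral_left) auto

lemma (in based) frag_support:
 assumes "pkeys a <= X \<times> carrier M"
 shows "finite (UN p:pkeys a. {i. crd (snd p) i ~= 0})"
 and "(UN p:pkeys a. {i. crd (snd p) i ~= 0}) <= I"
proof -
 have c: "snd p : carrier M" if "p : pkeys a" for p using assms that by auto
 show "finite (UN p:pkeys a. {i. crd (snd p) i ~= 0})"
 using crd_finite[OF c] by (intro finite_UN_I) auto
 show "(UN p:pkeys a. {i. crd (snd p) i ~= 0}) <= I"
 using crd_outside[OF c] by blast
qed

locale self_ext = based_ext M I crd "%b. b" A h
 for M :: "(complex poly, 'm) module" and I :: "'m set"
 and crd :: "'m => 'm => complex poly"
 and A :: "'a::comm_ring_1 ring" and h :: "complex poly => 'a"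
begin

lemma linear_crd:
 assumes T: "linear_map Oring M M T" and "u : carrier M" "finite J" "{i. crd u i ~= 0} <= J" "J <= I"
 shows "crd (T u) i = (SUM b:J. crd u b * crd (T b) i)"
proof -
 have T1: "!!u. u : carrier M ==> T u : carrier M"
 "!!u v. u : carrier M ==> v : carrier M ==> T (u \<oplus>\<^bsub>M\<^esub> v) = T u \<oplus>\<^bsub>M\<^esub> T v"
 "!!q u. u : carrier M ==> T (q \<odot>\<^bsub>M\<^esub> u) = q \<odot>\<^bsub>M\<^esub> T u"
 using T unfolding linear_map_def by auto
 have z: "crd (T \<zero>\<^bsub>M\<^esub>) i = 0"
 using crd_add[OF T1(1)[OF M.M.zero_closed] T1(1)[OF M.M.zero_closed], of i]
 T1(2)[OF M.M.zero_closed M.M.zero_closed] by simp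
 have "crd (T (\<Oplus>\<^bsub>M\<^esub>b\<in>J'. crd u b \<odot>\<^bsub>M\<^esub> b)) i = (SUM b:J'. crd u b * crd (T b) i)" if "J' <= J" for J'
 using finite_subset[OF that assms(3)] that
 proof (induction J')
 case empty
 then show ?case using z by simp
 next
 case (insert b J')
 have f: "(%b. crd u b \<odot>\<^bsub>M\<^esub> b) : J' \<rightarrow> carrier M" "crd u b \<odot>\<^bsub>M\<^esub> b : carrier M" "b : carrier M"
 using insert.prems assms(5) bas_in by auto
 show ?case
 unfolding M.M.finsum_insert[OF insert.hyps f(1,2)] T1(2)[OF f(2) M.M.finsum_closed[OF f(1)]]
 crd_add[OF T1(1)[OF f(2)] T1(1)[OF M.M.finsum_closed[OF f(1)]]]
 unfolding T1(3)[OF f(3)] crd_smult[OF T1(1)[OF f(3)]]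
 using insert by simp
 qed
 from this[OF order_refl] reconstruct[OF assms(2-5)] show ?thesis by simp
qed

lemma extm_frag:
 assumes T: "linear_map Oring M M T" and a: "pkeys a <= carrier A \<times> carrier M"
 shows "fsum (%(u, v). u * h (crd (T v) i)) a = extm h crd T (fc a) i"
proof -
 define J where "J = (UN p:pkeys a. {i. crd (snd p) i ~= 0})"
 have J: "finite J" "J <= I" unfolding J_def by (rule frag_support[OF a])+
 have Ja: "{i. crd (snd p) i ~= 0} <= J" if "p : pkeys a" for p using that unfolding J_def by blast
 have s: "{b. fc a b ~= 0} <= J"
 proof
 fix b assume b: "b : {b. fc a b ~= 0}"
 show "b : J"
 proof (rule ccontr)
 assume "b ~: J"
 then have "crd (snd p) b = 0" if "p : pkeys a" for p using Ja[OF that] by blast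
 then have "fc a b = fsum (%_. 0) a" unfolding fcoord_def by (intro fsum_cong) (auto simp: split_beta)
 then show False using b by (simp add: fsum_def)
 qed
 qed
 have "fsum (%(u, v). u * h (crd (T v) i)) a = fsum (%p. SUM b:J. h (crd (T b) i) * (case p of (u, v) => u * h (crd v b))) a"
 proof (rule fsum_cong)
 fix p assume p: "p : pkeys a"
 obtain u v where uv: "p = (u, v)" "v : carrier M" using p a by (cases p) auto
 have "crd (T v) i = (SUM b:J. crd v b * crd (T b) i)"
 by (rule linear_crd[OF T uv(2) J(1) _ J(2)]) (use Ja[OF p] uv in simp)
 then show "(case p of (u, v) => u * h (crd (T v) i)) = (SUM b:J. h (crd (T b) i) * (case p of (u, v) => u * h (crd v b)))"
 by (simp add: uv h_sum h_mult sum_distrib_left mult_ac)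
 qed
 also have "... = (SUM b:J. h (crd (T b) i) * fc a b)"
 by (simp add: fsum_sum_fun fsum_cmult fcoord_def)
 also have "... = extm h crd T (fc a) i" unfolding extm_superset[OF J(1) s] by (simp add: mult.commute)
 finally show ?thesis .
qed

lemma base_map_class:
 assumes T: "linear_map Oring M M T" and a: "pkeys a <= carrier A \<times> carrier M"
 shows "base_map A h M (%q. q) T (cls a) = cls (frag_extend (%(u, v). frag_of (u, T v)) a)"
 "pkeys (frag_extend (%(u, v). frag_of (u, T v)) a) <= carrier A \<times> carrier M"
proof -
 have T1: "!!u. u : carrier M ==> T u : carrier M"
 "!!u v. u : carrier M ==> v : carrier M ==> T (u \<oplus>\<^bsub>M\<^esub> v) = T u \<oplus>\<^bsub>M\<^esub> T v"
 "!!q u. u : carrier M ==> T (q \<odot>\<^bsub>M\<^esub> u) = q \<odot>\<^bsub>M\<^esub> T u"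
 using T unfolding linear_map_def by auto
 have bal: "frag_of (h r * u, T v) - frag_of (u, T (r \<odot>\<^bsub>M\<^esub> v)) : rel" if "u : carrier A" "v : carrier M" for r u v
 using T.rel_smult[of r u "T v"] that by (simp add: T1)
 note tm = tensor_map_class[OF T.tensor_pair_axioms T.tensor_pair_axioms, of "%q. q" T a]
 show "base_map A h M (%q. q) T (cls a) = cls (frag_extend (%(u, v). frag_of (u, T v)) a)"
 by (rule tm(1)) (use bal a T1 in simp_all)
 show "pkeys (frag_extend (%(u, v). frag_of (u, T v)) a) <= carrier A \<times> carrier M"
 using tm(2) bal a T1 by simp
qed

lemma tc_base_map:
 assumes T: "linear_map Oring M M T" and t: "t : carrier BC"
 shows "base_map A h M (%q. q) T t : carrier BC" "tc (base_map A h M (%q. q) T t) = extm h crd T (tc t)"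
proof -
 obtain a where a: "t = cls a" "pkeys a <= carrier A \<times> carrier M" using BC_cases[OF t] by metis
 show "base_map A h M (%q. q) T t : carrier BC"
 unfolding a(1) base_map_class(1)[OF T a(2)] using base_map_class(2)[OF T a(2)] by simp
 show "tc (base_map A h M (%q. q) T t) = extm h crd T (tc t)"
 unfolding a(1) base_map_class(1)[OF T a(2)] tc_class
 by (rule ext) (simp add: fc_extend extm_frag[OF T a(2)])
qed

lemma extm_fin_supp:
 assumes T: "linear_map Oring M M T" and v: "v : fin_supp I (carrier A)"
 shows "extm h crd T v : fin_supp I (carrier A)"
 using tc_base_map[OF T mk(1)[OF v]] mk(2)[OF v] tc_in by metis

end

locale adapted = fam_rep K F rh
 for K :: "(complex^'n^'n) set" and F :: "(complex poly, 'f) module" (structure) and rh +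
 fixes B :: "'f set" and crd :: "'f => 'f => complex poly" and Bs :: "'f set => 'f set"
 assumes based_F: "based F B crd (%b. b)"
 and B_def: "B = (UN U:isotypic_summands K (as_complex F) rh. Bs U)"
 and Bs: "!!U. U : isotypic_summands K (as_complex F) rh ==> finite (Bs U) & Bs U <= U & U = Sp F (Bs U)"
 and Bs_disj: "!!U U'. U : isotypic_summands K (as_complex F) rh ==> U' : isotypic_summands K (as_complex F) rh ==>
 U ~= U' ==> Bs U \<inter> Bs U' = {}"
begin

sublocale gF: self_ext F B crd Kfield to_fract
 by (intro self_ext.intro based_ext.intro based_F Kfield_ext)

abbreviation "D \<equiv> twisted_dual K F rh"
abbreviation "\<U> \<equiv> isotypic_summands K V rh"

definition "crdD e i = (if i : B then e i else 0)" for e :: "'f => complex poly"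
text \<open>The dual basis: the conjugation makes the coordinate functional conjugate-linear, as the
  twisted dual requires.\<close>

definition "basD i = (%f. if f : carrier F then conj_poly (crd f i) else 0)"

lemma D_iff: "e : carrier D \<longleftrightarrow> (ALL f. f ~: carrier F --> e f = 0)
 & (ALL f:carrier F. ALL f':carrier F. e (f \<oplus> f') = e f + e f')
 & (ALL q. ALL f:carrier F. e (q \<odot> f) = conj_poly q * e f) & finite {U : \<U>. EX f:U. e f ~= 0}"
 by (simp add: twisted_dual_def)

lemma D_expand:
 assumes e: "e : carrier D" and f: "f : carrier F" "finite J" "{i. crd f i ~= 0} <= J" "J <= B"
 shows "e f = (SUM i:J. conj_poly (crd f i) * e i)"
proof -
 have eD: "!!f f'. f : carrier F ==> f' : carrier F ==> e (f \<oplus> f') = e f + e f'"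
 "!!q f. f : carrier F ==> e (q \<odot> f) = conj_poly q * e f" using e unfolding D_iff by blast+
 have z: "e \<zero> = 0" using eD(1)[of \<zero> \<zero>] by simp
 have "e (\<Oplus>i\<in>J'. crd f i \<odot> i) = (SUM i:J'. conj_poly (crd f i) * e i)" if "J' <= J" for J'
 using finite_subset[OF that f(2)] that
 proof (induction J')
 case empty
 then show ?case using z by simp
 next
 case (insert b J')
 have fc: "(%b. crd f b \<odot> b) : J' \<rightarrow> carrier F" "crd f b \<odot> b : carrier F" "b : carrier F"
 using insert.prems f(4) gF.bas_in by auto
 show ?case
 unfolding F.M.finsum_insert[OF insert.hyps fc(1,2)] eD(1)[OF fc(2) F.M.finsum_closed[OF fc(1)]] eD(2)[OF fc(3)]
 using insert by simp
 qed
 from this[OF order_refl] gF.reconstruct[OF f] show ?thesis by simp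
qed

lemma crd_summand: assumes "U : \<U>" "f : U" "crd f i ~= 0" shows "i : Bs U"
proof -
 have b: "finite (Bs U)" "Bs U <= B" using Bs[OF assms(1)] B_def assms(1) by auto
 obtain c where "f = (\<Oplus>b\<in>Bs U. c b \<odot> b)" using Bs[OF assms(1)] assms(2) unfolding Sp_def LC_def by blast
 then show ?thesis using gF.crd_mk(2)[OF b, of c i] assms(3) by (auto split: if_splits)
qed

lemma summand_sub: "U : \<U> ==> U <= carrier F"
 using isotyp_osubmod F.submodD(1) by (auto simp: V.isotypic_summands_eq)

lemma mem_D:
 assumes "!!f. f ~: carrier F ==> e f = 0"
 "!!f f'. f : carrier F ==> f' : carrier F ==> e (f \<oplus> f') = e f + e f'"
 "!!q f. f : carrier F ==> e (q \<odot> f) = conj_poly q * e f"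
 "finite {U : \<U>. EX f:U. e f ~= 0}"
 shows "e : carrier D"
 unfolding D_iff using assms by blast

lemma basD_in: assumes "i : B" shows "basD i : carrier D"
proof (rule mem_D)
 obtain U where U: "U : \<U>" "i : Bs U" using assms B_def by blast
 have "{U' : \<U>. EX f:U'. basD i f ~= 0} <= {U}"
 proof
 fix U' assume "U' : {U' : \<U>. EX f:U'. basD i f ~= 0}"
 then obtain f where f: "U' : \<U>" "f : U'" "crd f i ~= 0" by (auto simp: basD_def split: if_splits)
 then have "i : Bs U'" using crd_summand by blast
 then show "U' : {U}" using Bs_disj[OF U(1) f(1)] U(2) by blast
 qed
 then show "finite {U : \<U>. EX f:U. basD i f ~= 0}" using finite_subset by blast
qed (auto simp: basD_def gF.crd_add gF.crd_smult)

lemma module_D: "Module.module Oring D"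
proof (rule moduleI)
 have sub: "finite {U : \<U>. EX f:U. g f ~= 0}" if "e : carrier D" "e' : carrier D"
 "!!f. g f ~= 0 ==> e f ~= 0 | e' f ~= 0" for e e' g :: "'f => complex poly"
 proof (rule finite_subset)
 show "{U : \<U>. EX f:U. g f ~= 0} <= {U : \<U>. EX f:U. e f ~= 0} \<union> {U : \<U>. EX f:U. e' f ~= 0}"
 using that(3) by blast
 show "finite ({U : \<U>. EX f:U. e f ~= 0} \<union> {U : \<U>. EX f:U. e' f ~= 0})"
 using that(1,2) unfolding D_iff by blast
 qed
 have sm: "(%f. q * e f) : carrier D" if "e : carrier D" for q e
 by (rule mem_D) (use that sub[OF that that, of "%f. q * e f"] in \<open>auto simp: D_iff algebra_simps\<close>)
 show "abelian_group D"
 proof (rule abelian_groupI)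
 fix e e' assume *: "e : carrier D" "e' : carrier D"
 have "finite {U : \<U>. EX f:U. e f + e' f ~= 0}" by (rule sub[OF *]) auto
 then have "(%f. e f + e' f) : carrier D"
 by (intro mem_D) (use * in \<open>auto simp: D_iff distrib_left\<close>)
 then show "e \<oplus>\<^bsub>D\<^esub> e' : carrier D" by simp
 next
 show "\<zero>\<^bsub>D\<^esub> : carrier D" unfolding twisted_dual_simps by (rule mem_D) auto
 fix e assume "e : carrier D"
 then show "EX y:carrier D. y \<oplus>\<^bsub>D\<^esub> e = \<zero>\<^bsub>D\<^esub>"
 using sm[of e "-1"] by (intro bexI[of _ "%f. -1 * e f"]) auto
 qed (auto simp: algebra_simps)
 show "q \<odot>\<^bsub>D\<^esub> e : carrier D" if "e : carrier D" for q e using sm[OF that] by simp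
qed (auto simp: algebra_simps)

text \<open>Finite rank of the K-types enters here: a functional that vanishes on all but finitely
  many summands is nonzero on only finitely many elements of \<open>B\<close>, so it is a finite
  combination of the dual basis.\<close>

lemma based_D: "based D B crdD basD"
proof (rule based.intro[OF module_D])
 fix e assume e: "e : carrier D"
 have "{i. crdD e i ~= 0} <= (UN U:{U : \<U>. EX f:U. e f ~= 0}. Bs U)"
 proof
 fix i assume "i : {i. crdD e i ~= 0}"
 then have i: "i : B" "e i ~= 0" by (auto simp: crdD_def split: if_splits)
 then obtain U where "U : \<U>" "i : Bs U" using B_def by blast
 then show "i : (UN U:{U : \<U>. EX f:U. e f ~= 0}. Bs U)" using Bs i by blast
 qed
 moreover have "finite (UN U:{U : \<U>. EX f:U. e f ~= 0}. Bs U)"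
 using e Bs unfolding D_iff by blast
 ultimately show "finite {i. crdD e i ~= 0}" by (rule finite_subset)
next
 fix e e' assume e: "e : carrier D" "e' : carrier D" "crdD e = crdD e'"
 then have "e i = e' i" if "i : B" for i using that unfolding crdD_def by (metis (full_types))
 then have "e f = e' f" if f: "f : carrier F" for f
 proof -
 have J: "finite {i. crd f i ~= 0}" "{i. crd f i ~= 0} <= B" using gF.crd_finite gF.crd_outside f by auto
 show ?thesis unfolding D_expand[OF e(1) f J(1) order_refl J(2)] D_expand[OF e(2) f J(1) order_refl J(2)]
 using J \<open>!!i. i : B ==> e i = e' i\<close> by (intro sum.cong) auto
 qed
 moreover have "e f = e' f" if "f ~: carrier F" for f using e(1,2) that unfolding D_iff by metis
 ultimately show "e = e'" by blast
next
 show "basD i : carrier D" if "i : B" for i using basD_in[OF that] .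
 show "crdD (basD i) j = (if j = i then 1 else 0)" if "i : B" for i j
 using that gF.crd_bas[of j i] gF.bas_in[of j] by (auto simp: crdD_def basD_def)
qed (auto simp: crdD_def)

sublocale gD: based_ext D B crdD basD Kfield to_fract
 by (intro based_ext.intro based_D Kfield_ext)

end

text \<open>The evaluation of the twisted dual on \<open>F\<close>, written in dual bases; this is
  the reason for the conjugation in the second argument.\<close>

definition dot :: "('i => complex poly fract) => ('i => complex poly fract) => complex poly fract" where
 "dot u v = (SUM b:{b. v b ~= 0}. u b * conj_fract (v b))"

lemma dot_superset: "finite J ==> {b. v b ~= 0} <= J ==> dot u v = (SUM b:J. u b * conj_fract (v b))"
 unfolding dot_def by (rule sum.mono_neutral_left) auto

context adapted
begin

definition pair_frag :: "(complex poly fract \<times> ('f => complex poly) \<Rightarrow>\<^sub>0 int) => (complex poly fract \<times> 'f \<Rightarrow>\<^sub>0 int) => complex poly fract" where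
 "pair_frag a b = fsum (%(q, e). fsum (%(r, f). q * to_fract (e f) * conj_fract r) b) a"

lemma pair_frag_dot:
 assumes a: "pkeys a <= UNIV \<times> carrier D" and b: "pkeys b <= UNIV \<times> carrier F"
 shows "pair_frag a b = dot (gD.fc a) (gF.fc b)"
proof -
 define J where "J = (UN p:pkeys b. {i. crd (snd p) i ~= 0})"
 have J: "finite J" "J <= B" unfolding J_def by (rule gF.frag_support[OF b])+
 have Jb: "{i. crd (snd p) i ~= 0} <= J" if "p : pkeys b" for p using that unfolding J_def by blast
 have s: "{i. gF.fc b i ~= 0} <= J"
 proof
 fix i assume i: "i : {i. gF.fc b i ~= 0}"
 show "i : J"
 proof (rule ccontr)
 assume "i ~: J"
 then have "crd (snd p) i = 0" if "p : pkeys b" for p using Jb[OF that] by blast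
 then have "gF.fc b i = fsum (%_. 0) b" unfolding fcoord_def by (intro fsum_cong) (auto simp: split_beta)
 then show False using i by (simp add: fsum_def)
 qed
 qed
 have conj_fc: "conj_fract (gF.fc b i) = fsum (%(r, f). conj_fract r * to_fract (conj_poly (crd f i))) b" for i
 unfolding fcoord_def by (subst fsum_hom) (auto intro!: fsum_cong)
 have inner: "fsum (%(r, f). q * to_fract (e f) * conj_fract r) b
 = (SUM i:J. q * to_fract (crdD e i) * conj_fract (gF.fc b i))" if e: "e : carrier D" for q e
 proof -
 have "fsum (%(r, f). q * to_fract (e f) * conj_fract r) b
 = fsum (%p. SUM i:J. q * to_fract (crdD e i) * (case p of (r, f) => conj_fract r * to_fract (conj_poly (crd f i)))) b"
 proof (rule fsum_cong)
 fix p assume p: "p : pkeys b"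
 obtain r f where rf: "p = (r, f)" "f : carrier F" using p b by (cases p) auto
 have "e f = (SUM i:J. conj_poly (crd f i) * e i)"
 by (rule D_expand[OF e rf(2) J(1) _ J(2)]) (use Jb[OF p] rf in simp)
 also have "... = (SUM i:J. conj_poly (crd f i) * crdD e i)"
 using J(2) by (intro sum.cong) (auto simp: crdD_def)
 finally have "to_fract (e f) = (SUM i:J. to_fract (conj_poly (crd f i)) * to_fract (crdD e i))"
 by (simp add: gF.h_sum)
 then show "(case p of (r, f) => q * to_fract (e f) * conj_fract r)
 = (SUM i:J. q * to_fract (crdD e i) * (case p of (r, f) => conj_fract r * to_fract (conj_poly (crd f i))))"
 by (simp add: rf sum_distrib_left sum_distrib_right mult_ac)
 qed
 then show ?thesis by (simp add: fsum_sum_fun fsum_cmult conj_fc)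
 qed
 have "pair_frag a b = fsum (%p. SUM i:J. conj_fract (gF.fc b i) * (case p of (q, e) => q * to_fract (crdD e i))) a"
 unfolding pair_frag_def
 proof (rule fsum_cong)
 fix p assume p: "p : pkeys a"
 obtain q e where qe: "p = (q, e)" "e : carrier D" using p a by (cases p) auto
 show "(case p of (q, e) => fsum (%(r, f). q * to_fract (e f) * conj_fract r) b)
 = (SUM i:J. conj_fract (gF.fc b i) * (case p of (q, e) => q * to_fract (crdD e i)))"
 using inner[OF qe(2), of q] by (simp add: qe(1) mult_ac)
 qed
 also have "... = (SUM i:J. conj_fract (gF.fc b i) * gD.fc a i)"
 by (simp add: fsum_sum_fun fsum_cmult fcoord_def)
 also have "... = dot (gD.fc a) (gF.fc b)" unfolding dot_superset[OF J(1) s] by (simp add: mult.commute)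
 finally show ?thesis .
qed

lemma dual_eval_eq_frag:
 "(\<Sum>(q, e)\<in>pkeys a. \<Sum>(r, f)\<in>pkeys b.
 of_int (Poly_Mapping.lookup a (q, e) * Poly_Mapping.lookup b (r, f)) * (q * to_fract (e f) * conj_fract r)) = pair_frag a b"
 unfolding pair_frag_def fsum_def by (simp add: split_beta sum_distrib_left mult_ac)

text \<open>All choices of representatives give the same value, which is what the definite
  description in \<open>dual_eval\<close> needs.\<close>

lemma dual_eval_dot:
 assumes u: "u : carrier (generic D)" and t: "t : carrier (generic F)"
 shows "dual_eval u t = dot (gD.tc u) (gF.tc t)"
 unfolding dual_eval_def dual_eval_eq_frag
proof (rule the_equality)
 have eq: "pair_frag a b = dot (gD.tc u) (gF.tc t)" if "a : u" "b : t" for a b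
 proof -
 have "pkeys a <= UNIV \<times> carrier D" "pkeys b <= UNIV \<times> carrier F"
 using gD.T.mem_tensor_keys(1)[of u a] gF.T.mem_tensor_keys(1)[of t b] u t that by simp_all
 then show ?thesis using pair_frag_dot gD.tc_mem[OF u that(1)] gF.tc_mem[OF t that(2)] by simp
 qed
 obtain a b where "a : u" "b : t" using gD.BC_cases[OF u] gF.BC_cases[OF t] by metis
 then show "EX a:u. EX b:t. dot (gD.tc u) (gF.tc t) = pair_frag a b" using eq by metis
 show "v = dot (gD.tc u) (gF.tc t)" if "EX a:u. EX b:t. v = pair_frag a b" for v using that eq by metis
qed

text \<open>Equivariance of a generic isomorphism forces the contragredient operators to preserve the twisted
 dual: the coset of the image contains representatives involving any given functional with coefficient 0.\<close>

lemma dual_operator_closed: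
 assumes t: "t : carrier (generic D)" and s: "base_map Kfield to_fract D (%q. q) \<delta> t : carrier (generic D)"
 and e: "e : carrier D"
 shows "\<delta> e : carrier D"
proof -
 obtain a where a: "t = gD.cls a" "pkeys a <= UNIV \<times> carrier D" "a : t" using gD.BC_cases[OF t] by auto
 have a': "a + frag_of (0, e) : t" unfolding a(1) gD.T.mem_class using gD.frag_zero_left[OF e] by simp
 let ?x = "frag_extend (%(u, v). frag_of (u, \<delta> v))"
 have "?x b : base_map Kfield to_fract D (%q. q) \<delta> t" if "b : t" for b
 unfolding tensor_map_def using that gD.T.self_mem_class[of "?x b"] by blast
 then have k: "pkeys (?x b) <= UNIV \<times> carrier D" if "b : t" for b
 using gD.T.mem_tensor_keys(1)[of "base_map Kfield to_fract D (%q. q) \<delta> t" "?x b"] s that by simp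
 have "frag_of (0, \<delta> e) = ?x (a + frag_of (0, e)) - ?x a" by (simp add: frag_extend_add)
 then have "pkeys (frag_of (0 :: complex poly fract, \<delta> e)) <= UNIV \<times> carrier D"
 using k[OF a'] k[OF a(3)] keys_diff[of "?x (a + frag_of (0, e))" "?x a"] by auto
 then show ?thesis by (simp add: keys_frag_of)
qed

text \<open>The scalar \<open>c\<close> is -1 for the Lie algebra and 1 for the group. Linearity of
  \<delta> on the dual is not assumed but derived from \<open>adj\<close>.\<close>

lemma dual_eval_adjoint:
 assumes T: "linear_map Oring F F T" and u: "u : carrier (generic D)" and t: "t : carrier (generic F)"
 and \<delta>: "!!e. e : carrier D ==> \<delta> e : carrier D"
 and adj: "!!e f. e : carrier D ==> f : carrier F ==> \<delta> e f = c * e (T f)"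
 shows "dual_eval (base_map Kfield to_fract D (%q. q) \<delta> u) t
 = to_fract c * dual_eval u (base_map Kfield to_fract F (%q. q) T t)"
proof -
 obtain a where a: "u = gD.cls a" "pkeys a <= UNIV \<times> carrier D" using gD.BC_cases[OF u] by auto
 obtain b where b: "t = gF.cls b" "pkeys b <= UNIV \<times> carrier F" using gF.BC_cases[OF t] by auto
 have TF: "T f : carrier F" if "f : carrier F" for f using T that unfolding linear_map_def by auto
 let ?a = "frag_extend (%(u, v). frag_of (u, \<delta> v)) a"
 let ?b = "frag_extend (%(u, v). frag_of (u, T v)) b"
 have \<delta>_out: "\<delta> e f = 0" if "e : carrier D" "f ~: carrier F" for e f using \<delta>[OF that(1)] that(2) unfolding D_iff by blast
 have \<delta>_add: "\<delta> (%f. e f + e' f) = (%f. \<delta> e f + \<delta> e' f)" if "e : carrier D" "e' : carrier D" for e e'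
 proof
 fix f
 have "(%f. e f + e' f) : carrier D" using gD.M.M.a_closed[OF that] by simp
 then show "\<delta> (%f. e f + e' f) f = \<delta> e f + \<delta> e' f"
 using that adj \<delta>_out by (cases "f : carrier F") (simp_all add: algebra_simps)
 qed
 have \<delta>_sm: "\<delta> (%f. r * e f) = (%f. r * \<delta> e f)" if "e : carrier D" for r e
 proof
 fix f
 have "(%f. r * e f) : carrier D" using gD.M.smult_closed[of r e] that by simp
 then show "\<delta> (%f. r * e f) f = r * \<delta> e f"
 using that adj \<delta>_out by (cases "f : carrier F") (simp_all add: algebra_simps)
 qed
 have bal: "frag_of (to_fract r * q, \<delta> e) - frag_of (q, \<delta> (%f. r * e f)) : gD.rel" if "e : carrier D" for r q e
 using gD.T.rel_smult[of r q "\<delta> e"] \<delta>[OF that] by (simp add: \<delta>_sm[OF that])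
 note tm = tensor_map_class[OF gD.T.tensor_pair_axioms gD.T.tensor_pair_axioms, of "%q. q" \<delta> a]
 have 1: "base_map Kfield to_fract D (%q. q) \<delta> u = gD.cls ?a"
 unfolding a(1) by (rule tm(1)) (use bal a(2) \<delta> \<delta>_add in simp_all)
 have 2: "pkeys ?a <= UNIV \<times> carrier D"
 using tm(2) bal a(2) \<delta> \<delta>_add by simp
 note 3 = gF.base_map_class[OF T, of b]
 have uc: "gD.cls ?a : carrier (generic D)" "gF.cls ?b : carrier (generic F)"
 using 2 3(2) b(2) by simp_all
 have "dual_eval (base_map Kfield to_fract D (%q. q) \<delta> u) t = pair_frag ?a b"
 unfolding 1 dual_eval_dot[OF uc(1) t] gD.tc_class unfolding b(1) gF.tc_class using pair_frag_dot[OF 2 b(2)] by simp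
 also have "... = to_fract c * pair_frag a ?b"
 proof -
 have "pair_frag ?a b = fsum (%p. to_fract c * (case p of (q, e) => fsum (%(r, f). q * to_fract (e f) * conj_fract r) ?b)) a"
 unfolding pair_frag_def fsum_extend
 proof (rule fsum_cong)
 fix p assume p: "p : pkeys a"
 obtain q e where qe: "p = (q, e)" "e : carrier D" using p a by (cases p) auto
 have "fsum (%(r, f). q * to_fract (\<delta> e f) * conj_fract r) b
 = fsum (%p. to_fract c * (case p of (r, f) => q * to_fract (e (T f)) * conj_fract r)) b"
 proof (rule fsum_cong)
 fix y assume "y : pkeys b"
 then obtain r f where "y = (r, f)" "f : carrier F" using b by (cases y) auto
 then show "(case y of (r, f) => q * to_fract (\<delta> e f) * conj_fract r) = to_fract c * (case y of (r, f) => q * to_fract (e (T f)) * conj_fract r)"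
 using adj[OF qe(2)] by simp
 qed
 also have "... = to_fract c * fsum (%(r, f). q * to_fract (e (T f)) * conj_fract r) b"
 by (simp add: fsum_cmult)
 finally show "fsum (%(q, e). fsum (%(r, f). q * to_fract (e f) * conj_fract r) b) (case p of (u, v) => frag_of (u, \<delta> v))
 = to_fract c * (case p of (q, e) => fsum (%p. fsum (%(r, f). q * to_fract (e f) * conj_fract r) (case p of (u, v) => frag_of (u, T v))) b)"
 by (simp add: qe(1) case_prod_unfold)
 qed
 then show ?thesis by (simp add: fsum_cmult pair_frag_def)
 qed
 also have "pair_frag a ?b = dual_eval u (base_map Kfield to_fract F (%q. q) T t)"
 unfolding b(1) 3(1)[OF b(2)[folded type_ring_simps(1)]] dual_eval_dot[OF u uc(2)] gF.tc_class
 unfolding a(1) gD.tc_class using pair_frag_dot[OF a(2), of ?b] 3(2) b(2) by simp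
 finally show ?thesis .
qed

end

section \<open>Sections of the constant group\<close>

lemma matrix_inv_unique_ring:
 fixes A :: "'a::comm_ring_1^'n^'n"
 assumes "A ** A' = mat 1" "A' ** A = mat 1"
 shows "matrix_inv A = A'"
proof -
 have "A ** matrix_inv A = mat 1 & matrix_inv A ** A = mat 1"
 unfolding matrix_inv_def by (rule someI[of _ A']) (use assms in simp)
 then show ?thesis using assms by (metis matrix_mul_assoc matrix_mul_lid matrix_mul_rid)
qed

lemma ev_mat_mult: "ev_mat z (A ** B) = ev_mat z A ** ev_mat z B"
 by (simp add: ev_mat_def matrix_matrix_mult_def vec_eq_iff poly_sum)

lemma ev_mat_1: "ev_mat z (mat 1) = mat 1"
 by (simp add: ev_mat_def mat_def vec_eq_iff)

lemma ev_mat_eqI: "(!!z. ev_mat z A = ev_mat z B) ==> A = B"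
proof -
 assume *: "!!z. ev_mat z A = ev_mat z B"
 have "A $ i $ j = B $ i $ j" for i j
 by (rule conj_poly_eqI) (use * in \<open>simp add: ev_mat_def vec_eq_iff\<close>)
 then show ?thesis by (simp add: vec_eq_iff)
qed

lemma poly_det: "poly (det A) z = det (ev_mat z A)"
 by (simp add: det_def ev_mat_def poly_sum poly_prod)

lemma ev_const_mat [simp]: "ev_mat z (const_mat k) = k"
 by (simp add: ev_mat_def const_mat_def vec_eq_iff)

definition sect_poly :: "(complex^'n^'n => complex) => complex poly^'n^'n => complex poly" where
 "sect_poly c G = (THE q. ALL z. poly q z = c (ev_mat z G))"

text \<open>The critical case is the inverse determinant: a polynomial matrix invertible at every
  point has a determinant without zeros, which is constant by the fundamental theorem of
  algebra.\<close>

lemma sect_poly_ex: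
 fixes G :: "complex poly^'n^'n"
 assumes inv: "!!z. invertible (ev_mat z G)" and "c : regular_functions"
 shows "EX q. ALL z. poly q z = c (ev_mat z G)"
 using assms(2)
proof induction
 case (const c)
 show ?case by (intro exI[of _ "[:c:]"]) simp
next
 case (entry a b)
 show ?case by (intro exI[of _ "G $ a $ b"]) (simp add: ev_mat_def)
next
 case inverse_det
 have nz: "poly (det G) z ~= 0" for z using inv[of z] by (simp add: poly_det invertible_det_nz)
 then have "constant (poly (det G))" using fundamental_theorem_of_algebra[of "det G"] by blast
 then have "inverse (det (ev_mat z G)) = inverse (poly (det G) 0)" for z
 by (simp add: constant_def flip: poly_det)
 then show ?case by (intro exI[of _ "[:inverse (poly (det G) 0):]"]) simp
next
 case (add c d)
 then obtain q r where "ALL z. poly q z = c (ev_mat z G)" "ALL z. poly r z = d (ev_mat z G)" by blast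
 then show ?case by (intro exI[of _ "q + r"]) simp
next
 case (mult c d)
 then obtain q r where "ALL z. poly q z = c (ev_mat z G)" "ALL z. poly r z = d (ev_mat z G)" by blast
 then show ?case by (intro exI[of _ "q * r"]) simp
qed

lemma poly_sect_poly:
 assumes "!!z. invertible (ev_mat z G)" "c : regular_functions"
 shows "poly (sect_poly c G) z = c (ev_mat z G)"
proof -
 have "\<exists>!q. ALL z. poly q z = c (ev_mat z G)"
 using sect_poly_ex[OF assms] conj_poly_eqI by (metis (no_types, lifting))
 from theI'[OF this] show ?thesis unfolding sect_poly_def by blast
qed

context adapted
begin

lemma section_invertible: "G : sections K ==> invertible (ev_mat z G)"
 unfolding sections_def using V.invertible_K by blast

lemma section_mem: "G : sections K ==> ev_mat z G : K"
 unfolding sections_def by blast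

lemma const_section: "k : K ==> const_mat k : sections K"
 unfolding sections_def by simp

lemma expansion_crd:
 assumes e: "expansion K V rh v N c m" and k: "k : K"
 shows "crd (rh k v) b = (\<Sum>i<N. [:c i k:] * crd (m i) b)"
proof -
 have m: "m i : carrier F" if "i < N" for i using e that unfolding expansion_def by simp
 have "rh k v = (\<Oplus>i\<in>{..<N}. [:c i k:] \<odot> m i)"
 using e k unfolding expansion_def finsum_restrict by simp
 then have "crd (rh k v) b = (\<Sum>i<N. crd ([:c i k:] \<odot> m i) b)"
 using m by (simp only:) (rule gF.crd_finsum, auto)
 also have "... = (\<Sum>i<N. [:c i k:] * crd (m i) b)"
 using m by (intro sum.cong) (simp_all only: gF.crd_smult lessThan_iff)
 finally show ?thesis .
qed

text \<open>At a point \<open>z\<close> the coordinates of the sum are those of the group element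
  \<open>ev_mat z G\<close> acting on \<open>v\<close>. Hence two expansions of the coaction give
  the same vector, and the definite description in \<open>section_act\<close> is justified.\<close>

lemma section_act_expansion:
 assumes v: "v : carrier F" and G: "G : sections K" and e: "expansion K V rh v N c m"
 shows "section_act K F rh G v = (\<Oplus>i\<in>{..<N}. sect_poly (c i) G \<odot> m i)"
 and "(\<Oplus>i\<in>{..<N}. sect_poly (c i) G \<odot> m i) : carrier F"
 and "poly (crd (\<Oplus>i\<in>{..<N}. sect_poly (c i) G \<odot> m i) b) z = poly (crd (rh (ev_mat z G) v) b) z"
proof -
 have cl: "(\<Oplus>i\<in>{..<N}. sect_poly (c i) G \<odot> m i) : carrier F" if "expansion K V rh v N c m" for N c m
 by (rule F.M.finsum_closed) (use that in \<open>auto simp: expansion_def\<close>)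
 have ev: "poly (crd (\<Oplus>i\<in>{..<N}. sect_poly (c i) G \<odot> m i) b) z = poly (crd (rh (ev_mat z G) v) b) z"
 if e: "expansion K V rh v N c m" for N c m b z
 proof -
 have m: "m i : carrier F" "c i : regular_functions" if "i < N" for i using e that unfolding expansion_def by auto
 have "crd (\<Oplus>i\<in>{..<N}. sect_poly (c i) G \<odot> m i) b = (\<Sum>i<N. crd (sect_poly (c i) G \<odot> m i) b)"
 by (rule gF.crd_finsum) (use m in auto)
 also have "... = (\<Sum>i<N. sect_poly (c i) G * crd (m i) b)"
 using m by (intro sum.cong) (simp_all only: gF.crd_smult lessThan_iff)
 finally show ?thesis
 unfolding expansion_crd[OF e section_mem[OF G]]
 using m poly_sect_poly[OF section_invertible[OF G]] by (simp add: poly_sum)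
 qed
 show "(\<Oplus>i\<in>{..<N}. sect_poly (c i) G \<odot> m i) : carrier F" using cl[OF e] .
 show "poly (crd (\<Oplus>i\<in>{..<N}. sect_poly (c i) G \<odot> m i) b) z = poly (crd (rh (ev_mat z G) v) b) z" using ev[OF e] .
 have uniq: "(\<Oplus>i\<in>{..<N}. sect_poly (c i) G \<odot> m i) = (\<Oplus>i\<in>{..<N'}. sect_poly (c' i) G \<odot> m' i)"
 if "expansion K V rh v N' c' m'" for N' c' m'
 by (rule gF.crd_inj[OF cl[OF e] cl[OF that]], rule ext, rule conj_poly_eqI) (simp add: ev[OF e] ev[OF that])
 show "section_act K F rh G v = (\<Oplus>i\<in>{..<N}. sect_poly (c i) G \<odot> m i)"
 unfolding section_act_def sect_poly_def[symmetric]
 proof (rule the_equality)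
 show "EX N' c' m'. expansion K V rh v N' c' m' & (\<Oplus>i\<in>{..<N}. sect_poly (c i) G \<odot> m i) = (\<Oplus>i\<in>{..<N'}. sect_poly (c' i) G \<odot> m' i)"
 using e by blast
 fix w assume "EX N c m. expansion K V rh v N c m & w = (\<Oplus>i\<in>{..<N}. sect_poly (c i) G \<odot> m i)"
 then obtain N' c' m' where "expansion K V rh v N' c' m'" "w = (\<Oplus>i\<in>{..<N'}. sect_poly (c' i) G \<odot> m' i)"
 by (elim exE conjE)
 then show "w = (\<Oplus>i\<in>{..<N}. sect_poly (c i) G \<odot> m i)" using uniq[of N' c' m'] by simp
 qed
qed

lemma section_act_closed: "v : carrier F ==> G : sections K ==> section_act K F rh G v : carrier F"
 and section_act_eval: "v : carrier F ==> G : sections K ==>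
 poly (crd (section_act K F rh G v) b) z = poly (crd (rh (ev_mat z G) v) b) z"
proof -
 assume v: "v : carrier F" and G: "G : sections K"
 then have "v : carrier V" by simp
 then obtain N c m where e: "expansion K V rh v N c m" using V.expansion_ex by blast
 show "section_act K F rh G v : carrier F" using section_act_expansion(1,2)[OF v G e] by simp
 show "poly (crd (section_act K F rh G v) b) z = poly (crd (rh (ev_mat z G) v) b) z"
 using section_act_expansion(1,3)[OF v G e] by simp
qed

lemma crd_eval_eqI:
 assumes "u : carrier F" "v : carrier F" "!!z b. poly (crd u b) z = poly (crd v b) z"
 shows "u = v"
 by (rule gF.crd_inj[OF assms(1,2)], rule ext, rule conj_poly_eqI) (rule assms(3))

lemma rho_lin_F: "k : K ==> linear_map Oring F F (rh k)"
 using fam unfolding family_rep_def by blast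

lemma rho_F: "k : K ==> v : carrier F ==> rh k v : carrier F"
 using V.rho_closed by simp

lemma section_act_linear:
 assumes G: "G : sections K"
 shows "linear_map Oring F F (section_act K F rh G)"
 unfolding linear_map_def
proof (intro conjI ballI)
 show "section_act K F rh G : carrier F \<rightarrow> carrier F" using section_act_closed G by auto
 fix u assume u: "u : carrier F"
 show "section_act K F rh G (u \<oplus> v) = section_act K F rh G u \<oplus> section_act K F rh G v" if v: "v : carrier F" for v
 by (rule crd_eval_eqI)
 (use u v G section_act_closed rho_F[OF section_mem[OF G]] V.rho_add[OF section_mem[OF G]] in
 \<open>simp_all add: section_act_eval gF.crd_add\<close>)
 show "section_act K F rh G (q \<odot> u) = q \<odot> section_act K F rh G u" for q
 by (rule crd_eval_eqI)
 (use u G section_act_closed rho_F[OF section_mem[OF G]] rho_osmult[OF section_mem[OF G]] in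
 \<open>simp_all add: section_act_eval gF.crd_smult\<close>)
qed

lemma section_act_const: "k : K ==> v : carrier F ==> section_act K F rh (const_mat k) v = rh k v"
 by (rule crd_eval_eqI) (simp_all add: section_act_closed const_section rho_F section_act_eval)

text \<open>A map linear over polynomials descends to the fiber at \<open>z\<close>, here in terms
  of coordinates.\<close>

lemma linear_eval_cong:
 assumes T: "linear_map Oring F F T" and "u : carrier F" "v : carrier F" "!!b. poly (crd u b) z = poly (crd v b) z"
 shows "poly (crd (T u) i) z = poly (crd (T v) i) z"
proof -
 let ?J = "{i. crd u i ~= 0} \<union> {i. crd v i ~= 0}"
 have J: "finite ?J" "?J <= B" using assms gF.crd_finite gF.crd_outside by auto
 have "crd (T u) i = (SUM b:?J. crd u b * crd (T b) i)" "crd (T v) i = (SUM b:?J. crd v b * crd (T b) i)"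
 by (rule gF.linear_crd[OF T _ J(1) _ J(2)]; use assms in auto)+
 then show ?thesis using assms(4) by (simp add: poly_sum)
qed

lemma section_act_comp_eval:
 assumes "v : carrier F" "G : sections K" "G' : sections K"
 shows "poly (crd (section_act K F rh G (section_act K F rh G' v)) b) z = poly (crd (rh (ev_mat z G) (rh (ev_mat z G') v)) b) z"
 unfolding section_act_eval[OF section_act_closed[OF assms(1,3)] assms(2)]
 by (rule linear_eval_cong[OF rho_lin_F[OF section_mem[OF assms(2)]]])
 (use assms section_act_closed rho_F section_mem section_act_eval in auto)

text \<open>Over polynomials \<open>matrix_inv\<close> is only a choice. The pointwise inverses are
  regular in the entries and therefore form a polynomial matrix, and this two-sided inverse pins the
  choice down.\<close>

lemma section_inverse:
 assumes G: "G : sections K"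
 shows "matrix_inv G : sections K" "ev_mat z (matrix_inv G) = matrix_inv (ev_mat z G)"
proof -
 obtain c :: "'n => 'n => complex^'n^'n => complex" where c: "!!a b. c a b : regular_functions" "!!a b k. invertible k ==> c a b k = matrix_inv k $ a $ b"
 using regular_inv[OF regular_functions.entry] by metis
 define H where "H = (\<chi> a b. sect_poly (c a b) G)"
 have H: "ev_mat z H = matrix_inv (ev_mat z G)" for z
 using poly_sect_poly[OF section_invertible[OF G] c(1)] c(2)[OF section_invertible[OF G]]
 by (simp add: ev_mat_def H_def vec_eq_iff)
 have "G ** H = mat 1" "H ** G = mat 1"
 by (rule ev_mat_eqI, simp add: ev_mat_mult ev_mat_1 H V.matrix_inv_K[OF section_mem[OF G]])+
 then have "matrix_inv G = H" by (rule matrix_inv_unique_ring)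
 then show "ev_mat z (matrix_inv G) = matrix_inv (ev_mat z G)" "matrix_inv G : sections K"
 using H V.inv_K[OF section_mem[OF G]] by (simp_all add: sections_def)
qed

end

section \<open>Twisted invariant pairings\<close>

definition clin :: "(complex, 'v) module => 'v set => ('v => complex) => bool" where
 "clin V W f \<longleftrightarrow> (ALL u:W. ALL v:W. f (u \<oplus>\<^bsub>V\<^esub> v) = f u + f v) & (ALL c. ALL u:W. f (c \<odot>\<^bsub>V\<^esub> u) = cnj c * f u)"

text \<open>A functional vanishing on the common kernel of finitely many others is their
  combination: restrict to the kernel of one of them, and read its coefficient off at a vector where
  it does not vanish.\<close>

lemma (in tmod) functional_span:
 fixes V :: "(complex, 'v) module"
 assumes V: "tmod V" and "finite G" and "submod V W" "!!g. g : G ==> clin V W (\<theta> g)" "clin V W f"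
 "!!w. w : W ==> (!!g. g : G ==> \<theta> g w = 0) ==> f w = 0"
 shows "EX s. ALL w:W. f w = (SUM g:G. s g * \<theta> g w)"
 using assms(2-)
proof (induction G arbitrary: W)
 case empty
 then show ?case by simp
next
 case (insert g0 G)
 interpret V: tmod V by (rule V)
 note WD = V.submodD[OF insert.prems(1)]
 have \<theta>: "\<theta> g (u \<oplus>\<^bsub>V\<^esub> v) = \<theta> g u + \<theta> g v" "\<theta> g (c \<odot>\<^bsub>V\<^esub> u) = cnj c * \<theta> g u"
 if "g : insert g0 G" "u : W" "v : W" for g u v c using insert.prems(2)[OF that(1)] that unfolding clin_def by blast+
 have f: "f (u \<oplus>\<^bsub>V\<^esub> v) = f u + f v" "f (c \<odot>\<^bsub>V\<^esub> u) = cnj c * f u"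
 if "u : W" "v : W" for u v c using insert.prems(3) that unfolding clin_def by blast+
 define W' where "W' = {w : W. \<theta> g0 w = 0}"
 have W': "submod V W'"
 by (rule V.submodI) (use WD \<theta>[of g0] \<theta>(2)[of g0 "\<zero>\<^bsub>V\<^esub>" "\<zero>\<^bsub>V\<^esub>" 0] in \<open>auto simp: W'_def\<close>)
 have "EX s. ALL w:W'. f w = (SUM g:G. s g * \<theta> g w)"
 proof (rule insert.IH[OF W'])
 show "clin V W' (\<theta> g)" if "g : G" for g using \<theta>[of g] that unfolding clin_def W'_def by auto
 show "clin V W' f" using f unfolding clin_def W'_def by auto
 show "f w = 0" if "w : W'" "!!g. g : G ==> \<theta> g w = 0" for w
 using insert.prems(4)[of w] that unfolding W'_def by auto
 qed
 then obtain s where s: "!!w. w : W' ==> f w = (SUM g:G. s g * \<theta> g w)" by blast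
 show ?case
 proof (cases "EX w0:W. \<theta> g0 w0 ~= 0")
 case False
 then have "f w = (SUM g:insert g0 G. s g * \<theta> g w)" if "w : W" for w
 using s[of w] that insert.hyps unfolding W'_def by auto
 then show ?thesis by blast
 next
 case True
 then obtain w0 where w0: "w0 : W" "\<theta> g0 w0 ~= 0" by blast
 define h where "h w = f w - (SUM g:G. s g * \<theta> g w)" for w
 have h: "h (u \<oplus>\<^bsub>V\<^esub> v) = h u + h v" "h (c \<odot>\<^bsub>V\<^esub> u) = cnj c * h u" if "u : W" "v : W" for u v c
 unfolding h_def using f[OF that] \<theta>[OF _ that]
 by (simp_all add: distrib_left sum.distrib sum_distrib_left right_diff_distrib mult.left_commute)
 define s' where "s' = s(g0 := h w0 / \<theta> g0 w0)"
 have "f w = (SUM g:insert g0 G. s' g * \<theta> g w)" if w: "w : W" for w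
 proof -
 \<comment> \<open>The conjugate appears because the functionals are conjugate-linear; with this
   \<open>c\<close> the corrected vector is annihilated by the functional at
   \<open>g0\<close>.\<close>
 define c where "c = - cnj (\<theta> g0 w / \<theta> g0 w0)"
 define w' where "w' = w \<oplus>\<^bsub>V\<^esub> c \<odot>\<^bsub>V\<^esub> w0"
 have cw: "c \<odot>\<^bsub>V\<^esub> w0 : W" using WD(4) w0 by blast
 have "\<theta> g0 w' = \<theta> g0 w + cnj c * \<theta> g0 w0"
 unfolding w'_def using \<theta>(1)[OF insertI1 w cw] \<theta>(2)[OF insertI1 w0(1) w0(1)] by simp
 then have "w' : W'" unfolding W'_def w'_def using w0 WD(3)[OF w cw] by (simp add: c_def)
 then have "h w' = 0" unfolding h_def using s by simp
 then have "h w = - (cnj c * h w0)" unfolding w'_def using h(1)[OF w cw] h(2)[OF w0(1) w0(1)]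
 by (simp add: eq_neg_iff_add_eq_0)
 then have "h w = s' g0 * \<theta> g0 w" by (simp add: c_def s'_def)
 moreover have "(SUM g:G. s' g * \<theta> g w) = (SUM g:G. s g * \<theta> g w)"
 using insert.hyps by (intro sum.cong) (auto simp: s'_def)
 ultimately show ?thesis using insert.hyps by (simp add: h_def algebra_simps)
 qed
 then show ?thesis by blast
 qed
qed

text \<open>For irreducible \<open>W\<close> and \<open>W'\<close> such a \<beta> amounts to an
  isomorphism of \<open>W\<close> with the conjugate dual of \<open>W'\<close>, on which
  \<open>K\<close> acts through \<open>sg\<close>.\<close>

definition twisted_pair where
 "twisted_pair K V rh sg W W' \<beta> \<longleftrightarrow>
 (ALL w:W'. ALL u:W. ALL v:W. \<beta> (u \<oplus>\<^bsub>V\<^esub> v) w = \<beta> u w + \<beta> v w) & (ALL c. ALL u:W. ALL w:W'. \<beta> (c \<odot>\<^bsub>V\<^esub> u) w = c * \<beta> u w)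
 & (ALL u:W. clin V W' (\<beta> u))
 & (ALL k:K. ALL u:W. ALL w:W'. \<beta> (rh k u) (rh (sg k) w) = \<beta> u w) & (EX u:W. EX w:W'. \<beta> u w ~= (0::complex))"

locale twisted_rep = arep K V rh
 for K :: "(complex^'n^'n) set" and V :: "(complex, 'v) module" (structure) and rh +
 fixes sg :: "complex^'n^'n => complex^'n^'n"
 assumes sg_in: "!!k. k : K ==> sg k : K" and sg_inv: "!!k. k : K ==> sg (sg k) = k"
begin

abbreviation "tp \<equiv> twisted_pair K V rh sg"

lemma tpD:
 assumes "tp W W' \<beta>"
 shows "!!u v w. u : W ==> v : W ==> w : W' ==> \<beta> (u \<oplus> v) w = \<beta> u w + \<beta> v w"
 "!!c u w. u : W ==> w : W' ==> \<beta> (c \<odot> u) w = c * \<beta> u w"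
 "!!u v w. u : W ==> v : W' ==> w : W' ==> \<beta> u (v \<oplus> w) = \<beta> u v + \<beta> u w"
 "!!c u w. u : W ==> w : W' ==> \<beta> u (c \<odot> w) = cnj c * \<beta> u w"
 "!!k u w. k : K ==> u : W ==> w : W' ==> \<beta> (rh k u) (rh (sg k) w) = \<beta> u w"
 "EX u:W. EX w:W'. \<beta> u w ~= 0"
 using assms unfolding twisted_pair_def clin_def by blast+

text \<open>Conjugating and exchanging the arguments moves the twist to the other side; this is
  again a twisted pairing because \<open>sg\<close> is an involution.\<close>

lemma tp_sym: "tp W W' \<beta> ==> tp W' W (%w u. cnj (\<beta> u w))" if "srep W" "srep W'"
proof -
 assume tp: "tp W W' \<beta>"
 note D = tpD[OF tp]
 have "cnj (\<beta> (rh (sg k) w) (rh k u)) = cnj (\<beta> w u)" if "k : K" "u : W'" "w : W" for k u w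
 using D(5)[OF sg_in[OF that(1)] that(3,2)] sg_inv[OF that(1)] by simp
 then show ?thesis using D(1-4,6) unfolding twisted_pair_def clin_def by auto
qed

text \<open>The left kernel is a subrepresentation, since every \<open>w\<close> can be written as
  \<open>sg k\<close> applied to a vector of \<open>W'\<close>. It is proper as the pairing is
  nonzero.\<close>

lemma tp_left_kernel:
 assumes W: "irr W" "srep W'" and tp: "tp W W' \<beta>" and u: "u : W" "!!w. w : W' ==> \<beta> u w = 0"
 shows "u = \<zero>"
proof -
 note D = tpD[OF tp] and Ws = irrD(1)[OF W(1)]
 note WD = submodD[OF srepD(1)[OF Ws]]
 define L where "L = {u : W. ALL w:W'. \<beta> u w = 0}"
 have "srep L"
 proof (intro srepI submodI)
 show "L <= carrier V" using WD(1) by (auto simp: L_def)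
 have "\<beta> \<zero> w = 0" if "w : W'" for w using D(2)[OF WD(2) that, of 0] by simp
 then show "\<zero> : L" using WD(2) by (auto simp: L_def)
 fix k u assume k: "k : K" "u : L"
 have "\<beta> (rh k u) w = 0" if w: "w : W'" for w
 proof -
 let ?w = "rh (matrix_inv (sg k)) w"
 have "?w : W'" using srepD(2)[OF W(2) inv_K[OF sg_in[OF k(1)]] w] .
 then have "\<beta> (rh k u) (rh (sg k) ?w) = 0" using D(5)[OF k(1), of u ?w] k(2) by (simp add: L_def)
 moreover have "rh (sg k) ?w = w" using rho_inv'[OF sg_in[OF k(1)]] w srep_sub[OF W(2)] by blast
 ultimately show ?thesis by simp
 qed
 then show "rh k u : L" using srepD(2)[OF Ws k(1)] k(2) by (auto simp: L_def)
 qed (use WD(3,4) D(1,2) in \<open>auto simp: L_def\<close>)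
 then have "L = {\<zero>} | L = W" using irrD(3)[OF W(1)] by (auto simp: L_def)
 moreover have "L ~= W" using D(6) by (auto simp: L_def)
 ultimately have "L = {\<zero>}" by blast
 then show ?thesis using u by (auto simp: L_def)
qed

lemma tp_iso:
 assumes "iso_rep W1 W" "srep W1" "tp W W' \<beta>"
 shows "EX \<beta>'. tp W1 W' \<beta>'"
proof -
 obtain f where f: "bij_betw f W1 W" "linear_map Cfield (V\<lparr>carrier := W1\<rparr>) (V\<lparr>carrier := W\<rparr>) f"
 "ALL k:K. ALL w:W1. f (rh k w) = rh k (f w)" using assms(1) unfolding isomorphic_subreps_def by blast
 have fW: "f w : W" if "w : W1" for w using f(1) that by (auto simp: bij_betw_def)
 have fl: "f (u \<oplus> v) = f u \<oplus> f v" "f (c \<odot> u) = c \<odot> f u" if "u : W1" "v : W1" for u v c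
 using f(2) that unfolding linear_map_def by auto
 note D = tpD[OF assms(3)]
 obtain u w where uw: "u : W" "w : W'" "\<beta> u w ~= 0" using D(6) by blast
 then obtain u1 where "u1 : W1" "f u1 = u" using f(1) by (auto simp: bij_betw_def)
 then have nz: "EX u:W1. EX w:W'. \<beta> (f u) w ~= 0" using uw by blast
 have "tp W1 W' (%u. \<beta> (f u))"
 unfolding twisted_pair_def clin_def
 using nz D(1-5) fW fl f(3) by simp
 then show ?thesis by blast
qed

text \<open>Both \<open>W1\<close> and \<open>W2\<close> embed into the conjugate dual of
  \<open>W'\<close>, and \<open>W2\<close> fills it because its pairing has no right kernel.
  Relating vectors that induce the same functional gives the graph of an isomorphism.\<close>

lemma tp_unique:
 assumes W: "irr W1" "irr W2" "irr W'" and tp1: "tp W1 W' \<beta>1" and tp2: "tp W2 W' \<beta>2"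
 shows "iso_rep W1 W2"
proof -
 note D1 = tpD[OF tp1] and D2 = tpD[OF tp2]
 note S = irrD(1)[OF W(1)] irrD(1)[OF W(2)] irrD(1)[OF W(3)]
 note WD1 = submodD[OF srepD(1)[OF S(1)]] and WD2 = submodD[OF srepD(1)[OF S(2)]] and WD' = submodD[OF srepD(1)[OF S(3)]]
 obtain G where G: "finite G" "G <= W2" "W2 = Sp V G" using irr_fg[OF W(2)] by blast
 have Gc: "G <= carrier V" using G(2) WD2(1) by blast
 have \<beta>2_LC: "\<beta>2 (LC V s G) w = (SUM g:G. s g * \<beta>2 g w)" if w: "w : W'" for s w
 proof -
 have "\<beta>2 (LC V s G') w = (SUM g:G'. s g * \<beta>2 g w) & LC V s G' : W2" if "G' <= G" for G'
 using finite_subset[OF that G(1)] that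
 proof (induction G')
 case empty
 have "\<beta>2 \<zero> w = 0" using D2(2)[OF WD2(2) w, of 0] by simp
 then show ?case using WD2(2) by (simp add: LC_def)
 next
 case (insert g G')
 then have g: "g : W2" "g : carrier V" "G' <= carrier V" using G(2) Gc by auto
 have "s g \<odot> g : W2" using WD2(4) g by blast
 then show ?case
 unfolding LC_insert[OF insert.hyps(1) g(3) insert.hyps(2) g(2)]
 using insert D1 D2(1)[OF _ _ w] D2(2)[OF g(1) w] WD2(3) by simp
 qed
 then show ?thesis by blast
 qed
 define \<Gamma> where "\<Gamma> = {(u, v). u : W1 & v : W2 & (ALL w:W'. \<beta>1 u w = \<beta>2 v w)}"
 show ?thesis
 proof (rule iso_of_graph[OF W(1,2), of \<Gamma>])
 fix k u v assume k: "k : K" and uv: "(u, v) : \<Gamma>"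
 have "\<beta>1 (rh k u) w = \<beta>2 (rh k v) w" if w: "w : W'" for w
 proof -
 let ?w = "rh (matrix_inv (sg k)) w"
 have w': "?w : W'" using srepD(2)[OF S(3) inv_K[OF sg_in[OF k]] w] .
 have "rh (sg k) ?w = w" using rho_inv'[OF sg_in[OF k]] w WD'(1) by blast
 then show ?thesis using D1(5)[OF k _ w', of u] D2(5)[OF k _ w', of v] uv w' by (simp add: \<Gamma>_def)
 qed
 then show "(rh k u, rh k v) : \<Gamma>" using uv k srepD(2)[OF S(1)] srepD(2)[OF S(2)] by (auto simp: \<Gamma>_def)
 next
 fix u assume u: "u : W1"
 have "EX s. ALL w:W'. \<beta>1 u w = (SUM g:G. s g * \<beta>2 g w)"
 proof (rule functional_span[OF tmod_axioms G(1) srepD(1)[OF S(3)]])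
 show "clin V W' (\<beta>2 g)" if "g : G" for g using tp2 G(2) that unfolding twisted_pair_def by blast
 show "clin V W' (\<beta>1 u)" using tp1 u unfolding twisted_pair_def by blast
 fix w assume w: "w : W'" "!!g. g : G ==> \<beta>2 g w = 0"
 have "\<beta>2 v w = 0" if "v : W2" for v using that G(3) \<beta>2_LC[OF w(1)] w(2) unfolding Sp_def by auto
 then have "w = \<zero>"
 using tp_left_kernel[OF W(3) S(2) tp_sym[OF S(2,3) tp2] w(1)] by simp
 then show "\<beta>1 u w = 0" using D1(4)[OF u WD'(2), of 0] by simp
 qed
 then obtain s where "ALL w:W'. \<beta>1 u w = (SUM g:G. s g * \<beta>2 g w)" by blast
 then have "(u, LC V s G) : \<Gamma>" using u \<beta>2_LC G(3) unfolding \<Gamma>_def Sp_def by auto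
 then show "EX v. (u, v) : \<Gamma>" by blast
 next
 fix v assume v: "(\<zero>, v) : \<Gamma>"
 have "\<beta>2 v w = 0" if "w : W'" for w using v that D1(2)[OF WD1(2) that, of 0] by (simp add: \<Gamma>_def)
 then show "v = \<zero>" using tp_left_kernel[OF W(2) S(3) tp2] v by (auto simp: \<Gamma>_def)
 next
 fix u assume u: "(u, \<zero>) : \<Gamma>"
 have "\<beta>1 u w = 0" if "w : W'" for w using u that D2(2)[OF WD2(2) that, of 0] by (simp add: \<Gamma>_def)
 then show "u = \<zero>" using tp_left_kernel[OF W(1) S(3) tp1] u by (auto simp: \<Gamma>_def)
 qed (use WD1 WD2 D1 D2 in \<open>auto simp: \<Gamma>_def\<close>)
qed

definition Nrel :: "'v set => 'v set => bool" where
 "Nrel U U' \<longleftrightarrow> (EX W W' \<beta>. irr W & irr W' & U = isotyp W & U' = isotyp W' & tp W W' \<beta>)"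

lemma Nrel_sym: "Nrel U U' ==> Nrel U' U"
 unfolding Nrel_def using tp_sym irrD(1) by blast

lemma isotyp_eq_iso: "irr W ==> irr W' ==> isotyp W = isotyp W' ==> iso_rep W W'"
proof -
 assume W: "irr W" "irr W'" "isotyp W = isotyp W'"
 have "W <= isotyp W'" using irr_isotyp[OF W(1) W(1) iso_refl[OF irrD(1)[OF W(1)]]] W(3) by simp
 then have "EX X:{X. irr X & iso_rep W' X}. iso_rep W X"
 by (intro irr_in_cspan[OF W(1)]) (auto simp: isotyp_def)
 then obtain X where X: "irr X" "iso_rep W' X" "iso_rep W X" by blast
 then show ?thesis using iso_trans[OF X(3) iso_sym[OF irrD(1)[OF W(2)] X(2)]] by blast
qed

text \<open>Together with symmetry this makes \<open>Nrel\<close> a partial matching of the K-types: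
  each one has at most one partner on either side.\<close>

lemma Nrel_unique:
 assumes "Nrel U1 U'" "Nrel U2 U'"
 shows "U1 = U2"
proof -
 obtain W1 W1' \<beta>1 where 1: "irr W1" "irr W1'" "U1 = isotyp W1" "U' = isotyp W1'" "tp W1 W1' \<beta>1"
 using assms(1) unfolding Nrel_def by blast
 obtain W2 W2' \<beta>2 where 2: "irr W2" "irr W2'" "U2 = isotyp W2" "U' = isotyp W2'" "tp W2 W2' \<beta>2"
 using assms(2) unfolding Nrel_def by blast
 have i: "iso_rep W1' W2'" by (rule isotyp_eq_iso) (use 1 2 in auto)
 obtain \<beta> where "tp W1' W2 \<beta>"
 using tp_iso[OF i irrD(1)[OF 1(2)] tp_sym[OF irrD(1)[OF 2(1)] irrD(1)[OF 2(2)] 2(5)]] by blast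
 then have "tp W2 W1' (%w u. cnj (\<beta> u w))" using tp_sym irrD(1) 1(2) 2(1) by blast
 then have "iso_rep W1 W2" using tp_unique[OF 1(1) 2(1) 1(2) 1(5)] by blast
 then show ?thesis using isotyp_cong[OF 1(1) 2(1)] 1(3) 2(3) by simp
qed

end

section \<open>The sesquilinear form of an equivariant isomorphism\<close>

lemma dot_add_left: "dot (%b. u b + u' b) v = dot u v + dot u' v"
 by (simp add: dot_def distrib_right sum.distrib)
lemma dot_smult_left: "dot (%b. q * u b) v = q * dot u v"
 by (simp add: dot_def sum_distrib_left mult.assoc)
lemma dot_add_right:
 assumes "finite {b. v b ~= 0}" "finite {b. v' b ~= 0}"
 shows "dot u (%b. v b + v' b) = dot u v + dot u v'"
proof -
 let ?J = "{b. v b ~= 0} \<union> {b. v' b ~= 0}"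
 have "finite ?J" "{b. v b + v' b ~= 0} <= ?J" using assms by auto
 then show ?thesis using assms dot_superset[of ?J v u] dot_superset[of ?J v' u]
 by (simp add: dot_superset[of ?J] distrib_left sum.distrib)
qed
lemma dot_smult_right: "dot u (%b. q * v b) = conj_fract q * dot u v"
proof (cases "q = 0")
 case False
 then have "{b. q * v b ~= 0} = {b. v b ~= 0}" by auto
 then show ?thesis by (simp add: dot_def sum_distrib_left mult_ac)
qed (simp add: dot_def)
lemma dot_zero_left [simp]: "dot (%b. 0) v = 0" by (simp add: dot_def)
lemma dot_zero_right [simp]: "dot u (%b. 0) = 0" by (simp add: dot_def)
lemma dot_delta: "dot u (delta b) = u b"
 using dot_superset[of "{b}" "delta b" u] by auto

lemma fin_supp_add: "u : fin_supp B UNIV ==> v : fin_supp B UNIV ==> (%i. u i + v i) : fin_supp B UNIV"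
 unfolding fin_supp_def by (auto intro: finite_subset[of _ "{i. u i ~= 0} \<union> {i. v i ~= 0}"])
lemma fin_supp_smult: "u : fin_supp B UNIV ==> (%i. q * u i) : fin_supp B UNIV"
 unfolding fin_supp_def by (auto elim: finite_subset[rotated])
lemma fin_supp_zero [simp]: "(%i. 0) : fin_supp B UNIV"
 unfolding fin_supp_def by auto
lemma fin_supp_delta: "b : B ==> delta b : fin_supp B UNIV"
 unfolding fin_supp_def by auto
lemma fin_suppD: "u : fin_supp B S ==> finite {b. u b ~= 0}" "u : fin_supp B S ==> i ~: B ==> u i = 0"
 unfolding fin_supp_def by auto

lemma fin_supp_induct [consumes 1, case_names zero add]:
 assumes "u : fin_supp B (UNIV :: 'a::comm_ring_1 set)" "Q (%_. 0)"
 "!!b q v. b : B ==> v : fin_supp B UNIV ==> Q v ==> Q (%i. q * delta b i + v i)"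
 shows "Q u"
proof -
 have "finite J ==> ALL u:fin_supp B UNIV. {b. u b ~= 0} <= J --> Q u" for J
 proof (induction J rule: finite_induct)
 case empty
 have "u = (%_. 0)" if "{b. u b ~= 0} <= {}" for u :: "'b => 'a" using that by auto
 then show ?case using assms(2) by blast
 next
 case (insert b J)
 show ?case
 proof (intro ballI impI)
 fix u :: "'b => 'a" assume u: "u : fin_supp B UNIV" "{b. u b ~= 0} <= insert b J"
 define v where "v = u(b := 0)"
 have v: "v : fin_supp B UNIV" "{b. v b ~= 0} <= J"
 using u unfolding v_def fin_supp_def by (auto elim: finite_subset[rotated])
 show "Q u"
 proof (cases "b : B")
 case True
 have "(%i. u b * delta b i + v i) = u" by (auto simp: v_def)
 then show ?thesis using assms(3)[OF True v(1), of "u b"] insert.IH v by simp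
 next
 case False
 then have "u = v" using u(1) unfolding v_def fin_supp_def by auto
 then show ?thesis using insert.IH v by simp
 qed
 qed
 qed
 then show ?thesis using assms(1) fin_suppD(1) by blast
qed

lemma linear_mapD:
 assumes "linear_map R M N f"
 shows "u : carrier M ==> v : carrier M ==> f (u \<oplus>\<^bsub>M\<^esub> v) = f u \<oplus>\<^bsub>N\<^esub> f v"
 and "a : carrier R ==> v : carrier M ==> f (a \<odot>\<^bsub>M\<^esub> v) = a \<odot>\<^bsub>N\<^esub> f v"
 and "v : carrier M ==> f v : carrier N"
 using assms unfolding linear_map_def by auto

locale setting = adapted K F rh B crd Bs + hc: hc_module_family K gg br \<alpha> \<iota> F \<pi> rh
 + re: real_hc_pair_family K gg br \<alpha> \<iota> sggg sgK + real_coord x p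
 for K :: "(complex^'n^'n) set" and gg :: "(complex poly, 'g) module" and br \<alpha> \<iota> sggg sgK
 and F :: "(complex poly, 'f) module" and \<pi> rh B crd Bs x p
begin

text \<open>For real \<open>x\<close> the map \<open>sgK x0\<close> is an involution of
  \<open>K\<close>; at a general point only the composite with the map at the conjugate point is the
  identity.\<close>

sublocale TW: twisted_rep K V rh "sgK x0"
proof (intro twisted_rep.intro V.arep_axioms twisted_rep_axioms.intro)
 show "sgK x0 k : K" if "k : K" for k using re.sigmaK_closed that by blast
 show "sgK x0 (sgK x0 k) = k" if "k : K" for k using re.sigmaK_involutive[OF that, of x0] by simp
qed

abbreviation "VV \<equiv> fin_supp B (UNIV :: complex poly fract set)"
abbreviation "ext T \<equiv> extm to_fract crd T"

definition "emb f = (%i. to_fract (crd f i))"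

lemma emb_in: "f : carrier F ==> emb f : VV"
 using gF.crd_finite gF.crd_outside unfolding emb_def fin_supp_def by auto

lemma emb_add: "u : carrier F ==> v : carrier F ==> emb (u \<oplus>\<^bsub>F\<^esub> v) = (%i. emb u i + emb v i)"
 by (simp add: emb_def gF.crd_add fun_eq_iff)
lemma emb_smult: "u : carrier F ==> emb (q \<odot>\<^bsub>F\<^esub> u) = (%i. to_fract q * emb u i)"
 by (simp add: emb_def gF.crd_smult fun_eq_iff)
lemma emb_bas: "b : B ==> emb b = delta b"
 by (simp add: emb_def gF.crd_bas fun_eq_iff)

lemma emb_ext:
 assumes T: "linear_map Oring F F T" and f: "f : carrier F"
 shows "ext T (emb f) = emb (T f)"
proof
 fix i
 let ?J = "{i. crd f i ~= 0}"
 have J: "finite ?J" "?J <= B" using f gF.crd_finite gF.crd_outside by auto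
 have "ext T (emb f) i = (SUM b:?J. emb f b * to_fract (crd (T b) i))"
 by (rule extm_superset[OF J(1)]) (auto simp: emb_def)
 also have "... = to_fract (crd (T f) i)"
 unfolding gF.linear_crd[OF T f J(1) order_refl J(2)] by (simp add: emb_def gF.h_sum)
 finally show "ext T (emb f) i = emb (T f) i" by (simp add: emb_def)
qed

lemma ext_in: "linear_map Oring F F T ==> v : VV ==> ext T v : VV"
 using gF.extm_fin_supp by simp

lemma pi_linear: "X : carrier gg ==> linear_map Oring F F (\<pi> X)"
 using hc.lie_linear(1) .

text \<open>By \<open>sigmaK_antiholomorphic\<close> the entries of \<open>sgK (cnj z) k\<close> are
  polynomials in \<open>z\<close> whose coefficients are conjugates of regular functions at
  \<open>k\<close>. The resulting section may be nonconstant although \<open>k\<close> is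
  constant.\<close>

lemma real_section:
 assumes k: "k : K"
 shows "conj_section sgK (const_mat k) : sections K" "ev_mat z (conj_section sgK (const_mat k)) = sgK (cnj z) k"
proof -
 have "EX q. ALL z. poly q z = sgK (cnj z) k $ a $ b" for a b
 proof -
 obtain N c where c: "ALL z. ALL k:K. cnj (sgK z k $ a $ b) = (\<Sum>i<N. c i k * z ^ i)"
 using re.sigmaK_antiholomorphic by blast
 have "sgK (cnj z) k $ a $ b = cnj (\<Sum>i<N. c i k * cnj z ^ i)" for z using c k by (metis complex_cnj_cnj)
 then have "poly (\<Sum>i<N. Polynomial.monom (cnj (c i k)) i) z = sgK (cnj z) k $ a $ b" for z
 by (simp add: poly_sum Polynomial.poly_monom)
 then show ?thesis by blast
 qed
 then obtain Q where Q: "!!a b z. poly (Q a b) z = sgK (cnj z) k $ a $ b" by metis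
 have H: "ev_mat z (\<chi> a b. Q a b) = sgK (cnj z) k" for z by (simp add: ev_mat_def Q vec_eq_iff)
 have "conj_section sgK (const_mat k) = (\<chi> a b. Q a b)"
 unfolding conj_section_def
 proof (rule the_equality)
 show "ALL z. ev_mat z (\<chi> a b. Q a b) = sgK (cnj z) (ev_mat (cnj z) (const_mat k))" using H by simp
 show "H' = (\<chi> a b. Q a b)" if "ALL z. ev_mat z H' = sgK (cnj z) (ev_mat (cnj z) (const_mat k))" for H'
 by (rule ev_mat_eqI) (use that H in simp)
 qed
 then show "ev_mat z (conj_section sgK (const_mat k)) = sgK (cnj z) k" "conj_section sgK (const_mat k) : sections K"
 using H re.sigmaK_closed[OF k] by (simp_all add: sections_def)
qed

end

locale equi = setting K gg br \<alpha> \<iota> sggg sgK F \<pi> rh B crd Bs x p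
 for K :: "(complex^'n^'n) set" and gg :: "(complex poly, 'g) module" and br \<alpha> \<iota> sggg sgK
 and F :: "(complex poly, 'f) module" and \<pi> rh B crd Bs x p +
 fixes ph :: "'f generic_map"
 assumes eqv: "equivariant_iso K gg sggg sgK F \<pi> rh ph"
begin

lemma phi: "linear_map Kfield (generic F) (generic D) ph" "bij_betw ph (carrier (generic F)) (carrier (generic D))"
 "!!X t. X : carrier gg ==> t : carrier (generic F) ==> ph (base_map Kfield to_fract F (%q. q) (\<pi> X) t)
 = base_map Kfield to_fract D (%q. q) (dual_lie_act F \<pi> sggg X) (ph t)"
 "!!G t. G : sections K ==> t : carrier (generic F) ==> ph (base_map Kfield to_fract F (%q. q) (section_act K F rh G) t)
 = base_map Kfield to_fract D (%q. q) (dual_section_act K F rh sgK G) (ph t)"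
 using eqv unfolding equivariant_iso_def Let_def by blast+

lemma phi_in: "t : carrier (generic F) ==> ph t : carrier (generic D)"
 using phi(2) by (auto simp: bij_betw_def simp del: base_change_simps)

definition "Ph v = gD.tc (ph (gF.mk v))"
definition "form u v = dot (Ph u) v"

lemma mk_in: "v : VV ==> gF.mk v : carrier (generic F)" and tc_mk: "v : VV ==> gF.tc (gF.mk v) = v"
 using gF.mk[of v] by simp_all

lemma Phi_tc: "t : carrier (generic F) ==> Ph (gF.tc t) = gD.tc (ph t)"
 unfolding Ph_def using gF.mk_tc by simp

lemma tc_VV: "t : carrier (generic F) ==> gF.tc t : VV" "u : carrier (generic D) ==> gD.tc u : VV"
 using gF.tc_in gD.tc_in by simp_all

lemma Phi_in: "v : VV ==> Ph v : VV"
 unfolding Ph_def using tc_VV(2) phi_in mk_in by blast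

lemma Phi_add:
 assumes "u : VV" "v : VV" shows "Ph (%i. u i + v i) = (%i. Ph u i + Ph v i)"
proof -
 note m = mk_in[OF assms(1)] mk_in[OF assms(2)]
 have "gF.mk (%i. u i + v i) = gF.mk u \<oplus>\<^bsub>generic F\<^esub> gF.mk v"
 proof (rule gF.tc_inj)
 show "gF.tc (gF.mk (%i. u i + v i)) = gF.tc (gF.mk u \<oplus>\<^bsub>generic F\<^esub> gF.mk v)"
 unfolding gF.tc_add[OF m] using tc_mk assms fin_supp_add[OF assms] by simp
 qed (use gF.BC_add_closed[OF m] mk_in[OF fin_supp_add[OF assms]] in auto)
 then have "ph (gF.mk (%i. u i + v i)) = ph (gF.mk u) \<oplus>\<^bsub>generic D\<^esub> ph (gF.mk v)"
 using linear_mapD(1)[OF phi(1) m] by simp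
 then show ?thesis unfolding Ph_def using gD.tc_add[OF phi_in[OF m(1)] phi_in[OF m(2)]] by simp
qed

lemma Phi_smult:
 assumes "u : VV" shows "Ph (%i. q * u i) = (%i. q * Ph u i)"
proof -
 note m = mk_in[OF assms(1)]
 have q: "q : carrier Kfield" by simp
 have "gF.mk (%i. q * u i) = q \<odot>\<^bsub>generic F\<^esub> gF.mk u"
 proof (rule gF.tc_inj)
 show "gF.tc (gF.mk (%i. q * u i)) = gF.tc (q \<odot>\<^bsub>generic F\<^esub> gF.mk u)"
 unfolding gF.tc_smult(1)[OF q m] using tc_mk assms fin_supp_smult[OF assms] by simp
 qed (use gF.tc_smult(2)[OF q m] mk_in[OF fin_supp_smult[OF assms]] in auto)
 then have "ph (gF.mk (%i. q * u i)) = q \<odot>\<^bsub>generic D\<^esub> ph (gF.mk u)"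
 using linear_mapD(2)[OF phi(1) q m] by simp
 then show ?thesis unfolding Ph_def using gD.tc_smult(1)[OF q phi_in[OF m]] by simp
qed

lemma Phi_zero [simp]: "Ph (%_. 0) = (%_. 0)"
 using Phi_smult[OF fin_supp_zero, of 0] by simp

lemma Phi_inj: "u : VV ==> v : VV ==> Ph u = Ph v ==> u = v"
proof -
 assume *: "u : VV" "v : VV" "Ph u = Ph v"
 then have "ph (gF.mk u) = ph (gF.mk v)"
 unfolding Ph_def using gD.tc_inj[OF phi_in[OF mk_in[OF *(1)]] phi_in[OF mk_in[OF *(2)]]] by simp
 then have "gF.mk u = gF.mk v"
 using inj_onD[OF bij_betw_imp_inj_on[OF phi(2)] _ mk_in[OF *(1)] mk_in[OF *(2)]] by simp
 then show "u = v" using tc_mk * by metis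
qed

lemma Phi_surj: "d : VV ==> EX u:VV. Ph u = d"
proof -
 assume d: "d : VV"
 have m: "gD.mk d : carrier (generic D)" "gD.tc (gD.mk d) = d" using gD.mk[of d] d by simp_all
 have "gD.mk d : ph ` carrier (generic F)" unfolding bij_betw_imp_surj_on[OF phi(2)] by (rule m(1))
 then obtain t where t: "t : carrier (generic F)" "ph t = gD.mk d" by (elim imageE) (simp del: base_change_simps)
 then show ?thesis using Phi_tc[OF t(1)] tc_VV(1)[OF t(1)] m by auto
qed

lemma pairing_form: "s : carrier (generic F) ==> t : carrier (generic F) ==> pairing ph s t = form (gF.tc s) (gF.tc t)"
 unfolding pairing_def form_def using dual_eval_dot[OF phi_in] Phi_tc by simp

lemma form_add_left: "u : VV ==> u' : VV ==> form (%i. u i + u' i) v = form u v + form u' v"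
 and form_smult_left: "u : VV ==> form (%i. q * u i) v = q * form u v"
 and form_add_right: "v : VV ==> v' : VV ==> form u (%i. v i + v' i) = form u v + form u v'"
 and form_smult_right: "form u (%i. q * v i) = conj_fract q * form u v"
 and form_zero_left [simp]: "form (%_. 0) v = 0" and form_zero_right [simp]: "form u (%_. 0) = 0"
 and form_delta: "form u (delta b) = Ph u b"
 unfolding form_def using Phi_add Phi_smult dot_add_left dot_smult_left dot_add_right[OF fin_suppD(1) fin_suppD(1)]
 dot_smult_right dot_delta by simp_all

lemma form_nondeg_left: "u : VV ==> (!!b. b : B ==> form u (delta b) = 0) ==> u = (%_. 0)"
proof -
 assume u: "u : VV" "!!b. b : B ==> form u (delta b) = 0"
 have "Ph u b = 0" for b using u(2) form_delta fin_suppD(2)[OF Phi_in[OF u(1)]] by (cases "b : B") auto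
 then have "Ph u = Ph (%_. 0)" by auto
 then show ?thesis using Phi_inj[OF u(1) fin_supp_zero] by simp
qed

lemma dual_lie_closed: "X : carrier gg ==> e : carrier D ==> dual_lie_act F \<pi> sggg X e : carrier D"
 and dual_section_closed: "G : sections K ==> e : carrier D ==> dual_section_act K F rh sgK G e : carrier D"
proof -
 assume e: "e : carrier D"
 \<comment> \<open>Any element of the generic module serves here, even zero, because a
   representative of its image may contain \<open>e\<close> with coefficient 0.\<close>
 have t: "\<zero>\<^bsub>generic F\<^esub> : carrier (generic F)" by (rule gF.BC_zero_closed)
 show "dual_lie_act F \<pi> sggg X e : carrier D" if X: "X : carrier gg"
 by (rule dual_operator_closed[OF phi_in[OF t] _ e], subst phi(3)[OF X t, symmetric])
 (rule phi_in[OF gF.tc_base_map(1)[OF pi_linear[OF X] t]])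
 show "dual_section_act K F rh sgK G e : carrier D" if G: "G : sections K"
 by (rule dual_operator_closed[OF phi_in[OF t] _ e], subst phi(4)[OF G t, symmetric])
 (rule phi_in[OF gF.tc_base_map(1)[OF section_act_linear[OF G] t]])
qed

lemma form_lie:
 assumes X: "X : carrier gg" and u: "u : VV" and v: "v : VV"
 shows "form (ext (\<pi> X) u) v = - form u (ext (\<pi> (sggg X)) v)"
proof -
 note m = mk_in[OF u] mk_in[OF v] and L = pi_linear[OF X] pi_linear[OF re.sigma_closed[OF X]]
 have "form (ext (\<pi> X) u) v = pairing ph (base_map Kfield to_fract F (%q. q) (\<pi> X) (gF.mk u)) (gF.mk v)"
 using pairing_form[OF gF.tc_base_map(1)[OF L(1) m(1)] m(2)] gF.tc_base_map(2)[OF L(1) m(1)] tc_mk u v by simp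
 also have "... = to_fract (-1) * dual_eval (ph (gF.mk u)) (base_map Kfield to_fract F (%q. q) (\<pi> (sggg X)) (gF.mk v))"
 unfolding pairing_def phi(3)[OF X m(1)]
 by (rule dual_eval_adjoint[OF L(2) phi_in[OF m(1)] m(2) dual_lie_closed[OF X]])
 (simp_all add: dual_lie_act_def)
 also have "... = - pairing ph (gF.mk u) (base_map Kfield to_fract F (%q. q) (\<pi> (sggg X)) (gF.mk v))"
 by (simp add: pairing_def)
 also have "... = - form u (ext (\<pi> (sggg X)) v)"
 using pairing_form[OF m(1) gF.tc_base_map(1)[OF L(2) m(2)]] gF.tc_base_map(2)[OF L(2) m(2)] tc_mk u v by simp
 finally show ?thesis .
qed

text \<open>The adjoint of the constant \<open>k\<close> is the inverse of the conjugate section. It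
  varies with \<open>z\<close>, and only its value at \<open>x\<close> is governed by
  \<open>sgK x0\<close>.\<close>

lemma form_group:
 assumes k: "k : K" and u: "u : VV" and v: "v : VV"
 shows "form (ext (rh k) u) v = form u (ext (section_act K F rh (matrix_inv (conj_section sgK (const_mat k)))) v)"
proof -
 let ?G = "const_mat k" and ?H = "matrix_inv (conj_section sgK (const_mat k))"
 have G: "?G : sections K" using const_section[OF k] .
 have H: "?H : sections K" using section_inverse(1)[OF real_section(1)[OF k]] .
 note m = mk_in[OF u] mk_in[OF v] and L = section_act_linear[OF G] section_act_linear[OF H]
 have "ext (rh k) u = ext (section_act K F rh ?G) u"
 unfolding extm_def using fin_suppD(2)[OF u] gF.bas_in section_act_const[OF k]
 by (intro ext sum.cong) (auto, metis)
 then have "form (ext (rh k) u) v = pairing ph (base_map Kfield to_fract F (%q. q) (section_act K F rh ?G) (gF.mk u)) (gF.mk v)"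
 using pairing_form[OF gF.tc_base_map(1)[OF L(1) m(1)] m(2)] gF.tc_base_map(2)[OF L(1) m(1)] tc_mk u v by simp
 also have "... = to_fract 1 * dual_eval (ph (gF.mk u)) (base_map Kfield to_fract F (%q. q) (section_act K F rh ?H) (gF.mk v))"
 unfolding pairing_def phi(4)[OF G m(1)]
 by (rule dual_eval_adjoint[OF L(2) phi_in[OF m(1)] m(2) dual_section_closed[OF G]])
 (simp_all add: dual_section_act_def)
 also have "... = pairing ph (gF.mk u) (base_map Kfield to_fract F (%q. q) (section_act K F rh ?H) (gF.mk v))"
 by (simp add: pairing_def)
 also have "... = form u (ext (section_act K F rh ?H) v)"
 using pairing_form[OF m(1) gF.tc_base_map(1)[OF L(2) m(2)]] gF.tc_base_map(2)[OF L(2) m(2)] tc_mk u v by simp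
 finally show ?thesis .
qed

section \<open>Matching the K-types by values at x\<close>

definition "Pf f g = form (emb f) (emb g)"

lemma Pf_add_left: "u : carrier F ==> v : carrier F ==> Pf (u \<oplus>\<^bsub>F\<^esub> v) w = Pf u w + Pf v w"
 and Pf_smult_left: "u : carrier F ==> Pf (q \<odot>\<^bsub>F\<^esub> u) w = to_fract q * Pf u w"
 and Pf_add_right: "u : carrier F ==> v : carrier F ==> Pf w (u \<oplus>\<^bsub>F\<^esub> v) = Pf w u + Pf w v"
 and Pf_smult_right: "u : carrier F ==> Pf w (q \<odot>\<^bsub>F\<^esub> u) = to_fract (conj_poly q) * Pf w u"
 by (simp_all add: Pf_def emb_add emb_smult form_add_left form_add_right form_smult_left form_smult_right emb_in)

lemma Pf_sum_right:
 assumes "finite S" "!!i. i : S ==> f i : carrier F"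
 shows "Pf w (\<Oplus>\<^bsub>F\<^esub>i\<in>S. q i \<odot>\<^bsub>F\<^esub> f i) = (SUM i:S. to_fract (conj_poly (q i)) * Pf w (f i))"
 using assms
proof (induction S)
 case empty
 have "Pf w \<zero>\<^bsub>F\<^esub> = 0" using Pf_smult_right[OF F.M.zero_closed, of w 0] by simp
 then show ?case by simp
next
 case (insert i S)
 then have f: "(%i. q i \<odot>\<^bsub>F\<^esub> f i) : S \<rightarrow> carrier F" "q i \<odot>\<^bsub>F\<^esub> f i : carrier F" "f i : carrier F" by auto
 show ?case
 unfolding F.M.finsum_insert[OF insert.hyps f(1,2)] Pf_add_right[OF f(2) F.M.finsum_closed[OF f(1)]] Pf_smult_right[OF f(3)]
 using insert by simp
qed

lemma Pf_group:
 assumes k: "k : K" and u: "u : carrier F" and v: "v : carrier F"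
 shows "Pf (rh k u) (section_act K F rh (conj_section sgK (const_mat k)) v) = Pf u v"
proof -
 let ?H = "conj_section sgK (const_mat k)"
 have H: "?H : sections K" "matrix_inv ?H : sections K" using real_section(1)[OF k] section_inverse(1) by auto
 let ?w = "section_act K F rh ?H v"
 have w: "?w : carrier F" using section_act_closed[OF v H(1)] .
 have "section_act K F rh (matrix_inv ?H) ?w = v"
 proof (rule crd_eval_eqI[OF section_act_closed[OF w H(2)] v])
 fix z b
 show "poly (crd (section_act K F rh (matrix_inv ?H) ?w) b) z = poly (crd v b) z"
 unfolding section_act_comp_eval[OF v H(2,1)] section_inverse(2)[OF H(1)]
 using V.rho_inv[OF section_mem[OF H(1)]] v by simp
 qed
 then show ?thesis
 unfolding Pf_def emb_ext[OF rho_lin_F[OF k] u, symmetric] form_group[OF k emb_in[OF u] emb_in[OF w]]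
 using emb_ext[OF section_act_linear[OF H(2)] w] by simp
qed

text \<open>The values of \<open>Pf\<close> are rational functions, and \<open>k\<close> crosses the
  form as a section varying with \<open>z\<close>. As \<open>W\<close> and \<open>W'\<close> are
  finite-dimensional, there is a least power of \<open>P\<close> that makes all values regular at
  \<open>x\<close>. After multiplication by it, evaluation at \<open>x\<close> gives a nonzero
  complex pairing, and the section becomes \<open>sgK x0 k\<close>.\<close>

lemma Pf_twisted_pair:
 assumes W: "V.irr W" "V.irr W'" and nz: "u0 : W" "w0 : W'" "Pf u0 w0 ~= 0"
 shows "EX \<beta>. TW.tp W W' \<beta>"
proof -
 note S = V.irrD(1)[OF W(1)] V.irrD(1)[OF W(2)]
 note WD = V.submodD[OF V.srepD(1)[OF S(1)]] and WD' = V.submodD[OF V.srepD(1)[OF S(2)]]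
 have Wc: "u : carrier F" if "u : W" for u using WD(1) that by auto
 have Wc': "u : carrier F" if "u : W'" for u using WD'(1) that by auto
 \<comment> \<open>\<open>Good k\<close> bounds the poles on all of \<open>W\<close> and
   \<open>W'\<close> at once. By sesquilinearity it can be checked on finitely many spanning
   vectors.\<close>
 define Good where "Good k \<longleftrightarrow> (ALL u:W. ALL w:W'. P powi k * Pf u w : R)" for k :: int
 obtain G where G: "finite G" "G <= W" "W = Sp V G" using V.irr_fg[OF W(1)] by blast
 obtain G' where G': "finite G'" "G' <= W'" "W' = Sp V G'" using V.irr_fg[OF W(2)] by blast
 have pow: "\<exists>n::nat. \<forall>k\<ge>int n. P powi k * q : R" for q
 proof (cases "q = 0")
 case False
 obtain j u where ju: "u : R" "q = P powi j * u" using order_unit[OF False] by blast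
 have "P powi k * q : R" if "k \<ge> int (nat (- j))" for k
 proof -
 have "P powi k * q = P powi (k + j) * u" by (simp add: ju(2) power_int_add mult.assoc)
 moreover have "P powi (k + j) : R" by (rule Ppowi_in) (use that in linarith)
 ultimately show ?thesis using Rloc_mult[OF _ ju(1), of "P powi (k + j)"] by simp
 qed
 then show ?thesis by blast
 qed auto
 have "\<exists>n::nat. Good (int n)"
 proof -
 obtain m where m: "!!q k. k \<ge> int (m q) ==> P powi k * q : R" using pow by metis
 define M where "M = (SUM g:G. SUM h:G'. m (Pf g h))"
 have gh: "P powi (int M) * Pf g h : R" if "g : G" "h : G'" for g h
 proof -
 have "m (Pf g h) <= (SUM h:G'. m (Pf g h))" using that G' by (intro member_le_sum) auto
 also have "... <= M" unfolding M_def using that G by (intro member_le_sum[of g G "%g. SUM h:G'. m (Pf g h)"]) auto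
 finally show ?thesis by (intro m) simp
 qed
 have g: "P powi (int M) * Pf g w : R" if g: "g : G" and w: "w : W'" for g w
 proof -
 have "submod V {w : W'. P powi (int M) * Pf g w : R}"
 proof (rule V.submodI)
 have "Pf g \<zero>\<^bsub>F\<^esub> = 0" using Pf_smult_right[OF F.M.zero_closed, of g 0] by simp
 then show "\<zero>\<^bsub>V\<^esub> : {w : W'. P powi (int M) * Pf g w : R}" using WD'(2) by simp
 show "u \<oplus>\<^bsub>V\<^esub> v : {w : W'. P powi (int M) * Pf g w : R}"
 if "u : {w : W'. P powi (int M) * Pf g w : R}" "v : {w : W'. P powi (int M) * Pf g w : R}" for u v
 using that WD'(3) Wc' by (auto simp: Pf_add_right distrib_left Rloc_add)
 show "c \<odot>\<^bsub>V\<^esub> u : {w : W'. P powi (int M) * Pf g w : R}" if "u : {w : W'. P powi (int M) * Pf g w : R}" for c u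
 using that WD'(4)[of u c] Wc' Rloc_mult[OF Rloc_to_fract(1)[of "conj_poly [:c:]"], of "P powi (int M) * Pf g u"]
 by (auto simp: Pf_smult_right mult.left_commute)
 qed (use WD'(1) in auto)
 then have "Sp V G' <= {w : W'. P powi (int M) * Pf g w : R}"
 by (rule V.Sp_least[OF G'(1) subset_trans[OF G'(2) WD'(1)]]) (use G'(2) gh[OF g] in auto)
 then show ?thesis using w G'(3) by blast
 qed
 have "Good (int M)"
 unfolding Good_def
 proof (intro ballI)
 fix u w assume u: "u : W" and w: "w : W'"
 have "submod V {u : W. P powi (int M) * Pf u w : R}"
 proof (rule V.submodI)
 have "Pf \<zero>\<^bsub>F\<^esub> w = 0" using Pf_smult_left[OF F.M.zero_closed, of 0 w] by simp
 then show "\<zero>\<^bsub>V\<^esub> : {u : W. P powi (int M) * Pf u w : R}" using WD(2) by simp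
 show "u \<oplus>\<^bsub>V\<^esub> v : {u : W. P powi (int M) * Pf u w : R}"
 if "u : {u : W. P powi (int M) * Pf u w : R}" "v : {u : W. P powi (int M) * Pf u w : R}" for u v
 using that WD(3) Wc by (auto simp: Pf_add_left distrib_left Rloc_add)
 show "c \<odot>\<^bsub>V\<^esub> u : {u : W. P powi (int M) * Pf u w : R}" if "u : {u : W. P powi (int M) * Pf u w : R}" for c u
 using that WD(4)[of u c] Wc Rloc_mult[OF Rloc_to_fract(1)[of "[:c:]"], of "P powi (int M) * Pf u w"]
 by (auto simp: Pf_smult_left mult.left_commute)
 qed (use WD(1) in auto)
 then have "Sp V G <= {u : W. P powi (int M) * Pf u w : R}"
 by (rule V.Sp_least[OF G(1) subset_trans[OF G(2) WD(1)]]) (use G(2) g[OF _ w] in auto)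
 then show "P powi (int M) * Pf u w : R" using u G(3) by blast
 qed
 then show ?thesis by blast
 qed
 then obtain n0 where n0: "Good (int n0)" by blast
 obtain j v where jv: "v : R" "val v ~= 0" "Pf u0 w0 = P powi j * v" using order_unit[OF nz(3)] by blast
 \<comment> \<open>The nonzero value at \<open>u0\<close> and \<open>w0\<close> has order
   \<open>j\<close>, which bounds the good exponents from below, so a least one exists.\<close>
 have lower: "k \<ge> - j" if "Good k" for k
 proof (rule ccontr)
 assume "~ k \<ge> - j"
 then have kj: "- (k + j) > 0" by simp
 have "P powi k * Pf u0 w0 : R" using that nz unfolding Good_def by blast
 then have "val (P powi (- (k + j)) * (P powi k * Pf u0 w0)) = 0" using Ppowi_val[OF kj] by blast
 moreover have "P powi (- (k + j)) * (P powi k * Pf u0 w0) = v"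
 by (simp add: jv(3) power_int_add[symmetric] power_int_minus flip: mult.assoc)
 ultimately show False using jv(2) by simp
 qed
 have "\<exists>i::nat. Good (int i - j)" using n0 lower[OF n0] by (intro exI[of _ "nat (int n0 + j)"]) simp
 then obtain i :: nat where i: "Good (int i - j)" "!!i'. i' < i ==> ~ Good (int i' - j)"
 using exists_least_iff[of "%i. Good (int i - j)"] by blast
 define m where "m = int i - j"
 have notgood: "~ Good (m - 1)"
 proof
 assume g: "Good (m - 1)"
 then have "i > 0" using lower[OF g] by (simp add: m_def)
 then have "int (i - 1) - j = m - 1" by (simp add: m_def)
 then have "Good (int (i - 1) - j)" using g by simp
 moreover have "i - 1 < i" using \<open>i > 0\<close> by simp
 ultimately show False using i(2)[of "i - 1"] by blast
 qed
 have good: "P powi m * Pf u w : R" if "u : W" "w : W'" for u w using i(1) that unfolding Good_def m_def by blast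
 define \<beta> where "\<beta> u w = val (P powi m * Pf u w)" for u w
 have nzb: "EX u:W. EX w:W'. \<beta> u w ~= 0"
 proof (rule ccontr)
 assume z: "~ (EX u:W. EX w:W'. \<beta> u w ~= 0)"
 have "Good (m - 1)"
 unfolding Good_def
 proof (intro ballI)
 fix u w assume uw: "u : W" "w : W'"
 then obtain r where r: "r : R" "P powi m * Pf u w = P * r"
 using R_zero_factor[OF good[OF uw]] z unfolding \<beta>_def by blast
 have "P * (P powi (m - 1) * Pf u w) = P powi m * Pf u w" by (simp add: power_int_diff)
 then have "P powi (m - 1) * Pf u w = r" using r(2) by simp
 then show "P powi (m - 1) * Pf u w : R" using r(1) by simp
 qed
 then show False using notgood by simp
 qed
 have b_add_left: "\<beta> (u \<oplus>\<^bsub>V\<^esub> v) w = \<beta> u w + \<beta> v w" if "u : W" "v : W" "w : W'" for u v w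
 unfolding \<beta>_def using that Wc good by (simp add: Pf_add_left distrib_left Rloc_add)
 have b_sm_left: "\<beta> (c \<odot>\<^bsub>V\<^esub> u) w = c * \<beta> u w" if "u : W" "w : W'" for c u w
 unfolding \<beta>_def using that Wc Rloc_mult[OF Rloc_to_fract(1)[of "[:c:]"] good[OF that]]
 by (simp add: Pf_smult_left mult.left_commute)
 have b_add_right: "\<beta> w (u \<oplus>\<^bsub>V\<^esub> v) = \<beta> w u + \<beta> w v" if "u : W'" "v : W'" "w : W" for u v w
 unfolding \<beta>_def using that Wc' good by (simp add: Pf_add_right distrib_left Rloc_add)
 have b_sm_right: "\<beta> w (c \<odot>\<^bsub>V\<^esub> u) = cnj c * \<beta> w u" if "u : W'" "w : W" for c u w
 unfolding \<beta>_def using that Wc' Rloc_mult[OF Rloc_to_fract(1)[of "conj_poly [:c:]"] good[OF that(2,1)]]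
 by (simp add: Pf_smult_right mult.left_commute map_poly_pCons)
 have b_inv: "\<beta> (rh k u) (rh (sgK x0 k) w) = \<beta> u w" if k: "k : K" and u: "u : W" and w: "w : W'" for k u w
 proof -
 let ?H = "conj_section sgK (const_mat k)"
 have H: "?H : sections K" "ev_mat x0 ?H = sgK x0 k" using real_section[OF k] by simp_all
 \<comment> \<open>With an expansion inside \<open>W'\<close> the section acts by polynomial
   coefficients; their values at \<open>x\<close> reassemble to \<open>sgK x0 k\<close> acting on
   \<open>w\<close>.\<close>
 obtain N c mm where e: "expansion K V rh w N c mm" "\<forall>i<N. mm i : W'"
 using V.expansion_in_srep[OF S(2) w] by blast
 have creg: "c i : regular_functions" if "i < N" for i using e(1) that unfolding expansion_def by blast
 have ku: "rh k u : W" using V.srepD(2)[OF S(1) k u] .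
 have "P powi m * Pf u w = P powi m * Pf (rh k u) (section_act K F rh ?H w)"
 using Pf_group[OF k Wc[OF u] Wc'[OF w]] by simp
 also have "... = (\<Sum>i<N. to_fract (conj_poly (sect_poly (c i) ?H)) * (P powi m * Pf (rh k u) (mm i)))"
 unfolding section_act_expansion(1)[OF Wc'[OF w] H(1) e(1)]
 by (subst Pf_sum_right) (use e(2) Wc' in \<open>auto simp: sum_distrib_left mult_ac\<close>)
 finally have "\<beta> u w = val (\<Sum>i<N. to_fract (conj_poly (sect_poly (c i) ?H)) * (P powi m * Pf (rh k u) (mm i)))"
 unfolding \<beta>_def by simp
 also have "... = (\<Sum>i<N. cnj (c i (sgK x0 k)) * \<beta> (rh k u) (mm i))"
 proof -
 have t: "to_fract (conj_poly (sect_poly (c i) ?H)) * (P powi m * Pf (rh k u) (mm i)) : R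
 & val (to_fract (conj_poly (sect_poly (c i) ?H)) * (P powi m * Pf (rh k u) (mm i))) = cnj (c i (sgK x0 k)) * \<beta> (rh k u) (mm i)"
 if "i < N" for i
 using Rloc_mult[OF Rloc_to_fract(1) good[OF ku], of "mm i" "conj_poly (sect_poly (c i) ?H)"] e(2) that
 poly_sect_poly[OF section_invertible[OF H(1)] creg[OF that], of x0] H(2)
 by (simp add: \<beta>_def poly_conj_poly)
 then show ?thesis using Rloc_sum[of "{..<N}" "%i. to_fract (conj_poly (sect_poly (c i) ?H)) * (P powi m * Pf (rh k u) (mm i))" x0] by simp
 qed
 also have "... = \<beta> (rh k u) (\<Oplus>\<^bsub>V\<^esub>i\<in>{..<N}. c i (sgK x0 k) \<odot>\<^bsub>V\<^esub> mm i)"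
 proof -
 have "\<beta> (rh k u) (\<Oplus>\<^bsub>V\<^esub>i\<in>{..<n}. c i (sgK x0 k) \<odot>\<^bsub>V\<^esub> mm i) = (\<Sum>i<n. cnj (c i (sgK x0 k)) * \<beta> (rh k u) (mm i))
 & (\<Oplus>\<^bsub>V\<^esub>i\<in>{..<n}. c i (sgK x0 k) \<odot>\<^bsub>V\<^esub> mm i) : W'" if "n <= N" for n
 using that
 proof (induction n)
 case 0
 have "\<beta> (rh k u) \<zero>\<^bsub>V\<^esub> = 0" using b_sm_right[OF WD'(2) ku, of 0] WD'(1,2) V.tsmult_0[of "\<zero>\<^bsub>V\<^esub>"] by simp
 then show ?case using WD'(2) by simp
 next
 case (Suc n)
 have mi: "c i (sgK x0 k) \<odot>\<^bsub>V\<^esub> mm i : W'" if "i <= n" for i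
 using WD'(4) e(2) that Suc.prems by auto
 have "(\<Oplus>\<^bsub>V\<^esub>i\<in>{..<Suc n}. c i (sgK x0 k) \<odot>\<^bsub>V\<^esub> mm i) = c n (sgK x0 k) \<odot>\<^bsub>V\<^esub> mm n \<oplus>\<^bsub>V\<^esub> (\<Oplus>\<^bsub>V\<^esub>i\<in>{..<n}. c i (sgK x0 k) \<odot>\<^bsub>V\<^esub> mm i)"
 by (rule V.finsum_Suc) (use mi WD'(1) in blast)
 then show ?case
 using Suc b_add_right[OF mi[OF order_refl] _ ku] b_sm_right[OF _ ku, of "mm n"] e(2) WD'(3)[OF mi[OF order_refl]] by simp
 qed
 from this[OF order_refl] show ?thesis by simp
 qed
 also have "(\<Oplus>\<^bsub>V\<^esub>i\<in>{..<N}. c i (sgK x0 k) \<odot>\<^bsub>V\<^esub> mm i) = rh (sgK x0 k) w"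
 using e(1) TW.sg_in[OF k] unfolding expansion_def by simp
 finally show ?thesis ..
 qed
 have "TW.tp W W' \<beta>"
 unfolding twisted_pair_def clin_def
 using nzb b_add_left b_sm_left b_add_right b_sm_right b_inv by blast
 then show ?thesis by blast
qed

text \<open>The summands are spanned by irreducibles of one type. If all irreducible pairs of the
  two types paired to zero, so would the summands.\<close>

lemma Pf_block:
 assumes U: "U : \<U>" "U' : \<U>" and u: "u : U" "w : U'" "Pf u w ~= 0"
 shows "TW.Nrel U U'"
proof -
 obtain W W' where W: "U = V.isotyp W" "V.irr W" "U' = V.isotyp W'" "V.irr W'"
 using U by (auto simp: V.isotypic_summands_eq)
 have Uc: "U <= carrier F" "U' <= carrier F" using summand_sub U by auto
 have "EX X Y x y. V.irr X & V.iso_rep W X & V.irr Y & V.iso_rep W' Y & x : X & y : Y & Pf x y ~= 0"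
 proof (rule ccontr)
 assume neg: "\<nexists>X Y x y. V.irr X & V.iso_rep W X & V.irr Y & V.iso_rep W' Y & x : X & y : Y & Pf x y ~= 0"
 have 1: "Pf a w = 0" if X: "V.irr X" "V.iso_rep W X" "a : X" and w: "w : U'" for X a w
 proof -
 have "U' <= {w : carrier F. Pf a w = 0}"
 unfolding W(3) V.isotyp_def
 proof (rule V.cspan_least)
 show "submod V {w : carrier F. Pf a w = 0}"
 by (rule V.submodI) (use Pf_smult_right[OF F.M.zero_closed, of a 0] in \<open>auto simp: Pf_add_right Pf_smult_right\<close>)
 fix Y assume Y: "Y : {W'a. V.irr W'a & V.iso_rep W' W'a}"
 then have "Y <= carrier F" using V.srep_sub V.irrD(1) by fastforce
 then show "Y <= {w : carrier F. Pf a w = 0}" using Y neg X by blast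
 qed
 then show ?thesis using w by blast
 qed
 have "U <= {a : carrier F. Pf a w = 0}"
 unfolding W(1) V.isotyp_def
 proof (rule V.cspan_least)
 show "submod V {a : carrier F. Pf a w = 0}"
 by (rule V.submodI) (use Pf_smult_left[OF F.M.zero_closed, of 0 w] in \<open>auto simp: Pf_add_left Pf_smult_left\<close>)
 fix X assume X: "X : {W'. V.irr W' & V.iso_rep W W'}"
 then have "X <= carrier F" using V.srep_sub V.irrD(1) by fastforce
 then show "X <= {a : carrier F. Pf a w = 0}" using X 1 u(2) by blast
 qed
 then show False using u by blast
 qed
 then obtain X Y x y where XY: "V.irr X" "V.iso_rep W X" "V.irr Y" "V.iso_rep W' Y" "x : X" "y : Y" "Pf x y ~= 0"
 by blast
 obtain \<beta> where "TW.tp X Y \<beta>" using Pf_twisted_pair[OF XY(1,3,5,6,7)] by blast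
 moreover have "U = V.isotyp X" "U' = V.isotyp Y" using V.isotyp_cong W XY by auto
 ultimately show ?thesis unfolding TW.Nrel_def using XY(1,3) by blast
qed

lemma form_block:
 assumes "U : \<U>" "U' : \<U>" "b : Bs U" "b' : Bs U'" "Ph (delta b) b' ~= 0"
 shows "TW.Nrel U U'"
proof -
 have "b : B" "b' : B" using assms B_def by auto
 then have "Pf b b' ~= 0" using assms(5) by (simp add: Pf_def emb_bas form_delta)
 moreover have "b : U" "b' : U'" using assms Bs by blast+
 ultimately show ?thesis using Pf_block assms(1,2) by blast
qed

end

section \<open>Linear algebra of finitely supported vectors\<close>

text \<open>A matrix in row convention: \<open>N b\<close> is the image of the basis vector
  \<open>b\<close>. The index set may be infinite, since only the support of \<open>v\<close> is
  summed over.\<close>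

definition mx :: "('i => 'j => 'a::comm_ring_1) => ('i => 'a) => 'j => 'a" where
 "mx N v i = (SUM b:{b. v b ~= 0}. v b * N b i)"

lemma mx_superset: "finite J ==> {b. v b ~= 0} <= J ==> mx N v i = (SUM b:J. v b * N b i)"
 unfolding mx_def by (rule sum.mono_neutral_left) auto

lemma mx_delta: "mx N (delta b) = N b"
 using mx_superset[of "{b}" "delta b" N] by (auto simp: fun_eq_iff)

lemma mx_add:
 assumes "finite {b. u b ~= 0}" "finite {b. v b ~= 0}"
 shows "mx N (%b. u b + v b) = (%i. mx N u i + mx N v i)"
proof
 fix i
 let ?J = "{b. u b ~= 0} \<union> {b. v b ~= 0}"
 have J: "finite ?J" "{b. u b + v b ~= 0} <= ?J" "{b. u b ~= 0} <= ?J" "{b. v b ~= 0} <= ?J" using assms by auto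
 show "mx N (%b. u b + v b) i = mx N u i + mx N v i"
 unfolding mx_superset[OF J(1,2)] mx_superset[OF J(1,3)] mx_superset[OF J(1,4)]
 by (simp add: distrib_right sum.distrib)
qed

lemma mx_smult:
 assumes "finite {b. v b ~= 0}" shows "mx N (%b. q * v b) = (%i. q * mx N v i)"
proof
 fix i
 have J: "{b. q * v b ~= 0} <= {b. v b ~= 0}" by auto
 show "mx N (%b. q * v b) i = q * mx N v i"
 unfolding mx_superset[OF assms J] mx_def[of N v] by (simp add: sum_distrib_left mult.assoc)
qed

lemma mx_cong: "(!!b. v b ~= 0 ==> N b = N' b) ==> mx N v = mx N' v"
 by (simp add: fun_eq_iff mx_def)

lemma mx_support: "{i. mx N v i ~= 0} <= (UN b:{b. v b ~= 0}. {i. N b i ~= 0})"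
proof
 fix i assume "i : {i. mx N v i ~= 0}"
 then have "(SUM b:{b. v b ~= 0}. v b * N b i) ~= 0" by (simp add: mx_def)
 then obtain b where "b : {b. v b ~= 0}" "v b * N b i ~= 0" by (meson sum.not_neutral_contains_not_neutral)
 then show "i : (UN b:{b. v b ~= 0}. {i. N b i ~= 0})" by auto
qed

lemma mx_mx:
 assumes v: "finite {b. v b ~= 0}" and N': "!!b. v b ~= 0 ==> finite {i. N' b i ~= 0}"
 shows "mx N (mx N' v) = mx (%b. mx N (N' b)) v"
proof
 fix i
 let ?J = "{b. v b ~= 0}" and ?L = "UN b:{b. v b ~= 0}. {i. N' b i ~= 0}"
 have L: "finite ?L" using v N' by blast
 have "mx N (mx N' v) i = (SUM c:?L. SUM b:?J. v b * (N' b c * N c i))"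
 unfolding mx_superset[OF L mx_support] by (simp add: mx_def sum_distrib_right mult.assoc)
 also have "... = (SUM b:?J. v b * (SUM c:?L. N' b c * N c i))"
 by (subst sum.swap) (simp add: sum_distrib_left)
 also have "... = (SUM b:?J. v b * mx N (N' b) i)"
 proof (rule sum.cong[OF refl])
 fix b assume "b : ?J"
 then have "{c. N' b c ~= 0} <= ?L" by blast
 then show "v b * (SUM c:?L. N' b c * N c i) = v b * mx N (N' b) i" by (simp only: mx_superset[OF L])
 qed
 finally show "mx N (mx N' v) i = mx (%b. mx N (N' b)) v i" by (simp add: mx_def)
qed

lemma mx_in:
 assumes v: "v : fin_supp B UNIV" and N: "!!b. b : B ==> N b : fin_supp B UNIV"
 shows "mx N v : fin_supp B UNIV"
proof -
 have vb: "b : B" if "v b ~= 0" for b using fin_suppD(2)[OF v] that by blast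
 have "finite (UN b:{b. v b ~= 0}. {i. N b i ~= 0})" using fin_suppD(1)[OF v] fin_suppD(1)[OF N] vb by blast
 then have "finite {i. mx N v i ~= 0}" using mx_support finite_subset by metis
 moreover have "mx N v i = 0" if "i ~: B" for i
 unfolding mx_def using vb fin_suppD(2)[OF N that] by (intro sum.neutral) auto
 ultimately show ?thesis unfolding fin_supp_def by auto
qed

lemma extm_mx: "extm h crd T = mx (%b i. h (crd (T b) i))"
 by (simp add: fun_eq_iff extm_def mx_def)

text \<open>More unknowns than equations: one unknown is eliminated with the help of each
  equation.\<close>

lemma homogeneous_system:
 assumes "finite J" "finite S" "card J < card S"
 shows "EX c. (EX s:S. c s ~= (0::'a::field)) & (ALL j:J. (SUM s:S. c s * M s j) = 0)"
 using assms
proof (induction J arbitrary: S M rule: finite_induct)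
 case empty
 then obtain s where "s : S" by fastforce
 then show ?case by (intro exI[of _ "%_. 1"]) auto
next
 case (insert j J)
 show ?case
 proof (cases "ALL s:S. M s j = 0")
 case True
 have "card J < card S" using insert by simp
 from insert.IH[OF insert.prems(1) this, of M] show ?thesis using True by auto
 next
 case False
 then obtain t where t: "t : S" "M t j ~= 0" by blast
 define S' where "S' = S - {t}"
 have S': "finite S'" "card J < card S'" "S = insert t S'" "t ~: S'"
 using insert t unfolding S'_def by auto
 obtain c where c: "EX s:S'. c s ~= 0" "ALL i:J. (SUM s:S'. c s * (M s i - M s j / M t j * M t i)) = 0"
 using insert.IH[OF S'(1,2), of "%s i. M s i - M s j / M t j * M t i"] by blast
 define d where "d s = (if s = t then - (SUM s:S'. c s * M s j) / M t j else c s)" for s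
 have d: "(SUM s:S. d s * M s i) = (SUM s:S'. c s * (M s i - M s j / M t j * M t i))" for i
 proof -
 have "(SUM s:S'. d s * M s i) = (SUM s:S'. c s * M s i)"
 by (rule sum.cong) (use S'(4) in \<open>auto simp: d_def\<close>)
 then have "(SUM s:S. d s * M s i) = - (SUM s:S'. c s * M s j) / M t j * M t i + (SUM s:S'. c s * M s i)"
 unfolding S'(3) using S'(1,4) by (simp add: d_def)
 also have "... = (SUM s:S'. c s * (M s i - M s j / M t j * M t i))"
 by (simp add: right_diff_distrib sum_subtractf sum_distrib_right sum_divide_distrib mult.assoc)
 finally show ?thesis .
 qed
 have "(SUM s:S. d s * M s i) = 0" if "i : insert j J" for i
 unfolding d using that c(2) t(2) by auto
 moreover have "EX s:S. d s ~= 0" using c(1) S' unfolding d_def by auto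
 ultimately show ?thesis by blast
 qed
qed

text \<open>In place of a characteristic polynomial, take a nonzero \<open>p\<close> of least degree
  that annihilates some nonzero \<open>v\<close> when evaluated at the matrix. A root
  \<open>a\<close> splits off a linear factor, and the cofactor applied to \<open>v\<close> is
  nonzero by minimality, hence an eigenvector for \<open>a\<close>.\<close>

lemma eigenvector:
 fixes N :: "'i \<Rightarrow> 'i \<Rightarrow> 'a::alg_closed_field"
 assumes J: "finite J" "J \<noteq> {}" and N: "\<And>b i. b \<in> J \<Longrightarrow> i \<notin> J \<Longrightarrow> N b i = 0"
 shows "\<exists>\<alpha> v. v \<noteq> (\<lambda>_. 0) \<and> {i. v i \<noteq> 0} \<subseteq> J \<and> mx N v = (\<lambda>i. \<alpha> * v i)"
proof -
 define S where "S = {v :: 'i \<Rightarrow> 'a. {i. v i \<noteq> 0} \<subseteq> J}"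
 let ?T = "mx N"
 have TS: "?T v \<in> S" if "v \<in> S" for v
 using that mx_support[of N v] N unfolding S_def by blast
 have pS: "(?T ^^ k) v \<in> S" if "v \<in> S" for k v
 by (induction k) (use that TS in auto)
 have T_sum: "?T (\<lambda>i. \<Sum>k\<in>A. c k * f k i) j = (\<Sum>k\<in>A. c k * ?T (f k) j)" if "\<And>k. k \<in> A \<Longrightarrow> f k \<in> S" for A c j and f :: "nat \<Rightarrow> 'i \<Rightarrow> 'a"
 proof -
 have "{i. (\<Sum>k\<in>A. c k * f k i) \<noteq> 0} \<subseteq> J"
 proof
 fix i assume "i \<in> {i. (\<Sum>k\<in>A. c k * f k i) \<noteq> 0}"
 then obtain k where "k \<in> A" "c k * f k i \<noteq> 0" by (auto elim: sum.not_neutral_contains_not_neutral)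
 then show "i \<in> J" using that[of k] unfolding S_def by auto
 qed
 then have "?T (\<lambda>i. \<Sum>k\<in>A. c k * f k i) j = (\<Sum>b\<in>J. \<Sum>k\<in>A. c k * (f k b * N b j))"
 by (subst mx_superset[OF J(1)]) (simp_all add: sum_distrib_right mult.assoc)
 also have "\<dots> = (\<Sum>k\<in>A. c k * (\<Sum>b\<in>J. f k b * N b j))"
 by (subst sum.swap) (simp add: sum_distrib_left)
 also have "\<dots> = (\<Sum>k\<in>A. c k * ?T (f k) j)"
 proof (rule sum.cong[OF refl])
 fix k assume "k \<in> A"
 then have "{b. f k b \<noteq> 0} \<subseteq> J" using that unfolding S_def by blast
 then show "c k * (\<Sum>b\<in>J. f k b * N b j) = c k * ?T (f k) j" by (simp only: mx_superset[OF J(1)])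
 qed
 finally show ?thesis .
 qed
 define ap where "ap p v i = (\<Sum>k\<le>Polynomial.degree p. Polynomial.coeff p k * (?T ^^ k) v i)" for p v i
 have ap_le: "ap p v i = (\<Sum>k\<le>n. Polynomial.coeff p k * (?T ^^ k) v i)" if "Polynomial.degree p \<le> n" for p v i n
 unfolding ap_def by (rule sum.mono_neutral_left) (use that in \<open>auto simp: coeff_eq_0\<close>)
 define Q where "Q n \<longleftrightarrow> (\<exists>p v. Polynomial.degree p = n \<and> p \<noteq> 0 \<and> v \<in> S \<and> v \<noteq> (\<lambda>_. 0) \<and> (\<forall>i. ap p v i = 0))" for n
 have "\<exists>n. Q n"
 proof -
 obtain b where b: "b \<in> J" using J(2) by blast
 have dS: "(delta b :: 'i \<Rightarrow> 'a) \<in> S" using b unfolding S_def by auto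
 \<comment> \<open>The iterates number one more than the dimension of the block, so they satisfy a
   nontrivial linear relation.\<close>
 obtain c where c: "\<exists>s\<in>{..card J}. c s \<noteq> 0" "\<forall>j\<in>J. (\<Sum>s\<le>card J. c s * (?T ^^ s) (delta b) j) = 0"
 using homogeneous_system[OF J(1), of "{..card J}" "\<lambda>s. (?T ^^ s) (delta b)"] by auto
 define p where "p = (\<Sum>s\<le>card J. Polynomial.monom (c s) s)"
 have cf: "Polynomial.coeff p k = (if k \<le> card J then c k else 0)" for k
 unfolding p_def Polynomial.coeff_sum Polynomial.coeff_monom by (simp add: sum.delta)
 have "p \<noteq> 0" using c(1) cf by (metis Polynomial.coeff_0 atMost_iff)
 moreover have "Polynomial.degree p \<le> card J" by (rule degree_le) (simp add: cf)
 then have ap_eq: "ap p (delta b) i = (\<Sum>s\<le>card J. c s * (?T ^^ s) (delta b) i)" for i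
 using ap_le cf by simp
 have "ap p (delta b) i = 0" for i
 proof (cases "i \<in> J")
 case False
 then have "(?T ^^ s) (delta b) i = 0" for s using pS[OF dS, of s] unfolding S_def by blast
 then show ?thesis using ap_eq by simp
 qed (use c(2) ap_eq in simp)
 moreover have "(delta b :: 'i \<Rightarrow> 'a) \<noteq> (\<lambda>_. 0)" by (metis zero_neq_one)
 ultimately show ?thesis unfolding Q_def using dS by blast
 qed
 then obtain n where n: "Q n" "\<And>m. m < n \<Longrightarrow> \<not> Q m" using exists_least_iff[of Q] by blast
 then obtain p v where p: "Polynomial.degree p = n" "p \<noteq> 0" "v \<in> S" "v \<noteq> (\<lambda>_. 0)" "\<And>i. ap p v i = 0"
 unfolding Q_def by blast
 have "Polynomial.degree p > 0"
 proof (rule ccontr)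
 assume "\<not> Polynomial.degree p > 0"
 then have d: "Polynomial.degree p = 0" by simp
 then have "Polynomial.coeff p 0 \<noteq> 0" using p(2) leading_coeff_0_iff[of p] by simp
 moreover have "Polynomial.coeff p 0 * v i = 0" for i using p(5)[of i] d by (simp add: ap_def)
 ultimately have "v = (\<lambda>_. 0)" by auto
 then show False using p(4) by blast
 qed
 then obtain a where "poly p a = 0" using alg_closed_imp_poly_has_root by blast
 then obtain q where q: "p = [:- a, 1:] * q" unfolding poly_eq_0_iff_dvd dvd_def by blast
 have q0: "q \<noteq> 0" using p(2) q by auto
 have dq: "Polynomial.degree p = Suc (Polynomial.degree q)" unfolding q using q0 Polynomial.degree_mult_eq[of "[:- a, 1:]" q] by (simp del: mult_pCons_left)
 define w where "w = ap q v"
 have wS: "w \<in> S"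
 proof -
 have "w i = 0" if "i \<notin> J" for i
 using pS[OF p(3)] that unfolding w_def ap_def S_def by (intro sum.neutral) auto
 then show ?thesis unfolding S_def by blast
 qed
 have "w \<noteq> (\<lambda>_. 0)"
 proof
 assume "w = (\<lambda>_. 0)"
 then have "Q (Polynomial.degree q)" unfolding Q_def w_def using q0 p(3,4) by (metis)
 then show False using n(2) dq p(1) by simp
 qed
 moreover have "mx N w = (\<lambda>i. a * w i)"
 proof
 fix i
 let ?d = "Polynomial.degree q"
 have cp: "Polynomial.coeff p k = Polynomial.coeff (pCons 0 q) k - a * Polynomial.coeff q k" for k
 by (simp add: q)
 have "ap p v i = (\<Sum>k\<le>Suc ?d. Polynomial.coeff (pCons 0 q) k * (?T ^^ k) v i) - a * (\<Sum>k\<le>Suc ?d. Polynomial.coeff q k * (?T ^^ k) v i)"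
 unfolding ap_def dq cp by (simp only: left_diff_distrib sum_subtractf sum_distrib_left mult.assoc)
 also have "(\<Sum>k\<le>Suc ?d. Polynomial.coeff q k * (?T ^^ k) v i) = w i"
 unfolding w_def by (rule ap_le[symmetric]) simp
 also have "(\<Sum>k\<le>Suc ?d. Polynomial.coeff (pCons 0 q) k * (?T ^^ k) v i) = (\<Sum>k\<le>?d. Polynomial.coeff q k * ?T ((?T ^^ k) v) i)"
 by (subst sum.atMost_Suc_shift) simp
 also have "\<dots> = ?T (\<lambda>i. \<Sum>k\<le>?d. Polynomial.coeff q k * (?T ^^ k) v i) i"
 by (rule T_sum[symmetric]) (rule pS[OF p(3)])
 also have "(\<lambda>i. \<Sum>k\<le>?d. Polynomial.coeff q k * (?T ^^ k) v i) = w" by (simp add: w_def ap_def fun_eq_iff)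
 finally show "mx N w i = a * w i" using p(5)[of i] by simp
 qed
 ultimately show ?thesis using wS unfolding S_def by blast
qed

section \<open>The action of the base change of a family of Lie algebras\<close>

text \<open>The right-hand side is evaluated on one representative \<open>a\<close> of
  \<open>s\<close>. It is the same for all of them because it is balanced in the Lie algebra
  argument, by linearity of \<pi>.\<close>

lemma (in self_ext) base_action:
 assumes gm: "Module.module Oring gg"
 and lin: "!!X. X : carrier gg ==> linear_map Oring M M (\<pi> X)" "!!f. f : carrier M ==> linear_map Oring gg M (%X. \<pi> X f)"
 and s: "s : carrier (base_change A h gg)" "a : s" and t: "t : carrier BC"
 shows "base_action A h M \<pi> s t : carrier BC"
 and "tc (base_action A h M \<pi> s t) = (%i. fsum (%(c, X). c * extm h crd (\<pi> X) (tc t) i) a)"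
proof -
 interpret Tg: tensor_pair Oring "alg_module A h" gg
 by (intro tensor_pair.intro scalar_closed_alg scalar_closed_module gm)
 have AX: "a * b : carrier A" if "a : carrier A" "b : carrier A" for a b using mult_in that .
 have piM: "\<pi> X f : carrier M" if "X : carrier gg" "f : carrier M" for X f using linear_mapD(3)[OF lin(1)] that by blast
 define E where "E a b = frag_extend (%(c :: 'a, X). frag_extend (%(d, f). frag_of (c * d, \<pi> X f)) b) a" for a b
 obtain b where b: "t = cls b" "pkeys b <= carrier A \<times> carrier M" "b : t" using BC_cases[OF t] .
 have sk: "pkeys a <= carrier A \<times> carrier gg" "s = tensor_class Oring (alg_module A h) gg a" if "a : s" for a
 using Tg.mem_tensor_keys[of s a] s(1) that by simp_all
 have bk: "pkeys b' <= carrier A \<times> carrier M" "fc b' = tc t" if "b' : t" for b'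
 using T.mem_tensor_keys(1)[of t b'] t that tc_mem[OF t that] by simp_all
 have keys: "pkeys (E a b) <= carrier A \<times> carrier M"
 if a: "pkeys a <= carrier A \<times> carrier gg" and b: "pkeys b <= carrier A \<times> carrier M" for a b
 proof -
 have "pkeys (frag_extend (%(d, f). frag_of (c * d, \<pi> X f)) b) <= carrier A \<times> carrier M"
 if "(c, X) : carrier A \<times> carrier gg" for c X
 proof -
 have "(UN x:pkeys b. pkeys ((%(d, f). frag_of (c * d, \<pi> X f)) x)) <= carrier A \<times> carrier M"
 proof (rule UN_least)
 fix x assume "x : pkeys b"
 then obtain d f where x: "x = (d, f)" "d : carrier A" "f : carrier M" using b by (cases x) auto
 have "c * d : carrier A" "\<pi> X f : carrier M" using AX piM x that by simp_all
 then show "pkeys ((%(d, f). frag_of (c * d, \<pi> X f)) x) <= carrier A \<times> carrier M"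
 by (simp add: x(1) keys_frag_of)
 qed
 then show ?thesis using keys_frag_extend by (rule subset_trans[rotated])
 qed
 then have "(UN x:pkeys a. pkeys ((%(c, X). frag_extend (%(d, f). frag_of (c * d, \<pi> X f)) b) x)) <= carrier A \<times> carrier M"
 using a by (intro UN_least) (auto split: prod.splits)
 then show ?thesis unfolding E_def using keys_frag_extend by (rule subset_trans[rotated])
 qed
 have fcE: "fc (E a b) i = fsum (%(c, X). c * extm h crd (\<pi> X) (fc b) i) a"
 if a: "pkeys a <= carrier A \<times> carrier gg" and b: "pkeys b <= carrier A \<times> carrier M" for a b i
 unfolding E_def fcoord_def fsum_extend
 proof (rule fsum_cong)
 fix q assume q: "q : pkeys a"
 obtain c X where cX: "q = (c, X)" "X : carrier gg" using q a by (cases q) auto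
 have "fsum (%q. fsum (%(c, m). c * h (crd m i)) ((%(d, f). frag_of (c * d, \<pi> X f)) q)) b
 = fsum (%q. c * (%(d, f). d * h (crd (\<pi> X f) i)) q) b"
 by (rule fsum_cong) (auto simp: mult.assoc)
 also have "... = c * extm h crd (\<pi> X) (fc b) i"
 unfolding fsum_cmult using extm_frag[OF lin(1)[OF cX(2)] b] by simp
 finally show "fsum (%(c, m). c * h (crd m i)) ((%(c, X). frag_extend (%(d, f). frag_of (c * d, \<pi> X f)) b) q)
 = (%(c, X). c * extm h crd (\<pi> X) (%i. fsum (%(c, m). c * h (crd m i)) b) i) q"
 by (simp add: cX(1) fsum_extend fcoord_def[abs_def])
 qed
 have supp: "v : carrier M" if "tc t v ~= 0" for v
 proof -
 have "v : I" using tc_in[OF t] that unfolding fin_supp_def by blast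
 then show ?thesis using bas_in by blast
 qed
 have indep: "fsum (%(c, X). c * extm h crd (\<pi> X) (tc t) i) a' = fsum (%(c, X). c * extm h crd (\<pi> X) (tc t) i) a"
 if a': "a' : s" for a' i
 proof -
 have "a' - a : tensor_rel Oring (alg_module A h) gg" using sk(2)[OF s(2)] a' Tg.mem_class by blast
 then have "fsum (%(c, X). c * extm h crd (\<pi> X) (tc t) i) (a' - a) = 0"
 proof (rule Tg.fsum_kill)
 fix c X Y assume X: "X : carrier gg" "Y : carrier gg"
 have "v * h (crd (\<pi> (X \<oplus>\<^bsub>gg\<^esub> Y) b) i) = v * h (crd (\<pi> X b) i) + v * h (crd (\<pi> Y b) i)" if "tc t b ~= 0" for v b
 using linear_mapD(1)[OF lin(2)[OF supp[OF that]] X] crd_add[OF piM[OF X(1) supp[OF that]] piM[OF X(2) supp[OF that]]]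
 by (simp add: h_add distrib_left)
 then have "extm h crd (\<pi> (X \<oplus>\<^bsub>gg\<^esub> Y)) (tc t) i = extm h crd (\<pi> X) (tc t) i + extm h crd (\<pi> Y) (tc t) i"
 unfolding extm_def sum.distrib[symmetric] by (intro sum.cong) auto
 then show "(case (c, X \<oplus>\<^bsub>gg\<^esub> Y) of (c, X) => c * extm h crd (\<pi> X) (tc t) i)
 = (case (c, X) of (c, X) => c * extm h crd (\<pi> X) (tc t) i) + (case (c, Y) of (c, X) => c * extm h crd (\<pi> X) (tc t) i)"
 by (simp add: distrib_left)
 next
 fix r c X assume X: "X : carrier gg"
 have "v * h (crd (\<pi> (r \<odot>\<^bsub>gg\<^esub> X) b) i) = h r * (v * h (crd (\<pi> X b) i))" if "tc t b ~= 0" for v b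
 using linear_mapD(2)[OF lin(2)[OF supp[OF that]] _ X, of r] crd_smult[OF piM[OF X supp[OF that]]]
 by (simp add: h_mult mult_ac)
 then have "extm h crd (\<pi> (r \<odot>\<^bsub>gg\<^esub> X)) (tc t) i = h r * extm h crd (\<pi> X) (tc t) i"
 unfolding extm_def sum_distrib_left by (intro sum.cong) auto
 then show "(case (r \<odot>\<^bsub>alg_module A h\<^esub> c, X) of (c, X) => c * extm h crd (\<pi> X) (tc t) i)
 = (case (c, r \<odot>\<^bsub>gg\<^esub> X) of (c, X) => c * extm h crd (\<pi> X) (tc t) i)" by (simp add: mult_ac)
 qed (simp add: distrib_right)
 then show ?thesis by (simp add: fsum_diff)
 qed
 have eq: "cls (E a' b') = cls (E a b)" if "a' : s" "b' : t" for a' b'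
 proof -
 have fceq: "fc (E a' b') i = fc (E a b) i" for i
 unfolding fcE[OF sk(1)[OF that(1)] bk(1)[OF that(2)]] fcE[OF sk(1)[OF s(2)] b(2)] bk(2)[OF that(2)] bk(2)[OF b(3)]
 by (rule indep[OF that(1)])
 have "pkeys (E a' b' - E a b) <= carrier A \<times> carrier M"
 using keys_diff[of "E a' b'" "E a b"] keys[OF sk(1)[OF that(1)] bk(1)[OF that(2)]] keys[OF sk(1)[OF s(2)] b(2)] by blast
 then show ?thesis unfolding T.class_eq_iff using rel_iff fceq by (simp add: fc_diff)
 qed
 have "base_action A h M \<pi> s t = (UN a:s. UN b:t. cls (E a b))"
 unfolding base_action_def E_def by (simp add: ops)
 also have "... = cls (E a b)" using eq s(2) b(3) by blast
 finally have ba: "base_action A h M \<pi> s t = cls (E a b)" .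
 show "base_action A h M \<pi> s t : carrier BC" unfolding ba using keys[OF sk(1)[OF s(2)] b(2)] by simp
 show "tc (base_action A h M \<pi> s t) = (%i. fsum (%(c, X). c * extm h crd (\<pi> X) (tc t) i) a)"
 unfolding ba tc_class using fcE[OF sk(1)[OF s(2)] b(2)] bk(2)[OF b(3)] by (simp add: fun_eq_iff)
qed

section \<open>Schur's lemma\<close>

context setting
begin

lemma module_g: "Module.module Oring gg"
 using hc.lie_algebra unfolding lie_algebra_family_def locally_free_def by blast

lemma mx_to_ac: "mx (%b i. to_ac (N b i)) (%b. to_ac (v b)) = (%i. to_ac (mx N v i))"
 by (simp add: mx_def fun_eq_iff to_ac_sum)

text \<open>\<open>F\<close> may have infinite rank, so the eigenvector must come from the finite
  set \<open>J\<close>, which \<open>M\<close> preserves. The full eigenspace over the algebraic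
  closure is stable under the extended Lie algebra, hence everything.\<close>

lemma schur:
 assumes gi: "generically_irreducible gg F \<pi>"
 and rows: "!!b. b : B ==> M b : VV"
 and comm: "!!X b. X : carrier gg ==> b : B ==> mx M (ext (\<pi> X) (delta b)) = ext (\<pi> X) (M b)"
 and J: "finite J" "J ~= {}" "J <= B" "!!b i. b : J ==> i ~: J ==> M b i = 0"
 shows "EX a. ALL b:B. M b = (%i. a * delta b i)"
proof -
 interpret kF: self_ext F B crd Kbar Kbar_embed
 by (intro self_ext.intro based_ext.intro based_F Kbar_ext)
 interpret kM: Module.module Kbar kF.BC by (rule kF.module_BC)
 let ?N = "%b i. to_ac (M b i)"
 have Nb: "?N b : fin_supp B UNIV" if "b : B" for b
 using rows[OF that] unfolding fin_supp_def by auto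
 obtain \<alpha> v where v: "v ~= (%_. 0)" "{i. v i ~= 0} <= J" "mx ?N v = (%i. \<alpha> * v i)"
 using eigenvector[OF J(1,2), of ?N] J(4) by auto
 have vin: "v : fin_supp B UNIV" using v(2) J finite_subset unfolding fin_supp_def by blast
 define W where "W = {t : carrier kF.BC. mx ?N (kF.tc t) = (%i. \<alpha> * kF.tc t i)}"
 have tcin: "kF.tc t : fin_supp B UNIV" if "t : carrier kF.BC" for t using kF.tc_in[OF that] by simp
 have commK: "mx ?N (extm Kbar_embed crd (\<pi> X) w) = extm Kbar_embed crd (\<pi> X) (mx ?N w)"
 if X: "X : carrier gg" and w: "w : fin_supp B UNIV" for X w
 proof -
 let ?E = "%b i. to_ac (to_fract (crd (\<pi> X b) i))"
 have wB: "b : B" if "w b ~= 0" for b using fin_suppD(2)[OF w] that by blast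
 have Eb: "ext (\<pi> X) (delta b) = (%i. to_fract (crd (\<pi> X b) i))" for b
 unfolding extm_mx mx_delta ..
 have Ef: "finite {i. ?E b i ~= 0}" if "b : B" for b
 using fin_suppD(1)[OF ext_in[OF pi_linear[OF X] fin_supp_delta[OF that]]] by (simp add: Eb)
 have "mx ?N (mx ?E w) = mx (%b. mx ?N (?E b)) w" by (rule mx_mx[OF fin_suppD(1)[OF w] Ef[OF wB]])
 also have "... = mx (%b. mx ?E (?N b)) w"
 proof (rule mx_cong)
 fix b assume "w b ~= 0"
 then have "mx M (%i. to_fract (crd (\<pi> X b) i)) = ext (\<pi> X) (M b)" using comm[OF X wB] Eb by simp
 then show "mx ?N (?E b) = mx ?E (?N b)" by (simp add: mx_to_ac extm_mx)
 qed
 also have "... = mx ?E (mx ?N w)"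
 by (rule mx_mx[OF fin_suppD(1)[OF w] fin_suppD(1)[OF Nb[OF wB]], symmetric])
 finally show ?thesis by (simp add: extm_mx)
 qed
 have WI: "t : W" if "t : carrier kF.BC" "mx ?N (kF.tc t) = (%i. \<alpha> * kF.tc t i)" for t
 using that unfolding W_def by blast
 have WD: "t : carrier kF.BC" "mx ?N (kF.tc t) = (%i. \<alpha> * kF.tc t i)" if "t : W" for t
 using that unfolding W_def by blast+
 have Wadd: "s \<oplus>\<^bsub>kF.BC\<^esub> t : W" if "s : W" "t : W" for s t
 by (rule WI[OF kF.BC_add_closed[OF WD(1)[OF that(1)] WD(1)[OF that(2)]]])
 (simp add: kF.tc_add[OF WD(1)[OF that(1)] WD(1)[OF that(2)]] mx_add[OF fin_suppD(1)[OF tcin] fin_suppD(1)[OF tcin]]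
 WD[OF that(1)] WD[OF that(2)] distrib_left del: base_change_simps)
 have Wsm: "c \<odot>\<^bsub>kF.BC\<^esub> t : W" if t: "t : W" for c t
 proof (rule WI)
 have c: "c : carrier Kbar" by simp
 show "c \<odot>\<^bsub>kF.BC\<^esub> t : carrier kF.BC" using kF.tc_smult(2)[OF c WD(1)[OF t]] .
 show "mx ?N (kF.tc (c \<odot>\<^bsub>kF.BC\<^esub> t)) = (%i. \<alpha> * kF.tc (c \<odot>\<^bsub>kF.BC\<^esub> t) i)"
 unfolding kF.tc_smult(1)[OF c WD(1)[OF t]] mx_smult[OF fin_suppD(1)[OF tcin[OF WD(1)[OF t]]]] WD(2)[OF t]
 by (simp add: mult_ac)
 qed
 have Wz: "\<zero>\<^bsub>kF.BC\<^esub> : W"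
 by (rule WI[OF kF.BC_zero_closed], unfold kF.tc_zero) (simp add: mx_def fun_eq_iff)
 have "submodule W Kbar kF.BC"
 proof (rule kM.submoduleI)
 show "W <= carrier kF.BC" unfolding W_def by blast
 show "\<ominus>\<^bsub>kF.BC\<^esub> t : W" if t: "t : W" for t
 proof -
 have c: "- 1 : carrier Kbar" by simp
 note m = WD(1)[OF t] WD(1)[OF Wsm[OF t, of "- 1"]]
 have "(- 1) \<odot>\<^bsub>kF.BC\<^esub> t \<oplus>\<^bsub>kF.BC\<^esub> t = \<zero>\<^bsub>kF.BC\<^esub>"
 by (rule kF.tc_inj[OF kF.BC_add_closed[OF m(2,1)] kF.BC_zero_closed])
 (simp add: kF.tc_add[OF m(2,1)] kF.tc_smult(1)[OF c m(1)] kF.tc_zero del: base_change_simps)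
 from kM.minus_equality[OF this m] show ?thesis using Wsm[OF t, of "- 1"] by simp
 qed
 qed (use Wadd Wsm Wz in blast)+
 moreover have "base_action Kbar Kbar_embed F \<pi> s ` W <= W" if s: "s : carrier (base_change Kbar Kbar_embed gg)" for s
 proof
 fix r assume "r : base_action Kbar Kbar_embed F \<pi> s ` W"
 then obtain t where t: "t : W" "r = base_action Kbar Kbar_embed F \<pi> s t" by blast
 interpret Tg: tensor_pair Oring "alg_module Kbar Kbar_embed" gg
 by (intro tensor_pair.intro kF.scalar_closed_alg scalar_closed_module module_g)
 obtain a where a: "a : s" "pkeys a <= UNIV \<times> carrier gg"
 proof -
 from s have "s : {tensor_class Oring (alg_module Kbar Kbar_embed) gg a |a. pkeys a <= UNIV \<times> carrier gg}"
 using Tg.carrier_tensor by simp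
 then obtain a where a: "s = tensor_class Oring (alg_module Kbar Kbar_embed) gg a" "pkeys a <= UNIV \<times> carrier gg" by blast
 have "a : s" unfolding a(1) by (rule Tg.self_mem_class)
 then show thesis using a(2) by (rule that)
 qed
 have ba: "base_action Kbar Kbar_embed F \<pi> s t : carrier kF.BC"
 "kF.tc (base_action Kbar Kbar_embed F \<pi> s t) = (%i. fsum (%(c, X). c * extm Kbar_embed crd (\<pi> X) (kF.tc t) i) a)"
 using kF.base_action[of gg \<pi>, OF module_g pi_linear hc.lie_linear(2) s a(1) WD(1)[OF t(1)]] by blast+
 let ?w = "kF.tc t"
 have lin: "(!!q. q : pkeys a ==> finite {i. f q i ~= 0}) ==>
 mx ?N (%i. fsum (%q. f q i) a) = (%i. fsum (%q. mx ?N (f q) i) a)" for f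
 proof
 fix i assume f: "!!q. q : pkeys a ==> finite {i. f q i ~= 0}"
 let ?L = "UN q:pkeys a. {i. f q i ~= 0}"
 have L: "finite ?L" "!!q. q : pkeys a ==> {i. f q i ~= 0} <= ?L" using f by auto
 have "fsum (%q. f q i) a = 0" if "i ~: ?L" for i
 unfolding fsum_def using that by (intro sum.neutral) auto
 then have sub: "{i. fsum (%q. f q i) a ~= 0} <= ?L" by blast
 have "mx ?N (%i. fsum (%q. f q i) a) i = fsum (%q. SUM b:?L. f q b * ?N b i) a"
 unfolding fsum_sum_fun mx_superset[OF L(1) sub] by (simp add: mult.commute[of _ "?N _ _"] fsum_cmult)
 also have "... = fsum (%q. mx ?N (f q) i) a"
 by (rule fsum_cong, rule mx_superset[OF L(1) L(2), symmetric])
 finally show "mx ?N (%i. fsum (%q. f q i) a) i = fsum (%q. mx ?N (f q) i) a" .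
 qed
 have X: "snd q : carrier gg" if "q : pkeys a" for q using that a(2) by auto
 let ?f = "%q i. fst q * extm Kbar_embed crd (\<pi> (snd q)) ?w i"
 have fin: "finite {i. extm Kbar_embed crd (\<pi> (snd q)) ?w i ~= 0}" if "q : pkeys a" for q
 using fin_suppD(1)[OF kF.extm_fin_supp[OF pi_linear[OF X[OF that]] kF.tc_in[OF WD(1)[OF t(1)]]]] .
 have ff: "finite {i. ?f q i ~= 0}" if "q : pkeys a" for q
 using fin[OF that] by (rule finite_subset[rotated]) auto
 have tcr: "kF.tc r = (%i. fsum (%q. ?f q i) a)" unfolding t(2) ba(2) case_prod_beta ..
 have step: "mx ?N (kF.tc r) = (%i. fsum (%q. mx ?N (?f q) i) a)" unfolding tcr by (rule lin) (rule ff)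
 have eig: "mx ?N (?f q) i = \<alpha> * ?f q i" if "q : pkeys a" for q i
 unfolding mx_smult[OF fin[OF that]] commK[OF X[OF that] tcin[OF WD(1)[OF t(1)]]] WD(2)[OF t(1)]
 unfolding extm_mx mx_smult[OF fin_suppD(1)[OF tcin[OF WD(1)[OF t(1)]]]] by (simp add: mult_ac)
 have "mx ?N (kF.tc r) = (%i. \<alpha> * kF.tc r i)"
 proof
 fix i
 have "fsum (%q. mx ?N (?f q) i) a = fsum (%q. \<alpha> * ?f q i) a" by (rule fsum_cong) (rule eig)
 then show "mx ?N (kF.tc r) i = \<alpha> * kF.tc r i" unfolding step unfolding tcr fsum_cmult by simp
 qed
 then show "r : W" using WI ba(1) t(2) by blast
 qed
 ultimately have "W = {\<zero>\<^bsub>kF.BC\<^esub>} | W = carrier kF.BC"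
 using gi unfolding generically_irreducible_def Let_def by blast
 moreover have "W ~= {\<zero>\<^bsub>kF.BC\<^esub>}"
 proof
 have m: "kF.mk v : carrier kF.BC" "kF.tc (kF.mk v) = v" using kF.mk[of v] vin by simp_all
 then have "kF.mk v : W" using WI v(3) by simp
 moreover assume "W = {\<zero>\<^bsub>kF.BC\<^esub>}"
 ultimately have "kF.mk v = \<zero>\<^bsub>kF.BC\<^esub>" by blast
 then show False using m(2) v(1) kF.tc_zero by simp
 qed
 ultimately have Wall: "W = carrier kF.BC" by blast
 have all: "?N b = (%i. \<alpha> * delta b i)" if "b : B" for b
 proof -
 have d: "(delta b :: 'f => complex poly fract alg_closure) : fin_supp B UNIV" using fin_supp_delta[OF that] .
 have m: "kF.mk (delta b) : carrier kF.BC" "kF.tc (kF.mk (delta b)) = delta b" using kF.mk[of "delta b"] d by simp_all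
 have "kF.mk (delta b) : W" using Wall m(1) by blast
 then show ?thesis using WD(2)[of "kF.mk (delta b)"] unfolding m(2) mx_delta by blast
 qed
 obtain b0 where b0: "b0 : B" using J by blast
 \<comment> \<open>The eigenvalue is a diagonal entry of \<open>M\<close>, so it descends from the
   algebraic closure to the field of rational functions.\<close>
 have al: "\<alpha> = to_ac (M b0 b0)" using fun_cong[OF all[OF b0], of b0] by simp
 have "M b i = M b0 b0 * delta b i" if "b : B" for b i
 proof -
 have "to_ac (M b i) = to_ac (M b0 b0 * delta b i)" using fun_cong[OF all[OF that], of i] al by simp
 then show ?thesis by (simp only: to_ac_eq_iff)
 qed
 then show ?thesis by blast
qed

end

section \<open>Functionals on lattices over the local ring\<close>

context real_coord
begin

lemmas R_mult = Rloc_mult[where z = x0, THEN conjunct1]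
 and R_add = Rloc_add[where z = x0, THEN conjunct1]
 and R_sum = Rloc_sum[where z = x0, THEN conjunct1]
 and R_conj = Rloc_conj[where x = x, THEN conjunct1]

lemma valuation_ring: "q : R | inverse q : R"
proof (cases "q = 0")
 case False
 obtain k u where u: "u : R" "val u ~= 0" "q = P powi k * u" using order_unit[OF False] by blast
 show ?thesis
 proof (cases "k \<ge> 0")
 case True
 then show ?thesis using Rloc_mult[OF Ppowi_in[OF True] u(1)] u(3) by simp
 next
 case False
 then have "P powi (- k) : R" using Ppowi_in by simp
 moreover have "inverse q = P powi (- k) * inverse u" by (simp add: u(3) power_int_minus)
 ultimately show ?thesis using Rloc_mult[of "P powi (- k)" x0 "inverse u"] Rloc_inverse[OF u(1,2)] by simp
 qed
qed simp

text \<open>\<open>P\<close> is fixed by conjugation, so conjugation preserves the order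
  \<open>k\<close> at \<open>x\<close>. The product has order \<open>k + k\<close>, which must
  vanish, and the values then multiply to 1.\<close>

lemma unimodular_unit:
 assumes a: "conj_fract a * a = 1"
 shows "a : R" "cmod (val a) = 1"
proof -
 have "a ~= 0" using a by auto
 obtain k u where u: "u : R" "val u ~= 0" "a = P powi k * u" using order_unit[OF \<open>a ~= 0\<close>] by blast
 let ?w = "conj_fract u * u"
 have w: "?w : R" "val ?w = cnj (val u) * val u"
 using Rloc_mult[of "conj_fract u" x0 u] Rloc_conj[OF u(1)] u(1) by auto
 then have w0: "val ?w ~= 0" using u(2) by simp
 have "P powi (k + k) = P powi k * P powi k" by (rule power_int_add) simp
 then have e: "P powi (k + k) * ?w = 1" using a by (simp only: u(3) conj_fract_mult conj_fract_powi P_conj mult_ac)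
 have k0: "k = 0"
 proof (rule ccontr)
 assume "k ~= 0"
 then consider "k + k > 0" | "- (k + k) > 0" by linarith
 then show False
 proof cases
 case 1
 then show False using Ppowi_val[OF 1 w(1)] e by simp
 next
 case 2
 have "?w = P powi (- (k + k)) * (P powi (k + k) * ?w)" by (simp add: power_int_minus)
 then have "?w = P powi (- (k + k)) * 1" unfolding e .
 then show False using Ppowi_val[OF 2, of 1] w0 by simp
 qed
 qed
 then show "a : R" using u by simp
 have "cnj (val u) * val u = 1" using e k0 w(2) by simp
 then have "(cmod (val u))\<^sup>2 = 1" using complex_norm_square[of "val u"] by (metis mult.commute of_real_eq_1_iff)
 then have "cmod (val u) = 1" using abs_square_eq_1[of "cmod (val u)"] by simp
 moreover have "a = u" using k0 u(3) by simp
 ultimately show "cmod (val a) = 1" by simp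
qed

text \<open>The pivot has least order at \<open>x\<close> among the coefficients. Dividing a
  relation by it keeps all coefficients regular.\<close>

lemma pivot:
 assumes "finite S" "EX s:S. c s ~= 0"
 shows "EX t:S. c t ~= 0 & (ALL s:S. c s / c t : R)"
 using assms
proof (induction S rule: finite_induct)
 case (insert s S)
 show ?case
 proof (cases "EX s:S. c s ~= 0")
 case False
 then have "c s ~= 0" using insert.prems by blast
 then show ?thesis using False by (intro bexI[of _ s]) auto
 next
 case True
 then obtain t where t: "t : S" "c t ~= 0" "ALL s:S. c s / c t : R" using insert.IH by blast
 show ?thesis
 proof (cases "c s / c t : R")
 case True
 then show ?thesis using t by blast
 next
 case False
 then have cs: "c s ~= 0" "c t / c s : R" using valuation_ring[of "c s / c t"] by auto
 have "c r / c s : R" if "r : S" for r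
 proof -
 have "(c r / c t) * (c t / c s) : R" by (rule R_mult[OF t(3)[rule_format, OF that] cs(2)])
 then show ?thesis using t(2) by simp
 qed
 then show ?thesis using cs(1) by (intro bexI[of _ s]) auto
 qed
 qed
qed simp

text \<open>The \<open>y s\<close> generate a lattice over the local ring that contains all unit
  vectors, and the vector given by \<open>r0\<close> is not in \<open>P\<close> times the lattice.
  Some functional integral on the lattice is then a unit on this vector. The generators are thinned
  out until they are independent; then the dual basis does it.\<close>

lemma lattice_functional:
 fixes y :: "'s => 'i => complex poly fract"
 assumes "finite S" and J: "finite J"
 and "!!j. j : J ==> EX r. (ALL s:S. r s : R) & (ALL i:J. (SUM s:S. r s * y s i) = delta j i)"
 and "!!s. s : S ==> r0 s : R"
 and "\<nexists>r. (ALL s:S. r s : R) & (ALL i:J. (SUM s:S. r0 s * y s i) = (SUM s:S. (P * r s) * y s i))"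
 shows "EX t. (ALL s:S. (SUM j:J. t j * y s j) : R) & val (SUM j:J. t j * (SUM s:S. r0 s * y s j)) ~= 0"
 using assms(1,3-5)
proof (induction S arbitrary: r0 rule: finite_psubset_induct)
 case (psubset S)
 note gen = psubset.prems(1) and r0 = psubset.prems(2) and notP = psubset.prems(3) and fS = psubset.hyps
 show ?case
 proof (cases "EX c. (EX s:S. c s ~= 0) & (ALL i:J. (SUM s:S. c s * y s i) = 0)")
 case True
 then obtain c where c: "EX s:S. c s ~= 0" "!!i. i : J ==> (SUM s:S. c s * y s i) = 0" by blast
 obtain t where t: "t : S" "c t ~= 0" "!!s. s : S ==> c s / c t : R" using pivot[OF fS c(1)] by blast
 define S' where "S' = S - {t}"
 \<comment> \<open>Solving the normalized relation for the generator at \<open>t\<close> has regular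
   coefficients, so dropping \<open>t\<close> does not shrink the lattice.\<close>
 define d where "d s = c s / c t" for s
 have S': "finite S'" "S = insert t S'" "t ~: S'" "S' \<subset> S" using fS t(1) unfolding S'_def by auto
 have dR: "d s : R" if "s : S'" for s using t(3) that S' unfolding d_def by blast
 have yt: "y t i = - (SUM s:S'. d s * y s i)" if "i : J" for i
 proof -
 have "c t * y t i + (SUM s:S'. c s * y s i) = 0" using c(2)[OF that] S' by simp
 then have "y t i = - ((SUM s:S'. c s * y s i) / c t)" using t(2) by (simp add: field_simps eq_neg_iff_add_eq_0)
 then show ?thesis by (simp add: d_def sum_divide_distrib)
 qed
 have red: "(SUM s:S. r s * y s i) = (SUM s:S'. (r s - r t * d s) * y s i)" if "i : J" for r i
 using S' yt[OF that] by (simp add: left_diff_distrib sum_subtractf sum_distrib_left mult.assoc)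
 have red_in: "r s - r t * d s : R" if "ALL s:S. r s : R" "s : S'" for r s
 using Rloc_diff[of "r s" x0 "r t * d s"] Rloc_mult[of "r t" x0 "d s"] dR that S'(2) by auto
 define r1 where "r1 s = r0 s - r0 t * d s" for s
 have "EX t. (ALL s:S'. (SUM j:J. t j * y s j) : R) & val (SUM j:J. t j * (SUM s:S'. r1 s * y s j)) ~= 0"
 proof (rule psubset.IH[OF S'(4)])
 fix j assume "j : J"
 then obtain r where r: "ALL s:S. r s : R" "ALL i:J. (SUM s:S. r s * y s i) = delta j i" using gen by blast
 show "EX r. (ALL s:S'. r s : R) & (ALL i:J. (SUM s:S'. r s * y s i) = delta j i)"
 by (intro exI[of _ "%s. r s - r t * d s"]) (use r red red_in[OF r(1)] in simp)
 next
 fix s assume "s : S'"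
 then show "r1 s : R" unfolding r1_def using red_in r0 by blast
 next
 show "\<nexists>r. (ALL s:S'. r s : R) & (ALL i:J. (SUM s:S'. r1 s * y s i) = (SUM s:S'. (P * r s) * y s i))"
 proof
 assume "EX r. (ALL s:S'. r s : R) & (ALL i:J. (SUM s:S'. r1 s * y s i) = (SUM s:S'. (P * r s) * y s i))"
 then obtain r where r: "!!s. s : S' ==> r s : R" "!!i. i : J ==> (SUM s:S'. r1 s * y s i) = (SUM s:S'. (P * r s) * y s i)" by blast
 define r2 where "r2 s = (if s = t then 0 else r s)" for s
 have "(SUM s:S'. (P * r2 s) * y s i) = (SUM s:S'. (P * r s) * y s i)" for i
 by (rule sum.cong) (use S'(3) in \<open>auto simp: r2_def\<close>)
 then have "(SUM s:S. r0 s * y s i) = (SUM s:S. (P * r2 s) * y s i)" if "i : J" for i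
 using r(2)[OF that] red[OF that, of r0] S'(1-3) by (simp add: r1_def r2_def)
 moreover have "r2 s : R" if "s : S" for s using that S'(2) r(1) by (auto simp: r2_def)
 ultimately show False using notP by blast
 qed
 qed
 then obtain \<tau> where \<tau>: "!!s. s : S' ==> (SUM j:J. \<tau> j * y s j) : R" "val (SUM j:J. \<tau> j * (SUM s:S'. r1 s * y s j)) ~= 0" by blast
 have "(SUM j:J. \<tau> j * y t j) = - (SUM s:S'. d s * (SUM j:J. \<tau> j * y s j))"
 by (simp add: yt sum_distrib_left sum_negf mult.left_commute) (rule sum.swap)
 moreover have "(SUM s:S'. d s * (SUM j:J. \<tau> j * y s j)) : R"
 by (intro R_sum R_mult dR \<tau>(1))
 ultimately have "(SUM j:J. \<tau> j * y t j) : R" using Rloc_uminus by simp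
 then have "ALL s:S. (SUM j:J. \<tau> j * y s j) : R" using \<tau>(1) S'(2) by blast
 moreover
 have "(SUM j:J. \<tau> j * (SUM s:S. r0 s * y s j)) = (SUM j:J. \<tau> j * (SUM s:S'. r1 s * y s j))"
 by (rule sum.cong) (use red in \<open>simp_all add: r1_def\<close>)
 then have "val (SUM j:J. \<tau> j * (SUM s:S. r0 s * y s j)) ~= 0" using \<tau>(2) by simp
 ultimately show ?thesis by (intro exI[of _ \<tau>] conjI)
 next
 case False
 then have ind: "c s = 0" if "!!i. i : J ==> (SUM s:S. c s * y s i) = 0" "s : S" for c s using that by blast
 have "EX s:S. val (r0 s) ~= 0"
 proof (rule ccontr)
 assume "~ (EX s:S. val (r0 s) ~= 0)"
 then have "ALL s:S. EX r:R. r0 s = P * r" using R_zero_factor r0 by blast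
 then obtain r where r: "!!s. s : S ==> r s : R" "!!s. s : S ==> r0 s = P * r s" by metis
 have "(SUM s:S. r0 s * y s i) = (SUM s:S. (P * r s) * y s i)" for i by (rule sum.cong) (simp_all add: r(2))
 then show False using notP r(1) by blast
 qed
 then obtain s1 where s1: "s1 : S" "val (r0 s1) ~= 0" by blast
 have "ALL j:J. EX r. (ALL s:S. r s : R) & (ALL i:J. (SUM s:S. r s * y s i) = delta j i)" using gen by blast
 from bchoice[OF this] obtain r where r0: "ALL j:J. (ALL s:S. r j s : R) & (ALL i:J. (SUM s:S. r j s * y s i) = delta j i)" ..
 have r: "!!j. j : J ==> ALL s:S. r j s : R" "!!j i. j : J ==> i : J ==> (SUM s:S. r j s * y s i) = delta j i"
 using r0 by simp_all
 have dual: "(SUM j:J. r j s1 * y s j) = (if s1 = s then 1 else 0)" if s: "s : S" for s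
 proof -
 \<comment> \<open>The coefficients \<open>r\<close> express unit vectors by the generators. By
   independence of the generators this one-sided inverse is two-sided, which gives the dual
   basis.\<close>
 define c where "c s' = (SUM j:J. r j s' * y s j) - (if s' = s then 1 else 0)" for s'
 have "(SUM s':S. c s' * y s' i) = 0" if i: "i : J" for i
 proof -
 have "(SUM s':S. (SUM j:J. r j s' * y s j) * y s' i) = (SUM j:J. y s j * (SUM s':S. r j s' * y s' i))"
 unfolding sum_distrib_right sum_distrib_left by (subst sum.swap) (simp add: mult_ac)
 also have "... = (SUM j:J. if i = j then y s j else 0)"
 by (rule sum.cong) (use r(2)[OF _ i] in auto)
 also have "... = y s i" using i J by simp
 moreover have "(SUM s':S. (if s' = s then 1 else 0) * y s' i) = (SUM s':S. if s = s' then y s' i else 0)"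
 by (rule sum.cong) auto
 ultimately show ?thesis using s fS by (simp add: c_def left_diff_distrib sum_subtractf)
 qed
 then show ?thesis using ind[of c s1] s1(1) unfolding c_def by simp
 qed
 have "(SUM j:J. r j s1 * y s j) : R" if "s : S" for s unfolding dual[OF that] by simp
 moreover have "(SUM j:J. r j s1 * (SUM s:S. r0 s * y s j)) = (SUM s:S. r0 s * (SUM j:J. r j s1 * y s j))"
 unfolding sum_distrib_left by (subst sum.swap) (simp add: mult_ac)
 moreover have "(SUM s:S. r0 s * (SUM j:J. r j s1 * y s j)) = (SUM s:S. if s1 = s then r0 s else 0)"
 by (rule sum.cong) (simp_all add: dual)
 ultimately show ?thesis using s1 fS by (intro exI[of _ "%j. r j s1"]) simp
 qed
qed

end

section \<open>Uniqueness of invariant forms\<close>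

lemma mx_scalar:
 assumes "finite {b. v b ~= 0}" shows "mx (%b i. a * delta b i) v = (%i. a * v i)"
proof
 fix i
 have "mx (%b i. a * delta b i) v i = (SUM b:{b. v b ~= 0}. if i = b then a * v b else 0)"
 unfolding mx_def by (rule sum.cong) auto
 then show "mx (%b i. a * delta b i) v i = a * v i" using assms by simp
qed

context setting
begin

definition "blkrel b b' \<longleftrightarrow> (EX U:\<U>. EX U':\<U>. b : Bs U & b' : Bs U' & TW.Nrel U U')"

lemma block_unique: "U : \<U> ==> U' : \<U> ==> b : Bs U ==> b : Bs U' ==> U = U'"
 using Bs_disj by blast

lemma blkrel_sym: "blkrel b b' ==> blkrel b' b"
 unfolding blkrel_def using TW.Nrel_sym by blast

text \<open>The summand of \<open>s\<close> is unique and has at most one partner, whose basis is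
  finite.\<close>

lemma blkrel_finite: "finite {b'. blkrel s b'}"
proof (cases "EX b'. blkrel s b'")
 case True
 then obtain U U' where U: "U : \<U>" "U' : \<U>" "s : Bs U" "TW.Nrel U U'" unfolding blkrel_def by blast
 have "b' : Bs U'" if sb: "blkrel s b'" for b'
 proof -
 obtain V V' where V: "V : \<U>" "V' : \<U>" "s : Bs V" "b' : Bs V'" "TW.Nrel V V'" using sb unfolding blkrel_def by blast
 have "V = U" using block_unique U V by blast
 then have "V' = U'" using TW.Nrel_unique[OF TW.Nrel_sym TW.Nrel_sym] U(4) V(5) by blast
 then show ?thesis using V by blast
 qed
 then have "{b'. blkrel s b'} <= Bs U'" by blast
 then show ?thesis using Bs[OF U(2)] finite_subset by blast
qed simp

text \<open>\<open>J\<close> collects the complete blocks that meet \<open>S\<close>, and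
  \<open>J'\<close> the blocks of their partners. Uniqueness of partners in both directions gives
  the equivalence.\<close>

lemma blocks:
 assumes S: "finite S" "S <= B"
 shows "EX J J'. finite J & finite J' & S <= J & J <= B & J' <= B & (ALL b b'. blkrel b b' --> (b : J \<longleftrightarrow> b' : J'))"
proof (intro exI conjI allI impI)
 let ?J = "UN s:S. UN U:{U\<in>\<U>. s : Bs U}. Bs U" and ?J' = "UN s:S. {b'. blkrel s b'}"
 have blk: "EX U:\<U>. s : Bs U" if "s : S" for s using S(2) that B_def by blast
 have "finite {U\<in>\<U>. s : Bs U}" if s: "s : S" for s
 proof -
 obtain U where "U : \<U>" "s : Bs U" using blk[OF s] by blast
 then have "{U\<in>\<U>. s : Bs U} <= {U}" using block_unique by blast
 then show ?thesis using finite_subset by blast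
 qed
 then show "finite ?J" using S(1) Bs by blast
 show "finite ?J'" using S(1) blkrel_finite by blast
 show "S <= ?J" using blk by blast
 show "?J <= B" using B_def by blast
 show "?J' <= B" using B_def unfolding blkrel_def by blast
 fix b b' assume r: "blkrel b b'"
 then obtain U U' where U: "U : \<U>" "U' : \<U>" "b : Bs U" "b' : Bs U'" "TW.Nrel U U'" unfolding blkrel_def by blast
 show "b : ?J \<longleftrightarrow> b' : ?J'"
 proof
 assume "b : ?J"
 then obtain s V where V: "s : S" "V : \<U>" "s : Bs V" "b : Bs V" by blast
 have "V = U" using block_unique V U by blast
 then have "blkrel s b'" unfolding blkrel_def using U V by blast
 then show "b' : ?J'" using V(1) by blast
 next
 assume "b' : ?J'"
 then obtain s V V' where V: "s : S" "V : \<U>" "V' : \<U>" "s : Bs V" "b' : Bs V'" "TW.Nrel V V'" unfolding blkrel_def by blast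
 have "V' = U'" using block_unique V U by blast
 then have "V = U" using TW.Nrel_unique U(5) V(6) by blast
 then show "b : ?J" using U V by blast
 qed
qed

end

context equi
begin

lemma Phi_mx: "u : VV ==> Ph u = mx (%b. Ph (delta b)) u"
proof (induction u rule: fin_supp_induct)
 case zero
 show ?case by (simp add: mx_def fun_eq_iff)
next
 case (add b q v)
 have d: "(delta b :: 'f => complex poly fract) : VV" using fin_supp_delta[OF add(1)] .
 show ?case
 unfolding Phi_add[OF fin_supp_smult[OF d] add(2)] Phi_smult[OF d] add(3)[symmetric]
 mx_add[OF fin_suppD(1)[OF fin_supp_smult[OF d]] fin_suppD(1)[OF add(2)]] mx_smult[OF fin_suppD(1)[OF d]] mx_delta ..
qed

lemma Phi_sum:
 assumes "finite A" "!!k. k : A ==> w k : VV"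
 shows "(%i. SUM k:A. c k * w k i) : VV & Ph (%i. SUM k:A. c k * w k i) = (%i. SUM k:A. c k * Ph (w k) i)"
 using assms
proof (induction A rule: finite_induct)
 case (insert k A)
 have w: "w k : VV" using insert.prems by blast
 have IH: "(%i. SUM k:A. c k * w k i) : VV" "Ph (%i. SUM k:A. c k * w k i) = (%i. SUM k:A. c k * Ph (w k) i)"
 using insert by blast+
 show ?case
 unfolding sum.insert[OF insert.hyps] Phi_add[OF fin_supp_smult[OF w] IH(1)] Phi_smult[OF w] IH(2)
 using fin_supp_add[OF fin_supp_smult[OF w] IH(1)] by simp
qed simp

lemma Phi_rel: "b : B ==> Ph (delta b) b' ~= 0 ==> blkrel b b'"
proof -
 assume b: "b : B" and nz: "Ph (delta b) b' ~= 0"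
 then have "b' : B" using fin_suppD(2)[OF Phi_in[OF fin_supp_delta[OF b]]] by blast
 then obtain U U' where "U : \<U>" "b : Bs U" "U' : \<U>" "b' : Bs U'" using b B_def by blast
 then show ?thesis using form_block nz unfolding blkrel_def by blast
qed

text \<open>For the converse, cut \<open>v\<close> into its parts inside and outside
  \<open>J\<close>. The image of the outer part vanishes on \<open>J'\<close> by the matching, and
  off \<open>J'\<close> because the images of \<open>v\<close> and of the inner part do; injectivity
  then kills the outer part.\<close>

lemma Phi_block:
 assumes v: "v : VV" and rel: "!!b b'. blkrel b b' ==> b : J \<longleftrightarrow> b' : J'"
 shows "{i. Ph v i ~= 0} <= J' \<longleftrightarrow> {i. v i ~= 0} <= J"
proof -
 have ex: "EX b. v b ~= 0 & blkrel b b'" if v: "v : VV" and nz: "Ph v b' ~= 0" for v b'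
 proof -
 obtain b where b: "v b ~= 0" "Ph (delta b) b' ~= 0"
 using mx_support[of "%b. Ph (delta b)" v] nz unfolding Phi_mx[OF v, symmetric] by blast
 then have "b : B" using fin_suppD(2)[OF v] by blast
 then show ?thesis using Phi_rel b by blast
 qed
 have fwd: "{i. Ph v i ~= 0} <= J'" if "v : VV" "{i. v i ~= 0} <= J" for v
 using ex[OF that(1)] that(2) rel by blast
 show ?thesis
 proof
 assume s: "{i. Ph v i ~= 0} <= J'"
 define u where "u i = (if i : J then v i else 0)" for i
 define w where "w i = (if i : J then 0 else v i)" for i
 have uw: "u : VV" "w : VV" using v unfolding u_def w_def fin_supp_def by (auto elim: finite_subset[rotated])
 have vuw: "v = (%i. u i + w i)" by (auto simp: u_def w_def)
 have "Ph w b' = 0" for b'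
 proof (cases "b' : J'")
 case True
 then show ?thesis using ex[OF uw(2), of b'] rel unfolding w_def by metis
 next
 case False
 have "{i. u i ~= 0} <= J" by (auto simp: u_def)
 then have "Ph u b' = 0" using fwd[OF uw(1)] False by blast
 moreover have "Ph v b' = Ph u b' + Ph w b'" unfolding vuw Phi_add[OF uw] ..
 moreover have "Ph v b' = 0" using s False by blast
 ultimately show ?thesis by simp
 qed
 then have "Ph w = Ph (%_. 0)" by auto
 then have "w = (%_. 0)" using Phi_inj[OF uw(2) fin_supp_zero] by blast
 then have "v = u" using vuw by simp
 then have "v i = 0" if "i ~: J" for i using fun_cong[of v u i] that by (simp add: u_def)
 then show "{i. v i ~= 0} <= J" by blast
 qed (rule fwd[OF v])
qed

lemma VV_empty: "B = {} ==> v : VV ==> v = (%_. 0)"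
 by (rule HOL.ext, rule fin_suppD(2)) auto

text \<open>\<open>M\<close> is the matrix \<open>e\<close> followed by the inverse of
  \<open>Ph\<close>. Invariance of both forms makes it commute with the Lie algebra, and since
  \<open>e\<close> respects the same matching of blocks as \<open>Ph\<close>, \<open>M\<close>
  preserves a finite block, as Schur's lemma requires.\<close>

lemma invariant_form_unique:
 assumes gi: "generically_irreducible gg F \<pi>"
 and e: "!!b. b : B ==> e b : VV" and e_rel: "!!b b'. b : B ==> e b b' ~= 0 ==> blkrel b b'"
 and inv: "!!X u v. X : carrier gg ==> u : VV ==> v : VV ==>
 dot (mx e (ext (\<pi> X) u)) v = - dot (mx e u) (ext (\<pi> (sggg X)) v)"
 shows "EX a. ALL v:VV. mx e v = (%i. a * Ph v i)"
proof (cases "B = {}")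
 case True
 have "mx e v = (%i. 0 * Ph v i)" if "v : VV" for v
 unfolding VV_empty[OF True that] by (simp add: mx_def fun_eq_iff)
 then show ?thesis by blast
next
 case False
 have "ALL b:B. EX u:VV. Ph u = e b" using Phi_surj e by blast
 then obtain M where M: "!!b. b : B ==> M b : VV" "!!b. b : B ==> Ph (M b) = e b" by metis
 have Min: "mx M v : VV" if "v : VV" for v using mx_in[OF that M(1)] .
 have PM: "Ph (mx M v) = mx e v" if v: "v : VV" for v
 proof -
 have vB: "b : B" if "v b ~= 0" for b using fin_suppD(2)[OF v] that by blast
 have "Ph (mx M v) = mx (%b. mx (%b. Ph (delta b)) (M b)) v"
 unfolding Phi_mx[OF Min[OF v]] by (rule mx_mx[OF fin_suppD(1)[OF v] fin_suppD(1)[OF M(1)[OF vB]]])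
 also have "... = mx e v" by (rule mx_cong) (simp add: Phi_mx[OF M(1)[OF vB], symmetric] M(2)[OF vB])
 finally show ?thesis .
 qed
 have comm: "mx M (ext (\<pi> X) (delta b)) = ext (\<pi> X) (M b)" if X: "X : carrier gg" and b: "b : B" for X b
 proof (rule Phi_inj)
 have d: "(delta b :: 'f => complex poly fract) : VV" using fin_supp_delta[OF b] .
 note L = ext_in[OF pi_linear[OF X] d] and R = ext_in[OF pi_linear[OF X] M(1)[OF b]]
 show "mx M (ext (\<pi> X) (delta b)) : VV" "ext (\<pi> X) (M b) : VV" using Min[OF L] R by auto
 show "Ph (mx M (ext (\<pi> X) (delta b))) = Ph (ext (\<pi> X) (M b))"
 proof
 fix b'
 show "Ph (mx M (ext (\<pi> X) (delta b))) b' = Ph (ext (\<pi> X) (M b)) b'"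
 proof (cases "b' : B")
 case True
 have d': "(delta b' :: 'f => complex poly fract) : VV" using fin_supp_delta[OF True] .
 have "Ph (mx M (ext (\<pi> X) (delta b))) b' = dot (mx e (ext (\<pi> X) (delta b))) (delta b')"
 unfolding PM[OF L] dot_delta ..
 also have "... = - form (M b) (ext (\<pi> (sggg X)) (delta b'))"
 unfolding inv[OF X d d'] mx_delta form_def M(2)[OF b] ..
 also have "... = form (ext (\<pi> X) (M b)) (delta b')" unfolding form_lie[OF X M(1)[OF b] d'] ..
 finally show ?thesis unfolding form_delta .
 next
 case False
 then show ?thesis using fin_suppD(2)[OF Phi_in[OF Min[OF L]]] fin_suppD(2)[OF Phi_in[OF R]] by simp
 qed
 qed
 qed
 obtain b0 where b0: "b0 : B" using False by blast
 have "EX J J'. finite J & finite J' & {b0} <= J & J <= B & J' <= B & (ALL b b'. blkrel b b' --> (b : J \<longleftrightarrow> b' : J'))"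
 by (rule blocks) (use b0 in auto)
 then obtain J J' where J: "finite J" "b0 : J" "J <= B" "!!b b'. blkrel b b' ==> b : J \<longleftrightarrow> b' : J'"
 by (elim exE conjE) simp
 have Mz: "M b i = 0" if "b : J" "i ~: J" for b i
 proof -
 have bB: "b : B" using that J by blast
 have "{i. Ph (M b) i ~= 0} <= J'" unfolding M(2)[OF bB] using e_rel[OF bB] J(4) that(1) by blast
 then have "{i. M b i ~= 0} <= J" using Phi_block[OF M(1)[OF bB] J(4)] by blast
 then show ?thesis using that(2) by blast
 qed
 have Jne: "J ~= {}" using J(2) by blast
 obtain a where a: "!!b. b : B ==> M b = (%i. a * delta b i)"
 using schur[OF gi M(1) comm J(1) Jne J(3) Mz] by blast
 have "mx e v = (%i. a * Ph v i)" if v: "v : VV" for v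
 proof -
 have "mx M v = mx (%b i. a * delta b i) v"
 by (rule mx_cong, rule a) (use fin_suppD(2)[OF v] in blast)
 then have "mx M v = (%i. a * v i)" using mx_scalar[OF fin_suppD(1)[OF v]] by simp
 then show ?thesis using PM[OF v] Phi_smult[OF v] by simp
 qed
 then show ?thesis by blast
qed

lemma hermitian_unit:
 assumes gi: "generically_irreducible gg F \<pi>"
 shows "EX a:R. cmod (val a) = 1 & (ALL u:VV. ALL v:VV. conj_fract (form v u) = a * form u v)"
proof (cases "B = {}")
 case True
 have "conj_fract (form v u) = 1 * form u v" if "u : VV" "v : VV" for u v
 unfolding VV_empty[OF True that(1)] VV_empty[OF True that(2)] by simp
 then show ?thesis by (intro bexI[of _ 1]) auto
next
 case False
 \<comment> \<open>The conjugate transpose of \<open>Ph\<close>. Its rows are columns of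
   \<open>Ph\<close>; they have finite support only because a block has a single finite
   partner.\<close>
 define e where "e b b' = (if b : B & b' : B then conj_fract (Ph (delta b') b) else 0)" for b b'
 have e_rel: "blkrel b b'" if "e b b' ~= 0" for b b'
 proof -
 have "b' : B" "Ph (delta b') b ~= 0" using that unfolding e_def by (auto split: if_splits)
 then show ?thesis using Phi_rel blkrel_sym by blast
 qed
 have e_in: "e b : VV" for b
 proof -
 have "{b'. e b b' ~= 0} <= {b'. blkrel b b'}" using e_rel by blast
 then have "finite {b'. e b b' ~= 0}" using blkrel_finite finite_subset by blast
 moreover have "e b b' = 0" if "b' ~: B" for b' using that by (simp add: e_def)
 ultimately show ?thesis unfolding fin_supp_def by blast
 qed
 have key: "dot (mx e u) v = conj_fract (form v u)" if u: "u : VV" and v: "v : VV" for u v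
 proof -
 let ?U = "{b. u b ~= 0}" and ?V = "{b. v b ~= 0}"
 have eq: "e b b' = conj_fract (Ph (delta b') b)" if "b : ?U" "b' : ?V" for b b'
 using that fin_suppD(2)[OF u] fin_suppD(2)[OF v] unfolding e_def by auto
 have "form v u = (SUM b:?U. (SUM b':?V. v b' * Ph (delta b') b) * conj_fract (u b))"
 unfolding form_def dot_def by (subst Phi_mx[OF v]) (simp add: mx_def)
 then have "conj_fract (form v u) = (SUM b:?U. SUM b':?V. u b * conj_fract (Ph (delta b') b) * conj_fract (v b'))"
 by (simp add: conj_fract_sum sum_distrib_right sum_distrib_left mult_ac)
 also have "... = (SUM b:?U. SUM b':?V. u b * e b b' * conj_fract (v b'))"
 by (intro sum.cong refl) (simp add: eq)
 also have "... = dot (mx e u) v"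
 unfolding dot_def mx_def by (subst sum.swap) (simp add: sum_distrib_right)
 finally show ?thesis ..
 qed
 have inv: "dot (mx e (ext (\<pi> X) u)) v = - dot (mx e u) (ext (\<pi> (sggg X)) v)"
 if X: "X : carrier gg" and u: "u : VV" and v: "v : VV" for X u v
 proof -
 have X': "sggg X : carrier gg" using re.sigma_closed[OF X] .
 show ?thesis
 unfolding key[OF ext_in[OF pi_linear[OF X] u] v] key[OF u ext_in[OF pi_linear[OF X'] v]]
 form_lie[OF X' v u] re.sigma_involutive[OF X] by simp
 qed
 obtain a where a: "!!v. v : VV ==> mx e v = (%i. a * Ph v i)"
 using invariant_form_unique[OF gi e_in e_rel inv] by blast
 have aform: "conj_fract (form v u) = a * form u v" if "u : VV" "v : VV" for u v
 using key[OF that] unfolding a[OF that(1)] dot_smult_left form_def by simp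
 obtain b where b: "b : B" using False by blast
 have d: "(delta b :: 'f => complex poly fract) : VV" using fin_supp_delta[OF b] .
 have "EX b':B. form (delta b) (delta b') ~= 0"
 proof (rule ccontr)
 assume "~ (EX b':B. form (delta b) (delta b') ~= 0)"
 then have "(delta b :: 'f => complex poly fract) = (%_. 0)" using form_nondeg_left[OF d] by blast
 from fun_cong[OF this, of b] show False by simp
 qed
 then obtain b' where b': "b' : B" "form (delta b) (delta b') ~= 0" by blast
 have d': "(delta b' :: 'f => complex poly fract) : VV" using fin_supp_delta[OF b'(1)] .
 have "form (delta b) (delta b') = conj_fract (conj_fract (form (delta b) (delta b')))" by simp
 also have "... = conj_fract a * (a * form (delta b) (delta b'))"
 unfolding aform[OF d' d] conj_fract_mult aform[OF d d'] ..
 finally have "conj_fract a * a = 1" using b'(2) by (simp add: mult.assoc[symmetric])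
 then show ?thesis using unimodular_unit aform by blast
qed

lemma proportional:
 assumes gi: "generically_irreducible gg F \<pi>"
 and ph': "equi K gg br \<alpha> \<iota> sggg sgK F \<pi> rh B crd Bs x p' ph'"
 shows "EX q. q ~= 0 & (ALL v:VV. equi.Ph F B ph' v = (%i. q * Ph v i))"
proof -
 interpret E: equi K gg br \<alpha> \<iota> sggg sgK F \<pi> rh B crd Bs x p' ph' by (rule ph')
 have dl: "(delta b :: 'f => complex poly fract) : VV" if "b : B" for b using fin_supp_delta[OF that] .
 have inv: "dot (mx (%b. E.Ph (delta b)) (ext (\<pi> X) u)) v = - dot (mx (%b. E.Ph (delta b)) u) (ext (\<pi> (sggg X)) v)"
 if "X : carrier gg" "u : VV" "v : VV" for X u v
 using E.form_lie[OF that] unfolding E.form_def E.Phi_mx[OF ext_in[OF pi_linear[OF that(1)] that(2)], symmetric]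
 E.Phi_mx[OF that(2), symmetric] .
 obtain q where q: "!!v. v : VV ==> mx (%b. E.Ph (delta b)) v = (%i. q * Ph v i)"
 using invariant_form_unique[OF gi E.Phi_in[OF dl] E.Phi_rel inv] by blast
 have q': "E.Ph v = (%i. q * Ph v i)" if "v : VV" for v using q[OF that] E.Phi_mx[OF that] by simp
 show ?thesis
 proof (cases "B = {}")
 case True
 have "E.Ph v = (%i. 1 * Ph v i)" if "v : VV" for v
 unfolding VV_empty[OF True that] by simp
 then show ?thesis by (intro exI[of _ 1]) auto
 next
 case False
 then obtain b where b: "b : B" by blast
 have "q ~= 0"
 proof
 assume "q = 0"
 then have "E.Ph (delta b) = E.Ph (%_. 0)" using q'[OF dl[OF b]] by simp
 then have "(delta b :: 'f => complex poly fract) = (%_. 0)" using E.Phi_inj[OF dl[OF b] fin_supp_zero] by blast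
 from fun_cong[OF this, of b] show False by simp
 qed
 then show ?thesis using q' by blast
 qed
qed

section \<open>The Jantzen lattices\<close>

abbreviation "Lat \<equiv> fin_supp B R"
text \<open>The coordinates of \<open>jantzen_local\<close>: membership in the multiple of the dual
  lattice by the power \<open>n\<close> of \<open>P\<close> is expressed by dividing by that power,
  for any sign of \<open>n\<close>.\<close>

definition "Jn n = {v : Lat. ALL i. P powi (- n) * Ph v i : R}"
definition "sc n u v = P powi (- n) * form u v"

lemma LatD: "v : Lat ==> v : VV" "v : Lat ==> v i : R"
 unfolding fin_supp_def by auto
lemma LatI: "v : VV ==> (!!i. v i : R) ==> v : Lat"
 unfolding fin_supp_def by auto
lemma JnD: "v : Jn n ==> v : Lat" "v : Jn n ==> v : VV" "v : Jn n ==> P powi (- n) * Ph v i : R"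
 unfolding Jn_def using LatD(1) by auto
lemma JnI: "v : Lat ==> (!!i. P powi (- n) * Ph v i : R) ==> v : Jn n"
 unfolding Jn_def by auto

lemma Lat_add: assumes "u : Lat" "v : Lat" shows "(%i. u i + v i) : Lat"
proof (rule LatI)
 show "(%i. u i + v i) : VV" using fin_supp_add[OF LatD(1)[OF assms(1)] LatD(1)[OF assms(2)]] .
 show "u i + v i : R" for i using R_add[OF LatD(2)[OF assms(1)] LatD(2)[OF assms(2)]] .
qed
lemma Lat_smult: assumes "q : R" "v : Lat" shows "(%i. q * v i) : Lat"
proof (rule LatI)
 show "(%i. q * v i) : VV" using fin_supp_smult[OF LatD(1)[OF assms(2)]] .
 show "q * v i : R" for i using R_mult[OF assms(1) LatD(2)[OF assms(2)]] .
qed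
lemma Jn_add: assumes "u : Jn n" "v : Jn n" shows "(%i. u i + v i) : Jn n"
proof (rule JnI[OF Lat_add[OF JnD(1)[OF assms(1)] JnD(1)[OF assms(2)]]])
 fix i show "P powi (- n) * Ph (%i. u i + v i) i : R"
 unfolding Phi_add[OF JnD(2)[OF assms(1)] JnD(2)[OF assms(2)]] distrib_left
 using R_add[OF JnD(3)[OF assms(1)] JnD(3)[OF assms(2)]] .
qed
lemma Jn_smult: assumes "q : R" "v : Jn n" shows "(%i. q * v i) : Jn n"
proof (rule JnI[OF Lat_smult[OF assms(1) JnD(1)[OF assms(2)]]])
 fix i show "P powi (- n) * Ph (%i. q * v i) i : R"
 unfolding Phi_smult[OF JnD(2)[OF assms(2)]] mult.left_commute[of _ q]
 using R_mult[OF assms(1) JnD(3)[OF assms(2)]] .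
qed
lemma Jn_zero [simp]: "(%_. 0) : Jn n"
 by (intro JnI LatI) simp_all

lemma sc_R: "u : Jn n ==> v : Lat ==> sc n u v : R"
proof -
 assume u: "u : Jn n" and v: "v : Lat"
 have "sc n u v = (SUM b:{b. v b ~= 0}. P powi (- n) * Ph u b * conj_fract (v b))"
 by (simp add: sc_def form_def dot_def sum_distrib_left mult.assoc)
 moreover have "P powi (- n) * Ph u b * conj_fract (v b) : R" for b
 by (rule R_mult[OF JnD(3)[OF u] R_conj[OF LatD(2)[OF v]]])
 ultimately show ?thesis by (simp only: R_sum)
qed

lemma sc_add_left: "u : VV ==> u' : VV ==> sc n (%i. u i + u' i) v = sc n u v + sc n u' v"
 and sc_smult_left: "u : VV ==> sc n (%i. q * u i) v = q * sc n u v"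
 and sc_add_right: "v : VV ==> v' : VV ==> sc n u (%i. v i + v' i) = sc n u v + sc n u v'"
 and sc_smult_right: "sc n u (%i. q * v i) = conj_fract q * sc n u v"
 by (simp_all add: sc_def form_add_left form_smult_left form_add_right form_smult_right distrib_left mult.left_commute)

lemma jantzen_nondegenerate:
 assumes gi: "generically_irreducible gg F \<pi>" and f: "f : Jn n"
 and orth: "!!g. g : Jn n ==> val (sc n f g) = 0"
 shows "EX f1:Jn (n + 1). EX f2:Lat. f = (%i. f1 i + P * f2 i)"
proof (rule ccontr)
 assume neg: "~ ?thesis"
 obtain a where a: "a : R" "cmod (val a) = 1" "!!u v. u : VV ==> v : VV ==> conj_fract (form v u) = a * form u v"
 using hermitian_unit[OF gi] by blast
 have fV: "f : VV" and fR: "!!i. f i : R" using JnD(2)[OF f] LatD(2)[OF JnD(1)[OF f]] by auto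
 have "{b. f b ~= 0} <= B" using fin_suppD(2)[OF fV] by blast
 from blocks[OF fin_suppD(1)[OF fV] this]
 obtain J J' where J: "finite J" "finite J'" "{b. f b ~= 0} <= J" "J <= B" "J' <= B"
 "!!b b'. blkrel b b' ==> b : J \<longleftrightarrow> b' : J'" by (elim exE conjE) simp
 have dl: "(delta b :: 'f => complex poly fract) : VV" if "b : B" for b using fin_supp_delta[OF that] .
 have "ALL b:J'. EX u:VV. Ph u = delta b" using Phi_surj dl J(5) by blast
 then obtain w where w: "!!b. b : J' ==> w b : VV" "!!b. b : J' ==> Ph (w b) = delta b" by metis
 have wJ: "w b i = 0" if "b : J'" "i ~: J" for b i
 proof -
 have "{i. Ph (w b) i ~= 0} <= J'" unfolding w(2)[OF that(1)] using that(1) by auto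
 then have "{i. w b i ~= 0} <= J" using Phi_block[OF w(1)[OF that(1)] J(6)] by blast
 then show ?thesis using that(2) by blast
 qed
 have sumJ': "(SUM b:J'. c b * delta b i) = (if i : J' then c i else 0)" for c :: "'f => complex poly fract" and i
 proof -
 have "(SUM b:J'. c b * delta b i) = (SUM b:J'. if i = b then c b else 0)" by (rule sum.cong) auto
 then show ?thesis using J(2) by simp
 qed
 have sumJ: "(SUM b:J. c b * delta b i) = (if i : J then c i else 0)" for c :: "'f => complex poly fract" and i
 proof -
 have "(SUM b:J. c b * delta b i) = (SUM b:J. if i = b then c b else 0)" by (rule sum.cong) auto
 then show ?thesis using J(1) by simp
 qed
 \<comment> \<open>Generators, on a finite block containing the support of \<open>f\<close>, of the
   sum of the local lattice (left summand) and of the scaled preimage under \<open>Ph\<close> of the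
   dual lattice (right summand).\<close>
 define y where "y s = (case s of Inl b => delta b | Inr b => (%i. P powi n * w b i))" for s :: "'f + 'f"
 define r0 where "r0 s = (case s of Inl b => f b | Inr b => 0)" for s :: "'f + 'f"
 let ?S = "J <+> J'"
 have fS: "finite ?S" using J by simp
 have sumS: "(SUM s:?S. g s) = (SUM b:J. g (Inl b)) + (SUM b:J'. g (Inr b))" for g :: "'f + 'f => complex poly fract"
 using J by (simp add: sum.Plus)
 have r0y: "(SUM s:?S. r0 s * y s i) = (if i : J then f i else 0)" for i
 unfolding sumS by (simp add: r0_def y_def sumJ[of f])
 have "EX t. (ALL s:?S. (SUM j:J. t j * y s j) : R) & val (SUM j:J. t j * (SUM s:?S. r0 s * y s j)) ~= 0"
 proof (rule lattice_functional[OF fS J(1)])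
 fix j assume j: "j : J"
 have "(SUM s:?S. (case s of Inl b => delta j b | Inr b => 0) * y s i) = delta j i" for i
 unfolding sumS using sumJ[of "delta j"] j by (auto simp: y_def)
 then show "EX r. (ALL s:?S. r s : R) & (ALL i:J. (SUM s:?S. r s * y s i) = delta j i)"
 by (intro exI[of _ "%s. case s of Inl b => delta j b | Inr b => 0"]) (auto split: sum.split)
 next
 fix s assume "s : ?S"
 show "r0 s : R" using fR by (simp add: r0_def split: sum.split)
 next
 show "\<nexists>r. (ALL s:?S. r s : R) & (ALL i:J. (SUM s:?S. r0 s * y s i) = (SUM s:?S. (P * r s) * y s i))"
 proof
 assume "EX r. (ALL s:?S. r s : R) & (ALL i:J. (SUM s:?S. r0 s * y s i) = (SUM s:?S. (P * r s) * y s i))"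
 then obtain r where r': "(ALL s:?S. r s : R) & (ALL i:J. (SUM s:?S. r0 s * y s i) = (SUM s:?S. (P * r s) * y s i))" ..
 have r: "!!s. s : ?S ==> r s : R" "!!i. i : J ==> (SUM s:?S. r0 s * y s i) = (SUM s:?S. (P * r s) * y s i)"
 by (rule bspec[OF conjunct1[OF r']], assumption) (rule bspec[OF conjunct2[OF r']])
 \<comment> \<open>If \<open>f\<close> were in \<open>P\<close> times this lattice, the left
   coefficients would give \<open>f2\<close>, and the right ones would give an \<open>f1\<close>
   whose image under \<open>Ph\<close> is divisible by the power \<open>n + 1\<close> of
   \<open>P\<close>. This is the excluded decomposition.\<close>
 define f2 where "f2 i = (if i : J then r (Inl i) else 0)" for i
 define f1 where "f1 = (%i. SUM b:J'. (P * r (Inr b) * P powi n) * w b i)"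
 have f12: "f = (%i. f1 i + P * f2 i)"
 proof
 fix i
 show "f i = f1 i + P * f2 i"
 proof (cases "i : J")
 case True
 then have "f i = (SUM b:J. (P * r (Inl b)) * delta b i) + (SUM b:J'. (P * r (Inr b)) * (P powi n * w b i))"
 using r(2)[OF True] unfolding r0y sumS by (simp add: y_def)
 then show ?thesis using True unfolding sumJ f1_def f2_def by (simp add: mult.assoc add.commute)
 next
 case False
 then show ?thesis using J(3) wJ unfolding f1_def f2_def by (auto intro!: sum.neutral)
 qed
 qed
 have f2L: "f2 : Lat"
 proof (rule LatI)
 show "f2 : VV" using J(1,4) unfolding f2_def fin_supp_def by auto
 show "f2 i : R" for i using r(1)[of "Inl i"] unfolding f2_def by auto
 qed
 have f1V: "f1 : VV" "Ph f1 i = (SUM b:J'. (P * r (Inr b) * P powi n) * delta b i)" for i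
 using Phi_sum[OF J(2) w(1), where c = "%b. P * r (Inr b) * P powi n"] w(2) unfolding f1_def by (auto intro!: sum.cong)
 have f1L: "f1 : Lat"
 proof (rule LatI[OF f1V(1)])
 fix i
 have "f1 i = f i - P * f2 i" using fun_cong[OF f12, of i] by simp
 then show "f1 i : R" using Rloc_diff[OF fR, of "P * f2 i"] Rloc_mult[OF P_in(1) LatD(2)[OF f2L]] by simp
 qed
 have "f1 : Jn (n + 1)"
 proof (rule JnI[OF f1L])
 fix i
 have "P powi (- (n + 1)) * (P * q * P powi n) = q" for q
 proof -
 have a: "P powi (n + 1) = P powi n * P" by (rule power_int_add_1) simp
 have "P powi (- (n + 1)) * (P * q * P powi n) = P powi (- (n + 1)) * P powi (n + 1) * q"
 unfolding a by (simp only: mult_ac)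
 then show ?thesis unfolding power_int_minus by simp
 qed
 then have "P powi (- (n + 1)) * Ph f1 i = (if i : J' then r (Inr i) else 0)"
 unfolding f1V(2) sumJ' by simp
 then show "P powi (- (n + 1)) * Ph f1 i : R" using r(1)[of "Inr i"] by auto
 qed
 then show False using neg f12 f2L by blast
 qed
 qed
 then obtain t where t: "!!s. s : ?S ==> (SUM j:J. t j * y s j) : R" "val (SUM j:J. t j * (SUM s:?S. r0 s * y s j)) ~= 0" by blast
 have tR: "t b : R" if b: "b : J" for b
 proof -
 have "(SUM j:J. t j * y (Inl b) j) = (SUM j:J. t j * delta j b)" by (rule sum.cong) (auto simp: y_def)
 then show ?thesis using t(1)[of "Inl b"] b sumJ[of t b] by auto
 qed
 define \<theta> where "\<theta> v = (SUM j:J. t j * v j)" for v :: "'f => complex poly fract"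
 have \<theta>f: "val (\<theta> f) ~= 0" using t(2) unfolding \<theta>_def r0y by simp
 have \<theta>w: "P powi n * \<theta> (w b) : R" if "b : J'" for b
 proof -
 have "P powi n * \<theta> (w b) = (SUM j:J. t j * y (Inr b) j)"
 unfolding \<theta>_def y_def sum.case sum_distrib_left by (simp only: mult_ac)
 then show ?thesis using t(1)[OF InrI[OF that]] by simp
 qed
 \<comment> \<open>Forced by the requirement that pairing with \<open>g\<close> be the power
   \<open>n\<close> of \<open>P\<close> times \<theta>: the form of \<open>w b\<close> with
   \<open>g\<close> is the conjugate of \<open>g b\<close>.\<close>
 define g where "g b = (if b : J' then conj_fract (P powi n * \<theta> (w b)) else 0)" for b
 have gL: "g : Lat"
 proof (rule LatI)
 have "{b. g b ~= 0} <= J'" unfolding g_def by auto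
 then show "g : VV" using J(2,5) finite_subset unfolding fin_supp_def by (auto simp: g_def)
 show "g i : R" for i using Rloc_conj[OF \<theta>w] unfolding g_def by simp
 qed
 have gs: "{b. g b ~= 0} <= J'" unfolding g_def by auto
 have fg: "form v g = P powi n * \<theta> v" if v: "v : VV" "{i. v i ~= 0} <= J" for v
 proof -
 have s: "{i. Ph v i ~= 0} <= J'" using Phi_block[OF v(1) J(6)] v(2) by blast
 note ps = Phi_sum[OF J(2) w(1), where c = "Ph v"]
 have "v = (%i. SUM b:J'. Ph v b * w b i)"
 proof (rule Phi_inj[OF v(1)])
 show "(%i. SUM b:J'. Ph v b * w b i) : VV" by (rule conjunct1[OF ps])
 have "(SUM b:J'. Ph v b * Ph (w b) i) = Ph v i" for i
 proof -
 have "(SUM b:J'. Ph v b * Ph (w b) i) = (SUM b:J'. Ph v b * delta b i)" by (rule sum.cong) (simp_all add: w(2))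
 then show ?thesis unfolding sumJ' using s by auto
 qed
 then show "Ph v = Ph (%i. SUM b:J'. Ph v b * w b i)" using ps by auto
 qed
 then have \<theta>v: "\<theta> v = (SUM j:J. t j * (SUM b:J'. Ph v b * w b j))" unfolding \<theta>_def by (intro sum.cong) (auto dest: fun_cong)
 have "form v g = (SUM b:J'. Ph v b * (P powi n * \<theta> (w b)))"
 unfolding form_def dot_superset[OF J(2) gs] by (rule sum.cong) (simp_all add: g_def)
 also have "... = P powi n * \<theta> v"
 unfolding \<theta>v unfolding \<theta>_def sum_distrib_left by (subst sum.swap) (simp add: mult_ac)
 finally show ?thesis .
 qed
 have gJ: "g : Jn n"
 proof (rule JnI[OF gL])
 fix b
 have val_a: "val a ~= 0" "a ~= 0" using a(2) by auto
 show "P powi (- n) * Ph g b : R"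
 proof (cases "b : B")
 case True
 \<comment> \<open>Hermitian symmetry up to \<open>a\<close> turns the known pairing of basis
   vectors with \<open>g\<close> into the coordinates of \<open>Ph g\<close>. Integrality of
   \<open>t\<close> on the left generators then gives membership of \<open>g\<close> in
   \<open>Jn n\<close>.\<close>
 have ag: "a * Ph g b = conj_fract (form (delta b) g)" using a(3)[OF LatD(1)[OF gL] dl[OF True]] unfolding form_delta by simp
 show ?thesis
 proof (cases "b : J")
 case bJ: True
 have "form (delta b) g = P powi n * t b"
 using fg[OF dl[OF True]] bJ sumJ[of t b] by (auto simp: \<theta>_def eq_commute[of b] cong: if_cong)
 then have "a * Ph g b = P powi n * conj_fract (t b)" using ag by simp
 then have "P powi (- n) * Ph g b = inverse a * conj_fract (t b)"
 using val_a(2) by (simp add: power_int_minus field_simps)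
 then show ?thesis using Rloc_mult[of "inverse a" x0] Rloc_inverse[OF a(1) val_a(1)] Rloc_conj[OF tR[OF bJ]] by simp
 next
 case False
 have "Ph (delta b) b' = 0" if "b' : J'" for b' using Phi_rel[OF True] J(6) False that by blast
 then have "form (delta b) g = 0" unfolding form_def dot_superset[OF J(2) gs] by simp
 then show ?thesis using ag val_a(2) by simp
 qed
 next
 case False
 then show ?thesis using fin_suppD(2)[OF Phi_in[OF LatD(1)[OF gL]]] by simp
 qed
 qed
 have "sc n f g = \<theta> f" unfolding sc_def fg[OF fV J(3)] by (simp add: power_int_minus)
 then show False using orth[OF gJ] \<theta>f by simp
qed

end

section \<open>Jantzen quotients in coordinates\<close>

text \<open>A change of scalars acts on coordinates entry by entry. It is used for the inclusion of
  the local ring into the field and for evaluation at \<open>x\<close>.\<close>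

lemma base_map_coefficients:
 assumes 1: "based_ext M I crd bas A h" and 2: "based_ext M I crd bas A' h'"
 and f: "!!u. u : carrier A ==> f u : carrier A'" "!!u v. u : carrier A ==> v : carrier A ==> f (u + v) = f u + f v"
 "!!r u. u : carrier A ==> f (h r * u) = h' r * f u"
 and t: "t : carrier (base_change A h M)"
 shows "base_map A' h' M f (%m. m) t : carrier (base_change A' h' M)"
 and "tcoord h' crd (base_map A' h' M f (%m. m) t) = (%i. f (tcoord h crd t i))"
proof -
 interpret X: based_ext M I crd bas A h by (rule 1)
 interpret Y: based_ext M I crd bas A' h' by (rule 2)
 let ?v = "X.tc t"
 define a where "a = (SUM i:{i. ?v i ~= 0}. frag_of (?v i, bas i))"
 have v: "?v i : carrier A" "?v i ~= 0 ==> i : I" "finite {i. ?v i ~= 0}" for i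
 using X.tc_in[OF t] unfolding fin_supp_def by auto
 have f0: "f 0 = 0" using f(2)[of 0 0] by simp
 have "(UN i:{i. ?v i ~= 0}. pkeys (frag_of (?v i, bas i))) <= carrier A \<times> carrier M"
 using v(1,2) X.bas_in by (auto simp: keys_frag_of)
 then have ka: "pkeys a <= carrier A \<times> carrier M" unfolding a_def using keys_sum by (rule subset_trans[rotated])
 have ta: "t = X.cls a" using X.mk_tc[OF t] unfolding X.mk_def a_def by simp
 have bal: "frag_of (f (h r * u), m) - frag_of (f u, r \<odot>\<^bsub>M\<^esub> m) : Y.rel" if "u : carrier A" "m : carrier M" for r u m
 using Y.T.rel_smult[of r "f u" m] f(1,3) that by simp
 note tm = tensor_map_class[OF X.T.tensor_pair_axioms Y.T.tensor_pair_axioms, of f "%m. m" a]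
 have tm1: "base_map A' h' M f (%m. m) t = Y.cls (frag_extend (%(u, v). frag_of (f u, v)) a)"
 unfolding ta by (rule tm(1)) (use f bal ka in simp_all)
 have tm2: "pkeys (frag_extend (%(u, v). frag_of (f u, v)) a) <= carrier A' \<times> carrier M"
 using tm(2) f bal ka by simp
 show "base_map A' h' M f (%m. m) t : carrier (base_change A' h' M)" unfolding tm1 using tm2 by simp
 show "tcoord h' crd (base_map A' h' M f (%m. m) t) = (%i. f (X.tc t i))"
 proof
 fix j
 have "Y.tc (base_map A' h' M f (%m. m) t) j = (SUM i:{i. ?v i ~= 0}. f (?v i) * h' (crd (bas i) j))"
 unfolding tm1 Y.tc_class using Y.fc_extend[of f "%m. m" a j] by (simp add: a_def fsum_sum)
 also have "... = (SUM i:{i. ?v i ~= 0}. if j = i then f (?v i) else 0)"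
 by (rule sum.cong) (use X.crd_bas[OF v(2)] in auto)
 also have "... = f (?v j)" using v(3) f0 by simp
 finally show "tcoord h' crd (base_map A' h' M f (%m. m) t) j = f (X.tc t j)" .
 qed
qed

locale jantzen = equi K gg br \<alpha> \<iota> sggg sgK F \<pi> rh B crd Bs x p ph
 for K :: "(complex^'n^'n) set" and gg :: "(complex poly, 'g) module" and br \<alpha> \<iota> sggg sgK
 and F :: "(complex poly, 'f) module" and \<pi> rh B crd Bs x p and ph :: "'f generic_map" +
 assumes gi: "generically_irreducible gg F \<pi>"
begin

sublocale lF: self_ext F B crd "local_ring x0" to_fract
 by (intro self_ext.intro based_ext.intro based_F local_ring_ext)
sublocale lD: based_ext D B crdD basD "local_ring x0" to_fract
 by (intro based_ext.intro based_D local_ring_ext)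
sublocale cF: self_ext F B crd Cfield "ev x0"
 by (intro self_ext.intro based_ext.intro based_F Cfield_ext)

abbreviation "red v \<equiv> (%i. val (v i))"
abbreviation "filt n \<equiv> jantzen_filtration K F rh ph x p n"
abbreviation "Quo n \<equiv> jantzen_quotient K F rh ph x p n"
abbreviation "frm n \<equiv> jantzen_form K F rh ph x p n"

lemma to_generic:
 assumes "t : carrier (localized x0 F)"
 shows "localized_to_generic F t : carrier (generic F)" "gF.tc (localized_to_generic F t) = gF.tc t"
 using base_map_coefficients[OF lF.based_ext_axioms gF.based_ext_axioms, of "%q. q", OF _ _ _ assms]
 unfolding localized_to_generic_def by (simp_all del: base_change_simps)

lemma to_generic_dual:
 assumes "t : carrier (localized x0 D)"
 shows "localized_to_generic D t : carrier (generic D)" "gD.tc (localized_to_generic D t) = gD.tc t"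
 using base_map_coefficients[OF lD.based_ext_axioms gD.based_ext_axioms, of "%q. q", OF _ _ _ assms]
 unfolding localized_to_generic_def by (simp_all del: base_change_simps)

definition "rl v = localized_to_fiber x0 F (lF.mk v)"

lemma lF_mk: "v : Lat ==> lF.mk v : carrier (localized x0 F)" "v : Lat ==> gF.tc (lF.mk v) = v"
 using lF.mk[of v] by blast+

lemma rl:
 assumes "v : Lat" shows "rl v : carrier (fiber x0 F)" "cF.tc (rl v) = red v"
proof -
 have h: "!!u. u : R ==> val u : carrier Cfield" "!!u v. u : R ==> v : R ==> val (u + v) = val u + val v"
 "!!r u. u : R ==> val (to_fract r * u) = poly r x0 * val u"
 using Rloc_add[where z = x0] Rloc_mult[OF Rloc_to_fract(1), where z = x0] by simp_all
 note bm = base_map_coefficients[OF lF.based_ext_axioms cF.based_ext_axioms, of val, OF h lF_mk(1)[OF assms]]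
 show "rl v : carrier (fiber x0 F)" unfolding rl_def localized_to_fiber_def by (rule bm(1))
 show "cF.tc (rl v) = red v" using bm(2) by (simp only: rl_def localized_to_fiber_def lF_mk(2)[OF assms])
qed

lemma rl_eq: "u : Lat ==> v : Lat ==> rl u = rl v \<longleftrightarrow> red u = red v"
 using cF.tc_inj[OF rl(1) rl(1)] rl(2) by metis

lemma rl_add:
 assumes "u : Lat" "v : Lat" shows "rl u \<oplus>\<^bsub>fiber x0 F\<^esub> rl v = rl (%i. u i + v i)"
proof (rule cF.tc_inj[OF cF.BC_add_closed[OF rl(1)[OF assms(1)] rl(1)[OF assms(2)]] rl(1)[OF Lat_add[OF assms]]])
 show "cF.tc (rl u \<oplus>\<^bsub>fiber x0 F\<^esub> rl v) = cF.tc (rl (%i. u i + v i))"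
 unfolding cF.tc_add[OF rl(1)[OF assms(1)] rl(1)[OF assms(2)]] rl(2)[OF assms(1)] rl(2)[OF assms(2)] rl(2)[OF Lat_add[OF assms]]
 by (rule HOL.ext) (rule Rloc_add[OF LatD(2)[OF assms(1)] LatD(2)[OF assms(2)], THEN conjunct2, symmetric])
qed

lemma rl_smult:
 assumes "v : Lat" shows "c \<odot>\<^bsub>fiber x0 F\<^esub> rl v = rl (%i. to_fract [:c:] * v i)"
proof -
 have c: "c : carrier Cfield" by simp
 have s: "(%i. to_fract [:c:] * v i) : Lat" by (rule Lat_smult[OF Rloc_to_fract(1) assms])
 show ?thesis
 proof (rule cF.tc_inj[OF cF.tc_smult(2)[OF c rl(1)[OF assms]] rl(1)[OF s]])
 show "cF.tc (c \<odot>\<^bsub>fiber x0 F\<^esub> rl v) = cF.tc (rl (%i. to_fract [:c:] * v i))"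
 unfolding cF.tc_smult(1)[OF c rl(1)[OF assms]] rl(2)[OF assms] rl(2)[OF s]
 using Rloc_mult[OF Rloc_to_fract(1) LatD(2)[OF assms]] by (simp add: fun_eq_iff)
 qed
qed

text \<open>The element \<open>u\<close> demanded by the definition has coordinates
  \<open>Ph\<close> divided by the power \<open>n\<close> of \<open>P\<close>, and it exists over
  the local ring exactly when these are regular.\<close>

lemma jantzen_local_iff:
 assumes t: "t : carrier (localized x0 F)"
 shows "t : jantzen_local K F rh ph x p n \<longleftrightarrow> gF.tc t : Jn n"
proof -
 have L: "gF.tc t : Lat" using lF.tc_in[OF t] .
 have Pt: "gD.tc (ph (localized_to_generic F t)) = Ph (gF.tc t)"
 using Phi_tc[OF to_generic(1)[OF t]] to_generic(2)[OF t] by simp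
 have q: "P powi n : carrier Kfield" by simp
 have c: "P powi (- n) * (P powi n * r) = r" "P powi n * (P powi (- n) * r) = r" for r by (simp_all add: power_int_minus)
 show ?thesis
 proof
 assume "t : jantzen_local K F rh ph x p n"
 then obtain u where u: "u : carrier (localized x0 D)"
 "ph (localized_to_generic F t) = (P powi n) \<odot>\<^bsub>generic D\<^esub> localized_to_generic D u"
 unfolding jantzen_local_def Let_def P_def by blast
 have "Ph (gF.tc t) = (%i. P powi n * gD.tc u i)"
 unfolding Pt[symmetric] u(2) gD.tc_smult(1)[OF q to_generic_dual(1)[OF u(1)]] to_generic_dual(2)[OF u(1)] ..
 moreover have "gD.tc u i : R" for i using lD.tc_in[OF u(1)] unfolding fin_supp_def by auto
 ultimately show "gF.tc t : Jn n" by (intro JnI[OF L]) (simp only: c)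
 next
 assume J: "gF.tc t : Jn n"
 let ?w = "%i. P powi (- n) * Ph (gF.tc t) i"
 have w: "?w : Lat" by (rule LatI[OF fin_supp_smult[OF Phi_in[OF JnD(2)[OF J]]]]) (rule JnD(3)[OF J])
 note u = lD.mk[OF w]
 have "ph (localized_to_generic F t) = (P powi n) \<odot>\<^bsub>generic D\<^esub> localized_to_generic D (lD.mk ?w)"
 proof (rule gD.tc_inj[OF phi_in[OF to_generic(1)[OF t]] gD.tc_smult(2)[OF q to_generic_dual(1)[OF u(1)]]])
 show "gD.tc (ph (localized_to_generic F t)) = gD.tc ((P powi n) \<odot>\<^bsub>generic D\<^esub> localized_to_generic D (lD.mk ?w))"
 unfolding Pt gD.tc_smult(1)[OF q to_generic_dual(1)[OF u(1)]] to_generic_dual(2)[OF u(1)] u(2) c ..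
 qed
 then show "t : jantzen_local K F rh ph x p n"
 unfolding jantzen_local_def Let_def P_def[symmetric] by (intro CollectI conjI t bexI[OF _ u(1)])
 qed
qed

lemma jantzen_local_eq: "jantzen_local K F rh ph x p n = lF.mk ` Jn n"
proof
 show "jantzen_local K F rh ph x p n <= lF.mk ` Jn n"
 proof
 fix t assume t: "t : jantzen_local K F rh ph x p n"
 then have tc: "t : carrier (localized x0 F)" unfolding jantzen_local_def Let_def by blast
 then have "gF.tc t : Jn n" using jantzen_local_iff t by blast
 then show "t : lF.mk ` Jn n" using lF.mk_tc[OF tc] by force
 qed
 show "lF.mk ` Jn n <= jantzen_local K F rh ph x p n"
 proof
 fix t assume "t : lF.mk ` Jn n"
 then obtain v where v: "v : Jn n" "t = lF.mk v" by blast
 show "t : jantzen_local K F rh ph x p n"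
 unfolding v(2) jantzen_local_iff[OF lF_mk(1)[OF JnD(1)[OF v(1)]]] lF_mk(2)[OF JnD(1)[OF v(1)]] by (rule v(1))
 qed
qed

lemma filt_eq: "filt n = rl ` Jn n"
 unfolding jantzen_filtration_def jantzen_local_eq rl_def image_image ..

lemma scaled_pairing_eq:
 assumes "u : Lat" "v : Lat" shows "scaled_pairing F ph p n (lF.mk u) (lF.mk v) = sc n u v"
 unfolding scaled_pairing_def sc_def P_def
 pairing_form[OF to_generic(1)[OF lF_mk(1)[OF assms(1)]] to_generic(1)[OF lF_mk(1)[OF assms(2)]]]
 to_generic(2)[OF lF_mk(1)[OF assms(1)]] to_generic(2)[OF lF_mk(1)[OF assms(2)]] lF_mk(2)[OF assms(1)] lF_mk(2)[OF assms(2)] ..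

section \<open>Classes in the Jantzen quotients and the induced form\<close>

definition "cq n v = filt (n + 1) +>\<^bsub>fiber x0 F\<^esub> rl v"

lemma class_cq: "jantzen_class K F rh ph x p n (lF.mk v) = cq n v"
 unfolding jantzen_class_def cq_def rl_def ..

lemma cq_eq: assumes "v : Lat" shows "cq n v = (%w. rl (%i. w i + v i)) ` Jn (n + 1)"
proof -
 have "cq n v = (%w. rl w \<oplus>\<^bsub>fiber x0 F\<^esub> rl v) ` Jn (n + 1)"
 unfolding cq_def filt_eq a_r_coset_def' by blast
 also have "... = (%w. rl (%i. w i + v i)) ` Jn (n + 1)"
 by (rule image_cong[OF refl]) (rule rl_add[OF JnD(1) assms])
 finally show ?thesis .
qed

lemma cq_red: assumes "u : Lat" "v : Lat" "red u = red v" shows "cq n u = cq n v"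
 unfolding cq_def iffD2[OF rl_eq[OF assms(1,2)] assms(3)] ..

lemma cq_absorb:
 assumes v: "v : Lat" and w: "w : Jn (n + 1)" shows "cq n (%i. w i + v i) = cq n v"
proof -
 have m1: "- 1 : R" using Rloc_uminus[OF Rloc_1(1)] by blast
 have "(%w'. rl (%i. w' i + (w i + v i))) ` Jn (n + 1) = (%w. rl (%i. w i + v i)) ` Jn (n + 1)" (is "?A = ?B")
 proof
 show "?A <= ?B"
 proof
 fix t assume "t : ?A"
 then obtain w' where w': "w' : Jn (n + 1)" "t = rl (%i. w' i + (w i + v i))" by blast
 have "t = rl (%i. (w' i + w i) + v i)" unfolding w'(2) by (simp add: add.assoc)
 then show "t : ?B" by (rule image_eqI[OF _ Jn_add[OF w'(1) w]])
 qed
 show "?B <= ?A"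
 proof
 fix t assume "t : ?B"
 then obtain w' where w': "w' : Jn (n + 1)" "t = rl (%i. w' i + v i)" by blast
 have "t = rl (%i. (w' i + - 1 * w i) + (w i + v i))" unfolding w'(2) by simp
 then show "t : ?A" by (rule image_eqI[OF _ Jn_add[OF w'(1) Jn_smult[OF m1 w]]])
 qed
 qed
 then show ?thesis unfolding cq_eq[OF v] cq_eq[OF Lat_add[OF JnD(1)[OF w] v]] .
qed

text \<open>A regular function with value 0 at \<open>x\<close> is divisible by \<open>P\<close>, so
  the kernel of reduction to the fiber is \<open>P\<close> times the lattice.\<close>

lemma red_eqD:
 assumes "u : Lat" "v : Lat" "red u = red v" shows "EX z:Lat. u = (%i. v i + P * z i)"
proof -
 have m1: "- 1 : R" using Rloc_uminus[OF Rloc_1(1)] by blast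
 have d: "(%i. u i + - 1 * v i) : Lat" using Lat_add[OF assms(1) Lat_smult[OF m1 assms(2)]] .
 define z where "z i = inverse P * (u i + - 1 * v i)" for i
 have Pz: "P * z i = u i - v i" for i by (simp add: z_def)
 have "z : VV" unfolding z_def[abs_def] using fin_supp_smult[OF LatD(1)[OF d]] .
 moreover have "z i : R" for i
 proof -
 have "u i - v i : R & val (u i - v i) = 0"
 using Rloc_diff[OF LatD(2)[OF assms(1)] LatD(2)[OF assms(2)]] fun_cong[OF assms(3), of i] by simp
 then obtain r where "r : R" "u i - v i = P * r" using R_zero_factor by blast
 then have "P * z i = P * r" "r : R" using Pz by simp_all
 then show ?thesis by simp
 qed
 ultimately have "z : Lat" by (rule LatI)
 moreover have "u = (%i. v i + P * z i)" by (simp add: Pz)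
 ultimately show ?thesis by blast
qed

definition "ha = (SOME a. a : R & cmod (val a) = 1 & (ALL u:VV. ALL v:VV. conj_fract (form v u) = a * form u v))"

lemma ha: "ha : R" "cmod (val ha) = 1" "u : VV ==> v : VV ==> conj_fract (form v u) = ha * form u v"
proof -
 have "EX a. a : R & cmod (val a) = 1 & (ALL u:VV. ALL v:VV. conj_fract (form v u) = a * form u v)"
 using hermitian_unit[OF gi] by blast
 from someI_ex[OF this]
 have h: "ha : R & cmod (val ha) = 1 & (ALL u:VV. ALL v:VV. conj_fract (form v u) = ha * form u v)" unfolding ha_def .
 show "ha : R" using conjunct1[OF h] .
 show "cmod (val ha) = 1" using conjunct1[OF conjunct2[OF h]] .
 show "u : VV ==> v : VV ==> conj_fract (form v u) = ha * form u v"
 using bspec[OF bspec[OF conjunct2[OF conjunct2[OF h]]]] .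
qed

lemma ha_nz: "val ha ~= 0" "ha ~= 0"
proof -
 show "val ha ~= 0" using ha(2) by auto
 then show "ha ~= 0" by auto
qed

lemma sc_conj: "u : VV ==> v : VV ==> conj_fract (sc n v u) = ha * sc n u v"
 by (simp add: sc_def ha(3) mult.left_commute)

text \<open>Membership in \<open>Jn n\<close> controls the first argument by definition. The
  hermitian symmetry with the unit \<open>ha\<close> carries the bound over to the second.\<close>

lemma sc_R_right:
 assumes "u : Lat" "v : Jn n" shows "sc n u v : R"
proof -
 have "sc n u v = inverse ha * conj_fract (sc n v u)"
 unfolding sc_conj[OF LatD(1)[OF assms(1)] JnD(2)[OF assms(2)]] using ha_nz(2) by simp
 moreover have "inverse ha : R" using Rloc_inverse[OF ha(1) ha_nz(1)] by blast
 ultimately show ?thesis using R_mult[OF _ R_conj[OF sc_R[OF assms(2,1)]]] by simp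
qed

lemma val_sc_conj:
 assumes "u : Jn n" "v : Jn n" shows "cnj (val (sc n v u)) = val ha * val (sc n u v)"
proof -
 have "cnj (val (sc n v u)) = val (conj_fract (sc n v u))"
 using Rloc_conj[OF sc_R[OF assms(2) JnD(1)[OF assms(1)]]] by simp
 also have "... = val ha * val (sc n u v)"
 unfolding sc_conj[OF JnD(2)[OF assms(1)] JnD(2)[OF assms(2)]]
 using Rloc_mult[OF ha(1) sc_R[OF assms(1) JnD(1)[OF assms(2)]]] by blast
 finally show ?thesis .
qed

lemma P_shift: "P powi (- n) = P * P powi (- (n + 1))"
 using power_int_add[of P 1 "- (n + 1)"] by simp

lemma Jn_mono: "w : Jn (n + 1) ==> w : Jn n"
proof (rule JnI[OF JnD(1)])
 fix i assume w: "w : Jn (n + 1)"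
 have "P powi (- n) * Ph w i = P * (P powi (- (n + 1)) * Ph w i)" unfolding P_shift[of n] by (rule mult.assoc)
 then show "P powi (- n) * Ph w i : R" using R_mult[OF P_in(1) JnD(3)[OF w]] by (simp only:)
qed

lemma sc_next: "sc n u v = P * sc (n + 1) u v"
 unfolding sc_def P_shift[of n] by (rule mult.assoc)

lemma val_sc_next:
 assumes "w : Jn (n + 1)" "v : Jn n" shows "val (sc n w v) = 0" "val (sc n v w) = 0"
proof -
 show 0: "val (sc n w v) = 0"
 unfolding sc_next[of n] using Rloc_mult[OF P_in(1) sc_R[OF assms(1) JnD(1)[OF assms(2)]]] by simp
 show "val (sc n v w) = 0" using val_sc_conj[OF assms(2) Jn_mono[OF assms(1)]] 0 ha_nz(1) by simp
qed

text \<open>Lattice vectors with the same reduction differ by \<open>P\<close> times a lattice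
  vector \<open>z\<close>. Here \<open>z\<close> need not lie in \<open>Jn n\<close>: it is enough
  that the other argument does.\<close>

lemma val_sc_red:
 assumes "u : Lat" "u' : Lat" "red u = red u'" "v : Jn n"
 shows "val (sc n u v) = val (sc n u' v)" "val (sc n v u) = val (sc n v u')"
proof -
 obtain z where z: "z : Lat" "u = (%i. u' i + P * z i)" using red_eqD[OF assms(1-3)] by blast
 have "sc n u v = sc n u' v + P * sc n z v"
 unfolding z(2) sc_add_left[OF LatD(1)[OF assms(2)] fin_supp_smult[OF LatD(1)[OF z(1)]]] sc_smult_left[OF LatD(1)[OF z(1)]] ..
 then show "val (sc n u v) = val (sc n u' v)"
 using Rloc_add[OF sc_R_right[OF assms(2,4)] R_mult[OF P_in(1) sc_R_right[OF z(1) assms(4)]]]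
 Rloc_mult[OF P_in(1) sc_R_right[OF z(1) assms(4)]] by simp
 have "sc n v u = sc n v u' + P * sc n v z"
 unfolding z(2) sc_add_right[OF LatD(1)[OF assms(2)] fin_supp_smult[OF LatD(1)[OF z(1)]]] sc_smult_right by simp
 then show "val (sc n v u) = val (sc n v u')"
 using Rloc_add[OF sc_R[OF assms(4,2)] R_mult[OF P_in(1) sc_R[OF assms(4) z(1)]]]
 Rloc_mult[OF P_in(1) sc_R[OF assms(4) z(1)]] by simp
qed

text \<open>Two lifts of one class differ by an element of \<open>Jn (n + 1)\<close> and a multiple
  of \<open>P\<close> in the lattice. Both contribute a pairing with value 0 at
  \<open>x\<close>.\<close>

lemma val_sc_cq:
 assumes "u : Jn n" "u' : Jn n" "cq n u = cq n u'" and v: "v : Jn n"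
 shows "val (sc n u v) = val (sc n u' v)" "val (sc n v u) = val (sc n v u')"
proof -
 have "rl u : cq n u" unfolding cq_eq[OF JnD(1)[OF assms(1)]] by (rule image_eqI[OF _ Jn_zero]) simp
 then obtain w where w: "w : Jn (n + 1)" "rl u = rl (%i. w i + u' i)"
 unfolding assms(3) cq_eq[OF JnD(1)[OF assms(2)]] by blast
 note wu = Jn_add[OF Jn_mono[OF w(1)] assms(2)]
 have r: "red u = red (%i. w i + u' i)" using w(2) rl_eq[OF JnD(1)[OF assms(1)] JnD(1)[OF wu]] by blast
 note e = val_sc_red[OF JnD(1)[OF assms(1)] JnD(1)[OF wu] r v]
 show "val (sc n u v) = val (sc n u' v)"
 unfolding e(1) sc_add_left[OF JnD(2)[OF w(1)] JnD(2)[OF assms(2)]]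
 using Rloc_add[OF sc_R[OF Jn_mono[OF w(1)] JnD(1)[OF v]] sc_R[OF assms(2) JnD(1)[OF v]]] val_sc_next(1)[OF w(1) v] by simp
 show "val (sc n v u) = val (sc n v u')"
 unfolding e(2) sc_add_right[OF JnD(2)[OF w(1)] JnD(2)[OF assms(2)]]
 using Rloc_add[OF sc_R[OF v JnD(1)[OF w(1)]] sc_R[OF v JnD(1)[OF assms(2)]]] val_sc_next(2)[OF w(1) v] by simp
qed

lemma frm_cq:
 assumes u: "u : Jn n" and v: "v : Jn n" shows "frm n (cq n u) (cq n v) = val (sc n u v)"
 unfolding jantzen_form_def
proof (rule the_equality)
 show "EX f1:jantzen_local K F rh ph x p n. EX f2:jantzen_local K F rh ph x p n.
 cq n u = jantzen_class K F rh ph x p n f1 & cq n v = jantzen_class K F rh ph x p n f2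
 & val (sc n u v) = val (scaled_pairing F ph p n f1 f2)"
 proof (intro bexI conjI)
 show "cq n u = jantzen_class K F rh ph x p n (lF.mk u)" "cq n v = jantzen_class K F rh ph x p n (lF.mk v)"
 unfolding class_cq by (rule refl)+
 show "val (sc n u v) = val (scaled_pairing F ph p n (lF.mk u) (lF.mk v))"
 unfolding scaled_pairing_eq[OF JnD(1)[OF u] JnD(1)[OF v]] ..
 show "lF.mk u : jantzen_local K F rh ph x p n" "lF.mk v : jantzen_local K F rh ph x p n"
 unfolding jantzen_local_eq by (rule imageI[OF u]) (rule imageI[OF v])
 qed
 fix c assume "EX f1:jantzen_local K F rh ph x p n. EX f2:jantzen_local K F rh ph x p n.
 cq n u = jantzen_class K F rh ph x p n f1 & cq n v = jantzen_class K F rh ph x p n f2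
 & c = val (scaled_pairing F ph p n f1 f2)"
 then obtain f1 f2 where f: "f1 : lF.mk ` Jn n" "f2 : lF.mk ` Jn n" "cq n u = jantzen_class K F rh ph x p n f1"
 "cq n v = jantzen_class K F rh ph x p n f2" "c = val (scaled_pairing F ph p n f1 f2)"
 unfolding jantzen_local_eq by (elim bexE conjE)
 obtain u' where u': "u' : Jn n" "f1 = lF.mk u'" using f(1) by (elim imageE)
 obtain v' where v': "v' : Jn n" "f2 = lF.mk v'" using f(2) by (elim imageE)
 have e: "cq n u = cq n u'" "cq n v = cq n v'" using f(3,4) unfolding u'(2) v'(2) class_cq by blast+
 show "c = val (sc n u v)"
 unfolding f(5) u'(2) v'(2) scaled_pairing_eq[OF JnD(1)[OF u'(1)] JnD(1)[OF v'(1)]]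
 val_sc_cq(1)[OF u u'(1) e(1) v] val_sc_cq(2)[OF v v'(1) e(2) u'(1)] ..
qed

lemma induces: "induces_form K F rh ph x p n"
 unfolding induces_form_def jantzen_local_eq
proof (intro ballI)
 fix f1 f2 assume "f1 : lF.mk ` Jn n" "f2 : lF.mk ` Jn n"
 then obtain u v where uv: "u : Jn n" "f1 = lF.mk u" "v : Jn n" "f2 = lF.mk v" by (elim imageE)
 show "scaled_pairing F ph p n f1 f2 : R
 & frm n (jantzen_class K F rh ph x p n f1) (jantzen_class K F rh ph x p n f2) = val (scaled_pairing F ph p n f1 f2)"
 unfolding uv(2,4) class_cq scaled_pairing_eq[OF JnD(1)[OF uv(1)] JnD(1)[OF uv(3)]] frm_cq[OF uv(1,3)]
 using sc_R[OF uv(1) JnD(1)[OF uv(3)]] by simp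
qed

lemma Quo_carrier: "carrier (Quo n) = cq n ` Jn n"
 unfolding jantzen_quotient_def subquotient_def filt_eq[of n] cq_def by auto

lemma Quo_cases: assumes "X : carrier (Quo n)" obtains u where "u : Jn n" "X = cq n u"
 using assms unfolding Quo_carrier by (elim imageE)

lemma Quo_zero: "\<zero>\<^bsub>Quo n\<^esub> = cq n (%_. 0)"
proof -
 have "(%_. 0) : Lat" using JnD(1)[OF Jn_zero] .
 from cq_eq[OF this] show ?thesis unfolding jantzen_quotient_def subquotient_def filt_eq by simp
qed

lemma Quo_add:
 assumes "u : Jn n" "v : Jn n" shows "cq n u \<oplus>\<^bsub>Quo n\<^esub> cq n v = cq n (%i. u i + v i)"
proof -
 have "cq n u \<oplus>\<^bsub>Quo n\<^esub> cq n v = cq n u <+>\<^bsub>fiber x0 F\<^esub> cq n v"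
 unfolding jantzen_quotient_def subquotient_def by simp
 also have "... = (UN w:Jn (n + 1). UN w':Jn (n + 1). {rl (%i. w i + u i) \<oplus>\<^bsub>fiber x0 F\<^esub> rl (%i. w' i + v i)})"
 unfolding set_add_def' cq_eq[OF JnD(1)[OF assms(1)]] cq_eq[OF JnD(1)[OF assms(2)]] by blast
 also have "... = (UN w:Jn (n + 1). UN w':Jn (n + 1). {rl (%i. (w i + w' i) + (u i + v i))})"
 proof (intro SUP_cong refl)
 fix w w' assume w: "w : Jn (n + 1)" "w' : Jn (n + 1)"
 show "{rl (%i. w i + u i) \<oplus>\<^bsub>fiber x0 F\<^esub> rl (%i. w' i + v i)} = {rl (%i. (w i + w' i) + (u i + v i))}"
 unfolding rl_add[OF Lat_add[OF JnD(1)[OF w(1)] JnD(1)[OF assms(1)]] Lat_add[OF JnD(1)[OF w(2)] JnD(1)[OF assms(2)]]]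
 by (simp add: add_ac)
 qed
 also have "... = (%w. rl (%i. w i + (u i + v i))) ` Jn (n + 1)"
 proof
 show "(%w. rl (%i. w i + (u i + v i))) ` Jn (n + 1) <= (UN w:Jn (n + 1). UN w':Jn (n + 1). {rl (%i. (w i + w' i) + (u i + v i))})"
 proof
 fix t assume "t : (%w. rl (%i. w i + (u i + v i))) ` Jn (n + 1)"
 then obtain w where w: "w : Jn (n + 1)" "t = rl (%i. w i + (u i + v i))" by (elim imageE)
 have "t = rl (%i. (w i + 0) + (u i + v i))" unfolding w(2) by simp
 then show "t : (UN w:Jn (n + 1). UN w':Jn (n + 1). {rl (%i. (w i + w' i) + (u i + v i))})"
 by (intro UN_I[OF w(1)] UN_I[OF Jn_zero]) simp
 qed
 show "(UN w:Jn (n + 1). UN w':Jn (n + 1). {rl (%i. (w i + w' i) + (u i + v i))}) <= (%w. rl (%i. w i + (u i + v i))) ` Jn (n + 1)"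
 proof (intro UN_least)
 fix w w' assume w: "w : Jn (n + 1)" "w' : Jn (n + 1)"
 show "{rl (%i. (w i + w' i) + (u i + v i))} <= (%w. rl (%i. w i + (u i + v i))) ` Jn (n + 1)"
 using imageI[OF Jn_add[OF w], of "%w. rl (%i. w i + (u i + v i))"] by simp
 qed
 qed
 also have "... = cq n (%i. u i + v i)" unfolding cq_eq[OF JnD(1)[OF Jn_add[OF assms]]] ..
 finally show ?thesis .
qed

text \<open>Scalar multiplication and induced maps on a subquotient are unions over representatives,
  which reduce to one coset once all representatives agree.\<close>

lemma Union_const: "A ~= {} ==> (!!w. w : A ==> f w = c) ==> (UN w:A. f w) = c"
 by simp

lemma Jn_ne: "Jn n ~= {}" using Jn_zero by blast

lemma Quo_smult:
 assumes u: "u : Jn n" shows "c \<odot>\<^bsub>Quo n\<^esub> cq n u = cq n (%i. to_fract [:c:] * u i)"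
proof -
 have cR: "to_fract [:c:] : R" by simp
 have "c \<odot>\<^bsub>Quo n\<^esub> cq n u = (UN w:Jn (n + 1). filt (n + 1) +>\<^bsub>fiber x0 F\<^esub> (c \<odot>\<^bsub>fiber x0 F\<^esub> rl (%i. w i + u i)))"
 unfolding jantzen_quotient_def subquotient_def cq_eq[OF JnD(1)[OF u]] by (simp del: base_change_simps)
 also have "... = cq n (%i. to_fract [:c:] * u i)"
 proof (rule Union_const[OF Jn_ne])
 fix w assume w: "w : Jn (n + 1)"
 show "filt (n + 1) +>\<^bsub>fiber x0 F\<^esub> (c \<odot>\<^bsub>fiber x0 F\<^esub> rl (%i. w i + u i)) = cq n (%i. to_fract [:c:] * u i)"
 unfolding rl_smult[OF Lat_add[OF JnD(1)[OF w] JnD(1)[OF u]]] cq_def[symmetric] distrib_left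
 by (rule cq_absorb[OF Lat_smult[OF cR JnD(1)[OF u]] Jn_smult[OF cR w]])
 qed
 finally show ?thesis .
qed

lemma sesquilinear: "sesquilinear_on (Quo n) (frm n)"
 unfolding sesquilinear_on_def
proof (intro conjI ballI allI)
 fix X Y Z assume "X : carrier (Quo n)" "Y : carrier (Quo n)" "Z : carrier (Quo n)"
 then obtain u v w where u: "u : Jn n" "X = cq n u" and v: "v : Jn n" "Y = cq n v" and w: "w : Jn n" "Z = cq n w"
 by (elim Quo_cases)
 show "frm n (X \<oplus>\<^bsub>Quo n\<^esub> Y) Z = frm n X Z + frm n Y Z"
 unfolding u(2) v(2) w(2) Quo_add[OF u(1) v(1)] frm_cq[OF Jn_add[OF u(1) v(1)] w(1)] frm_cq[OF u(1) w(1)] frm_cq[OF v(1) w(1)]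
 sc_add_left[OF JnD(2)[OF u(1)] JnD(2)[OF v(1)]]
 using Rloc_add[OF sc_R[OF u(1) JnD(1)[OF w(1)]] sc_R[OF v(1) JnD(1)[OF w(1)]]] by blast
 show "frm n X (Y \<oplus>\<^bsub>Quo n\<^esub> Z) = frm n X Y + frm n X Z"
 unfolding u(2) v(2) w(2) Quo_add[OF v(1) w(1)] frm_cq[OF u(1) Jn_add[OF v(1) w(1)]] frm_cq[OF u(1) v(1)] frm_cq[OF u(1) w(1)]
 sc_add_right[OF JnD(2)[OF v(1)] JnD(2)[OF w(1)]]
 using Rloc_add[OF sc_R[OF u(1) JnD(1)[OF v(1)]] sc_R[OF u(1) JnD(1)[OF w(1)]]] by blast
next
 fix c X Y assume "X : carrier (Quo n)" "Y : carrier (Quo n)"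
 then obtain u v where u: "u : Jn n" "X = cq n u" and v: "v : Jn n" "Y = cq n v" by (elim Quo_cases)
 have cR: "to_fract [:c:] : R" by simp
 show "frm n (c \<odot>\<^bsub>Quo n\<^esub> X) Y = c * frm n X Y"
 unfolding u(2) v(2) Quo_smult[OF u(1)] frm_cq[OF Jn_smult[OF cR u(1)] v(1)] frm_cq[OF u(1) v(1)] sc_smult_left[OF JnD(2)[OF u(1)]]
 using Rloc_mult[OF cR sc_R[OF u(1) JnD(1)[OF v(1)]]] by simp
 show "frm n X (c \<odot>\<^bsub>Quo n\<^esub> Y) = cnj c * frm n X Y"
 unfolding u(2) v(2) Quo_smult[OF v(1)] frm_cq[OF u(1) Jn_smult[OF cR v(1)]] frm_cq[OF u(1) v(1)] sc_smult_right
 using Rloc_mult[OF R_conj[OF cR] sc_R[OF u(1) JnD(1)[OF v(1)]]] Rloc_conj[OF cR] by simp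
qed

lemma cq_nondeg:
 assumes u: "u : Jn n" and z: "!!v. v : Jn n ==> val (sc n u v) = 0"
 shows "cq n u = \<zero>\<^bsub>Quo n\<^esub>"
proof -
 obtain f1 f2 where f: "f1 : Jn (n + 1)" "f2 : Lat" "u = (%i. f1 i + P * f2 i)"
 using jantzen_nondegenerate[OF gi u z] by blast
 have L: "(%i. P * f2 i) : Lat" "(%_. 0) : Lat" using Lat_smult[OF P_in(1) f(2)] JnD(1)[OF Jn_zero] by blast+
 have "red (%i. P * f2 i) = red (%_. 0)" using Rloc_mult[OF P_in(1) LatD(2)[OF f(2)]] by simp
 then show ?thesis unfolding f(3) cq_absorb[OF L(1) f(1)] Quo_zero by (rule cq_red[OF L])
qed

lemma nondegenerate: "nondegenerate_on (Quo n) (frm n)"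
 unfolding nondegenerate_on_def
proof (intro conjI ballI impI)
 fix X assume "X : carrier (Quo n)" and z: "ALL Y:carrier (Quo n). frm n X Y = 0"
 then obtain u where u: "u : Jn n" "X = cq n u" by (elim Quo_cases)
 have "val (sc n u v) = 0" if "v : Jn n" for v
 using z that unfolding Quo_carrier u(2) frm_cq[OF u(1) that, symmetric] by blast
 then show "X = \<zero>\<^bsub>Quo n\<^esub>" unfolding u(2) by (rule cq_nondeg[OF u(1)])
next
 fix X assume "X : carrier (Quo n)" and z: "ALL Y:carrier (Quo n). frm n Y X = 0"
 then obtain u where u: "u : Jn n" "X = cq n u" by (elim Quo_cases)
 have "val (sc n u v) = 0" if v: "v : Jn n" for v
 proof -
 have "val (sc n v u) = 0" using z v unfolding Quo_carrier u(2) frm_cq[OF v u(1), symmetric] by blast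
 then show ?thesis using val_sc_conj[OF u(1) v] ha_nz(1) by simp
 qed
 then show "X = \<zero>\<^bsub>Quo n\<^esub>" unfolding u(2) by (rule cq_nondeg[OF u(1)])
qed

section \<open>Invariance of the induced forms\<close>

lemma ext_Lat: "linear_map Oring F F T ==> v : Lat ==> ext T v : Lat"
 using lF.extm_fin_supp .

lemma ext_add: "u : VV ==> v : VV ==> ext T (%i. u i + v i) = (%i. ext T u i + ext T v i)"
 unfolding extm_mx by (rule mx_add[OF fin_suppD(1) fin_suppD(1)])

lemma val_ext:
 assumes v: "v : Lat" shows "val (ext T v i) = (SUM b:{b. v b ~= 0}. val (v b) * poly (crd (T b) i) x0)"
proof -
 have "v b * to_fract (crd (T b) i) : R & val (v b * to_fract (crd (T b) i)) = val (v b) * poly (crd (T b) i) x0" for b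
 using Rloc_mult[OF LatD(2)[OF v] Rloc_to_fract(1)] by simp
 then show ?thesis unfolding extm_def using Rloc_sum[of _ "%b. v b * to_fract (crd (T b) i)" x0] by simp
qed

lemma red_ext: assumes v: "v : Lat" shows "red (ext T v) = extm (ev x0) crd T (red v)"
proof
 fix i
 have s: "{b. val (v b) ~= 0} <= {b. v b ~= 0}" by auto
 show "val (ext T v i) = extm (ev x0) crd T (red v) i"
 unfolding val_ext[OF v] extm_superset[OF fin_suppD(1)[OF LatD(1)[OF v]] s] ..
qed

text \<open>An operator on the fiber that is the reduction of \<open>T\<close> acts on classes by
  \<open>T\<close> on lifts. That \<open>T\<close> preserves \<open>Jn (n + 1)\<close> makes the
  result independent of the lift.\<close>

lemma act_cq:
 assumes T: "linear_map Oring F F T"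
 and \<tau>: "!!t. t : carrier (fiber x0 F) ==> \<tau> t : carrier (fiber x0 F)" "!!t. t : carrier (fiber x0 F) ==> cF.tc (\<tau> t) = extm (ev x0) crd T (cF.tc t)"
 and pres: "!!m v. v : Jn m ==> ext T v : Jn m" and u: "u : Jn n"
 shows "subquotient_map (fiber x0 F) (filt (n + 1)) \<tau> (cq n u) = cq n (ext T u)"
proof -
 have rlT: "\<tau> (rl v) = rl (ext T v)" if v: "v : Lat" for v
 proof (rule cF.tc_inj[OF \<tau>(1)[OF rl(1)[OF v]] rl(1)[OF ext_Lat[OF T v]]])
 show "cF.tc (\<tau> (rl v)) = cF.tc (rl (ext T v))"
 unfolding \<tau>(2)[OF rl(1)[OF v]] rl(2)[OF v] rl(2)[OF ext_Lat[OF T v]] red_ext[OF v] ..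
 qed
 have "subquotient_map (fiber x0 F) (filt (n + 1)) \<tau> (cq n u) = (UN w:Jn (n + 1). filt (n + 1) +>\<^bsub>fiber x0 F\<^esub> \<tau> (rl (%i. w i + u i)))"
 unfolding subquotient_map_def cq_eq[OF JnD(1)[OF u]] by (simp del: base_change_simps)
 also have "... = cq n (ext T u)"
 proof (rule Union_const[OF Jn_ne])
 fix w assume w: "w : Jn (n + 1)"
 show "filt (n + 1) +>\<^bsub>fiber x0 F\<^esub> \<tau> (rl (%i. w i + u i)) = cq n (ext T u)"
 unfolding rlT[OF Lat_add[OF JnD(1)[OF w] JnD(1)[OF u]]] cq_def[symmetric] ext_add[OF JnD(2)[OF w] JnD(2)[OF u]]
 by (rule cq_absorb[OF ext_Lat[OF T JnD(1)[OF u]] pres[OF w]])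
 qed
 finally show ?thesis .
qed

text \<open>The coordinates of \<open>Ph\<close> are pairings with basis vectors. Moving
  \<open>T\<close> across the form replaces a basis vector by its image under the adjoint
  \<open>T'\<close>, which is again a lattice vector.\<close>

lemma preserve:
 assumes T: "linear_map Oring F F T" and T': "linear_map Oring F F T'"
 and adj: "!!u v. u : VV ==> v : VV ==> form (ext T u) v = c * form u (ext T' v)" and c: "c : R"
 and u: "u : Jn m"
 shows "ext T u : Jn m"
proof (rule JnI[OF ext_Lat[OF T JnD(1)[OF u]]])
 fix b
 show "P powi (- m) * Ph (ext T u) b : R"
 proof (cases "b : B")
 case True
 have d: "(delta b :: 'f => complex poly fract) : Lat" by (rule LatI[OF fin_supp_delta[OF True]]) simp
 have "P powi (- m) * Ph (ext T u) b = c * sc m u (ext T' (delta b))"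
 unfolding form_delta[symmetric] adj[OF JnD(2)[OF u] LatD(1)[OF d]] sc_def by (simp add: mult.left_commute)
 then show ?thesis using R_mult[OF c sc_R[OF u ext_Lat[OF T' d]]] by simp
 next
 case False
 then show ?thesis using fin_suppD(2)[OF Phi_in[OF ext_in[OF T JnD(2)[OF u]]]] by simp
 qed
qed

text \<open>Constants can be moved across the tensor sign, so every element of the fiber is the
  tensor of 1 with a global section.\<close>

lemma fiber_element:
 assumes "X : carrier (fiber x0 gg)" shows "EX Y:carrier gg. frag_of (1, Y) : X"
proof -
 interpret Tg: tensor_pair Oring "alg_module Cfield (ev x0)" gg
 by (intro tensor_pair.intro cF.scalar_closed_alg scalar_closed_module module_g)
 interpret G: Module.module Oring gg by (rule module_g)
 let ?rel = "tensor_rel Oring (alg_module Cfield (ev x0)) gg"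
 have rs: "frag_of (c * u, Y) - frag_of (u, [:c:] \<odot>\<^bsub>gg\<^esub> Y) : ?rel" if "Y : carrier gg" for c u Y
 using Tg.rel_smult[of "[:c:]" u Y] that by simp
 have ra: "frag_of (u + u', Y) - frag_of (u, Y) - frag_of (u', Y) : ?rel" if "Y : carrier gg" for u u' Y
 using Tg.rel_add_left[of u u' Y] that by simp
 have X: "X : carrier (tensor Oring (alg_module Cfield (ev x0)) gg)" using assms by simp
 have "X : {tensor_class Oring (alg_module Cfield (ev x0)) gg a |a. pkeys a <= carrier (alg_module Cfield (ev x0)) \<times> carrier gg}"
 using X unfolding Tg.carrier_tensor .
 then obtain a where a: "X = tensor_class Oring (alg_module Cfield (ev x0)) gg a" "pkeys a <= UNIV \<times> carrier gg" by auto
 have "EX Y:carrier gg. a - frag_of (1, Y) : ?rel"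
 using a(2)
 proof (induction a rule: frag_induction)
 case zero
 have "frag_of (1, \<zero>\<^bsub>gg\<^esub> \<oplus>\<^bsub>gg\<^esub> \<zero>\<^bsub>gg\<^esub>) - frag_of (1, \<zero>\<^bsub>gg\<^esub>) - frag_of (1, \<zero>\<^bsub>gg\<^esub>) : ?rel"
 by (rule Tg.rel_add_right) simp_all
 then have "0 - frag_of (1, \<zero>\<^bsub>gg\<^esub>) : ?rel" by simp
 then show ?case using G.zero_closed by blast
 next
 case (one q)
 obtain c Y where q: "q = (c, Y)" "Y : carrier gg" using one by (cases q) auto
 have "frag_of q - frag_of (1, [:c:] \<odot>\<^bsub>gg\<^esub> Y) : ?rel" using rs[OF q(2), of c 1] q(1) by simp
 moreover have "[:c:] \<odot>\<^bsub>gg\<^esub> Y : carrier gg" using q(2) by simp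
 ultimately show ?case by blast
 next
 case (diff a b)
 obtain Y where Y: "Y : carrier gg" "a - frag_of (1, Y) : ?rel" using diff(1) by (elim bexE)
 obtain Y' where Y': "Y' : carrier gg" "b - frag_of (1, Y') : ?rel" using diff(2) by (elim bexE)
 let ?m = "[:- 1:] \<odot>\<^bsub>gg\<^esub> Y'"
 have m: "?m : carrier gg" using Y'(1) by simp
 have r1: "frag_of (1, Y \<oplus>\<^bsub>gg\<^esub> ?m) - frag_of (1, Y) - frag_of (1, ?m) : ?rel"
 by (rule Tg.rel_add_right[OF _ Y(1) m]) simp
 have r2: "frag_of (- 1, Y') - frag_of (1, ?m) : ?rel" using rs[OF Y'(1), of "- 1" 1] by simp
 have r3: "frag_of (0, Y') - frag_of (- 1, Y') - frag_of (1, Y') : ?rel" using ra[OF Y'(1), of "- 1" 1] by simp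
 have r4: "- frag_of (0, Y') : ?rel" using ra[OF Y'(1), of 0 0] by simp
 have "(a - frag_of (1, Y)) - (b - frag_of (1, Y')) - (frag_of (1, Y \<oplus>\<^bsub>gg\<^esub> ?m) - frag_of (1, Y) - frag_of (1, ?m))
 + (frag_of (- 1, Y') - frag_of (1, ?m)) + (frag_of (0, Y') - frag_of (- 1, Y') - frag_of (1, Y')) + - frag_of (0, Y') : ?rel"
 by (rule Tg.rel_add[OF Tg.rel_add[OF Tg.rel_add[OF Tg.rel_diff[OF Tg.rel_diff[OF Y(2) Y'(2)] r1] r2] r3] r4])
 then have "a - b - frag_of (1, Y \<oplus>\<^bsub>gg\<^esub> ?m) : ?rel" by (simp add: algebra_simps)
 moreover have "Y \<oplus>\<^bsub>gg\<^esub> ?m : carrier gg" using Y(1) m by simp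
 ultimately show ?case by blast
 qed
 then obtain Y where Y: "Y : carrier gg" "a - frag_of (1, Y) : ?rel" by (elim bexE)
 have "frag_of (1, Y) - a : ?rel" using Tg.rel_uminus[OF Y(2)] by simp
 then have "frag_of (1, Y) : X" unfolding a(1) Tg.mem_class .
 then show ?thesis using Y(1) by blast
qed

lemma fiber_conj_element:
 assumes X: "X : carrier (fiber x0 gg)" and Y: "Y : carrier gg" "frag_of (1, Y) : X"
 shows "fiber_conj gg sggg x X : carrier (fiber x0 gg)" "frag_of (1, sggg Y) : fiber_conj gg sggg x X"
proof -
 interpret Tg: tensor_pair Oring "alg_module Cfield (ev x0)" gg
 by (intro tensor_pair.intro cF.scalar_closed_alg scalar_closed_module module_g)
 have Xc: "X = tensor_class Oring (alg_module Cfield (ev x0)) gg (frag_of (1, Y))"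
 by (rule Tg.mem_tensor_keys(2)[OF _ Y(2)]) (use X in simp)
 have k: "pkeys (frag_of (1 :: complex, Y)) <= carrier (alg_module Cfield (ev x0)) \<times> carrier gg"
 using Y(1) by (simp add: keys_frag_of)
 have bal: "frag_of (cnj (r \<odot>\<^bsub>alg_module Cfield (ev x0)\<^esub> u), sggg v) - frag_of (cnj u, sggg (r \<odot>\<^bsub>gg\<^esub> v))
 : tensor_rel Oring (alg_module Cfield (ev x0)) gg" if "v : carrier gg" for r u v
 using Tg.rel_smult[of "conj_poly r" "cnj u" "sggg v"] re.sigma_closed[OF that] re.sigma_smult[OF that]
 by (simp add: poly_conj_poly)
 note tm = tensor_map_class[OF Tg.tensor_pair_axioms Tg.tensor_pair_axioms, of cnj sggg "frag_of (1, Y)"]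
 have e: "fiber_conj gg sggg x X = tensor_class Oring (alg_module Cfield (ev x0)) gg (frag_extend (%(u, v). frag_of (cnj u, sggg v)) (frag_of (1, Y)))"
 unfolding fiber_conj_def Xc
 by (rule tm(1)) (use re.sigma_closed re.sigma_add k bal in simp_all)
 then have e': "fiber_conj gg sggg x X = tensor_class Oring (alg_module Cfield (ev x0)) gg (frag_of (1, sggg Y))" by simp
 have "pkeys (frag_of (1 :: complex, sggg Y)) <= carrier (alg_module Cfield (ev x0)) \<times> carrier gg"
 using re.sigma_closed[OF Y(1)] by (simp add: keys_frag_of)
 then show "fiber_conj gg sggg x X : carrier (fiber x0 gg)" unfolding e' using Tg.class_in_tensor by simp
 show "frag_of (1, sggg Y) : fiber_conj gg sggg x X" unfolding e' by (rule Tg.self_mem_class)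
qed

lemma pi_Jn: "Y : carrier gg ==> u : Jn m ==> ext (\<pi> Y) u : Jn m"
proof (rule preserve[OF pi_linear pi_linear[OF re.sigma_closed], where c = "- 1"])
 show "- 1 : R" using Rloc_uminus[OF Rloc_1(1)] by blast
qed (simp_all add: form_lie)

lemma rho_Jn: "k : K ==> u : Jn m ==> ext (rh k) u : Jn m"
 by (rule preserve[OF rho_lin_F section_act_linear[OF section_inverse(1)[OF real_section(1)]], where c = 1])
 (simp_all add: form_group)

lemma lie_act_cq:
 assumes X: "X : carrier (fiber x0 gg)" and Y: "Y : carrier gg" "frag_of (1, Y) : X" and u: "u : Jn n"
 shows "subquotient_map (fiber x0 F) (filt (n + 1)) (fiber_lie_act F \<pi> x X) (cq n u) = cq n (ext (\<pi> Y) u)"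
proof (rule act_cq[OF pi_linear[OF Y(1)] _ _ pi_Jn[OF Y(1)] u])
 fix t assume t: "t : carrier (fiber x0 F)"
 note ba = cF.base_action[of gg \<pi>, OF module_g pi_linear hc.lie_linear(2) X Y(2) t]
 show "fiber_lie_act F \<pi> x X t : carrier (fiber x0 F)" unfolding fiber_lie_act_def by (rule ba(1))
 show "cF.tc (fiber_lie_act F \<pi> x X t) = extm (ev x0) crd (\<pi> Y) (cF.tc t)"
 unfolding fiber_lie_act_def using ba(2) by simp
qed

lemma group_act_cq:
 assumes k: "k : K" and u: "u : Jn n"
 shows "subquotient_map (fiber x0 F) (filt (n + 1)) (fiber_group_act F rh x k) (cq n u) = cq n (ext (rh k) u)"
proof (rule act_cq[OF rho_lin_F[OF k] _ _ rho_Jn[OF k] u])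
 fix t assume t: "t : carrier (fiber x0 F)"
 show "fiber_group_act F rh x k t : carrier (fiber x0 F)"
 unfolding fiber_group_act_def by (rule cF.tc_base_map(1)[OF rho_lin_F[OF k] t])
 show "cF.tc (fiber_group_act F rh x k t) = extm (ev x0) crd (rh k) (cF.tc t)"
 unfolding fiber_group_act_def by (rule cF.tc_base_map(2)[OF rho_lin_F[OF k] t])
qed

lemma ext_comp:
 assumes T: "linear_map Oring F F T" "linear_map Oring F F T'" and v: "v : VV"
 shows "ext T (ext T' v) = ext (%m. T (T' m)) v"
proof -
 have vB: "b : B" if "v b ~= 0" for b using fin_suppD(2)[OF v] that by blast
 have T'c: "T' b : carrier F" if "b : B" for b using linear_mapD(3)[OF T(2) gF.bas_in[OF that]] .
 have row: "(%i. to_fract (crd (T' b) i)) = emb (T' b)" for b by (simp add: emb_def)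
 have "ext T (ext T' v) = mx (%b. ext T (emb (T' b))) v"
 unfolding extm_mx row by (rule mx_mx[OF fin_suppD(1)[OF v] fin_suppD(1)[OF emb_in[OF T'c[OF vB]]]])
 also have "... = mx (%b. emb (T (T' b))) v"
 by (rule mx_cong) (rule emb_ext[OF T(1) T'c[OF vB]])
 finally show ?thesis unfolding extm_mx by (simp add: emb_def)
qed

text \<open>Moving \<open>k\<close> across the form produces the section \<open>?H\<close>, whose
  value at \<open>x\<close> is the inverse of \<open>sgK x0 k\<close>. The two operators on
  \<open>v\<close> thus cancel only after reduction at \<open>x\<close>, which is enough for the
  value of the pairing.\<close>

lemma form_group_val:
 assumes k: "k : K" and u: "u : Jn n" and v: "v : Jn n"
 shows "val (sc n (ext (rh k) u) (ext (rh (sgK x0 k)) v)) = val (sc n u v)"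
proof -
 let ?H = "matrix_inv (conj_section sgK (const_mat k))" and ?k = "sgK x0 k"
 have k': "?k : K" using re.sigmaK_closed[OF k] .
 have G: "conj_section sgK (const_mat k) : sections K" using real_section(1)[OF k] .
 have H: "?H : sections K" using section_inverse(1)[OF G] .
 have Hx: "ev_mat x0 ?H = matrix_inv ?k" using section_inverse(2)[OF G, of x0] real_section(2)[OF k, of x0] by simp
 let ?w = "ext (section_act K F rh ?H) (ext (rh ?k) v)"
 have wL: "?w : Lat" by (rule ext_Lat[OF section_act_linear[OF H] ext_Lat[OF rho_lin_F[OF k'] JnD(1)[OF v]]])
 have "sc n (ext (rh k) u) (ext (rh ?k) v) = sc n u ?w"
 unfolding sc_def form_group[OF k JnD(2)[OF u] LatD(1)[OF ext_Lat[OF rho_lin_F[OF k'] JnD(1)[OF v]]]] ..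
 moreover have "red ?w = red v"
 proof
 fix i
 have vB: "b : B" if "v b ~= 0" for b using fin_suppD(2)[OF JnD(2)[OF v]] that by blast
 have "poly (crd (section_act K F rh ?H (rh ?k b)) i) x0 = (if i = b then 1 else 0)" if b: "b : B" for b
 proof -
 have bc: "b : carrier F" using gF.bas_in[OF b] .
 have "poly (crd (section_act K F rh ?H (rh ?k b)) i) x0 = poly (crd (rh (matrix_inv ?k) (rh ?k b)) i) x0"
 using section_act_eval[OF rho_F[OF k' bc] H, of i x0] unfolding Hx .
 also have "rh (matrix_inv ?k) (rh ?k b) = b" using V.rho_inv[OF k'] bc by simp
 finally show ?thesis using gF.crd_bas[OF b, of i] by simp
 qed
 then have "val (?w i) = (SUM b:{b. v b ~= 0}. if i = b then val (v b) else 0)"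
 unfolding ext_comp[OF section_act_linear[OF H] rho_lin_F[OF k'] JnD(2)[OF v]] val_ext[OF JnD(1)[OF v]]
 by (intro sum.cong refl) (use vB in auto)
 then show "val (?w i) = val (v i)" using fin_suppD(1)[OF JnD(2)[OF v]] by auto
 qed
 ultimately show ?thesis using val_sc_red(2)[OF wL JnD(1)[OF v] _ u] by simp
qed

lemma invariant: "invariant_form K gg sggg sgK F \<pi> rh ph x p n"
 unfolding invariant_form_def Let_def
proof (intro conjI ballI)
 fix X U W assume X: "X : carrier (fiber x0 gg)" and "U : carrier (Quo n)" "W : carrier (Quo n)"
 then obtain u v where u: "u : Jn n" "U = cq n u" and v: "v : Jn n" "W = cq n v" by (elim Quo_cases)
 obtain Y where Y: "Y : carrier gg" "frag_of (1, Y) : X" using fiber_element[OF X] by (elim bexE)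
 note cX = fiber_conj_element[OF X Y] and Y' = re.sigma_closed[OF Y(1)]
 have "sc n (ext (\<pi> Y) u) v + sc n u (ext (\<pi> (sggg Y)) v) = 0"
 unfolding sc_def form_lie[OF Y(1) JnD(2)[OF u(1)] JnD(2)[OF v(1)]] by simp
 then have "val (sc n (ext (\<pi> Y) u) v) + val (sc n u (ext (\<pi> (sggg Y)) v)) = 0"
 using Rloc_add[OF sc_R[OF pi_Jn[OF Y(1) u(1)] JnD(1)[OF v(1)]] sc_R[OF u(1) JnD(1)[OF pi_Jn[OF Y' v(1)]]]] by simp
 then show "frm n (subquotient_map (fiber x0 F) (filt (n + 1)) (fiber_lie_act F \<pi> x X) U) W
 + frm n U (subquotient_map (fiber x0 F) (filt (n + 1)) (fiber_lie_act F \<pi> x (fiber_conj gg sggg x X)) W) = 0"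
 unfolding u(2) v(2) lie_act_cq[OF X Y u(1)] lie_act_cq[OF cX(1) Y' cX(2) v(1)]
 frm_cq[OF pi_Jn[OF Y(1) u(1)] v(1)] frm_cq[OF u(1) pi_Jn[OF Y' v(1)]] .
next
 fix k U W assume k: "k : K" and "U : carrier (Quo n)" "W : carrier (Quo n)"
 then obtain u v where u: "u : Jn n" "U = cq n u" and v: "v : Jn n" "W = cq n v" by (elim Quo_cases)
 have k': "sgK x0 k : K" using re.sigmaK_closed[OF k] .
 show "frm n (subquotient_map (fiber x0 F) (filt (n + 1)) (fiber_group_act F rh x k) U)
 (subquotient_map (fiber x0 F) (filt (n + 1)) (fiber_group_act F rh x (sgK x0 k)) W) = frm n U W"
 unfolding u(2) v(2) group_act_cq[OF k u(1)] group_act_cq[OF k' v(1)] frm_cq[OF rho_Jn[OF k u(1)] rho_Jn[OF k' v(1)]]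
 frm_cq[OF u(1) v(1)] by (rule form_group_val[OF k u(1) v(1)])
qed

lemma hermitian: "EX l. hermitian_scalar K F rh ph x p l"
proof -
 \<comment> \<open>Conjugating \<open>l\<close> times the form produces the factor
   \<open>cnj l * val ha\<close>. This equals \<open>l\<close> when \<open>l\<close> has modulus one
   and square \<open>val ha\<close>; as \<open>ha\<close> does not involve \<open>n\<close>, neither
   does \<open>l\<close>.\<close>
 define l where "l = csqrt (val ha)"
 have l2: "l * l = val ha" using power2_csqrt[of "val ha"] by (simp add: l_def power2_eq_square)
 have "cmod l * cmod l = 1" using l2 ha(2) by (metis norm_mult)
 then have l1: "cmod l = 1" using abs_square_eq_1[of "cmod l"] by (simp add: power2_eq_square)
 then have ll: "l * cnj l = 1" using complex_norm_square[of l] by simp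
 have herm: "hermitian_on (Quo n) (%u v. l * frm n u v)" for n
 unfolding hermitian_on_def
 proof (intro conjI ballI)
 show "sesquilinear_on (Quo n) (%u v. l * frm n u v)"
 using sesquilinear[of n] unfolding sesquilinear_on_def by (simp add: distrib_left mult.left_commute)
 fix U W assume "U : carrier (Quo n)" "W : carrier (Quo n)"
 then obtain u v where u: "u : Jn n" "U = cq n u" and v: "v : Jn n" "W = cq n v" by (elim Quo_cases)
 have "cnj (l * frm n U W) = cnj l * (l * l * frm n W U)"
 unfolding u(2) v(2) frm_cq[OF u(1) v(1)] frm_cq[OF v(1) u(1)] l2 using val_sc_conj[OF v(1) u(1)] by simp
 also have "... = (l * cnj l) * (l * frm n W U)" by (simp only: mult_ac)
 finally show "l * frm n W U = cnj (l * frm n U W)" using ll by simp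
 qed
 show ?thesis unfolding hermitian_scalar_def using l1 herm by blast
qed

lemma unit_powi:
 assumes "q : R" "val q ~= 0" shows "q powi m : R & val (q powi m) ~= 0"
proof -
 have pw: "r ^ j : R & val (r ^ j) ~= 0" if "r : R" "val r ~= 0" for r and j :: nat
 using that Rloc_mult[OF that(1)] by (induction j) auto
 have iq: "inverse q : R" "val (inverse q) ~= 0" using Rloc_inverse[OF assms] assms(2) by simp_all
 show ?thesis unfolding power_int_def using pw[OF assms] pw[OF iq] by simp
qed

text \<open>The two isomorphisms differ by a rational function \<open>q\<close>, and the coordinates
  \<open>p'\<close> and \<open>p\<close> by a nonzero constant. The order of \<open>q\<close> at
  \<open>x\<close> shifts the filtration, and the remaining unit rescales the forms.\<close>

lemma independent_of_choices:
 assumes J': "jantzen K gg br \<alpha> \<iota> sggg sgK F \<pi> rh B crd Bs x p' ph'"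
 shows "EX m. (ALL n. jantzen_quotient K F rh ph' x p' n = Quo (n + m))
 & (ALL l l' n. hermitian_scalar K F rh ph x p l & hermitian_scalar K F rh ph' x p' l' -->
 (\<exists>c::real. c ~= 0 & (ALL u:carrier (Quo (n + m)). ALL v:carrier (Quo (n + m)).
 l' * jantzen_form K F rh ph' x p' n u v = of_real c * (l * frm (n + m) u v))))"
proof -
 interpret E: jantzen K gg br \<alpha> \<iota> sggg sgK F \<pi> rh B crd Bs x p' ph' by (rule J')
 obtain q where q: "q ~= 0" "!!v. v : VV ==> E.Ph v = (%i. q * Ph v i)"
 using proportional[OF gi E.equi_axioms] by blast
 have "poly p' x0 = 0" using E.coord by (simp add: real_coordinate_def)
 then obtain a' where a': "p' = p * a'" using poly_zero_factor by blast
 have a0: "a' ~= 0" using a' E.p_nz by auto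
 have "Polynomial.degree p' = Polynomial.degree p + Polynomial.degree a'"
 unfolding a' using p_nz a0 by (rule Polynomial.degree_mult_eq)
 then have "Polynomial.degree a' = 0" using E.coord coord by (simp add: real_coordinate_def)
 then obtain c where c: "a' = [:c:]" by (rule degree_eq_zeroE)
 define C where "C = to_fract [:c:]"
 have C: "C : R" "val C ~= 0" using a0 c by (simp_all add: C_def)
 have "to_fract p' = to_fract [:c:] * to_fract p" unfolding a' c by (simp only: to_fract_mult mult.commute)
 then have PC: "E.P = C * P" by (simp only: E.P_def P_def C_def)
 obtain k u where ku: "u : R" "val u ~= 0" "q = P powi k * u" using order_unit[OF q(1)] by blast
 \<comment> \<open>The unit left over at level \<open>n\<close>: the unit part of \<open>q\<close>
   together with the constant ratio of the two coordinates raised to the power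
   \<open>- n\<close>.\<close>
 define W where "W n = C powi (- n) * u" for n
 have W: "W n : R" "val (W n) ~= 0" for n
 using unit_powi[OF C, of "- n"] Rloc_mult[of "C powi (- n)" x0 u] ku(1,2) unfolding W_def by auto
 have scale: "E.P powi (- n) * (q * z) = W n * (P powi (- (n + - k)) * z)" for n z
 proof -
 have "P powi (- (n + - k)) = P powi (- n + k)" by simp
 also have "... = P powi (- n) * P powi k" by (rule power_int_add) simp
 finally show ?thesis by (simp add: PC ku(3) W_def power_int_mult_distrib mult_ac)
 qed
 have WR: "W n * z : R \<longleftrightarrow> z : R" for n z
 proof
 assume "W n * z : R"
 then have "inverse (W n) * (W n * z) : R" using R_mult Rloc_inverse[OF W] by blast
 moreover have "W n ~= 0" using W(2)[of n] by auto
 ultimately show "z : R" by (simp add: mult.assoc[symmetric])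
 qed (rule R_mult[OF W(1)])
 have JnE: "E.Jn n = Jn (n + - k)" for n
 proof -
 have "E.P powi (- n) * E.Ph v i : R \<longleftrightarrow> P powi (- (n + - k)) * Ph v i : R" if "v : Lat" for v i
 unfolding q(2)[OF LatD(1)[OF that]] scale WR ..
 then show ?thesis unfolding E.Jn_def Jn_def by blast
 qed
 have filtE: "E.filt n = filt (n + - k)" for n by (simp only: E.filt_eq filt_eq JnE)
 have shift: "n + 1 + - k = n + - k + 1" for n :: int by simp
 have QuoE: "E.Quo n = Quo (n + - k)" for n unfolding jantzen_quotient_def filtE shift ..
 have cqE: "E.cq n = cq (n + - k)" for n by (rule HOL.ext) (simp only: E.cq_def cq_def filtE shift)
 have scE: "E.sc n v w = W n * sc (n + - k) v w" if "v : VV" for n v w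
 unfolding E.sc_def sc_def E.form_def form_def q(2)[OF that] dot_smult_left scale ..
 have frmE: "E.frm n U V = val (W n) * frm (n + - k) U V"
 if UV: "U : carrier (Quo (n + - k))" "V : carrier (Quo (n + - k))" for n U V
 proof -
 obtain v w where v: "v : Jn (n + - k)" "U = cq (n + - k) v" and w: "w : Jn (n + - k)" "V = cq (n + - k) w"
 using UV by (elim Quo_cases)
 have "E.frm n U V = val (E.sc n v w)"
 unfolding v(2) w(2) cqE[symmetric] by (rule E.frm_cq) (use v(1) w(1) in \<open>simp_all only: JnE\<close>)
 then show ?thesis
 unfolding scE[OF JnD(2)[OF v(1)]] v(2) w(2) frm_cq[OF v(1) w(1)]
 using Rloc_mult[OF W(1) sc_R[OF v(1) JnD(1)[OF w(1)]]] by simp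
 qed
 show ?thesis
 proof (intro exI[of _ "- k"] conjI allI impI)
 show "E.Quo n = Quo (n + - k)" for n by (rule QuoE)
 fix l l' n assume h: "hermitian_scalar K F rh ph x p l & hermitian_scalar K F rh ph' x p' l'"
 let ?Q = "carrier (Quo (n + - k))" and ?b = "frm (n + - k)"
 have l: "l ~= 0" "l' ~= 0" using h unfolding hermitian_scalar_def by auto
 have h1: "l * ?b v u = cnj (l * ?b u v)" if "u : ?Q" "v : ?Q" for u v
 using h that unfolding hermitian_scalar_def hermitian_on_def by blast
 have h2: "l' * E.frm n v u = cnj (l' * E.frm n u v)" if "u : ?Q" "v : ?Q" for u v
 using h that unfolding hermitian_scalar_def hermitian_on_def QuoE by blast
 \<comment> \<open>The ratio of the two normalized forms, a nonzero complex number. It is real once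
   some value is nonzero, because both forms are hermitian.\<close>
 define \<kappa> where "\<kappa> = l' * val (W n) / l"
 have \<kappa>: "\<kappa> ~= 0" using l W(2) by (simp add: \<kappa>_def)
 have e: "l' * E.frm n u v = \<kappa> * (l * ?b u v)" if "u : ?Q" "v : ?Q" for u v
 unfolding frmE[OF that] \<kappa>_def using l(1) by simp
 show "\<exists>c::real. c ~= 0 & (ALL u:?Q. ALL v:?Q. l' * E.frm n u v = of_real c * (l * ?b u v))"
 \<comment> \<open>If the form vanishes identically, \<kappa> may fail to be real, but then the
   factor 1 serves.\<close>
 proof (cases "EX u:?Q. EX v:?Q. ?b u v ~= 0")
 case True
 then obtain u v where uv: "u : ?Q" "v : ?Q" "?b u v ~= 0" by (elim bexE)
 have "\<kappa> * (l * ?b u v) = cnj \<kappa> * cnj (l * ?b v u)"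
 using h2[OF uv(2,1)] unfolding e[OF uv(1,2)] e[OF uv(2,1)] by simp
 then have "\<kappa> * (l * ?b u v) = cnj \<kappa> * (l * ?b u v)" unfolding h1[OF uv(2,1)] by simp
 then have "cnj \<kappa> = \<kappa>" using uv(3) l(1) by simp
 then have r: "\<kappa> = of_real (Re \<kappa>)" by (simp add: complex_eq_iff)
 then have "Re \<kappa> ~= 0" using \<kappa> by auto
 then show ?thesis using e r by (intro exI[of _ "Re \<kappa>"]) simp
 next
 case False
 then have "l' * E.frm n u v = of_real 1 * (l * ?b u v)" if "u : ?Q" "v : ?Q" for u v
 using e[OF that] that by auto
 then show ?thesis by (intro exI[of _ "1::real"]) simp
 qed
 qed
qed

end

theorem mainTheorem2:
  fixes K :: "(complex^'n^'n) set"
    and \<gg> :: "(complex poly, 'g) module"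
    and br :: "'g \<Rightarrow> 'g \<Rightarrow> 'g"
    and \<alpha> :: "complex^'n^'n \<Rightarrow> 'g \<Rightarrow> 'g"
    and \<iota> :: "complex poly^'n^'n \<Rightarrow> 'g"
    and \<sigma>\<gg> :: "'g \<Rightarrow> 'g"
    and \<sigma>K :: "complex \<Rightarrow> complex^'n^'n \<Rightarrow> complex^'n^'n"
    and F :: "(complex poly, 'f) module"
    and \<pi> :: "'g \<Rightarrow> 'f \<Rightarrow> 'f"
    and \<rho> :: "complex^'n^'n \<Rightarrow> 'f \<Rightarrow> 'f"
    and \<phi> :: "'f generic_map"
    and x :: real
    and p :: "complex poly"
  assumes "real_hc_pair_family K \<gg> br \<alpha> \<iota> \<sigma>\<gg> \<sigma>K"
    and "zariski_connected K"
    and "reductive K"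
    and "hc_module_family K \<gg> br \<alpha> \<iota> F \<pi> \<rho>"
    and "quasi_admissible K F \<rho>"
    and "generically_irreducible \<gg> F \<pi>"
    and "equivariant_iso K \<gg> \<sigma>\<gg> \<sigma>K F \<pi> \<rho> \<phi>"
    and "real_coordinate x p"
  shows
    "(\<forall>n. induces_form K F \<rho> \<phi> x p n
       \<and> sesquilinear_on (jantzen_quotient K F \<rho> \<phi> x p n) (jantzen_form K F \<rho> \<phi> x p n)
       \<and> nondegenerate_on (jantzen_quotient K F \<rho> \<phi> x p n) (jantzen_form K F \<rho> \<phi> x p n)
       \<and> invariant_form K \<gg> \<sigma>\<gg> \<sigma>K F \<pi> \<rho> \<phi> x p n)
     \<and> (\<exists>l. hermitian_scalar K F \<rho> \<phi> x p l)
     \<and> (\<forall>\<phi>' p'. equivariant_iso K \<gg> \<sigma>\<gg> \<sigma>K F \<pi> \<rho> \<phi>' \<and> real_coordinate x p' \<longrightarrow>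
       (\<exists>m. (\<forall>n. jantzen_quotient K F \<rho> \<phi>' x p' n = jantzen_quotient K F \<rho> \<phi> x p (n + m))
          \<and> (\<forall>l l' n. hermitian_scalar K F \<rho> \<phi> x p l \<and> hermitian_scalar K F \<rho> \<phi>' x p' l' \<longrightarrow>
               (\<exists>c::real. c \<noteq> 0 \<and>
                 (\<forall>u\<in>carrier (jantzen_quotient K F \<rho> \<phi> x p (n + m)).
                  \<forall>v\<in>carrier (jantzen_quotient K F \<rho> \<phi> x p (n + m)).
                    l' * jantzen_form K F \<rho> \<phi>' x p' n u v
                      = of_real c * (l * jantzen_form K F \<rho> \<phi> x p (n + m) u v))))))"
proof -
 interpret hc: hc_module_family K \<gg> br \<alpha> \<iota> F \<pi> \<rho> by (rule assms(4))
 have fr: "fam_rep K F \<rho>"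
 by (intro fam_rep.intro hc.algebraic_group hc.group_action hc.flat)
 obtain B crd Bs where b: "based F B crd (\<lambda>b. b)" "B = (\<Union>U\<in>isotypic_summands K (as_complex F) \<rho>. Bs U)"
 "\<forall>U\<in>isotypic_summands K (as_complex F) \<rho>. finite (Bs U) \<and> Bs U \<subseteq> U \<and> U = Sp F (Bs U)"
 "\<forall>U\<in>isotypic_summands K (as_complex F) \<rho>. \<forall>U'\<in>isotypic_summands K (as_complex F) \<rho>. U \<noteq> U' \<longrightarrow> Bs U \<inter> Bs U' = {}"
 using fam_rep.adapted_basis[OF fr assms(3,5)] by (elim exE conjE)
 have ad: "adapted K F \<rho> B crd Bs"
 by (intro adapted.intro fr adapted_axioms.intro b(1,2)) (use b(3,4) in simp_all)
 \<comment> \<open>The adapted basis depends only on \<open>K\<close>, \<open>F\<close> and \<rho>,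
   so one choice of coordinates serves all isomorphisms and coordinates at \<open>x\<close>, which
   makes them comparable.\<close>
 have jz: "jantzen K \<gg> br \<alpha> \<iota> \<sigma>\<gg> \<sigma>K F \<pi> \<rho> B crd Bs x p' \<phi>'"
 if "equivariant_iso K \<gg> \<sigma>\<gg> \<sigma>K F \<pi> \<rho> \<phi>'" "real_coordinate x p'" for \<phi>' p'
 by (intro jantzen.intro equi.intro setting.intro ad assms(1,4) real_coord.intro equi_axioms.intro jantzen_axioms.intro assms(6) that)
 interpret J: jantzen K \<gg> br \<alpha> \<iota> \<sigma>\<gg> \<sigma>K F \<pi> \<rho> B crd Bs x p \<phi> by (rule jz[OF assms(7,8)])
 show ?thesis
 proof (intro conjI allI impI)
 fix \<phi>' p' assume "equivariant_iso K \<gg> \<sigma>\<gg> \<sigma>K F \<pi> \<rho> \<phi>' \<and> real_coordinate x p'"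
 then show "\<exists>m. (\<forall>n. jantzen_quotient K F \<rho> \<phi>' x p' n = jantzen_quotient K F \<rho> \<phi> x p (n + m))
 \<and> (\<forall>l l' n. hermitian_scalar K F \<rho> \<phi> x p l \<and> hermitian_scalar K F \<rho> \<phi>' x p' l' \<longrightarrow>
 (\<exists>c::real. c \<noteq> 0 \<and>
 (\<forall>u\<in>carrier (jantzen_quotient K F \<rho> \<phi> x p (n + m)).
 \<forall>v\<in>carrier (jantzen_quotient K F \<rho> \<phi> x p (n + m)).
 l' * jantzen_form K F \<rho> \<phi>' x p' n u v
 = of_real c * (l * jantzen_form K F \<rho> \<phi> x p (n + m) u v))))"
 by (elim conjE) (rule J.independent_of_choices[OF jz])
 qed (rule J.induces J.sesquilinear J.nondegenerate J.invariant J.hermitian)+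
qed

end
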